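(* Let $R$ be a rational function without poles in $\overline{\mathbb{D}}$, of degree $N=N_1+N_2$, written as $$R(z)=P(z)+\sum_{l=1}^{r}\sum_{j=1}^{k_l}\frac{\alpha_{l,j}}{(z-\eta_l)^j},$$ where $P$ is a polynomial of degree $N_1$, $\alpha_{l,j}\in\mathbb{C}$, the points $\eta_1,\dots,\eta_r\in\mathbb{C}\setminus\overline{\mathbb{D}}$ are the distinct poles of $R$, of multiplicities $k_1,\dots,k_r$, and $N_2=\sum_{l=1}^r k_l$. Let $\varphi\in A(\mathbb{D})$ and $$\Phi(z)=R\Big(\frac1z\Big)+\varphi(z).$$ Assume that $$\mathbb{D}\cap\big(\mathbb{C}\setminus\overline{\Phi(\mathbb{D})}\big)\neq\emptyset\quad\text{and}\quad \widehat{\mathbb{D}}\cap\big(\mathbb{C}\setminus\overline{\Phi(\mathbb{D})}\big)\neq\emptyset,$$ where $\widehat{\mathbb{D}}=\mathbb{C}\setminus\overline{\mathbb{D}}$. Assume moreover that for every $w\in\Phi(\overline{\mathbb{D}})$ the equation $\Phi(z)=w$ has exactly $N$ solutions in $\overline{\mathbb{D}}$, counting multiplicities. Then the Toeplitz operator $T_\Phi$ is hypercyclic on $H^2$.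
   Context: $\mathbb{D}$ is the open unit disc and $\mathbb{T}$ the unit circle. $H^2$ is the Hardy space of functions analytic in $\mathbb{D}$ with square summable Taylor coefficients (identified with a closed subspace of $L^2(\mathbb{T})$ via boundary values). $A(\mathbb{D})$ is the disc algebra: functions continuous in $\overline{\mathbb{D}}$ and analytic in $\mathbb{D}$. For $\psi\in L^\infty(\mathbb{T})$ the Toeplitz operator $T_\psi:H^2\to H^2$ is $T_\psi f=P_+(\psi f)$, where $P_+$ is the orthogonal projection from $L^2(\mathbb{T})$ onto $H^2$; $T_\Phi$ is the Toeplitz operator whose symbol is the restriction of $\Phi$ to $\mathbb{T}$. A continuous linear operator $T$ on a separable Banach space $X$ is hypercyclic if there is $x\in X$ such that $\{T^n x:n=0,1,2,\dots\}$ is dense in $X$. The cases $N_1=0$ ($P$ constant) and $N_2=0$ ($r=0$, $R=P$) are allowed. The function $\Phi$ is analytic in $\mathbb{D}$ except for a pole of order $N_1$ at $0$ (if $N_1\ge1$) and poles of multiplicity $k_l$ at $1/\eta_l$, and is continuous on $\overline{\mathbb{D}}$ away from these poles. $\Phi(\mathbb{D})$ and $\Phi(\overline{\mathbb{D}})$ denote the sets of finite values of $\Phi$ on $\mathbb{D}$, resp. $\overline{\mathbb{D}}$ (poles excluded), and closures are taken in $\mathbb{C}$. The multiplicity of a solution $z\in\mathbb{D}$ of $\Phi(z)=w$ is the order of the zero of $\Phi-w$ at $z$; no separate convention for solutions on $\mathbb{T}$ is specified. *)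

theory Defs
  imports "HOL-Complex_Analysis.Complex_Analysis"
begin

class complex_banach = banach +
  fixes scaleC :: "complex \<Rightarrow> 'a \<Rightarrow> 'a"  (infixr \<open>*\<^sub>C\<close> 75)
  assumes scaleC_add_right: "c *\<^sub>C (x + y) = c *\<^sub>C x + c *\<^sub>C y"
    and scaleC_add_left: "(c + d) *\<^sub>C x = c *\<^sub>C x + d *\<^sub>C x"
    and scaleC_scaleC: "c *\<^sub>C (d *\<^sub>C x) = (c * d) *\<^sub>C x"
    and scaleC_of_real: "complex_of_real t *\<^sub>C x = t *\<^sub>R x"
    and norm_scaleC: "norm (c *\<^sub>C x) = cmod c * norm x"

text \<open>Separability of the space is not required explicitly: it follows from the density of
  the (countable) orbit.\<close>

definition hypercyclic :: "('a::complex_banach \<Rightarrow> 'a) \<Rightarrow> bool" where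
  "hypercyclic T \<longleftrightarrow>
     bounded_linear T \<and> (\<forall>c x. T (c *\<^sub>C x) = c *\<^sub>C T x) \<and>
     (\<exists>x. closure (range (\<lambda>n. (T ^^ n) x)) = UNIV)"

text \<open>\<open>fps_expansion f 0\<close> is the Taylor series of \<open>f\<close> at the origin. The functions are
  normalised to vanish off the disc, so that equality of elements is equality on the disc.\<close>

typedef hardy2 = "{f :: complex \<Rightarrow> complex. f holomorphic_on ball 0 1 \<and>
    summable (\<lambda>n. (cmod (fps_nth (fps_expansion f 0) n))\<^sup>2) \<and> (\<forall>z. z \<notin> ball 0 1 \<longrightarrow> f z = 0)}"
  morphisms hardy_fun Abs_hardy2
proof -
  have "fps_expansion (\<lambda>z. 0) 0 = 0" by (intro fps_expansion_eqI) auto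
  thus ?thesis by (intro exI[of _ "\<lambda>z. 0"]) auto
qed

setup_lifting type_definition_hardy2

definition taylor_coeff :: "hardy2 \<Rightarrow> nat \<Rightarrow> complex" where
  "taylor_coeff f n = fps_nth (fps_expansion (hardy_fun f) 0) n"

lemma hardy_holomorphic: "hardy_fun f holomorphic_on ball 0 1"
  and hardy_outside: "z \<notin> ball 0 1 \<Longrightarrow> hardy_fun f z = 0"
  and hardy_summable: "summable (\<lambda>n. (cmod (taylor_coeff f n))\<^sup>2)"
  using hardy_fun[of f] by (auto simp: taylor_coeff_def)

lemma hardy_sums:
  assumes "z \<in> ball 0 1"
  shows "(\<lambda>n. taylor_coeff f n * z ^ n) sums hardy_fun f z"
  unfolding taylor_coeff_def
  by (rule has_fps_expansion_imp_sums_complex[where r = 1])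
     (use assms hardy_holomorphic[of f] in \<open>auto intro: has_fps_expansion_fps_expansion[of "ball 0 1"]
        simp: one_ereal_def\<close>)

lemma hardy_eqI:
  assumes "\<And>n. taylor_coeff f n = taylor_coeff g n"
  shows "f = g"
proof -
  have "hardy_fun f z = hardy_fun g z" for z
  proof (cases "z \<in> ball 0 1")
    case True
    thus ?thesis using hardy_sums[OF True, of f] hardy_sums[OF True, of g]
      by (simp add: assms sums_unique2)
  qed (simp add: hardy_outside)
  thus ?thesis by (simp add: hardy_fun_inject[symmetric] fun_eq_iff)
qed

lemma square_summable_bounded_iff:
  fixes a :: "nat \<Rightarrow> complex"
  shows "summable (\<lambda>n. (cmod (a n))\<^sup>2) \<longleftrightarrow> (\<exists>B. \<forall>m. L2_set (\<lambda>n. cmod (a n)) {..<m} \<le> B)"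
proof
  assume s: "summable (\<lambda>n. (cmod (a n))\<^sup>2)"
  have "L2_set (\<lambda>n. cmod (a n)) {..<m} \<le> sqrt (\<Sum>n. (cmod (a n))\<^sup>2)" for m
    unfolding L2_set_def by (intro real_sqrt_le_mono sum_le_suminf s) auto
  thus "\<exists>B. \<forall>m. L2_set (\<lambda>n. cmod (a n)) {..<m} \<le> B" by blast
next
  assume "\<exists>B. \<forall>m. L2_set (\<lambda>n. cmod (a n)) {..<m} \<le> B"
  then obtain B where B: "\<And>m. L2_set (\<lambda>n. cmod (a n)) {..<m} \<le> B" by blast
  show "summable (\<lambda>n. (cmod (a n))\<^sup>2)"
  proof (rule summableI_nonneg_bounded)
    fix m
    have "(L2_set (\<lambda>n. cmod (a n)) {..<m})\<^sup>2 \<le> B\<^sup>2"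
      by (intro power_mono B) auto
    thus "(\<Sum>n<m. (cmod (a n))\<^sup>2) \<le> B\<^sup>2"
      by (simp add: L2_set_def sum_nonneg)
  qed auto
qed

lemma sqrt_suminf_le:
  fixes a :: "nat \<Rightarrow> complex"
  assumes "\<And>m. L2_set (\<lambda>n. cmod (a n)) {..<m} \<le> B"
  shows "sqrt (\<Sum>n. (cmod (a n))\<^sup>2) \<le> B"
proof -
  have s: "summable (\<lambda>n. (cmod (a n))\<^sup>2)"
    using assms square_summable_bounded_iff by blast
  have "(\<lambda>m. L2_set (\<lambda>n. cmod (a n)) {..<m}) \<longlonglongrightarrow> sqrt (\<Sum>n. (cmod (a n))\<^sup>2)"
    unfolding L2_set_def by (intro tendsto_real_sqrt summable_LIMSEQ s)
  thus ?thesis using assms by (intro LIMSEQ_le_const2) auto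
qed

lemma L2_set_le_sqrt_suminf:
  fixes a :: "nat \<Rightarrow> complex"
  assumes "summable (\<lambda>n. (cmod (a n))\<^sup>2)"
  shows "L2_set (\<lambda>n. cmod (a n)) {..<m} \<le> sqrt (\<Sum>n. (cmod (a n))\<^sup>2)"
  unfolding L2_set_def by (intro real_sqrt_le_mono sum_le_suminf assms) auto

lemma L2_set_cmod_add_le:
  fixes a b :: "nat \<Rightarrow> complex"
  assumes "summable (\<lambda>n. (cmod (a n))\<^sup>2)" "summable (\<lambda>n. (cmod (b n))\<^sup>2)"
  shows "L2_set (\<lambda>n. cmod (a n + b n)) {..<m}
           \<le> sqrt (\<Sum>n. (cmod (a n))\<^sup>2) + sqrt (\<Sum>n. (cmod (b n))\<^sup>2)"
proof -
  have "L2_set (\<lambda>n. cmod (a n + b n)) {..<m} \<le> L2_set (\<lambda>n. cmod (a n) + cmod (b n)) {..<m}"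
    by (intro L2_set_mono norm_triangle_ineq) auto
  also have "\<dots> \<le> L2_set (\<lambda>n. cmod (a n)) {..<m} + L2_set (\<lambda>n. cmod (b n)) {..<m}"
    by (rule L2_set_triangle_ineq)
  finally show ?thesis
    using L2_set_le_sqrt_suminf[OF assms(1), of m] L2_set_le_sqrt_suminf[OF assms(2), of m]
    by linarith
qed

lemma square_summable_add:
  fixes a b :: "nat \<Rightarrow> complex"
  assumes "summable (\<lambda>n. (cmod (a n))\<^sup>2)" "summable (\<lambda>n. (cmod (b n))\<^sup>2)"
  shows "summable (\<lambda>n. (cmod (a n + b n))\<^sup>2)"
  using L2_set_cmod_add_le[OF assms] unfolding square_summable_bounded_iff[of "\<lambda>n. a n + b n"]
  by blast

lemma square_summable_cmult:
  fixes a :: "nat \<Rightarrow> complex"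
  assumes "summable (\<lambda>n. (cmod (a n))\<^sup>2)"
  shows "summable (\<lambda>n. (cmod (c * a n))\<^sup>2)"
  using assms by (simp add: norm_mult power_mult_distrib summable_mult)

lemma has_fps_expansion_ball:
  "f holomorphic_on ball 0 1 \<Longrightarrow> f has_fps_expansion fps_expansion f 0"
  by (rule has_fps_expansion_fps_expansion[of "ball 0 1"]) auto

lemma fps_expansion_add:
  assumes "f holomorphic_on ball 0 1" "g holomorphic_on ball 0 1"
  shows "fps_expansion (\<lambda>z. f z + g z) 0 = fps_expansion f 0 + fps_expansion g 0"
  by (intro fps_expansion_eqI has_fps_expansion_add has_fps_expansion_ball assms)

lemma fps_expansion_cmult:
  assumes "f holomorphic_on ball 0 1"
  shows "fps_expansion (\<lambda>z. c * f z) 0 = fps_const c * fps_expansion f 0"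
  by (intro fps_expansion_eqI has_fps_expansion_cmult_left has_fps_expansion_ball assms)

instantiation hardy2 :: real_normed_vector
begin

lift_definition zero_hardy2 :: hardy2 is "\<lambda>z. 0"
proof -
  have "fps_expansion (\<lambda>z. 0) 0 = 0" by (intro fps_expansion_eqI) auto
  thus "?thesis" by auto
qed

lift_definition plus_hardy2 :: "hardy2 \<Rightarrow> hardy2 \<Rightarrow> hardy2" is "\<lambda>f g z. f z + g z"
  by (auto simp: fps_expansion_add square_summable_add intro!: holomorphic_intros)

lift_definition uminus_hardy2 :: "hardy2 \<Rightarrow> hardy2" is "\<lambda>f z. - f z"
  subgoal for f
    using fps_expansion_cmult[of f "-1"] by (auto intro!: holomorphic_intros)
  done

definition minus_hardy2 :: "hardy2 \<Rightarrow> hardy2 \<Rightarrow> hardy2" where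
  "minus_hardy2 f g = f + - g"

lift_definition scaleR_hardy2 :: "real \<Rightarrow> hardy2 \<Rightarrow> hardy2" is "\<lambda>t f z. of_real t * f z"
  using square_summable_cmult by (auto simp: fps_expansion_cmult intro!: holomorphic_intros)

definition norm_hardy2 :: "hardy2 \<Rightarrow> real" where
  "norm_hardy2 f = sqrt (\<Sum>n. (cmod (taylor_coeff f n))\<^sup>2)"

definition sgn_hardy2 :: "hardy2 \<Rightarrow> hardy2" where
  "sgn_hardy2 f = scaleR (inverse (norm f)) f"

definition dist_hardy2 :: "hardy2 \<Rightarrow> hardy2 \<Rightarrow> real" where
  "dist_hardy2 f g = norm (f - g)"

definition uniformity_hardy2 :: "(hardy2 \<times> hardy2) filter" where
  "uniformity_hardy2 = (INF e\<in>{0<..}. principal {(f, g). dist f g < e})"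

definition open_hardy2 :: "hardy2 set \<Rightarrow> bool" where
  "open_hardy2 U \<longleftrightarrow> (\<forall>f\<in>U. \<forall>\<^sub>F (g, h) in uniformity. g = f \<longrightarrow> h \<in> U)"

lemma taylor_coeff_0: "taylor_coeff 0 n = 0"
proof -
  have "fps_expansion (\<lambda>z. 0) 0 = 0" by (intro fps_expansion_eqI) auto
  thus ?thesis by (simp add: taylor_coeff_def zero_hardy2.rep_eq)
qed

lemma taylor_coeff_add: "taylor_coeff (f + g) n = taylor_coeff f n + taylor_coeff g n"
  by (simp add: taylor_coeff_def plus_hardy2.rep_eq fps_expansion_add hardy_holomorphic)

lemma taylor_coeff_uminus: "taylor_coeff (- f) n = - taylor_coeff f n"
  using fps_expansion_cmult[OF hardy_holomorphic, of "-1" f]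
  by (simp add: taylor_coeff_def uminus_hardy2.rep_eq)

lemma taylor_coeff_diff: "taylor_coeff (f - g) n = taylor_coeff f n - taylor_coeff g n"
  by (simp add: minus_hardy2_def taylor_coeff_add taylor_coeff_uminus)

lemma taylor_coeff_scaleR: "taylor_coeff (t *\<^sub>R f) n = of_real t * taylor_coeff f n"
  by (simp add: taylor_coeff_def scaleR_hardy2.rep_eq fps_expansion_cmult hardy_holomorphic)

instance
proof
  fix f g h :: hardy2 and s t :: real
  show "f + g + h = f + (g + h)" "f + g = g + f" "0 + f = f" "- f + f = 0" "f - g = f + - g"
    "t *\<^sub>R (f + g) = t *\<^sub>R f + t *\<^sub>R g" "(s + t) *\<^sub>R f = s *\<^sub>R f + t *\<^sub>R f"
    "s *\<^sub>R t *\<^sub>R f = (s * t) *\<^sub>R f" "1 *\<^sub>R f = f"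
    by (auto intro!: hardy_eqI simp: taylor_coeff_add taylor_coeff_0 taylor_coeff_uminus
          taylor_coeff_diff taylor_coeff_scaleR algebra_simps)
  show "norm f = 0 \<longleftrightarrow> f = 0"
  proof
    assume "norm f = 0"
    hence "\<forall>n. (cmod (taylor_coeff f n))\<^sup>2 = 0"
      by (subst (asm) norm_hardy2_def) (auto simp: suminf_eq_zero_iff hardy_summable)
    thus "f = 0" by (intro hardy_eqI) (simp add: taylor_coeff_0)
  qed (simp add: norm_hardy2_def taylor_coeff_0)
  show "norm (f + g) \<le> norm f + norm g"
    unfolding norm_hardy2_def taylor_coeff_add
    by (intro sqrt_suminf_le L2_set_cmod_add_le hardy_summable)
  show "norm (t *\<^sub>R f) = \<bar>t\<bar> * norm f"
    by (simp add: norm_hardy2_def taylor_coeff_scaleR norm_mult power_mult_distrib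
          suminf_mult hardy_summable real_sqrt_mult)
qed (simp_all add: sgn_hardy2_def dist_hardy2_def uniformity_hardy2_def open_hardy2_def)

end

lemma hardy_from_coeffs:
  fixes a :: "nat \<Rightarrow> complex"
  assumes "summable (\<lambda>n. (cmod (a n))\<^sup>2)"
  obtains f where "\<And>n. taylor_coeff f n = a n"
proof -
  define F where "F = Abs_fps a"
  define f where "f = (\<lambda>z. if z \<in> ball 0 1 then eval_fps F z else 0)"
  have "(\<lambda>n. (cmod (a n))\<^sup>2) \<longlonglongrightarrow> 0" using assms by (rule summable_LIMSEQ_zero)
  hence "(\<lambda>n. sqrt ((cmod (a n))\<^sup>2)) \<longlonglongrightarrow> sqrt 0" by (rule tendsto_real_sqrt)
  hence "(\<lambda>n. cmod (a n)) \<longlonglongrightarrow> 0" by simp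
  hence "Bseq a"
    using convergent_imp_Bseq[of a] by (auto simp: tendsto_norm_zero_iff convergent_def)
  then obtain K where K: "K > 0" "\<And>n. cmod (a n) \<le> K" by (auto elim: BseqE)
  have "conv_radius a \<ge> 1"
  proof (rule conv_radius_geI_ex')
    fix r :: real assume r: "0 < r" "ereal r < 1"
    show "summable (\<lambda>n. a n * of_real r ^ n)"
    proof (rule summable_comparison_test')
      show "summable (\<lambda>n. K * r ^ n)"
        using r by (intro summable_mult summable_geometric) (auto simp: one_ereal_def)
      show "norm (a n * of_real r ^ n) \<le> K * r ^ n" if "n \<ge> 0" for n
        using r K by (auto simp: norm_mult norm_power intro!: mult_right_mono)
    qed
  qed
  hence R: "fps_conv_radius F \<ge> 1" by (simp add: F_def fps_conv_radius_def)
  have holo: "f holomorphic_on ball 0 1"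
  proof -
    have "ereal (cmod z) < fps_conv_radius F" if "cmod z < 1" for z
    proof -
      have "ereal (cmod z) < 1" using that by (simp add: one_ereal_def)
      thus ?thesis using R by order
    qed
    hence "eval_fps F holomorphic_on ball 0 1"
      by (intro holomorphic_intros) auto
    thus ?thesis by (rule holomorphic_transform) (simp add: f_def)
  qed
  have "f has_fps_expansion F"
    unfolding has_fps_expansion_def
  proof
    show "0 < fps_conv_radius F" by (rule less_le_trans[OF _ R]) simp
    have "eventually (\<lambda>z. z \<in> ball (0::complex) 1) (nhds 0)"
      by (intro eventually_nhds_in_open) auto
    thus "eventually (\<lambda>z. eval_fps F z = f z) (nhds 0)"
      by eventually_elim (simp add: f_def)
  qed
  hence F: "fps_expansion f 0 = F" by (rule fps_expansion_eqI)
  have "hardy_fun (Abs_hardy2 f) = f"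
    using holo assms by (intro Abs_hardy2_inverse) (simp add: F F_def, simp add: f_def)
  hence "taylor_coeff (Abs_hardy2 f) n = a n" for n
    by (simp add: taylor_coeff_def F F_def)
  thus ?thesis by (rule that)
qed

lemma norm_taylor_coeff_le: "cmod (taylor_coeff f n) \<le> norm f"
proof -
  have "(\<Sum>k\<in>{n}. (cmod (taylor_coeff f k))\<^sup>2) \<le> (\<Sum>k. (cmod (taylor_coeff f k))\<^sup>2)"
    by (intro sum_le_suminf hardy_summable) auto
  thus ?thesis unfolding norm_hardy2_def by (intro real_le_rsqrt) simp
qed

instance hardy2 :: banach
proof
  fix X :: "nat \<Rightarrow> hardy2" assume "Cauchy X"
  have "Cauchy (\<lambda>k. taylor_coeff (X k) n)" for n
    unfolding Cauchy_def
  proof (intro allI impI)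
    fix e :: real assume "e > 0"
    then obtain M where M: "\<And>k l. k \<ge> M \<Longrightarrow> l \<ge> M \<Longrightarrow> dist (X k) (X l) < e"
      using \<open>Cauchy X\<close> unfolding Cauchy_def by blast
    have "dist (taylor_coeff (X k) n) (taylor_coeff (X l) n) \<le> dist (X k) (X l)" for k l
      using norm_taylor_coeff_le[of "X k - X l" n] by (simp add: dist_norm taylor_coeff_diff)
    thus "\<exists>M. \<forall>k\<ge>M. \<forall>l\<ge>M. dist (taylor_coeff (X k) n) (taylor_coeff (X l) n) < e"
      using M by (meson le_less_trans)
  qed
  hence "\<forall>n. \<exists>a. (\<lambda>k. taylor_coeff (X k) n) \<longlonglongrightarrow> a"
    by (simp add: Cauchy_convergent_iff convergent_def)
  then obtain a where a: "\<And>n. (\<lambda>k. taylor_coeff (X k) n) \<longlonglongrightarrow> a n" by metis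
  have *: "\<exists>M. \<forall>k\<ge>M. \<forall>m. L2_set (\<lambda>n. cmod (taylor_coeff (X k) n - a n)) {..<m} \<le> e"
    if "e > 0" for e :: real
  proof -
    obtain M where M: "\<And>k l. k \<ge> M \<Longrightarrow> l \<ge> M \<Longrightarrow> dist (X k) (X l) < e"
      using \<open>Cauchy X\<close> \<open>e > 0\<close> unfolding Cauchy_def by blast
    have "L2_set (\<lambda>n. cmod (taylor_coeff (X k) n - a n)) {..<m} \<le> e" if "k \<ge> M" for k m
    proof (rule tendsto_upperbound)
      show "(\<lambda>l. L2_set (\<lambda>n. cmod (taylor_coeff (X k) n - taylor_coeff (X l) n)) {..<m})
              \<longlonglongrightarrow> L2_set (\<lambda>n. cmod (taylor_coeff (X k) n - a n)) {..<m}"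
        unfolding L2_set_def by (intro tendsto_intros a)
      have "L2_set (\<lambda>n. cmod (taylor_coeff (X k) n - taylor_coeff (X l) n)) {..<m} \<le> e"
        if "l \<ge> M" for l
        using L2_set_le_sqrt_suminf[OF hardy_summable, of "X k - X l" m]
          M[OF \<open>k \<ge> M\<close> \<open>l \<ge> M\<close>] by (simp add: dist_norm norm_hardy2_def taylor_coeff_diff)
      thus "\<forall>\<^sub>F l in sequentially.
              L2_set (\<lambda>n. cmod (taylor_coeff (X k) n - taylor_coeff (X l) n)) {..<m} \<le> e"
        by (auto simp: eventually_sequentially)
    qed auto
    thus ?thesis by blast
  qed
  obtain M where "\<And>m. L2_set (\<lambda>n. cmod (taylor_coeff (X M) n - a n)) {..<m} \<le> 1"
    using *[of 1] by auto
  hence "summable (\<lambda>n. (cmod (taylor_coeff (X M) n - a n))\<^sup>2)"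
    unfolding square_summable_bounded_iff by blast
  from square_summable_add[OF hardy_summable[of "X M"] square_summable_cmult[OF this, of "-1"]]
  have "summable (\<lambda>n. (cmod (a n))\<^sup>2)" by simp
  then obtain f where f: "\<And>n. taylor_coeff f n = a n" using hardy_from_coeffs by blast
  have "X \<longlonglongrightarrow> f"
    unfolding lim_sequentially
  proof (intro allI impI)
    fix e :: real assume "e > 0"
    then obtain M where
      M: "\<And>k m. k \<ge> M \<Longrightarrow> L2_set (\<lambda>n. cmod (taylor_coeff (X k) n - a n)) {..<m} \<le> e / 2"
      using *[of "e / 2"] by auto
    have "dist (X k) f \<le> e / 2" if "k \<ge> M" for k
      unfolding dist_norm norm_hardy2_def taylor_coeff_diff f
      by (intro sqrt_suminf_le M that)
    thus "\<exists>M. \<forall>k\<ge>M. dist (X k) f < e" using \<open>e > 0\<close> by (intro exI[of _ M]) force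
  qed
  thus "convergent X" by (auto simp: convergent_def)
qed

instantiation hardy2 :: complex_banach
begin

lift_definition scaleC_hardy2 :: "complex \<Rightarrow> hardy2 \<Rightarrow> hardy2" is "\<lambda>c f z. c * f z"
  using square_summable_cmult by (auto simp: fps_expansion_cmult intro!: holomorphic_intros)

lemma taylor_coeff_scaleC: "taylor_coeff (c *\<^sub>C f) n = c * taylor_coeff f n"
  by (simp add: taylor_coeff_def scaleC_hardy2.rep_eq fps_expansion_cmult hardy_holomorphic)

instance
proof
  fix f g :: hardy2 and c d :: complex and t :: real
  show "c *\<^sub>C (f + g) = c *\<^sub>C f + c *\<^sub>C g" "(c + d) *\<^sub>C f = c *\<^sub>C f + d *\<^sub>C f"
    "c *\<^sub>C (d *\<^sub>C f) = (c * d) *\<^sub>C f" "complex_of_real t *\<^sub>C f = t *\<^sub>R f"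
    by (auto intro!: hardy_eqI
          simp: taylor_coeff_add taylor_coeff_scaleR taylor_coeff_scaleC algebra_simps)
  show "norm (c *\<^sub>C f) = cmod c * norm f"
    by (simp add: norm_hardy2_def taylor_coeff_scaleC norm_mult power_mult_distrib
          suminf_mult hardy_summable real_sqrt_mult)
qed

end

text \<open>Normalised arc length measure on the unit circle. Its underlying space is the circle, so
  that measurability and integrals only depend on the values of a function on the circle.\<close>

definition circle_measure :: "complex measure" where
  "circle_measure =
     distr (uniform_measure lborel {0..2*pi}) (restrict_space borel (sphere 0 1)) cis"

definition L2_circle :: "(complex \<Rightarrow> complex) set" where
  "L2_circle = {g \<in> borel_measurable circle_measure.
     integrable circle_measure (\<lambda>\<zeta>. (cmod (g \<zeta>))\<^sup>2)}"

text \<open>The boundary function of \<open>f\<close> in \<open>H\<^sup>2\<close> is the \<open>L\<^sup>2\<close>-limit of the dilations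
  \<open>\<zeta> \<mapsto> f (r \<zeta>)\<close> as \<open>r \<rightarrow> 1-\<close>. It is determined almost everywhere; \<open>SOME\<close> picks a
  representative, and only integrals involving it are used below.\<close>

definition boundary_fun :: "hardy2 \<Rightarrow> complex \<Rightarrow> complex" where
  "boundary_fun f = (SOME g. g \<in> L2_circle \<and>
     ((\<lambda>r. \<integral>\<zeta>. (cmod (hardy_fun f (of_real r * \<zeta>) - g \<zeta>))\<^sup>2 \<partial>circle_measure)
        \<longlongrightarrow> 0) (at_left 1))"

text \<open>The orthogonal projection of \<open>L\<^sup>2\<close> of the circle onto \<open>H\<^sup>2\<close>: the element \<open>h\<close> of \<open>H\<^sup>2\<close>
  such that \<open>g - h\<close> is orthogonal to \<open>H\<^sup>2\<close>.\<close>

definition riesz_projection :: "(complex \<Rightarrow> complex) \<Rightarrow> hardy2" where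
  "riesz_projection g = (THE h. \<forall>f.
     (\<integral>\<zeta>. (g \<zeta> - boundary_fun h \<zeta>) * cnj (boundary_fun f \<zeta>) \<partial>circle_measure) = 0)"

definition toeplitz :: "(complex \<Rightarrow> complex) \<Rightarrow> hardy2 \<Rightarrow> hardy2" where
  "toeplitz \<psi> f = riesz_projection (\<lambda>\<zeta>. \<psi> \<zeta> * boundary_fun f \<zeta>)"

definition disc_algebra :: "(complex \<Rightarrow> complex) set" where
  "disc_algebra = {\<phi>. continuous_on (cball 0 1) \<phi> \<and> \<phi> holomorphic_on ball 0 1}"

text \<open>\<open>R (1/z)\<close>, with the value at infinity of \<open>R\<close> taken at \<open>z = 0\<close>; it is a finite value
  precisely if the polynomial part of \<open>R\<close> is constant, and is irrelevant otherwise, since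
  \<open>0\<close> is then a pole. (In HOL, \<open>1/0 = 0\<close>.)\<close>

definition at_reciprocal :: "(complex \<Rightarrow> complex) \<Rightarrow> complex \<Rightarrow> complex" where
  "at_reciprocal R z = (if z = 0 then Lim at_infinity R else R (1 / z))"

text \<open>HOL functions are total, so the junk values at poles are removed from the domain
  explicitly. All poles of the symbols considered lie in the open disc.\<close>

definition poles :: "(complex \<Rightarrow> complex) \<Rightarrow> complex set" where
  "poles \<Phi> = {z \<in> ball 0 1. is_pole \<Phi> z}"

text \<open>Multiplicity of a solution \<open>z\<close> of \<open>\<Phi> z = w\<close>: the order of the zero of \<open>\<Phi> - w\<close> in the
  open disc. On the circle, where \<open>\<Phi>\<close> is merely continuous and there is no order of a zero,
  each solution is counted once.\<close>

definition solution_mult :: "(complex \<Rightarrow> complex) \<Rightarrow> complex \<Rightarrow> complex \<Rightarrow> nat" where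
  "solution_mult \<Phi> w z = (if z \<in> ball 0 1 then nat (zorder (\<lambda>u. \<Phi> u - w) z) else 1)"

definition exactly_n_solutions :: "(complex \<Rightarrow> complex) \<Rightarrow> complex \<Rightarrow> nat \<Rightarrow> bool" where
  "exactly_n_solutions \<Phi> w n \<longleftrightarrow>
     finite {z \<in> cball 0 1 - poles \<Phi>. \<Phi> z = w} \<and>
     (\<Sum>z\<in>{z \<in> cball 0 1 - poles \<Phi>. \<Phi> z = w}. solution_mult \<Phi> w z) = n"

end

theory Submission
  imports Defs "HOL-Computational_Algebra.Fundamental_Theorem_Algebra"
begin

text \<open>The eigenvectors of \<open>T\<^sub>\<Phi>\<close> can be written down, and the Godefroy-Shapiro criterion turns their
completeness into hypercyclicity. Let \<open>Q\<close> be the monic polynomial of degree \<open>N\<close> whose zeros are the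
poles of \<open>\<Phi>\<close>, and write \<open>\<Phi> = A / Q + \<phi>\<close> with a polynomial \<open>A\<close>. If \<open>\<lambda>\<close> is outside the closure of
the image of the disc, then \<open>D\<^sub>\<lambda> = A + (\<phi> - \<lambda>) Q = Q (\<Phi> - \<lambda>)\<close> lies in the disc algebra and has no zero in
the closed disc. For a polynomial \<open>p\<close> of degree less than \<open>N\<close> one has
\<open>\<Phi> p / D\<^sub>\<lambda> = \<lambda> p / D\<^sub>\<lambda> + p / Q\<close> on the circle, and \<open>p / Q\<close>, a proper fraction with all its poles in
the open disc, is orthogonal to \<open>H\<^sup>2\<close>. So \<open>p / D\<^sub>\<lambda>\<close> is an eigenvector for the eigenvalue \<open>\<lambda>\<close>
(lemma \<open>eigenvector\<close>). By \<open>Godefroy_Shapiro\<close> it remains to show that the eigenvectors with \<open>\<lambda>\<close> in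
an arbitrarily small disc around such a point \<open>\<lambda>\<^sub>0\<close> have dense span in \<open>H\<^sup>2\<close>; the two points are
chosen inside and outside the unit circle.

Put \<open>v = Q / D\<^sub>\<lambda>\<^sub>0 = 1 / (\<Phi> - \<lambda>\<^sub>0)\<close>, an element of the disc algebra. Since
\<open>D\<^sub>\<lambda> = D\<^sub>\<lambda>\<^sub>0 (1 - (\<lambda> - \<lambda>\<^sub>0) v)\<close>, the closed span contains all \<open>p v\<^sup>n / D\<^sub>\<lambda>\<^sub>0\<close>, and with them all
\<open>p F(v) / D\<^sub>\<lambda>\<^sub>0\<close> for uniform limits \<open>F\<close> of polynomials on \<open>K = v(closed disc)\<close>. The hypothesis on
the number of solutions says that \<open>v\<close> takes each of its values exactly \<open>N\<close> times in the closed
disc; the value \<open>0\<close> is taken at the poles of \<open>\<Phi>\<close>. This rigidity, the locale \<open>exact_valence\<close>, has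
strong consequences. No value on the circle is interior to \<open>K\<close>
(\<open>boundary_image_not_interior\<close>). Hence \<open>v\<close> is a proper map of the disc onto a simply connected
domain \<open>\<Omega>\<close>, and for the Riemann map \<open>\<psi>\<close> of \<open>\<Omega>\<close> the composition \<open>B = \<psi> \<circ> v\<close> is a finite Blaschke
product of degree \<open>N\<close> (\<open>Blaschke_factorization\<close>). Moreover \<open>K\<close> is homeomorphic to the closed disc, so
that its complement is connected (\<open>connected_complement_image\<close>), and polynomials are plentiful on
\<open>K\<close>: the Riemann maps of simply connected neighbourhoods shrinking to \<open>K\<close> are uniform limits of
polynomials on \<open>K\<close>, are bounded by one, and converge to \<open>\<psi>\<close> on \<open>\<Omega>\<close>
(\<open>Riemann_map_bounded_approximation\<close>). Therefore the closed span contains all \<open>p B\<^sup>m / D\<^sub>\<lambda>\<^sub>0\<close>.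

The passage to all of \<open>H\<^sup>2\<close> rests on an identity for finite Blaschke products
\<open>B = b / q\<close> with \<open>b\<close> and \<open>q\<close> reflections of each other: for fixed \<open>\<zeta>\<close> in the disc the function
\<open>q(z) (1 - B(z) cnj B(\<zeta>)) / (1 - z cnj \<zeta>)\<close> is a polynomial in \<open>z\<close> of degree less than \<open>N\<close>
(\<open>Blaschke_kernel_polynomial\<close>). Expanding \<open>1 / (1 - B cnj B(\<zeta>))\<close> in powers of \<open>B\<close> shows that the
closed span contains \<open>q / D\<^sub>\<lambda>\<^sub>0\<close> times every Cauchy kernel, hence times every power of \<open>z\<close>; since
\<open>q / D\<^sub>\<lambda>\<^sub>0\<close> is bounded with bounded inverse, it contains everything
(\<open>resolvent_family_complete\<close>).\<close>

section \<open>Injectivity at the boundary by the reflection principle\<close>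

lemma cnj_reflection_holomorphic:
  assumes "f holomorphic_on {u \<in> ball 0 \<delta>. Im u > 0}" "\<And>u. u \<in> ball 0 \<delta> \<Longrightarrow> Im u > 0 \<Longrightarrow> f u \<noteq> 0"
  shows "(\<lambda>u. 1 / cnj (f (cnj u))) holomorphic_on {u \<in> ball 0 \<delta>. Im u < 0}"
proof -
  have "(cnj \<circ> f \<circ> cnj) holomorphic_on {u \<in> ball 0 \<delta>. Im u < 0}"
  proof -
    have "cnj ` {u \<in> ball 0 \<delta>. Im u < 0} = {u \<in> ball 0 \<delta>. Im u > 0}"
      by (auto simp: image_iff intro!: exI[of _ "cnj _"])
    moreover have "open {u \<in> ball 0 \<delta>. Im u < 0}"
    proof -
      have "{u \<in> ball 0 \<delta>. Im u < 0} = ball 0 \<delta> \<inter> {u. Im u < 0}" by auto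
      thus ?thesis by (simp add: open_Int open_halfspace_Im_lt)
    qed
    ultimately show ?thesis
      using assms(1) by (subst holomorphic_on_compose_cnj_cnj) auto
  qed
  thus ?thesis
    using assms(2) by (auto intro!: holomorphic_intros simp: o_def)
qed

text \<open>The reflection principle for a function that need not extend continuously to the real line: only its
modulus is known to tend to one there. The candidate for the extension below the line is
\<open>1 / cnj (f (cnj u))\<close>. Neither it nor \<open>f\<close> need have boundary values, but their primitives do, since
they are Lipschitz. On parallels to the line approaching it the two functions differ by less and less, so
the boundary values of the primitives differ by a constant; the glued primitive is holomorphic, and
its derivative is the extension.\<close>

lemma reflection_extension:
  fixes f :: "complex \<Rightarrow> complex" and m :: "complex \<Rightarrow> real"
  assumes "\<delta> > 0"
    and hol: "f holomorphic_on {u \<in> ball 0 \<delta>. Im u > 0}"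
    and bnd: "\<And>u. u \<in> ball 0 \<delta> \<Longrightarrow> Im u > 0 \<Longrightarrow> 1 / 2 \<le> cmod (f u) \<and> cmod (f u) \<le> 1"
    and m: "continuous_on {u \<in> ball 0 \<delta>. Im u \<ge> 0} m"
      "\<And>u. u \<in> ball 0 \<delta> \<Longrightarrow> Im u > 0 \<Longrightarrow> m u = cmod (f u)"
      "\<And>u. u \<in> ball 0 \<delta> \<Longrightarrow> Im u = 0 \<Longrightarrow> m u = 1"
  obtains S where "S holomorphic_on ball 0 \<delta>" "\<And>u. u \<in> ball 0 \<delta> \<Longrightarrow> Im u > 0 \<Longrightarrow> S u = f u"
proof -
  define U where "U = {u :: complex. u \<in> ball 0 \<delta> \<and> Im u > 0}"
  define W where "W = {u :: complex. u \<in> ball 0 \<delta> \<and> Im u < 0}"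
  have U_alt: "U = ball 0 \<delta> \<inter> {u. Im u > 0}" and W_alt: "W = ball 0 \<delta> \<inter> {u. Im u < 0}"
    by (auto simp: U_def W_def)
  have oU: "open U" and oW: "open W"
    by (auto simp: U_alt W_alt intro!: open_Int open_halfspace_Im_gt open_halfspace_Im_lt)
  have cU: "convex U" and cW: "convex W"
    by (auto simp: U_alt W_alt intro!: convex_Int convex_halfspace_Im_gt convex_halfspace_Im_lt)
  define fs where "fs = (\<lambda>u. 1 / cnj (f (cnj u)))"
  have fs_hol: "fs holomorphic_on W"
  proof -
    have "f u \<noteq> 0" if "u \<in> ball 0 \<delta>" "Im u > 0" for u using bnd[OF that] by auto
    thus ?thesis
      using cnj_reflection_holomorphic[OF hol] by (simp add: fs_def W_def)
  qed
  obtain F where F: "\<And>u. u \<in> U \<Longrightarrow> (F has_field_derivative f u) (at u within U)"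
    using holomorphic_convex_primitive'[OF cU oU, of f] hol by (auto simp: U_def)
  obtain Fs where Fs: "\<And>u. u \<in> W \<Longrightarrow> (Fs has_field_derivative fs u) (at u within W)"
    using holomorphic_convex_primitive'[OF cW oW fs_hol] by auto
  have "dist (F x) (F y) \<le> 1 * dist x y" if "x \<in> U" "y \<in> U" for x y
    unfolding dist_norm
    by (rule field_differentiable_bound[OF cU F]) (use that bnd in \<open>auto simp: U_def\<close>)
  hence "uniformly_continuous_on U F"
    by (intro lipschitz_on_uniformly_continuous[of 1] lipschitz_onI) auto
  then obtain F' where F': "uniformly_continuous_on (closure U) F'" "\<And>x. x \<in> U \<Longrightarrow> F x = F' x"
    using uniformly_continuous_on_extension_on_closure by metis
  have fsb: "cmod (fs u) \<le> 2" if "u \<in> W" for u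
  proof -
    have "1 / 2 \<le> cmod (f (cnj u))" using bnd[of "cnj u"] that by (auto simp: W_def)
    hence "1 / cmod (f (cnj u)) \<le> 1 / (1 / 2)" by (intro divide_left_mono) auto
    thus ?thesis by (simp add: fs_def norm_divide)
  qed
  have "dist (Fs x) (Fs y) \<le> 2 * dist x y" if "x \<in> W" "y \<in> W" for x y
    unfolding dist_norm
    by (rule field_differentiable_bound[OF cW Fs]) (use that fsb in auto)
  hence "uniformly_continuous_on W Fs"
    by (intro lipschitz_on_uniformly_continuous[of 2] lipschitz_onI) auto
  then obtain Fs' where Fs': "uniformly_continuous_on (closure W) Fs'" "\<And>x. x \<in> W \<Longrightarrow> Fs x = Fs' x"
    using uniformly_continuous_on_extension_on_closure by metis
  have approach: "\<exists>\<eta>0>0. \<forall>\<eta>. 0 < \<eta> \<and> \<eta> < \<eta>0 \<longrightarrow> x + \<i> * of_real \<eta> \<in> ball 0 \<delta> \<and> x - \<i> * of_real \<eta> \<in> ball 0 \<delta>"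
    if "x \<in> ball 0 \<delta>" for x
  proof (intro exI[of _ "\<delta> - cmod x"] conjI allI impI)
    show "\<delta> - cmod x > 0" using that by simp
    fix \<eta> :: real assume "0 < \<eta> \<and> \<eta> < \<delta> - cmod x"
    thus "x + \<i> * of_real \<eta> \<in> ball 0 \<delta>" "x - \<i> * of_real \<eta> \<in> ball 0 \<delta>"
      using norm_triangle_ineq[of x "\<i> * of_real \<eta>"] norm_triangle_ineq4[of x "\<i> * of_real \<eta>"]
      by (auto simp: norm_mult)
  qed
  have upper: "filterlim (\<lambda>\<eta>. x + \<i> * of_real \<eta>) (at x within U) (at_right (0::real)) \<and> x \<in> closure U"
    if x: "x \<in> ball 0 \<delta>" "Im x \<ge> 0" for x
  proof -
    obtain \<eta>0 where \<eta>0: "\<eta>0 > 0" "\<And>\<eta>. 0 < \<eta> \<Longrightarrow> \<eta> < \<eta>0 \<Longrightarrow> x + \<i> * of_real \<eta> \<in> ball 0 \<delta>"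
      using approach[OF x(1)] by auto
    have ev: "\<forall>\<^sub>F \<eta> in at_right 0. x + \<i> * of_real \<eta> \<in> U \<and> x + \<i> * of_real \<eta> \<noteq> x"
      using eventually_at_right_less[of 0] eventually_at_right_real[OF \<eta>0(1)]
      by eventually_elim (use \<eta>0(2) x in \<open>auto simp: U_def complex_eq_iff\<close>)
    have lim: "((\<lambda>\<eta>. x + \<i> * of_real \<eta>) \<longlongrightarrow> x) (at_right (0::real))"
      by (auto intro!: tendsto_eq_intros)
    have "x \<in> closure U"
      using lim ev
      by (intro Lim_in_closed_set[of "closure U" "\<lambda>\<eta>. x + \<i> * of_real \<eta>" "at_right (0::real)"])
         (auto elim!: eventually_mono intro: closure_subset[THEN subsetD])
    thus ?thesis using lim ev by (auto simp: filterlim_at)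
  qed
  have lower: "filterlim (\<lambda>\<eta>. x - \<i> * of_real \<eta>) (at x within W) (at_right (0::real)) \<and> x \<in> closure W"
    if x: "x \<in> ball 0 \<delta>" "Im x \<le> 0" for x
  proof -
    obtain \<eta>0 where \<eta>0: "\<eta>0 > 0" "\<And>\<eta>. 0 < \<eta> \<Longrightarrow> \<eta> < \<eta>0 \<Longrightarrow> x - \<i> * of_real \<eta> \<in> ball 0 \<delta>"
      using approach[OF x(1)] by auto
    have ev: "\<forall>\<^sub>F \<eta> in at_right 0. x - \<i> * of_real \<eta> \<in> W \<and> x - \<i> * of_real \<eta> \<noteq> x"
      using eventually_at_right_less[of 0] eventually_at_right_real[OF \<eta>0(1)]
      by eventually_elim (use \<eta>0(2) x in \<open>auto simp: W_def complex_eq_iff\<close>)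
    have lim: "((\<lambda>\<eta>. x - \<i> * of_real \<eta>) \<longlongrightarrow> x) (at_right (0::real))"
      by (auto intro!: tendsto_eq_intros)
    have "x \<in> closure W"
      using lim ev
      by (intro Lim_in_closed_set[of "closure W" "\<lambda>\<eta>. x - \<i> * of_real \<eta>" "at_right (0::real)"])
         (auto elim!: eventually_mono intro: closure_subset[THEN subsetD])
    thus ?thesis using lim ev by (auto simp: filterlim_at)
  qed
  have F'lim: "((\<lambda>\<eta>. F (x + \<i> * of_real \<eta>)) \<longlongrightarrow> F' x) (at_right (0::real))"
    if x: "x \<in> ball 0 \<delta>" "Im x = 0" for x
  proof -
    have "(F' \<longlongrightarrow> F' x) (at x within closure U)"
      using uniformly_continuous_imp_continuous[OF F'(1)] upper[OF x(1)] x(2)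
      by (auto simp: continuous_on_def)
    hence "(F' \<longlongrightarrow> F' x) (at x within U)"
      by (rule tendsto_within_subset) (rule closure_subset)
    hence "(F \<longlongrightarrow> F' x) (at x within U)"
      by (rule Lim_transform_eventually) (auto simp: eventually_at_filter F'(2))
    thus ?thesis using filterlim_compose upper[OF x(1)] x(2) by fastforce
  qed
  have Fs'lim: "((\<lambda>\<eta>. Fs (x - \<i> * of_real \<eta>)) \<longlongrightarrow> Fs' x) (at_right (0::real))"
    if x: "x \<in> ball 0 \<delta>" "Im x = 0" for x
  proof -
    have "(Fs' \<longlongrightarrow> Fs' x) (at x within closure W)"
      using uniformly_continuous_imp_continuous[OF Fs'(1)] lower[OF x(1)] x(2)
      by (auto simp: continuous_on_def)
    hence "(Fs' \<longlongrightarrow> Fs' x) (at x within W)"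
      by (rule tendsto_within_subset) (rule closure_subset)
    hence "(Fs \<longlongrightarrow> Fs' x) (at x within W)"
      by (rule Lim_transform_eventually) (auto simp: eventually_at_filter Fs'(2))
    thus ?thesis using filterlim_compose lower[OF x(1)] x(2) by fastforce
  qed
  \<comment> \<open>the jump of the primitives across the real line is constant\<close>
  have key: "F' x - Fs' x = F' 0 - Fs' 0" if x: "x \<in> ball 0 \<delta>" "Im x = 0" for x
  proof -
    define X where "X = closed_segment 0 x"
    have Xr: "Im t = 0 \<and> cmod t \<le> cmod x" if "t \<in> X" for t
      using that x by (auto simp: X_def in_segment norm_mult intro!: mult_left_le_one_le)
    define \<eta>0 where "\<eta>0 = (\<delta> - cmod x) / 2"
    have \<eta>0: "\<eta>0 > 0" "\<And>\<eta> t. 0 < \<eta> \<Longrightarrow> \<eta> \<le> \<eta>0 \<Longrightarrow> t \<in> X \<Longrightarrow> t + \<i> * of_real \<eta> \<in> U \<and> t - \<i> * of_real \<eta> \<in> W"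
    proof -
      show "\<eta>0 > 0" using x by (simp add: \<eta>0_def)
      fix \<eta> t assume "0 < \<eta>" "\<eta> \<le> \<eta>0" "t \<in> X"
      thus "t + \<i> * of_real \<eta> \<in> U \<and> t - \<i> * of_real \<eta> \<in> W"
        using Xr[of t] norm_triangle_ineq[of t "\<i> * of_real \<eta>"] norm_triangle_ineq4[of t "\<i> * of_real \<eta>"]
        by (auto simp: U_def W_def norm_mult \<eta>0_def field_simps)
    qed
    have small: "cmod ((F' x - Fs' x) - (F' 0 - Fs' 0)) \<le> 4 * \<epsilon> * cmod x" if "\<epsilon> > 0" for \<epsilon>
    proof -
      define Q where "Q = (\<lambda>(t, \<eta>). t + \<i> * of_real \<eta>) ` (X \<times> {0..\<eta>0})"
      have "compact Q" unfolding Q_def X_def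
        by (intro compact_continuous_image compact_Times) (auto simp: case_prod_unfold intro!: continuous_intros)
      moreover have Qs: "Q \<subseteq> {u \<in> ball 0 \<delta>. Im u \<ge> 0}"
      proof (clarsimp simp: Q_def)
        fix t \<eta> assume t: "t \<in> X" "0 \<le> \<eta>" "\<eta> \<le> \<eta>0"
        show "cmod (t + \<i> * of_real \<eta>) < \<delta> \<and> 0 \<le> Im t + \<eta>"
          using \<eta>0(2)[of \<eta> t] t Xr[of t] x by (cases "\<eta> = 0") (auto simp: U_def)
      qed
      ultimately have "uniformly_continuous_on Q m"
        by (intro compact_uniformly_continuous continuous_on_subset[OF m(1)])
      then obtain d where d: "d > 0" "\<And>a b. a \<in> Q \<Longrightarrow> b \<in> Q \<Longrightarrow> dist b a < d \<Longrightarrow> dist (m b) (m a) < \<epsilon>"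
        using \<open>\<epsilon> > 0\<close> unfolding uniformly_continuous_on_def by metis
      have step: "cmod ((F (x + \<i> * of_real \<eta>) - Fs (x - \<i> * of_real \<eta>)) - (F (0 + \<i> * of_real \<eta>) - Fs (0 - \<i> * of_real \<eta>))) \<le> 4 * \<epsilon> * cmod (x - 0)"
        if \<eta>: "0 < \<eta>" "\<eta> < d" "\<eta> \<le> \<eta>0" for \<eta>
      proof (rule field_differentiable_bound[where S = X and f' = "\<lambda>t. f (t + \<i> * of_real \<eta>) - fs (t - \<i> * of_real \<eta>)"])
        show "convex X" "x \<in> X" "0 \<in> X" by (auto simp: X_def)
        fix t assume t: "t \<in> X"
        hence tU: "t + \<i> * of_real \<eta> \<in> U" and tW: "t - \<i> * of_real \<eta> \<in> W" using \<eta>0(2) \<eta> by auto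
        have FF: "(F has_field_derivative f (t + \<i> * of_real \<eta>)) (at (t + \<i> * of_real \<eta>))"
          using F[OF tU] at_within_open[OF tU oU] by simp
        have FFs: "(Fs has_field_derivative fs (t - \<i> * of_real \<eta>)) (at (t - \<i> * of_real \<eta>))"
          using Fs[OF tW] at_within_open[OF tW oW] by simp
        have "((\<lambda>u. F (u + \<i> * of_real \<eta>)) has_field_derivative f (t + \<i> * of_real \<eta>) * 1) (at t)"
          by (rule DERIV_chain2[where f = F and g = "\<lambda>u. u + \<i> * of_real \<eta>", OF FF]) (auto intro!: derivative_eq_intros)
        moreover have "((\<lambda>u. Fs (u - \<i> * of_real \<eta>)) has_field_derivative fs (t - \<i> * of_real \<eta>) * 1) (at t)"
          by (rule DERIV_chain2[where f = Fs and g = "\<lambda>u. u - \<i> * of_real \<eta>", OF FFs]) (auto intro!: derivative_eq_intros)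
        ultimately have "((\<lambda>u. F (u + \<i> * of_real \<eta>) - Fs (u - \<i> * of_real \<eta>)) has_field_derivative
           f (t + \<i> * of_real \<eta>) * 1 - fs (t - \<i> * of_real \<eta>) * 1) (at t)" by (rule DERIV_diff)
        thus "((\<lambda>u. F (u + \<i> * of_real \<eta>) - Fs (u - \<i> * of_real \<eta>)) has_field_derivative
           f (t + \<i> * of_real \<eta>) - fs (t - \<i> * of_real \<eta>)) (at t within X)"
          by (simp add: has_field_derivative_at_within)
        define a where "a = f (t + \<i> * of_real \<eta>)"
        have ct: "cnj (t - \<i> * of_real \<eta>) = t + \<i> * of_real \<eta>" using Xr[OF t] by (simp add: complex_eq_iff)
        have fsa: "fs (t - \<i> * of_real \<eta>) = 1 / cnj a" by (simp only: fs_def ct a_def)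
        have a: "1 / 2 \<le> cmod a" "cmod a \<le> 1" using bnd[of "t + \<i> * of_real \<eta>"] tU by (auto simp: U_def a_def)
        have "dist (m (t + \<i> * of_real \<eta>)) (m t) < \<epsilon>"
        proof (rule d(2))
          have "t = t + \<i> * of_real 0" by simp
          thus "t \<in> Q" using t \<eta>0(1) unfolding Q_def by (force simp: image_iff)
          show "t + \<i> * of_real \<eta> \<in> Q" using t \<eta> unfolding Q_def by (force simp: image_iff)
          show "dist (t + \<i> * of_real \<eta>) t < d" using \<eta> by (simp add: dist_norm norm_mult)
        qed
        moreover have "m t = 1" using Xr[OF t] x by (intro m(3)) auto
        moreover have "m (t + \<i> * of_real \<eta>) = cmod a" using tU by (auto simp: a_def U_def intro!: m(2))
        ultimately have "1 - cmod a < \<epsilon>" by (simp add: dist_real_def)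
        have "a - 1 / cnj a = (a * cnj a - 1) / cnj a" using a by (auto simp: diff_divide_distrib)
        hence "cmod (a - 1 / cnj a) = cmod (a * cnj a - 1) / cmod a" by (simp add: norm_divide)
        also have "a * cnj a - 1 = of_real ((cmod a)\<^sup>2 - 1)" using complex_norm_square[of a] by simp
        also have "cmod \<dots> = (1 - cmod a) * (1 + cmod a)"
        proof -
          have "(cmod a)\<^sup>2 \<le> 1" using a by (simp add: power_le_one)
          thus ?thesis by (subst norm_of_real) (simp add: power2_eq_square algebra_simps)
        qed
        also have "\<dots> \<le> \<epsilon> * 2" using a \<open>1 - cmod a < \<epsilon>\<close> by (intro mult_mono) auto
        also have "\<epsilon> * 2 / cmod a \<le> \<epsilon> * 2 / (1 / 2)" using a \<open>\<epsilon> > 0\<close> by (intro divide_left_mono) auto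
        finally show "cmod (f (t + \<i> * of_real \<eta>) - fs (t - \<i> * of_real \<eta>)) \<le> 4 * \<epsilon>"
          using a by (simp add: fsa a_def divide_right_mono)
      qed
      show ?thesis
      proof (rule tendsto_upperbound)
        have z: "(0::complex) \<in> ball 0 \<delta>" using \<open>\<delta> > 0\<close> by simp
        show "((\<lambda>\<eta>. cmod ((F (x + \<i> * of_real \<eta>) - Fs (x - \<i> * of_real \<eta>)) - (F (0 + \<i> * of_real \<eta>) - Fs (0 - \<i> * of_real \<eta>))))
          \<longlongrightarrow> cmod ((F' x - Fs' x) - (F' 0 - Fs' 0))) (at_right (0::real))"
          by (intro tendsto_intros F'lim Fs'lim x z) auto
        have "min d \<eta>0 > 0" using d \<eta>0 by simp
        from eventually_at_right_real[OF this]
        show "\<forall>\<^sub>F \<eta> in at_right (0::real). cmod ((F (x + \<i> * of_real \<eta>) - Fs (x - \<i> * of_real \<eta>)) - (F (0 + \<i> * of_real \<eta>) - Fs (0 - \<i> * of_real \<eta>))) \<le> 4 * \<epsilon> * cmod x"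
          by eventually_elim (use step in auto)
      qed auto
    qed
    have "cmod ((F' x - Fs' x) - (F' 0 - Fs' 0)) \<le> 0 + e" if "e > 0" for e
    proof -
      have pos: "cmod x + 1 > 0" by (simp add: add_nonneg_pos)
      hence "4 * (e / (4 * (cmod x + 1))) * cmod x = e * (cmod x / (cmod x + 1))"
        by (simp add: field_simps)
      also have "\<dots> \<le> e * 1" using that pos by (intro mult_left_mono) (auto simp: divide_le_eq)
      finally show ?thesis using small[of "e / (4 * (cmod x + 1))"] that
        by (smt (verit, best) divide_pos_pos norm_ge_zero)
    qed
    hence "cmod ((F' x - Fs' x) - (F' 0 - Fs' 0)) \<le> 0" by (rule field_le_epsilon)
    thus ?thesis by simp
  qed
  define G where "G = (\<lambda>u. if Im u \<ge> 0 then F' u else Fs' u + (F' 0 - Fs' 0))"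
  have "continuous_on (ball 0 \<delta> \<inter> {u. Im u \<ge> 0} \<union> ball 0 \<delta> \<inter> {u. Im u \<le> 0}) G"
    unfolding G_def
  proof (rule continuous_on_cases_local)
    show "closedin (top_of_set (ball 0 \<delta> \<inter> {u. Im u \<ge> 0} \<union> ball 0 \<delta> \<inter> {u. Im u \<le> 0})) (ball 0 \<delta> \<inter> {u. Im u \<ge> 0})"
    proof -
      have "ball 0 \<delta> \<inter> {u. Im u \<ge> 0} = (ball 0 \<delta> \<inter> {u. Im u \<ge> 0} \<union> ball 0 \<delta> \<inter> {u. Im u \<le> 0}) \<inter> {u. Im u \<ge> 0}" by auto
      thus ?thesis by (metis closedin_closed_Int closed_halfspace_Im_ge)
    qed
    show "closedin (top_of_set (ball 0 \<delta> \<inter> {u. Im u \<ge> 0} \<union> ball 0 \<delta> \<inter> {u. Im u \<le> 0})) (ball 0 \<delta> \<inter> {u. Im u \<le> 0})"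
    proof -
      have "ball 0 \<delta> \<inter> {u. Im u \<le> 0} = (ball 0 \<delta> \<inter> {u. Im u \<ge> 0} \<union> ball 0 \<delta> \<inter> {u. Im u \<le> 0}) \<inter> {u. Im u \<le> 0}" by auto
      thus ?thesis by (metis closedin_closed_Int closed_halfspace_Im_le)
    qed
    show "continuous_on (ball 0 \<delta> \<inter> {u. Im u \<ge> 0}) F'"
      by (rule continuous_on_subset[OF uniformly_continuous_imp_continuous[OF F'(1)]]) (use upper in auto)
    show "continuous_on (ball 0 \<delta> \<inter> {u. Im u \<le> 0}) (\<lambda>u. Fs' u + (F' 0 - Fs' 0))"
      by (intro continuous_intros continuous_on_subset[OF uniformly_continuous_imp_continuous[OF Fs'(1)]]) (use lower in auto)
    fix u assume u: "u \<in> ball 0 \<delta> \<inter> {u. Im u \<ge> 0} \<and> \<not> Im u \<ge> 0 \<or> u \<in> ball 0 \<delta> \<inter> {u. Im u \<le> 0} \<and> Im u \<ge> 0"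
    hence "F' u - Fs' u = F' 0 - Fs' 0" by (intro key) auto
    thus "F' u = Fs' u + (F' 0 - Fs' 0)" by (simp add: algebra_simps)
  qed
  also have "ball 0 \<delta> \<inter> {u. Im u \<ge> 0} \<union> ball 0 \<delta> \<inter> {u. Im u \<le> 0} = ball 0 \<delta>" by auto
  finally have Gc: "continuous_on (ball 0 \<delta>) G" .
  have GU: "(G has_field_derivative f u) (at u)" if "u \<in> U" for u
  proof (rule has_field_derivative_transform_within_open[OF _ oU that])
    show "(F has_field_derivative f u) (at u)" using F[OF that] at_within_open[OF that oU] by simp
  qed (auto simp: G_def U_def F'(2))
  have GW: "(G has_field_derivative fs u) (at u)" if "u \<in> W" for u
  proof (rule has_field_derivative_transform_within_open[OF _ oW that])
    show "((\<lambda>u. Fs u + (F' 0 - Fs' 0)) has_field_derivative fs u) (at u)"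
      using Fs[OF that] at_within_open[OF that oW] by (auto intro!: derivative_eq_intros)
  qed (auto simp: G_def W_def Fs'(2))
  have Ghol: "G holomorphic_on ball 0 \<delta>"
  proof (rule holomorphic_on_paste_across_line[of _ \<i> _ 0])
    show "G holomorphic_on ball 0 \<delta> \<inter> {z. \<i> \<bullet> z < 0}"
      using GW by (intro holomorphic_onI) (auto simp: W_def inner_complex_def intro: has_field_derivative_at_within simp: field_differentiable_def)
    show "G holomorphic_on ball 0 \<delta> \<inter> {z. 0 < \<i> \<bullet> z}"
      using GU by (intro holomorphic_onI) (auto simp: U_def inner_complex_def intro: has_field_derivative_at_within simp: field_differentiable_def)
  qed (use Gc in auto)
  show ?thesis
  proof (rule that)
    show "deriv G holomorphic_on ball 0 \<delta>" by (intro holomorphic_deriv Ghol) auto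
    show "deriv G u = f u" if "u \<in> ball 0 \<delta>" "Im u > 0" for u
      using GU[of u] that by (auto simp: U_def intro!: DERIV_imp_deriv)
  qed
qed

text \<open>The extension \<open>S\<close> maps the upper half disc into the unit disc and \<open>0\<close> to the circle. If its derivative
vanished at \<open>0\<close>, then \<open>S\<close> would multiply angles at \<open>0\<close> by some \<open>n \<ge> 2\<close>, and the image of a half disc,
having an opening of at least a full turn, could not stay within the unit disc.\<close>

lemma reflection_injective:
  fixes f :: "complex \<Rightarrow> complex" and m :: "complex \<Rightarrow> real"
  assumes "\<delta> > 0"
    and hol: "f holomorphic_on {u \<in> ball 0 \<delta>. Im u > 0}"
    and bnd: "\<And>u. u \<in> ball 0 \<delta> \<Longrightarrow> Im u > 0 \<Longrightarrow> cmod (f u) < 1"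
    and m: "continuous_on {u \<in> ball 0 \<delta>. Im u \<ge> 0} m"
      "\<And>u. u \<in> ball 0 \<delta> \<Longrightarrow> Im u > 0 \<Longrightarrow> m u = cmod (f u)"
      "\<And>u. u \<in> ball 0 \<delta> \<Longrightarrow> Im u = 0 \<Longrightarrow> m u = 1"
  obtains \<epsilon> where "\<epsilon> > 0" "\<epsilon> \<le> \<delta>" "inj_on f {u \<in> ball 0 \<epsilon>. Im u > 0}"
proof -
  have "m 0 = 1" using m(3)[of 0] \<open>\<delta> > 0\<close> by simp
  obtain d where d: "d > 0" "\<And>u. u \<in> ball 0 \<delta> \<Longrightarrow> Im u \<ge> 0 \<Longrightarrow> dist u 0 < d \<Longrightarrow> dist (m u) (m 0) < 1 / 2"
    using m(1) \<open>\<delta> > 0\<close> unfolding continuous_on_iff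
    by (metis (no_types, lifting) centre_in_ball mem_Collect_eq order_refl zero_complex.sel(2) half_gt_zero_iff zero_less_one)
  define \<rho> where "\<rho> = min d \<delta>"
  have \<rho>: "\<rho> > 0" "\<rho> \<le> \<delta>" "\<rho> \<le> d" using d \<open>\<delta> > 0\<close> by (auto simp: \<rho>_def)
  have half: "1 / 2 \<le> cmod (f u)" if "u \<in> ball 0 \<rho>" "Im u > 0" for u
    using d(2)[of u] m(2)[of u] that \<rho> \<open>m 0 = 1\<close> by (auto simp: dist_real_def abs_if split: if_splits)
  obtain S where S: "S holomorphic_on ball 0 \<rho>" "\<And>u. u \<in> ball 0 \<rho> \<Longrightarrow> Im u > 0 \<Longrightarrow> S u = f u"
  proof (rule reflection_extension[of \<rho> f m])
    show "f holomorphic_on {u \<in> ball 0 \<rho>. 0 < Im u}"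
      by (rule holomorphic_on_subset[OF hol]) (use \<rho> in auto)
    show "continuous_on {u \<in> ball 0 \<rho>. 0 \<le> Im u} m"
      by (rule continuous_on_subset[OF m(1)]) (use \<rho> in auto)
    show "1 / 2 \<le> cmod (f u) \<and> cmod (f u) \<le> 1" if "u \<in> ball 0 \<rho>" "0 < Im u" for u
      using half[OF that] bnd[of u] that \<rho> by auto
  qed (use m \<rho> in auto)
  have Slt: "cmod (S u) < 1" if "u \<in> ball 0 \<rho>" "Im u > 0" for u
    using S(2)[OF that] bnd[of u] that \<rho> by auto
  have S0: "cmod (S 0) = 1"
  proof -
    have lim: "((\<lambda>\<eta>. \<i> * of_real \<eta>) \<longlongrightarrow> (0::complex)) (at_right (0::real))"
      by (auto intro!: tendsto_eq_intros)
    have ev: "\<forall>\<^sub>F \<eta> in at_right (0::real). \<i> * of_real \<eta> \<in> ball 0 \<rho> \<and> Im (\<i> * of_real \<eta>) > 0"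
      using eventually_at_right_less[of 0] eventually_at_right_real[OF \<rho>(1)]
      by eventually_elim (auto simp: norm_mult)
    have "isCont S 0" using S(1) \<rho> by (auto dest!: holomorphic_on_imp_continuous_on simp: continuous_on_eq_continuous_at)
    hence 1: "((\<lambda>\<eta>. cmod (S (\<i> * of_real \<eta>))) \<longlongrightarrow> cmod (S 0)) (at_right (0::real))"
      using lim by (intro tendsto_norm isCont_tendsto_compose[of 0 S]) auto
    have "((\<lambda>\<eta>. m (\<i> * of_real \<eta>)) \<longlongrightarrow> m 0) (at_right (0::real))"
    proof (rule continuous_on_tendsto_compose[OF m(1) lim])
      show "\<forall>\<^sub>F \<eta> in at_right 0. \<i> * of_real \<eta> \<in> {u \<in> ball 0 \<delta>. 0 \<le> Im u}"
        using ev by eventually_elim (use \<rho> in auto)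
    qed (use \<open>\<delta> > 0\<close> in auto)
    hence "((\<lambda>\<eta>. cmod (S (\<i> * of_real \<eta>))) \<longlongrightarrow> m 0) (at_right (0::real))"
    proof (rule Lim_transform_eventually)
      show "\<forall>\<^sub>F \<eta> in at_right 0. m (\<i> * of_real \<eta>) = cmod (S (\<i> * of_real \<eta>))"
        using ev by eventually_elim (use \<rho> m(2) S(2) in auto)
    qed
    with 1 show ?thesis using \<open>m 0 = 1\<close> tendsto_unique[OF trivial_limit_at_right_real] by metis
  qed
  define n where "n = nat (zorder (\<lambda>u. S u - S 0) 0)"
  define g where "g = zor_poly (\<lambda>u. S u - S 0) 0"
  have "\<i> * of_real (\<rho> / 2) \<in> ball 0 \<rho>" "Im (\<i> * of_real (\<rho> / 2)) > 0" using \<rho> by (auto simp: norm_mult)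
  hence "cmod (S (\<i> * of_real (\<rho> / 2))) < 1" by (rule Slt)
  hence "\<exists>w\<in>ball 0 \<rho>. S w - S 0 \<noteq> 0"
    using S0 \<open>\<i> * of_real (\<rho> / 2) \<in> ball 0 \<rho>\<close> by (intro bexI[of _ "\<i> * of_real (\<rho> / 2)"]) auto
  moreover have "(\<lambda>u. S u - S 0) holomorphic_on ball 0 \<rho>" by (intro holomorphic_intros S)
  ultimately have "(if S 0 - S 0 = 0 then zorder (\<lambda>u. S u - S 0) 0 > 0 else zorder (\<lambda>u. S u - S 0) 0 = 0) \<and>
    (\<exists>r. r > 0 \<and> cball (0::complex) r \<subseteq> ball 0 \<rho> \<and> g holomorphic_on cball 0 r
    \<and> (\<forall>w\<in>cball 0 r. S w - S 0 = g w * (w - 0) ^ n \<and> g w \<noteq> 0))"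
    unfolding n_def g_def
    by (intro zorder_exist_zero[of "\<lambda>u. S u - S 0" "ball 0 \<rho>" 0]) (use \<rho>(1) in auto)
  hence n: "n > 0" and "\<exists>r. r > 0 \<and> cball (0::complex) r \<subseteq> ball 0 \<rho> \<and> g holomorphic_on cball 0 r
    \<and> (\<forall>w\<in>cball 0 r. S w - S 0 = g w * w ^ n \<and> g w \<noteq> 0)"
    by (auto simp: n_def)
  then obtain r where r: "r > 0" "cball (0::complex) r \<subseteq> ball 0 \<rho>" "g holomorphic_on cball 0 r"
    and "\<forall>w\<in>cball 0 r. S w - S 0 = g w * w ^ n \<and> g w \<noteq> 0"
    by blast
  hence r4: "S w - S 0 = g w * w ^ n \<and> g w \<noteq> 0" if "w \<in> cball 0 r" for w
    using that by blast
  have g0: "g 0 \<noteq> 0" using r4[of 0] r(1) by auto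
  have gc: "isCont g 0"
    using r(1,3) continuous_on_interior[of "cball 0 r" g 0] holomorphic_on_imp_continuous_on by auto
  have "n = 1"
  proof (rule ccontr)
    assume "n \<noteq> 1"
    hence n2: "n \<ge> 2" using n by simp
    define c where "c = cnj (S 0) * g 0"
    have "c \<noteq> 0" using g0 S0 by (auto simp: c_def)
    \<comment> \<open>a direction into the upper half plane in which the term of order n points outwards\<close>
    define \<theta> where "\<theta> = (if Arg c > 0 then (2 * pi - Arg c) / n else (pi / 4 - Arg c) / n)"
    have Arg: "- pi < Arg c" "Arg c \<le> pi" using Arg_bounded by auto
    have \<theta>: "0 < \<theta>" "\<theta> < pi"
    proof -
      show "0 < \<theta>" unfolding \<theta>_def using n Arg pi_gt_zero by (auto simp: not_less)
      have le: "2 * pi \<le> pi * n" using n2 by simp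
      show "\<theta> < pi"
      proof (cases "Arg c > 0")
        case True
        have "2 * pi - Arg c < pi * n" using le True by linarith
        thus ?thesis using True n by (simp add: \<theta>_def divide_less_eq)
      next
        case False
        have "pi / 4 - Arg c < pi * n" using le Arg pi_gt_zero by linarith
        thus ?thesis using False n by (simp add: \<theta>_def divide_less_eq)
      qed
    qed
    have "Re (c * cis (n * \<theta>)) > 0"
    proof -
      have "c * cis (n * \<theta>) = of_real (cmod c) * cis (Arg c + n * \<theta>)"
        using \<open>c \<noteq> 0\<close> by (metis Arg_eq cis_conv_exp cis_mult mult.assoc rcis_def rcis_cmod_Arg)
      also have "Arg c + n * \<theta> = (if Arg c > 0 then 2 * pi else pi / 4)"
        using n by (simp add: \<theta>_def)
      finally show ?thesis using \<open>c \<noteq> 0\<close> by (simp add: cos_45)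
    qed
    have tlim: "((\<lambda>t. of_real t * cis \<theta>) \<longlongrightarrow> (0::complex)) (at_right (0::real))"
      by (auto intro!: tendsto_eq_intros)
    have "((\<lambda>t. Re (cnj (S 0) * g (of_real t * cis \<theta>) * cis (n * \<theta>))) \<longlongrightarrow> Re (c * cis (n * \<theta>))) (at_right (0::real))"
      unfolding c_def by (intro tendsto_intros isCont_tendsto_compose[OF gc] tlim)
    hence ev1: "\<forall>\<^sub>F t in at_right (0::real). Re (cnj (S 0) * g (of_real t * cis \<theta>) * cis (n * \<theta>)) > 0"
      using \<open>Re (c * cis (n * \<theta>)) > 0\<close> by (rule order_tendstoD(1))
    have "\<forall>\<^sub>F t in at_right (0::real). False"
      using ev1 eventually_at_right_less[of 0] eventually_at_right_real[OF r(1)]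
    proof eventually_elim
      case (elim t)
      define u where "u = of_real t * cis \<theta>"
      have "u \<in> cball 0 r" using elim by (auto simp: u_def norm_mult)
      hence S_u: "S u = S 0 + g u * u ^ n" using r4[of u] by (simp add: algebra_simps)
      have "sin \<theta> > 0" using \<theta> sin_gt_zero by auto
      hence "Im u > 0" using elim by (simp add: u_def)
      have "cmod (S u) < 1" using \<open>u \<in> cball 0 r\<close> r(2) \<open>Im u > 0\<close> by (intro Slt) auto
      hence "cmod (cnj (S 0) * S u) < 1" using S0 by (simp add: norm_mult)
      hence "Re (cnj (S 0) * S u) < 1" using complex_Re_le_cmod order.strict_trans1 by blast
      moreover have "cnj (S 0) * S u = 1 + cnj (S 0) * g u * u ^ n"
        using S0 by (simp add: S_u algebra_simps complex_norm_square [symmetric])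
      moreover have "u ^ n = of_real (t ^ n) * cis (n * \<theta>)"
        by (simp add: u_def power_mult_distrib Complex.DeMoivre)
      moreover have "Re (cnj (S 0) * g u * (of_real (t ^ n) * cis (n * \<theta>))) = t ^ n * Re (cnj (S 0) * g u * cis (n * \<theta>))"
        by (simp add: algebra_simps)
      moreover have "t ^ n * Re (cnj (S 0) * g u * cis (n * \<theta>)) > 0"
        using elim by (simp add: u_def)
      ultimately show False by simp
    qed
    thus False by simp
  qed
  have "(S has_field_derivative g 0) (at 0)"
  proof -
    have "((\<lambda>u. (S u - S 0) / (u - 0)) \<longlongrightarrow> g 0) (at 0)"
    proof (rule Lim_transform_eventually)
      show "(g \<longlongrightarrow> g 0) (at 0)" using gc by (simp add: isCont_def)
      have "\<forall>\<^sub>F u in at (0::complex). u \<in> ball 0 r - {0}"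
        using r(1) eventually_at_in_open[of "ball (0::complex) r" 0] by simp
      thus "\<forall>\<^sub>F u in at 0. g u = (S u - S 0) / (u - 0)"
        by eventually_elim (use r4 \<open>n = 1\<close> in auto)
    qed
    thus ?thesis by (simp add: has_field_derivative_iff)
  qed
  hence "deriv S 0 \<noteq> 0" using g0 DERIV_imp_deriv by metis
  moreover have "(0::complex) \<in> ball 0 \<rho>" using \<rho> by simp
  ultimately obtain \<epsilon> where \<epsilon>: "\<epsilon> > 0" "ball (0::complex) \<epsilon> \<subseteq> ball 0 \<rho>" "inj_on S (ball 0 \<epsilon>)"
    using has_complex_derivative_locally_injective[OF S(1) _ open_ball, of 0] by metis
  show ?thesis
  proof (rule that)
    show "\<epsilon> > 0" "\<epsilon> \<le> \<delta>" using \<epsilon>(1,2) \<rho> by (auto simp: ball_subset_ball_iff)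
    show "inj_on f {u \<in> ball 0 \<epsilon>. 0 < Im u}"
    proof (rule inj_onI)
      fix x y assume "x \<in> {u \<in> ball 0 \<epsilon>. 0 < Im u}" "y \<in> {u \<in> ball 0 \<epsilon>. 0 < Im u}" "f x = f y"
      moreover from this have "S x = f x" "S y = f y" using S(2) \<epsilon>(2) by auto
      ultimately show "x = y" using inj_onD[OF \<epsilon>(3), of x y] by auto
    qed
  qed
qed

text \<open>The exponential map carries a half disc to a neighbourhood of the boundary point within the disc.\<close>

lemma boundary_injective:
  fixes s :: "complex \<Rightarrow> complex" and m :: "complex \<Rightarrow> real"
  assumes \<zeta>: "cmod \<zeta> = 1" and "\<epsilon> > 0"
    and hol: "s holomorphic_on ball 0 1 \<inter> ball \<zeta> \<epsilon>"
    and bnd: "\<And>z. z \<in> ball 0 1 \<inter> ball \<zeta> \<epsilon> \<Longrightarrow> cmod (s z) < 1"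
    and m: "continuous_on (cball 0 1 \<inter> ball \<zeta> \<epsilon>) m"
      "\<And>z. z \<in> ball 0 1 \<inter> ball \<zeta> \<epsilon> \<Longrightarrow> m z = cmod (s z)"
      "\<And>z. z \<in> sphere 0 1 \<inter> ball \<zeta> \<epsilon> \<Longrightarrow> m z = 1"
  obtains \<epsilon>' where "\<epsilon>' > 0" "inj_on s (ball 0 1 \<inter> ball \<zeta> \<epsilon>')"
proof -
  define E where "E = (\<lambda>u. \<zeta> * exp (\<i> * u))"
  have E0: "E 0 = \<zeta>" by (simp add: E_def)
  have normE: "cmod (E u) = exp (- Im u)" for u using \<zeta> by (simp add: E_def norm_mult)
  have "isCont E 0" unfolding E_def by (intro continuous_intros)
  then obtain \<delta> where \<delta>: "\<delta> > 0" "\<And>u. dist u 0 < \<delta> \<Longrightarrow> dist (E u) (E 0) < \<epsilon>"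
    using \<open>\<epsilon> > 0\<close> unfolding continuous_at_eps_delta by metis
  have Eb: "E u \<in> ball \<zeta> \<epsilon>" if "u \<in> ball 0 \<delta>" for u
    using \<delta>(2)[of u] that by (simp add: E0 dist_commute)
  obtain \<epsilon>1 where \<epsilon>1: "\<epsilon>1 > 0" "\<epsilon>1 \<le> \<delta>" "inj_on (\<lambda>u. s (E u)) {u \<in> ball 0 \<epsilon>1. Im u > 0}"
  proof (rule reflection_injective[of \<delta> "\<lambda>u. s (E u)" "\<lambda>u. m (E u)"])
    have "(s \<circ> E) holomorphic_on {u \<in> ball 0 \<delta>. 0 < Im u}"
    proof (rule holomorphic_on_compose_gen[OF _ hol])
      show "E holomorphic_on {u \<in> ball 0 \<delta>. 0 < Im u}" unfolding E_def by (intro holomorphic_intros)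
    qed (use Eb normE in auto)
    thus "(\<lambda>u. s (E u)) holomorphic_on {u \<in> ball 0 \<delta>. 0 < Im u}" by (simp add: o_def)
    show "continuous_on {u \<in> ball 0 \<delta>. 0 \<le> Im u} (\<lambda>u. m (E u))"
    proof (rule continuous_on_compose2[OF m(1)])
      show "continuous_on {u \<in> ball 0 \<delta>. 0 \<le> Im u} E" unfolding E_def by (intro continuous_intros)
    qed (use Eb normE in auto)
  qed (use \<delta> Eb normE in \<open>auto intro!: bnd m(2,3)\<close>)
  define L where "L = (\<lambda>z. - \<i> * Ln (z / \<zeta>))"
  have "\<zeta> \<noteq> 0" using \<zeta> by auto
  have "isCont L \<zeta>" unfolding L_def
    using \<open>\<zeta> \<noteq> 0\<close> by (intro continuous_intros) (auto simp: complex_nonpos_Reals_iff)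
  moreover have "L \<zeta> = 0" using \<open>\<zeta> \<noteq> 0\<close> by (simp add: L_def)
  ultimately obtain \<epsilon>' where \<epsilon>': "\<epsilon>' > 0" "\<And>z. dist z \<zeta> < \<epsilon>' \<Longrightarrow> dist (L z) 0 < \<epsilon>1"
    using \<epsilon>1(1) unfolding continuous_at_eps_delta by metis
  define \<epsilon>'' where "\<epsilon>'' = min \<epsilon>' 1"
  have EL: "E (L z) = z" if "z \<in> ball \<zeta> \<epsilon>''" for z
  proof -
    have "z \<noteq> 0" using that \<zeta> by (auto simp: \<epsilon>''_def dist_norm)
    thus ?thesis using \<open>\<zeta> \<noteq> 0\<close> by (simp add: E_def L_def exp_Ln)
  qed
  have LU: "L z \<in> {u \<in> ball 0 \<epsilon>1. Im u > 0}" if "z \<in> ball 0 1 \<inter> ball \<zeta> \<epsilon>''" for z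
  proof -
    have "exp (- Im (L z)) < 1" using normE[of "L z"] EL[of z] that by auto
    hence "Im (L z) > 0" by simp
    moreover have "L z \<in> ball 0 \<epsilon>1" using \<epsilon>'(2)[of z] that by (auto simp: dist_commute \<epsilon>''_def)
    ultimately show ?thesis by auto
  qed
  show ?thesis
  proof (rule that)
    show "\<epsilon>'' > 0" using \<epsilon>' by (simp add: \<epsilon>''_def)
    show "inj_on s (ball 0 1 \<inter> ball \<zeta> \<epsilon>'')"
    proof (rule inj_onI)
      fix x y assume xy: "x \<in> ball 0 1 \<inter> ball \<zeta> \<epsilon>''" "y \<in> ball 0 1 \<inter> ball \<zeta> \<epsilon>''" "s x = s y"
      have "E (L x) = x" "E (L y) = y" using xy by (auto intro: EL)
      moreover have "L x = L y"
        by (rule inj_onD[OF \<epsilon>1(3) _ LU[OF xy(1)] LU[OF xy(2)]]) (simp add: calculation xy(3))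
      ultimately show "x = y" by metis
    qed
  qed
qed

text \<open>The boundary values of a Riemann map may fail to exist, but its modulus always tends to one at the
boundary, because the inverse image of a smaller closed disc is compact.\<close>

lemma disc_map_modulus_continuous:
  assumes "open C" and f: "f holomorphic_on C" and g: "g holomorphic_on ball 0 1"
    and fg: "\<And>z. z \<in> C \<Longrightarrow> f z \<in> ball 0 1 \<and> g (f z) = z"
    and gf: "\<And>z. z \<in> ball 0 1 \<Longrightarrow> g z \<in> C \<and> f (g z) = z"
  shows "continuous_on UNIV (\<lambda>w. if w \<in> C then cmod (f w) else 1)"
proof -
  define M where "M = (\<lambda>w. if w \<in> C then cmod (f w) else 1)"
  have "isCont M w" for w
  proof (cases "w \<in> C")
    case True
    have "isCont (\<lambda>w. cmod (f w)) w"
      using holomorphic_on_imp_continuous_on[OF f] True \<open>open C\<close>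
      by (intro continuous_norm) (auto simp: continuous_on_eq_continuous_at)
    moreover have "\<forall>\<^sub>F x in nhds w. cmod (f x) = M x"
      using eventually_nhds_in_open[OF \<open>open C\<close> True] by eventually_elim (auto simp: M_def)
    ultimately show ?thesis using isCont_cong by fast
  next
    case False
    show ?thesis unfolding continuous_at_eps_delta
    proof (intro allI impI)
      fix e :: real assume "e > 0"
      define r where "r = 1 - min e (1 / 2)"
      have "r < 1" using \<open>e > 0\<close> by (simp add: r_def)
      have "compact (g ` cball 0 r)"
        using \<open>r < 1\<close> by (intro compact_continuous_image holomorphic_on_imp_continuous_on holomorphic_on_subset[OF g]) auto
      moreover have "w \<notin> g ` cball 0 r" using False gf \<open>r < 1\<close> by force
      ultimately have "open (- g ` cball 0 r)" "w \<in> - g ` cball 0 r" by (auto intro: compact_imp_closed)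
      then obtain d where d: "d > 0" "ball w d \<subseteq> - g ` cball 0 r" by (meson open_contains_ball)
      have "dist (M x) (M w) < e" if "dist x w < d" for x
      proof (cases "x \<in> C")
        case True
        have "x \<notin> g ` cball 0 r" using d that by (auto simp: dist_commute)
        hence "f x \<notin> cball 0 r" using fg[OF True] by force
        moreover have "cmod (f x) < 1" using fg[OF True] by auto
        ultimately show ?thesis using True False by (auto simp: M_def r_def dist_real_def)
      qed (use False \<open>e > 0\<close> in \<open>auto simp: M_def\<close>)
      thus "\<exists>d>0. \<forall>x'. dist x' w < d \<longrightarrow> dist (M x') (M w) < e" using d by auto
    qed
  qed
  thus ?thesis by (simp add: continuous_on_eq_continuous_at M_def)
qed

text \<open>Composing with a Riemann map of the target makes the modulus tend to one at the circle, whatever the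
boundary of the target looks like, so that the reflection principle applies.\<close>

lemma boundary_injective_into_simply_connected:
  assumes v: "continuous_on (cball 0 1) v" "v holomorphic_on ball 0 1"
    and \<zeta>: "cmod \<zeta> = 1" "\<epsilon> > 0"
    and C: "open C" "simply_connected C" "C \<noteq> UNIV"
    and inside: "v ` (ball 0 1 \<inter> ball \<zeta> \<epsilon>) \<subseteq> C"
    and outside: "v ` (sphere 0 1 \<inter> ball \<zeta> \<epsilon>) \<inter> C = {}"
  obtains \<epsilon>' where "\<epsilon>' > 0" "inj_on v (ball 0 1 \<inter> ball \<zeta> \<epsilon>')"
proof -
  have "C \<noteq> {}"
  proof -
    have "\<zeta> \<in> closure (ball 0 1)" using \<zeta> by simp
    then obtain z where "z \<in> ball 0 1" "dist z \<zeta> < \<epsilon>" using \<zeta>(2) closure_approachable by metis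
    hence "z \<in> ball 0 1 \<inter> ball \<zeta> \<epsilon>" by (simp add: dist_commute)
    thus ?thesis using inside by blast
  qed
  then have "\<exists>f g. f holomorphic_on C \<and> g holomorphic_on ball 0 1 \<and>
      (\<forall>z\<in>C. f z \<in> ball 0 1 \<and> g (f z) = z) \<and> (\<forall>z\<in>ball 0 1. g z \<in> C \<and> f (g z) = z)"
    using C Riemann_mapping_theorem[of C] by blast
  then obtain f g where fg: "f holomorphic_on C" "g holomorphic_on ball 0 1"
    "\<And>z. z \<in> C \<Longrightarrow> f z \<in> ball 0 1 \<and> g (f z) = z" "\<And>z. z \<in> ball 0 1 \<Longrightarrow> g z \<in> C \<and> f (g z) = z"
    by blast
  define M where "M = (\<lambda>w. if w \<in> C then cmod (f w) else 1)"
  have M: "continuous_on UNIV M" unfolding M_def by (rule disc_map_modulus_continuous[OF C(1) fg])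
  obtain \<epsilon>' where \<epsilon>': "\<epsilon>' > 0" "inj_on (f \<circ> v) (ball 0 1 \<inter> ball \<zeta> \<epsilon>')"
  proof (rule boundary_injective[of \<zeta> \<epsilon> "f \<circ> v" "\<lambda>z. M (v z)"])
    show "f \<circ> v holomorphic_on ball 0 1 \<inter> ball \<zeta> \<epsilon>"
      by (rule holomorphic_on_compose_gen[OF holomorphic_on_subset[OF v(2)] fg(1)]) (use inside in auto)
    show "continuous_on (cball 0 1 \<inter> ball \<zeta> \<epsilon>) (\<lambda>z. M (v z))"
      by (rule continuous_on_compose2[OF M continuous_on_subset[OF v(1)]]) auto
    show "M (v z) = cmod ((f \<circ> v) z)" if "z \<in> ball 0 1 \<inter> ball \<zeta> \<epsilon>" for z
    proof -
      have "v z \<in> C" using that inside by blast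
      thus ?thesis by (simp add: M_def)
    qed
    show "M (v z) = 1" if "z \<in> sphere 0 1 \<inter> ball \<zeta> \<epsilon>" for z
    proof -
      have "v z \<notin> C" using that outside by blast
      thus ?thesis by (simp add: M_def)
    qed
    show "cmod ((f \<circ> v) z) < 1" if "z \<in> ball 0 1 \<inter> ball \<zeta> \<epsilon>" for z
    proof -
      have "v z \<in> C" using that inside by blast
      thus ?thesis using fg(3) by auto
    qed
  qed (use \<zeta> in auto)
  have "inj_on v (ball 0 1 \<inter> ball \<zeta> \<epsilon>')"
    using inj_on_imageI2[OF \<epsilon>'(2)] .
  thus ?thesis using \<epsilon>'(1) that by blast
qed

section \<open>Functions on the closed disc of constant valence\<close>

lemma compact_avoids_ball:
  assumes "compact S" "x \<notin> S"
  obtains \<delta> where "\<delta> > 0" "\<And>y. dist y x < \<delta> \<Longrightarrow> y \<notin> (S :: 'a :: metric_space set)"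
proof -
  have "open (- S)" using compact_imp_closed[OF assms(1)] by auto
  then obtain \<delta> where "\<delta> > 0" "ball x \<delta> \<subseteq> - S" using assms(2) by (meson ComplI openE)
  thus ?thesis using that[of \<delta>] by (auto simp: dist_commute subset_iff)
qed

text \<open>The functions \<open>1 / (\<Phi> - \<lambda>)\<close> have this property. It forces the circle into the boundary of the image
although \<open>v\<close> is merely continuous there: a solution on the circle counts once, and by the reflection
principle it is the limit of at most one solution from inside.\<close>

locale exact_valence =
  fixes v :: "complex \<Rightarrow> complex" and N :: nat
  assumes cont: "continuous_on (cball 0 1) v"
    and hol: "v holomorphic_on ball 0 1"
    and fibre_finite: "w \<in> v ` cball 0 1 \<Longrightarrow> finite {z \<in> cball 0 1. v z = w}"
    and fibre_sum: "w \<in> v ` cball 0 1 \<Longrightarrow> (\<Sum>z\<in>{z \<in> cball 0 1. v z = w}. solution_mult v w z) = N"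
begin

lemma nonconstant: "\<exists>z\<in>ball 0 1. v z - w \<noteq> 0"
proof (rule ccontr)
  assume "\<not> ?thesis"
  hence *: "v z = w" if "z \<in> ball 0 1" for z using that by auto
  have "v 0 = w" using *[of 0] by simp
  hence "w \<in> v ` cball 0 1" by (intro image_eqI[of _ _ 0]) auto
  hence "finite {z \<in> cball 0 1. v z = w}" by (rule fibre_finite)
  moreover have "ball 0 1 \<subseteq> {z \<in> cball 0 1. v z = w}" using * by auto
  ultimately have "finite (ball (0::complex) 1)" by (rule rev_finite_subset)
  thus False using finite_imp_not_open[of "ball (0::complex) 1"] by simp
qed

lemma zorder_pos: "z \<in> ball 0 1 \<Longrightarrow> v z = w \<Longrightarrow> zorder (\<lambda>u. v u - w) z > 0"
proof -
  assume z: "z \<in> ball 0 1" "v z = w"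
  have "(\<lambda>u. v u - w) holomorphic_on ball 0 1" by (intro holomorphic_intros hol)
  from zorder_exist_zero[OF this open_ball connected_ball z(1) nonconstant[of w]]
  show ?thesis using z(2) by simp
qed

lemma mult_pos: "z \<in> cball 0 1 \<Longrightarrow> v z = w \<Longrightarrow> solution_mult v w z \<ge> 1"
  using zorder_pos[of z w] by (auto simp: solution_mult_def)

lemma mult_sphere: "cmod z = 1 \<Longrightarrow> solution_mult v w z = 1"
  by (simp add: solution_mult_def)

lemma mult_injective:
  assumes "open S" "S \<subseteq> ball 0 1" "inj_on v S" "z \<in> S" "v z = w"
  shows "solution_mult v w z = 1"
proof -
  have h: "v holomorphic_on S" by (rule holomorphic_on_subset[OF hol assms(2)])
  have d: "deriv v z \<noteq> 0" by (rule holomorphic_injective_imp_regular[OF h assms(1,3,4)])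
  have "v field_differentiable (at z)" using h assms(1,4) by (rule holomorphic_on_imp_differentiable_at)
  hence "deriv (\<lambda>u. v u - w) z = deriv v z"
    by (intro DERIV_imp_deriv) (auto intro!: derivative_eq_intros field_differentiable_derivI)
  hence "zorder (\<lambda>u. v u - w) z = 1"
    using d assms by (intro zorder_zero_eqI[of _ S]) (auto intro!: holomorphic_intros h)
  thus ?thesis using assms by (auto simp: solution_mult_def)
qed

lemma interior_image: "v ` ball 0 1 \<subseteq> interior (v ` cball 0 1)"
proof (rule interior_maximal)
  show "v ` ball 0 1 \<subseteq> v ` cball 0 1" by auto
  have "\<not> v constant_on ball 0 1" using nonconstant unfolding constant_on_def by (metis diff_self)
  thus "open (v ` ball 0 1)"
    by (intro open_mapping_thm[OF hol]) auto
qed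

lemma compact_image: "compact (v ` cball 0 1)"
  by (intro compact_continuous_image cont) auto

lemma frontier_image: "frontier (v ` cball 0 1) \<subseteq> v ` sphere 0 1"
proof
  fix w assume w: "w \<in> frontier (v ` cball 0 1)"
  hence "w \<in> v ` cball 0 1" "w \<notin> interior (v ` cball 0 1)"
    using compact_imp_closed[OF compact_image] by (auto simp: frontier_def)
  thus "w \<in> v ` sphere 0 1" using interior_image by (force simp: less_le)
qed

text \<open>This puts the number of solutions in a smaller disc into the form in which Rouche's theorem counts
zeros.\<close>

lemma inner_sum:
  assumes \<rho>: "0 < \<rho>" "\<rho> < 1" and w: "w \<in> v ` cball 0 1" and off: "\<And>z. cmod z = \<rho> \<Longrightarrow> v z \<noteq> w"
  shows "(\<Sum>p\<in>{p \<in> ball 0 1. v p = w}. winding_number (circlepath 0 \<rho>) p * of_int (zorder (\<lambda>u. v u - w) p))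
       = of_nat (\<Sum>p\<in>{p \<in> ball 0 \<rho>. v p = w}. solution_mult v w p)"
proof -
  have fin: "finite {p \<in> ball 0 1. v p = w}" by (rule finite_subset[OF _ fibre_finite[OF w]]) auto
  have "(\<Sum>p\<in>{p \<in> ball 0 1. v p = w}. winding_number (circlepath 0 \<rho>) p * of_int (zorder (\<lambda>u. v u - w) p))
    = (\<Sum>p\<in>{p \<in> ball 0 \<rho>. v p = w}. of_nat (solution_mult v w p))"
  proof (rule sum.mono_neutral_cong_right[OF fin])
    show "{p \<in> ball 0 \<rho>. v p = w} \<subseteq> {p \<in> ball 0 1. v p = w}" using \<rho> by auto
    show "\<forall>p\<in>{p \<in> ball 0 1. v p = w} - {p \<in> ball 0 \<rho>. v p = w}.
      winding_number (circlepath 0 \<rho>) p * of_int (zorder (\<lambda>u. v u - w) p) = 0"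
    proof
      fix p assume p: "p \<in> {p \<in> ball 0 1. v p = w} - {p \<in> ball 0 \<rho>. v p = w}"
      hence "cmod p > \<rho>" using off[of p] by force
      hence "winding_number (circlepath 0 \<rho>) p = 0"
        using \<rho> by (intro winding_number_zero_outside[of _ "cball 0 \<rho>"]) auto
      thus "winding_number (circlepath 0 \<rho>) p * of_int (zorder (\<lambda>u. v u - w) p) = 0" by simp
    qed
    fix p assume p: "p \<in> {p \<in> ball 0 \<rho>. v p = w}"
    have "winding_number (circlepath 0 \<rho>) p = 1" using p by (intro winding_number_circlepath) auto
    thus "winding_number (circlepath 0 \<rho>) p * of_int (zorder (\<lambda>u. v u - w) p) = of_nat (solution_mult v w p)"
      using p \<rho> zorder_pos[of p w] by (auto simp: solution_mult_def)
  qed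
  thus ?thesis by simp
qed

lemma inner_count_constant:
  assumes \<rho>: "0 < \<rho>" "\<rho> < 1" and w0: "w0 \<in> v ` cball 0 1" and off: "\<And>z. cmod z = \<rho> \<Longrightarrow> v z \<noteq> w0"
  obtains \<delta> where "\<delta> > 0"
    "\<And>w. w \<in> v ` cball 0 1 \<Longrightarrow> dist w w0 < \<delta> \<Longrightarrow>
       (\<Sum>p\<in>{p \<in> ball 0 \<rho>. v p = w}. solution_mult v w p) = (\<Sum>p\<in>{p \<in> ball 0 \<rho>. v p = w0}. solution_mult v w0 p)"
proof -
  have "compact (v ` sphere 0 \<rho>)"
    by (intro compact_continuous_image continuous_on_subset[OF cont]) (use \<rho> in auto)
  moreover have "w0 \<notin> v ` sphere 0 \<rho>" using off unfolding image_iff by (metis mem_sphere_0)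
  ultimately obtain \<delta> where \<delta>: "\<delta> > 0" "\<And>y. dist y w0 < \<delta> \<Longrightarrow> y \<notin> v ` sphere 0 \<rho>"
    using compact_avoids_ball by blast
  show ?thesis
  proof (rule that[OF \<delta>(1)])
    fix w assume w: "w \<in> v ` cball 0 1" "dist w w0 < \<delta>"
    have off': "v z \<noteq> w" if "cmod z = \<rho>" for z
      using \<delta>(2)[of w] w(2) that by auto
    have fin: "finite {p \<in> ball 0 1. v p = w}" if "w \<in> v ` cball 0 1" for w
      by (rule finite_subset[OF _ fibre_finite[OF that]]) auto
    have eq: "v p - w0 + (w0 - w) = v p - w" for p by simp
    have R: "(\<Sum>p\<in>{p \<in> ball 0 1. v p - w0 + (w0 - w) = 0}. winding_number (circlepath 0 \<rho>) p * of_int (zorder (\<lambda>p. v p - w0 + (w0 - w)) p))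
       = (\<Sum>p\<in>{p \<in> ball 0 1. v p - w0 = 0}. winding_number (circlepath 0 \<rho>) p * of_int (zorder (\<lambda>p. v p - w0) p))"
    proof (rule Rouche_theorem)
      show "finite {p \<in> ball 0 1. v p - w0 + (w0 - w) = 0}" using fin[OF w(1)] by simp
      show "finite {p \<in> ball 0 1. v p - w0 = 0}" using fin[OF w0] by simp
      show "\<forall>z\<in>path_image (circlepath 0 \<rho>). cmod (w0 - w) < cmod (v z - w0)"
      proof
        fix z assume "z \<in> path_image (circlepath 0 \<rho>)"
        hence "v z \<in> v ` sphere 0 \<rho>" using \<rho> by auto
        hence "\<not> dist (v z) w0 < \<delta>" using \<delta>(2) by blast
        thus "cmod (w0 - w) < cmod (v z - w0)" using w(2) by (simp add: dist_norm norm_minus_commute)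
      qed
      show "\<forall>z. z \<notin> ball 0 1 \<longrightarrow> winding_number (circlepath 0 \<rho>) z = 0"
        using \<rho> by (intro allI impI winding_number_zero_outside[of _ "cball 0 \<rho>"]) auto
    qed (use \<rho> in \<open>auto intro!: holomorphic_intros hol\<close>)
    have "(of_nat (\<Sum>p\<in>{p \<in> ball 0 \<rho>. v p = w}. solution_mult v w p) :: complex) =
       of_nat (\<Sum>p\<in>{p \<in> ball 0 \<rho>. v p = w0}. solution_mult v w0 p)"
      using R unfolding eq by (simp only: right_minus_eq inner_sum[OF \<rho> w(1) off'] inner_sum[OF \<rho> w0 off])
    thus "(\<Sum>p\<in>{p \<in> ball 0 \<rho>. v p = w}. solution_mult v w p) = (\<Sum>p\<in>{p \<in> ball 0 \<rho>. v p = w0}. solution_mult v w0 p)"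
      using of_nat_eq_iff by blast
  qed
qed

text \<open>By compactness the solutions for a nearby value outside a smaller disc are close to solutions for the
original value.\<close>

lemma fibre_near:
  assumes "e > 0"
  obtains \<delta> where "\<delta> > 0"
    "\<And>z. z \<in> cball 0 1 \<Longrightarrow> cmod z \<ge> \<rho> \<Longrightarrow> dist (v z) w0 < \<delta> \<Longrightarrow>
       \<exists>\<zeta>\<in>cball 0 1. v \<zeta> = w0 \<and> cmod \<zeta> \<ge> \<rho> \<and> dist \<zeta> z < e"
proof -
  define A where "A = cball 0 1 \<inter> {z. cmod z \<ge> \<rho>} \<inter> (\<Inter>\<zeta>\<in>{\<zeta> \<in> cball 0 1. v \<zeta> = w0 \<and> cmod \<zeta> \<ge> \<rho>}. - ball \<zeta> e)"
  have "compact A" unfolding A_def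
    by (intro compact_Int_closed closed_INT) (auto intro!: closed_Collect_le continuous_intros)
  hence "compact (v ` A)" by (intro compact_continuous_image continuous_on_subset[OF cont]) (auto simp: A_def)
  moreover have "w0 \<notin> v ` A" using assms by (force simp: A_def)
  ultimately obtain \<delta> where \<delta>: "\<delta> > 0" "\<And>y. dist y w0 < \<delta> \<Longrightarrow> y \<notin> v ` A"
    using compact_avoids_ball by blast
  show ?thesis
  proof (rule that[OF \<delta>(1)])
    fix z assume z: "z \<in> cball 0 1" "cmod z \<ge> \<rho>" "dist (v z) w0 < \<delta>"
    have "z \<notin> A" using \<delta>(2) z(3) by blast
    thus "\<exists>\<zeta>\<in>cball 0 1. v \<zeta> = w0 \<and> cmod \<zeta> \<ge> \<rho> \<and> dist \<zeta> z < e" using z by (auto simp: A_def)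
  qed
qed

text \<open>The boundary of the image is contained in the connected curve \<open>v ` sphere 0 1\<close>. So a component of the
complement of the curve that meets the image is contained in it, and is bounded with connected
complement.\<close>

lemma component_simply_connected:
  assumes "C \<in> components (- v ` sphere 0 1)" "C \<inter> v ` cball 0 1 \<noteq> {}"
  shows "simply_connected C" "open C" "bounded C" "C \<subseteq> v ` cball 0 1"
proof -
  have comp: "compact (v ` sphere 0 1)"
    by (intro compact_continuous_image continuous_on_subset[OF cont]) auto
  have con: "connected (v ` sphere 0 1)"
    by (intro connected_continuous_image continuous_on_subset[OF cont] connected_sphere) auto
  show op: "open C" using assms(1) comp by (intro open_components[of "- v ` sphere 0 1" C]) (auto intro: compact_imp_closed)
  have cC: "connected C" using assms(1) by (rule in_components_connected)
  show sub: "C \<subseteq> v ` cball 0 1"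
  proof (rule ccontr)
    assume "\<not> C \<subseteq> v ` cball 0 1"
    hence "C \<inter> frontier (v ` cball 0 1) \<noteq> {}"
      using connected_Int_frontier[OF cC assms(2)] by blast
    thus False using frontier_image in_components_subset[OF assms(1)] by blast
  qed
  show bd: "bounded C" using compact_imp_bounded[OF compact_image] sub by (rule bounded_subset)
  have "connected (- C)" by (rule component_complement_connected[OF con assms(1)])
  thus "simply_connected C" using simply_connected_iff_simple[OF op bd] cC by simp
qed

lemma injective_near_boundary:
  assumes "cmod \<zeta> = 1" "\<epsilon> > 0" and avoid: "v ` (ball 0 1 \<inter> ball \<zeta> \<epsilon>) \<inter> v ` sphere 0 1 = {}"
  obtains \<epsilon>' where "\<epsilon>' > 0" "inj_on v (ball 0 1 \<inter> ball \<zeta> \<epsilon>')"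
proof -
  define H where "H = ball 0 1 \<inter> ball \<zeta> \<epsilon>"
  have "\<zeta> \<in> closure (ball 0 1)" using assms by simp
  then obtain z where "z \<in> ball 0 1" "dist z \<zeta> < \<epsilon>" using assms(2) closure_approachable by metis
  hence z: "z \<in> H" by (simp add: H_def dist_commute)
  define C where "C = connected_component_set (- v ` sphere 0 1) (v z)"
  have vH: "v ` H \<subseteq> - v ` sphere 0 1" using avoid by (auto simp: H_def)
  have C: "C \<in> components (- v ` sphere 0 1)"
    unfolding C_def using vH z by (intro componentsI) auto
  have "connected (v ` H)"
    by (intro connected_continuous_image holomorphic_on_imp_continuous_on holomorphic_on_subset[OF hol]
        convex_connected) (auto simp: H_def convex_Int)
  hence vHC: "v ` H \<subseteq> C"
    unfolding C_def using vH z by (intro connected_component_maximal) auto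
  have "v z \<in> v ` cball 0 1" using z by (auto simp: H_def)
  hence "C \<inter> v ` cball 0 1 \<noteq> {}" using vHC z by blast
  note C' = component_simply_connected[OF C this]
  show ?thesis
  proof (rule boundary_injective_into_simply_connected[OF cont hol assms(1,2) C'(2,1)])
    show "C \<noteq> UNIV" using C'(3) not_bounded_UNIV by auto
    show "v ` (ball 0 1 \<inter> ball \<zeta> \<epsilon>) \<subseteq> C" using vHC by (simp add: H_def)
    show "v ` (sphere 0 1 \<inter> ball \<zeta> \<epsilon>) \<inter> C = {}" using in_components_subset[OF C] by auto
  qed (use that in auto)
qed

definition sphere_fibre :: "complex \<Rightarrow> complex set" where
  "sphere_fibre w = {z \<in> sphere 0 1. v z = w}"

definition outer_fibre :: "real \<Rightarrow> complex \<Rightarrow> complex set" where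
  "outer_fibre \<rho> w = {z \<in> cball 0 1 - ball 0 \<rho>. v z = w}"

lemma fibre_subset_finite: "S \<subseteq> cball 0 1 \<Longrightarrow> finite {z \<in> S. v z = w}"
proof (cases "w \<in> v ` cball 0 1")
  case True
  assume "S \<subseteq> cball 0 1"
  thus ?thesis by (intro finite_subset[OF _ fibre_finite[OF True]]) auto
next
  case False
  assume "S \<subseteq> cball 0 1"
  hence e: "{z \<in> S. v z = w} = {}" using False by auto
  show ?thesis unfolding e by simp
qed

lemma sphere_fibre_finite: "finite (sphere_fibre w)"
  unfolding sphere_fibre_def by (rule fibre_subset_finite) auto

lemma outer_fibre_finite: "finite (outer_fibre \<rho> w)"
  unfolding outer_fibre_def by (rule fibre_subset_finite) auto

lemma sum_mult_sphere: "A \<subseteq> sphere 0 1 \<Longrightarrow> (\<Sum>p\<in>A. solution_mult v w p) = card A"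
  using sum.cong[of A A "solution_mult v w" "\<lambda>_. 1"] mult_sphere[of _ w] by (auto simp: subset_iff)

text \<open>Rouche's theorem keeps the number of solutions in a smaller disc constant near \<open>w0\<close>. As the total
is \<open>N\<close>, the number of the remaining solutions is constant as well.\<close>

lemma outer_sum:
  assumes \<rho>: "0 < \<rho>" "\<rho> < 1" "\<And>z. cmod z < 1 \<Longrightarrow> v z = w0 \<Longrightarrow> cmod z < \<rho>" and w0K: "w0 \<in> v ` cball 0 1"
  obtains \<delta> where "\<delta> > 0"
    "\<And>w. w \<in> v ` cball 0 1 \<Longrightarrow> dist w w0 < \<delta> \<Longrightarrow>
       (\<Sum>p\<in>outer_fibre \<rho> w. solution_mult v w p) = card (sphere_fibre w0)"
proof -
  have off: "v z \<noteq> w0" if "cmod z = \<rho>" for z using \<rho>(3)[of z] \<rho>(2) that by auto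
  obtain \<delta>1 where \<delta>1: "\<delta>1 > 0"
    "\<And>w. w \<in> v ` cball 0 1 \<Longrightarrow> dist w w0 < \<delta>1 \<Longrightarrow>
       (\<Sum>p\<in>{p \<in> ball 0 \<rho>. v p = w}. solution_mult v w p) = (\<Sum>p\<in>{p \<in> ball 0 \<rho>. v p = w0}. solution_mult v w0 p)"
    using inner_count_constant[OF \<rho>(1,2) w0K off] by blast
  have split: "(\<Sum>p\<in>{p \<in> ball 0 \<rho>. v p = w}. solution_mult v w p) + (\<Sum>p\<in>outer_fibre \<rho> w. solution_mult v w p) = N"
    if "w \<in> v ` cball 0 1" for w
  proof -
    have "{z \<in> cball 0 1. v z = w} = {p \<in> ball 0 \<rho>. v p = w} \<union> outer_fibre \<rho> w" using \<rho> by (auto simp: outer_fibre_def)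
    moreover have "{p \<in> ball 0 \<rho>. v p = w} \<inter> outer_fibre \<rho> w = {}" by (auto simp: outer_fibre_def)
    moreover have "finite {p \<in> ball 0 \<rho>. v p = w}" by (rule fibre_subset_finite) (use \<rho> in auto)
    ultimately show ?thesis using fibre_sum[OF that] outer_fibre_finite[of \<rho> w] by (simp add: sum.union_disjoint)
  qed
  have out0: "outer_fibre \<rho> w0 = sphere_fibre w0" using \<rho>(2,3) by (force simp: outer_fibre_def sphere_fibre_def)
  have "(\<Sum>p\<in>outer_fibre \<rho> w0. solution_mult v w0 p) = card (sphere_fibre w0)"
    unfolding out0 by (rule sum_mult_sphere) (auto simp: sphere_fibre_def)
  hence "(\<Sum>p\<in>outer_fibre \<rho> w. solution_mult v w p) = card (sphere_fibre w0)"
    if "w \<in> v ` cball 0 1" "dist w w0 < \<delta>1" for w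
    using \<delta>1(2)[OF that] split[OF that(1)] split[OF w0K] by simp
  thus ?thesis using \<delta>1(1) that by blast
qed

text \<open>Suppose that no solution for a value on the boundary curve near \<open>w0\<close> lies in the open disc close to the
circle. Then each half disc at a solution \<open>\<zeta>\<close> of \<open>v \<zeta> = w0\<close> on the circle is mapped off the boundary
curve, and \<open>v\<close> is injective there by the reflection principle. A nearby value off the curve thus has
at most one solution in each of the half discs, and since their number equals the number of half
discs, there is exactly one in each.\<close>

lemma boundary_solutions_continue:
  assumes w0K: "w0 \<in> v ` sphere 0 1"
    and \<rho>: "0 < \<rho>" "\<rho> < 1" "\<And>z. cmod z < 1 \<Longrightarrow> v z = w0 \<Longrightarrow> cmod z < \<rho>"
    and r0: "r0 > 0"
    and no_inner: "\<And>z w. w \<in> v ` sphere 0 1 \<Longrightarrow> dist w w0 < r0 \<Longrightarrow> z \<in> outer_fibre \<rho> w \<Longrightarrow> z \<notin> ball 0 1"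
    and e0: "e0 > 0"
  obtains e \<delta> where "e > 0" "e \<le> e0" "\<delta> > 0" "\<delta> \<le> r0"
    "\<And>\<zeta>. \<zeta> \<in> sphere_fibre w0 \<Longrightarrow> v ` (ball 0 1 \<inter> ball \<zeta> (2 * e)) \<inter> v ` sphere 0 1 = {}"
    "\<And>\<zeta>. \<zeta> \<in> sphere_fibre w0 \<Longrightarrow> ball \<zeta> (2 * e) \<inter> ball 0 \<rho> = {}"
    "\<And>\<zeta> \<zeta>' z. \<zeta> \<in> sphere_fibre w0 \<Longrightarrow> \<zeta>' \<in> sphere_fibre w0 \<Longrightarrow> dist \<zeta> z < 2 * e \<Longrightarrow> dist \<zeta>' z < 2 * e \<Longrightarrow> \<zeta> = \<zeta>'"
    "\<And>z w. z \<in> outer_fibre \<rho> w \<Longrightarrow> dist w w0 < \<delta> \<Longrightarrow> \<exists>\<zeta>\<in>sphere_fibre w0. dist \<zeta> z < e"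
    "\<And>w. w \<in> v ` cball 0 1 \<Longrightarrow> dist w w0 < \<delta> \<Longrightarrow> (\<Sum>p\<in>outer_fibre \<rho> w. solution_mult v w p) = card (sphere_fibre w0)"
    "\<And>w \<zeta>. w \<in> v ` cball 0 1 \<Longrightarrow> dist w w0 < \<delta> \<Longrightarrow> w \<notin> v ` sphere 0 1 \<Longrightarrow> \<zeta> \<in> sphere_fibre w0 \<Longrightarrow>
       \<exists>z. z \<in> outer_fibre \<rho> w \<and> dist \<zeta> z < e"
proof -
  define F0 where "F0 = sphere_fibre w0"
  define b where "b = card F0"
  define out where "out = outer_fibre \<rho>"
  note out_def' = outer_fibre_def
  have F0: "finite F0" "F0 \<noteq> {}" using sphere_fibre_finite w0K by (auto simp: F0_def sphere_fibre_def)
  have w0K': "w0 \<in> v ` cball 0 1" using w0K by auto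
  obtain \<delta>1 where \<delta>1: "\<delta>1 > 0" "\<And>w. w \<in> v ` cball 0 1 \<Longrightarrow> dist w w0 < \<delta>1 \<Longrightarrow> (\<Sum>p\<in>out w. solution_mult v w p) = b"
    using outer_sum[OF \<rho> w0K'] unfolding out_def b_def F0_def by blast
  define good where "good = (\<lambda>\<zeta> \<epsilon>. inj_on v (ball 0 1 \<inter> ball \<zeta> \<epsilon>) \<and> v ` (ball 0 1 \<inter> ball \<zeta> \<epsilon>) \<inter> v ` sphere 0 1 = {}
     \<and> ball \<zeta> \<epsilon> \<inter> ball 0 \<rho> = {})"
  have good_mono: "good \<zeta> e'" if "good \<zeta> e" "e' \<le> e" for \<zeta> e e'
  proof -
    have "ball \<zeta> e' \<subseteq> ball \<zeta> e" using that(2) by auto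
    thus ?thesis using that(1) unfolding good_def by (blast intro: inj_on_subset)
  qed
  have "\<exists>\<epsilon>>0. good \<zeta> \<epsilon>" if \<zeta>: "\<zeta> \<in> F0" for \<zeta>
  proof -
    have \<zeta>': "cmod \<zeta> = 1" "v \<zeta> = w0" using \<zeta> by (auto simp: F0_def sphere_fibre_def)
    have \<zeta>c: "\<zeta> \<in> cball 0 1" using \<zeta>' by simp
    obtain d where d: "d > 0" "\<And>z. z \<in> cball 0 1 \<Longrightarrow> dist z \<zeta> < d \<Longrightarrow> dist (v z) w0 < r0"
      using cont[unfolded continuous_on_iff, rule_format, OF \<zeta>c r0] \<zeta>'(2) by blast
    define \<epsilon> where "\<epsilon> = min d (1 - \<rho>)"
    have \<epsilon>: "\<epsilon> > 0" using d \<rho> by (simp add: \<epsilon>_def)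
    have disj: "ball \<zeta> \<epsilon> \<inter> ball 0 \<rho> = {}"
    proof -
      have False if "dist \<zeta> z < \<epsilon>" "cmod z < \<rho>" for z
        using that \<zeta>'(1) norm_triangle_ineq2[of \<zeta> z] by (auto simp: \<epsilon>_def dist_norm)
      thus ?thesis by auto
    qed
    have avoid: "v ` (ball 0 1 \<inter> ball \<zeta> \<epsilon>) \<inter> v ` sphere 0 1 = {}"
    proof -
      have False if z: "z \<in> ball 0 1" "z \<in> ball \<zeta> \<epsilon>" "v z \<in> v ` sphere 0 1" for z
      proof -
        have "dist (v z) w0 < r0" using z d(2)[of z] by (auto simp: \<epsilon>_def dist_commute)
        moreover have "z \<in> out (v z)" using z disj by (auto simp: out_def outer_fibre_def)
        ultimately show False using no_inner[of "v z" z] z by (auto simp: out_def)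
      qed
      thus ?thesis by blast
    qed
    obtain \<epsilon>' where "\<epsilon>' > 0" "inj_on v (ball 0 1 \<inter> ball \<zeta> \<epsilon>')"
      using injective_near_boundary[OF \<zeta>'(1) \<epsilon> avoid] by blast
    moreover have "ball \<zeta> (min \<epsilon> \<epsilon>') \<subseteq> ball \<zeta> \<epsilon>" "ball \<zeta> (min \<epsilon> \<epsilon>') \<subseteq> ball \<zeta> \<epsilon>'" by auto
    ultimately show ?thesis using \<epsilon> avoid disj
      by (intro exI[of _ "min \<epsilon> \<epsilon>'"]) (auto simp: good_def intro: inj_on_subset)
  qed
  then obtain E where E: "\<And>\<zeta>. \<zeta> \<in> F0 \<Longrightarrow> E \<zeta> > 0 \<and> good \<zeta> (E \<zeta>)" by metis
  obtain s where s: "s > 0" "\<And>x y. x \<in> F0 \<Longrightarrow> y \<in> F0 \<Longrightarrow> x \<noteq> y \<Longrightarrow> dist x y \<ge> s"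
    using finite_set_avoid[OF F0(1)] F0(1)
  proof -
    have "\<exists>s>0. \<forall>y\<in>F0. x \<noteq> y \<longrightarrow> s \<le> dist x y" for x using finite_set_avoid[OF F0(1), of x] by auto
    then obtain sf where sf: "\<And>x. sf x > 0 \<and> (\<forall>y\<in>F0. x \<noteq> y \<longrightarrow> sf x \<le> dist x y)" by metis
    have "Min (sf ` F0) > 0" using F0 sf by (subst Min_gr_iff) auto
    moreover have "dist x y \<ge> Min (sf ` F0)" if "x \<in> F0" "y \<in> F0" "x \<noteq> y" for x y
    proof -
      have "Min (sf ` F0) \<le> sf x" using F0 that by (intro Min_le) auto
      thus ?thesis using sf[of x] that by fastforce
    qed
    ultimately show ?thesis using that by blast
  qed
  define e where "e = Min {e0, s / 4, Min (E ` F0) / 2}"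
  have e: "e > 0" using s(1) F0 E e0 by (auto simp: e_def)
  have good2e: "good \<zeta> (2 * e)" if "\<zeta> \<in> F0" for \<zeta>
  proof -
    have "Min (E ` F0) \<le> E \<zeta>" using F0 that by (intro Min_le) auto
    moreover have "e \<le> Min (E ` F0) / 2" by (simp add: e_def)
    ultimately show ?thesis by (intro good_mono[OF conjunct2[OF E[OF that]]]) simp
  qed
  have sep: "\<zeta> = \<zeta>'" if "\<zeta> \<in> F0" "\<zeta>' \<in> F0" "dist \<zeta> z < 2 * e" "dist \<zeta>' z < 2 * e" for \<zeta> \<zeta>' z
  proof (rule ccontr)
    assume "\<zeta> \<noteq> \<zeta>'"
    hence "s \<le> dist \<zeta> \<zeta>'" using s(2) that by auto
    also have "\<dots> \<le> dist \<zeta> z + dist \<zeta>' z" by (rule dist_triangle2)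
    also have "\<dots> < 4 * e" using that by simp
    finally show False by (simp add: e_def)
  qed
  obtain \<delta>3 where \<delta>3: "\<delta>3 > 0" "\<And>z. z \<in> cball 0 1 \<Longrightarrow> cmod z \<ge> \<rho> \<Longrightarrow> dist (v z) w0 < \<delta>3 \<Longrightarrow>
       \<exists>\<zeta>\<in>cball 0 1. v \<zeta> = w0 \<and> cmod \<zeta> \<ge> \<rho> \<and> dist \<zeta> z < e"
    using fibre_near[OF e] by blast
  define \<delta> where "\<delta> = Min {r0, \<delta>1, \<delta>3}"
  have \<delta>: "\<delta> > 0" "\<delta> \<le> r0" "\<delta> \<le> \<delta>3" "\<delta> \<le> \<delta>1" using r0 \<delta>1 \<delta>3 by (auto simp: \<delta>_def)
  have near: "\<exists>\<zeta>\<in>F0. dist \<zeta> z < e" if "z \<in> out w" "dist w w0 < \<delta>" for z w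
  proof -
    have "\<exists>\<zeta>\<in>cball 0 1. v \<zeta> = w0 \<and> cmod \<zeta> \<ge> \<rho> \<and> dist \<zeta> z < e"
      using that \<delta> by (intro \<delta>3(2)) (auto simp: out_def outer_fibre_def)
    then obtain \<zeta> where \<zeta>: "\<zeta> \<in> cball 0 1" "v \<zeta> = w0" "cmod \<zeta> \<ge> \<rho>" "dist \<zeta> z < e" by blast
    hence "\<zeta> \<in> out w0" by (simp add: out_def outer_fibre_def)
    moreover have "out w0 = F0" using \<rho>(2,3) by (force simp: out_def outer_fibre_def F0_def sphere_fibre_def)
    ultimately show ?thesis using \<zeta>(4) by blast
  qed
  \<comment> \<open>each of the b boundary solutions continues to a solution for every nearby value\<close>
  have exists_off: "\<exists>z. z \<in> out w \<and> dist \<zeta> z < e" if wK: "w \<in> v ` cball 0 1" and w: "dist w w0 < \<delta>" "w \<notin> v ` sphere 0 1" and \<zeta>: "\<zeta> \<in> F0" for w \<zeta>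
  proof -
    have "\<forall>z\<in>out w. \<exists>\<zeta>. \<zeta> \<in> F0 \<and> dist \<zeta> z < e" using near w(1) by blast
    then obtain c where c: "\<And>z. z \<in> out w \<Longrightarrow> c z \<in> F0 \<and> dist (c z) z < e" by metis
    have outb: "z \<in> ball 0 1 \<inter> ball (c z) (2 * e)" if "z \<in> out w" for z
      using that w(2) c[OF that] e by (force simp: out_def outer_fibre_def less_le)
    have "solution_mult v w z = 1" if z: "z \<in> out w" for z
      using good2e[of "c z"] c[OF z] outb[OF z] z
      by (intro mult_injective[of "ball 0 1 \<inter> ball (c z) (2 * e)"]) (auto simp: good_def out_def outer_fibre_def)
    hence "card (out w) = b" using \<delta>1(2)[of w] wK w \<delta> by simp
    moreover have "inj_on c (out w)"
    proof (rule inj_onI)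
      fix x y assume xy: "x \<in> out w" "y \<in> out w" "c x = c y"
      have "inj_on v (ball 0 1 \<inter> ball (c x) (2 * e))" using good2e c[OF xy(1)] by (auto simp: good_def)
      thus "x = y" by (rule inj_onD) (use outb[OF xy(1)] outb[OF xy(2)] xy in \<open>auto simp: out_def outer_fibre_def\<close>)
    qed
    ultimately have "card (c ` out w) = card F0" by (simp add: card_image b_def)
    moreover have "c ` out w \<subseteq> F0" using c by auto
    ultimately have "c ` out w = F0" using card_subset_eq[OF F0(1)] by blast
    then obtain z where "z \<in> out w" "c z = \<zeta>" using \<zeta> by auto
    thus ?thesis using c by blast
  qed
  show ?thesis
  proof (rule that[of e \<delta>])
    show "e \<le> e0" by (simp add: e_def)
    show "(\<Sum>p\<in>outer_fibre \<rho> w. solution_mult v w p) = card (sphere_fibre w0)"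
      if "w \<in> v ` cball 0 1" "dist w w0 < \<delta>" for w
      using \<delta>1(2)[of w] that \<delta> by (simp add: out_def b_def F0_def)
  qed (use e \<delta> near sep exists_off good2e in \<open>auto simp: good_def out_def F0_def\<close>)
qed

lemma interior_radius:
  obtains \<rho> where "0 < \<rho>" "\<rho> < 1" "\<And>z. cmod z < 1 \<Longrightarrow> v z = w0 \<Longrightarrow> cmod z < \<rho>"
proof -
  define A where "A = insert 0 (cmod ` {z \<in> ball 0 1. v z = w0})"
  have A: "finite A" "A \<noteq> {}" using fibre_subset_finite[of "ball 0 1" w0] by (auto simp: A_def)
  have "Max A < 1" using A by (subst Max_less_iff) (auto simp: A_def)
  have "Max A \<ge> 0" using A by (intro Max_ge) (auto simp: A_def)
  have "cmod z \<le> Max A" if "cmod z < 1" "v z = w0" for z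
    using A that by (intro Max_ge) (auto simp: A_def)
  thus ?thesis using \<open>Max A < 1\<close> \<open>Max A \<ge> 0\<close> by (intro that[of "(1 + Max A) / 2"]) force+
qed

text \<open>Suppose that values on the circle are interior to the image, and pick one, \<open>w0\<close>, with the fewest
solutions on the circle. By minimality nearby boundary values have no further solutions near the
circle, so the solutions on the circle continue, and \<open>v\<close> maps a relative neighbourhood of a point of the
circle homeomorphically onto a full disc around \<open>w0\<close>. But \<open>v - w0\<close> has a continuous logarithm on a
starlike set that contains this neighbourhood without the point, whereas a circle around \<open>w0\<close> has
winding number one.\<close>

theorem boundary_image_not_interior: "v ` sphere 0 1 \<inter> interior (v ` cball 0 1) = {}"
proof (rule ccontr)
  assume ne: "\<not> ?thesis"
  define P where "P = (\<lambda>w. w \<in> v ` sphere 0 1 \<inter> interior (v ` cball 0 1))"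
  obtain w0 where w0: "P w0" and min: "\<And>w. P w \<Longrightarrow> card (sphere_fibre w0) \<le> card (sphere_fibre w)"
  proof -
    have "\<exists>w. P w" using ne unfolding P_def by blast
    thus ?thesis using ex_has_least_nat[of P _ "\<lambda>w. card (sphere_fibre w)"] that by blast
  qed
  have w0K: "w0 \<in> v ` cball 0 1" "w0 \<in> v ` sphere 0 1" using w0 interior_subset by (auto simp: P_def)
  define F0 where "F0 = sphere_fibre w0"
  define b where "b = card F0"
  have F0: "finite F0" "F0 \<noteq> {}" using sphere_fibre_finite w0K by (auto simp: F0_def sphere_fibre_def)
  obtain \<rho> where \<rho>: "0 < \<rho>" "\<rho> < 1" "\<And>z. cmod z < 1 \<Longrightarrow> v z = w0 \<Longrightarrow> cmod z < \<rho>"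
    using interior_radius by blast
  define out where "out = outer_fibre \<rho>"
  have out_fin: "finite (out w)" for w unfolding out_def by (rule outer_fibre_finite)
  have out0: "out w0 = F0" using \<rho>(2,3) by (force simp: out_def outer_fibre_def F0_def sphere_fibre_def)
  obtain \<delta>1 where \<delta>1: "\<delta>1 > 0" "\<And>w. w \<in> v ` cball 0 1 \<Longrightarrow> dist w w0 < \<delta>1 \<Longrightarrow> (\<Sum>p\<in>out w. solution_mult v w p) = b"
    using outer_sum[OF \<rho> w0K(1)] unfolding out_def b_def F0_def by blast
  obtain r0 where r0: "r0 > 0" "r0 \<le> \<delta>1" "ball w0 r0 \<subseteq> interior (v ` cball 0 1)"
  proof -
    obtain r where "r > 0" "ball w0 r \<subseteq> interior (v ` cball 0 1)"
      using w0 open_contains_ball[of "interior (v ` cball 0 1)"] by (auto simp: P_def)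
    thus ?thesis using \<delta>1(1) by (intro that[of "min r \<delta>1"]) auto
  qed
  have inK: "w \<in> v ` cball 0 1" if "dist w w0 < r0" for w
    using r0(3) that interior_subset by (force simp: dist_commute)
  \<comment> \<open>by minimality, values on the boundary curve have no interior solution near the circle\<close>
  have no_inner: "z \<notin> ball 0 1" if z: "z \<in> out w" and w: "w \<in> v ` sphere 0 1" "dist w w0 < r0" for z w
  proof
    assume "z \<in> ball 0 1"
    have "P w" unfolding P_def using w r0(3) by (auto simp: dist_commute)
    hence "b \<le> card (sphere_fibre w)" unfolding b_def F0_def by (rule min)
    have tfo: "sphere_fibre w \<subseteq> out w" using \<rho>(2) by (auto simp: sphere_fibre_def out_def outer_fibre_def)
    have "sphere_fibre w \<subseteq> sphere 0 1" by (auto simp: sphere_fibre_def)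
    hence "card (sphere_fibre w) + 1 \<le> (\<Sum>p\<in>sphere_fibre w. solution_mult v w p) + solution_mult v w z"
      using mult_pos[of z w] z sum_mult_sphere[of "sphere_fibre w" w] by (auto simp: out_def outer_fibre_def)
    also have "\<dots> = (\<Sum>p\<in>insert z (sphere_fibre w). solution_mult v w p)"
      using \<open>z \<in> ball 0 1\<close> finite_subset[OF tfo out_fin] by (subst sum.insert) (auto simp: sphere_fibre_def)
    also have "\<dots> \<le> (\<Sum>p\<in>out w. solution_mult v w p)"
      using z tfo by (intro sum_mono2 out_fin) auto
    also have "\<dots> = b" using w r0 by (intro \<delta>1(2) inK) auto
    finally show False using \<open>b \<le> card (sphere_fibre w)\<close> by simp
  qed
  obtain e \<delta> where e: "e > 0" and \<delta>: "\<delta> > 0" "\<delta> \<le> r0"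
    and avoid: "\<And>\<zeta>. \<zeta> \<in> F0 \<Longrightarrow> v ` (ball 0 1 \<inter> ball \<zeta> (2 * e)) \<inter> v ` sphere 0 1 = {}"
    and outer: "\<And>\<zeta>. \<zeta> \<in> F0 \<Longrightarrow> ball \<zeta> (2 * e) \<inter> ball 0 \<rho> = {}"
    and sep: "\<And>\<zeta> \<zeta>' z. \<zeta> \<in> F0 \<Longrightarrow> \<zeta>' \<in> F0 \<Longrightarrow> dist \<zeta> z < 2 * e \<Longrightarrow> dist \<zeta>' z < 2 * e \<Longrightarrow> \<zeta> = \<zeta>'"
    and near: "\<And>z w. z \<in> out w \<Longrightarrow> dist w w0 < \<delta> \<Longrightarrow> \<exists>\<zeta>\<in>F0. dist \<zeta> z < e"
    and out_sum: "\<And>w. w \<in> v ` cball 0 1 \<Longrightarrow> dist w w0 < \<delta> \<Longrightarrow> (\<Sum>p\<in>out w. solution_mult v w p) = b"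
    and exists_off': "\<And>w \<zeta>. w \<in> v ` cball 0 1 \<Longrightarrow> dist w w0 < \<delta> \<Longrightarrow> w \<notin> v ` sphere 0 1 \<Longrightarrow> \<zeta> \<in> F0 \<Longrightarrow>
       \<exists>z. z \<in> out w \<and> dist \<zeta> z < e"
  proof (rule boundary_solutions_continue[OF w0K(2) \<rho> r0(1) _ zero_less_one])
    show "z \<notin> ball 0 1" if "w \<in> v ` sphere 0 1" "dist w w0 < r0" "z \<in> outer_fibre \<rho> w" for z w
      using no_inner[of z w] that by (simp add: out_def)
  qed (auto simp: F0_def out_def b_def)
  have exists_off: "\<exists>z. z \<in> out w \<and> dist \<zeta> z < e" if "dist w w0 < \<delta>" "w \<notin> v ` sphere 0 1" "\<zeta> \<in> F0" for w \<zeta>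
    using exists_off'[of w \<zeta>] inK[of w] that \<delta> by auto
  have exists: "\<exists>z. z \<in> out w \<and> dist \<zeta> z < e" if w: "dist w w0 < \<delta>" and \<zeta>: "\<zeta> \<in> F0" for w \<zeta>
  proof (cases "w \<in> v ` sphere 0 1")
    case False
    thus ?thesis using exists_off w \<zeta> by blast
  next
    case True
    then obtain \<zeta>' where \<zeta>': "cmod \<zeta>' = 1" "v \<zeta>' = w" by auto
    hence "\<zeta>' \<in> out w" using \<rho>(2) by (auto simp: out_def outer_fibre_def)
    then obtain \<zeta>1 where \<zeta>1: "\<zeta>1 \<in> F0" "dist \<zeta>1 \<zeta>' < e" using near w by blast
    define Z where "Z = cball 0 1 \<inter> cball \<zeta> e"
    have "compact (v ` Z)"
      by (intro compact_continuous_image continuous_on_subset[OF cont]) (auto simp: Z_def)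
    hence cl: "closed (v ` Z)" by (rule compact_imp_closed)
    have "w \<in> closure (v ` Z)"
      unfolding closure_approachable
    proof (intro allI impI)
      fix \<epsilon> :: real assume \<epsilon>: "\<epsilon> > 0"
      have mp: "min \<epsilon> (\<delta> - dist w w0) > 0" using \<epsilon> w by simp
      have \<zeta>c: "\<zeta>' \<in> cball 0 1" using \<zeta>' by simp
      obtain d where d: "d > 0" "\<And>z. z \<in> cball 0 1 \<Longrightarrow> dist z \<zeta>' < d \<Longrightarrow> dist (v z) w < min \<epsilon> (\<delta> - dist w w0)"
        using cont[unfolded continuous_on_iff, rule_format, OF \<zeta>c mp] \<zeta>'(2) by blast
      have "\<zeta>' \<in> closure (ball 0 1)" using \<zeta>' by simp
      moreover have "min d (e - dist \<zeta>1 \<zeta>') > 0" using d \<zeta>1 by simp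
      ultimately obtain z where z: "z \<in> ball 0 1" "dist z \<zeta>' < min d (e - dist \<zeta>1 \<zeta>')"
        using closure_approachable by metis
      have vz: "dist (v z) w < \<epsilon>" "dist (v z) w0 < \<delta>"
        using d(2)[of z] z dist_triangle[of "v z" w0 w] by auto
      have "dist \<zeta>1 z < e" using z(2) dist_triangle[of \<zeta>1 z \<zeta>'] by (simp add: dist_commute)
      hence "v z \<notin> v ` sphere 0 1" using avoid[OF \<zeta>1(1)] z(1) e by (auto simp: disjoint_iff)
      then obtain y where y: "y \<in> out (v z)" "dist \<zeta> y < e" using exists_off[of "v z" \<zeta>] vz \<zeta> by blast
      have "v z \<in> v ` Z" using y by (intro image_eqI[of _ _ y]) (auto simp: Z_def out_def outer_fibre_def)
      thus "\<exists>y\<in>v ` Z. dist y w < \<epsilon>" using vz by blast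
    qed
    hence "w \<in> v ` Z" using cl by simp
    then obtain y where y: "y \<in> cball 0 1" "dist \<zeta> y \<le> e" "v y = w" by (auto simp: Z_def)
    have "y \<in> ball \<zeta> (2 * e)" using y(2) e by simp
    hence "y \<notin> ball 0 \<rho>" using outer[OF \<zeta>] by auto
    hence yo: "y \<in> out w" using y by (auto simp: out_def outer_fibre_def)
    then obtain \<zeta>2 where "\<zeta>2 \<in> F0" "dist \<zeta>2 y < e" using near w by blast
    moreover from this have "\<zeta>2 = \<zeta>" using sep[of \<zeta>2 \<zeta> y] y(2) e \<zeta> by auto
    ultimately show ?thesis using yo by blast
  qed
  have unique: "y = z" if w: "dist w w0 < \<delta>" and \<zeta>: "\<zeta> \<in> F0" and y: "y \<in> out w" "dist \<zeta> y < e" and z: "z \<in> out w" "dist \<zeta> z < e" for w \<zeta> y z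
  proof (rule ccontr)
    assume "y \<noteq> z"
    obtain c where c: "\<And>\<zeta>. \<zeta> \<in> F0 \<Longrightarrow> c \<zeta> \<in> out w \<and> dist \<zeta> (c \<zeta>) < e" using exists[OF w] by metis
    \<comment> \<open>a second solution near one point would exceed the total count\<close>
    define x where "x = (if c \<zeta> = y then z else y)"
    have x: "x \<in> out w" "dist \<zeta> x < e" "x \<noteq> c \<zeta>" using y z \<open>y \<noteq> z\<close> by (auto simp: x_def)
    have x': "x \<notin> c ` F0"
    proof
      assume "x \<in> c ` F0"
      then obtain \<zeta>' where "\<zeta>' \<in> F0" "x = c \<zeta>'" by auto
      moreover from this have "\<zeta>' = \<zeta>" using sep[of \<zeta>' \<zeta> x] c[of \<zeta>'] x e \<zeta> by auto
      ultimately show False using x by simp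
    qed
    have "inj_on c F0"
    proof (rule inj_onI)
      fix a a' assume "a \<in> F0" "a' \<in> F0" "c a = c a'"
      thus "a = a'" using sep[of a a' "c a"] c[of a] c[of a'] e by auto
    qed
    hence "card (insert x (c ` F0)) = b + 1" using x' F0(1) by (simp add: card_image b_def)
    moreover have "card (insert x (c ` F0)) \<le> card (out w)" using x c by (intro card_mono out_fin) auto
    moreover have "card (out w) \<le> (\<Sum>p\<in>out w. solution_mult v w p)"
      using sum_mono[of "out w" "\<lambda>_. 1" "solution_mult v w"] mult_pos by (auto simp: out_def outer_fibre_def)
    ultimately show False using out_sum[of w] inK[of w] w \<delta> r0 by simp
  qed
  \<comment> \<open>so v is a homeomorphism from a half neighbourhood of a boundary point onto a full disc\<close>
  obtain \<zeta> where \<zeta>: "\<zeta> \<in> F0" using F0 by auto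
  hence \<zeta>': "cmod \<zeta> = 1" "v \<zeta> = w0" by (auto simp: F0_def sphere_fibre_def)
  define d where "d = \<delta> / 2"
  have d: "d > 0" "d < \<delta>" using \<delta> by (auto simp: d_def)
  define X where "X = cball 0 1 \<inter> cball \<zeta> e \<inter> v -` cball w0 d"
  have Xo: "z \<in> out (v z) \<and> dist \<zeta> z < e \<and> dist (v z) w0 < \<delta>" if "z \<in> X" for z
  proof -
    have z: "z \<in> cball 0 1" "dist \<zeta> z \<le> e" "dist (v z) w0 < \<delta>" using that d by (auto simp: X_def dist_commute)
    have "z \<notin> ball 0 \<rho>" using outer[OF \<zeta>] z e by (auto simp: disjoint_iff)
    hence zo: "z \<in> out (v z)" using z by (auto simp: out_def outer_fibre_def)
    then obtain \<zeta>2 where "\<zeta>2 \<in> F0" "dist \<zeta>2 z < e" using near z by blast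
    moreover from this have "\<zeta>2 = \<zeta>" using sep[of \<zeta>2 \<zeta> z] z(2) e \<zeta> by auto
    ultimately show ?thesis using zo z by blast
  qed
  have "compact X"
  proof -
    have "closedin (top_of_set (cball 0 1 \<inter> cball \<zeta> e)) (cball 0 1 \<inter> cball \<zeta> e \<inter> v -` cball w0 d)"
      by (rule continuous_closedin_preimage) (auto intro: continuous_on_subset[OF cont])
    thus ?thesis unfolding X_def by (rule closedin_compact[rotated]) auto
  qed
  have "inj_on v X"
    by (rule inj_onI) (use Xo unique \<zeta> in metis)
  have vX: "v ` X = cball w0 d"
  proof
    show "v ` X \<subseteq> cball w0 d" by (auto simp: X_def)
    show "cball w0 d \<subseteq> v ` X"
    proof
      fix w assume w: "w \<in> cball w0 d"
      hence "dist w w0 < \<delta>" using d by (simp add: dist_commute)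
      then obtain z where "z \<in> out w" "dist \<zeta> z < e" using exists[OF _ \<zeta>] by blast
      thus "w \<in> v ` X" using w by (intro image_eqI[of _ _ z]) (auto simp: X_def out_def outer_fibre_def)
    qed
  qed
  obtain g where g: "homeomorphism X (cball w0 d) v g"
    using homeomorphism_compact[OF \<open>compact X\<close> _ vX \<open>inj_on v X\<close>] continuous_on_subset[OF cont, of X]
    by (auto simp: X_def)
  \<comment> \<open>the punctured half neighbourhood is starlike because the circle contains no segment\<close>
  define A where "A = cball 0 1 \<inter> ball \<zeta> (2 * e) - {\<zeta>}"
  have "contractible A"
  proof -
    define a where "a = (1 - min e (1 / 2)) *\<^sub>R \<zeta>"
    have a: "cmod a < 1" "a \<in> A"
    proof -
      show "cmod a < 1" using e \<zeta>' by (simp add: a_def)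
      have "a - \<zeta> = - (min e (1 / 2) *\<^sub>R \<zeta>)" by (simp add: a_def algebra_simps)
      hence "dist \<zeta> a = min e (1 / 2)" using \<zeta>' e by (simp add: dist_norm norm_minus_commute[of \<zeta> a])
      thus "a \<in> A" using \<open>cmod a < 1\<close> e \<zeta>' by (auto simp: A_def)
    qed
    have "closed_segment a x \<subseteq> A" if x: "x \<in> A" for x
    proof -
      have "closed_segment a x \<subseteq> cball 0 1 \<inter> ball \<zeta> (2 * e)"
        using a x by (intro closed_segment_subset convex_Int) (auto simp: A_def)
      moreover have "\<zeta> \<notin> closed_segment a x"
      proof
        assume "\<zeta> \<in> closed_segment a x"
        then obtain u where u: "\<zeta> = (1 - u) *\<^sub>R a + u *\<^sub>R x" "0 \<le> u" "u \<le> 1" by (auto simp: in_segment)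
        have "u \<noteq> 1" using u x by (auto simp: A_def)
        have "1 \<le> cmod ((1 - u) *\<^sub>R a) + cmod (u *\<^sub>R x)" using \<zeta>'(1) u(1) norm_triangle_ineq by metis
        also have "\<dots> = (1 - u) * cmod a + u * cmod x" using u by simp
        also have "\<dots> < (1 - u) * 1 + u * 1"
          using u x a \<open>u \<noteq> 1\<close> by (intro add_less_le_mono mult_strict_left_mono mult_left_mono) (auto simp: A_def)
        finally show False by simp
      qed
      ultimately show ?thesis by (auto simp: A_def)
    qed
    hence "starlike A" unfolding starlike_def using a(2) by blast
    thus ?thesis by (rule starlike_imp_contractible)
  qed
  moreover have "continuous_on A (\<lambda>z. v z - w0)"
    by (intro continuous_intros continuous_on_subset[OF cont]) (auto simp: A_def)
  moreover have "v z - w0 \<noteq> 0" if z: "z \<in> A" for z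
  proof
    assume "v z - w0 = 0"
    moreover have "z \<notin> ball 0 \<rho>" using outer[OF \<zeta>] z by (auto simp: A_def)
    ultimately have "z \<in> F0" using z out0 by (auto simp: A_def out_def outer_fibre_def)
    thus False using sep[of z \<zeta> z] \<zeta> z e by (auto simp: A_def)
  qed
  ultimately obtain L where L: "continuous_on A L" "\<And>z. z \<in> A \<Longrightarrow> v z - w0 = exp (L z)"
    using continuous_logarithm_on_contractible[of A "\<lambda>z. v z - w0"] by blast
  define p where "p = (\<lambda>t. w0 + circlepath 0 d t)"
  have pc: "p t \<in> cball w0 d" "p t \<noteq> w0" for t
    using d by (auto simp: p_def dist_norm circlepath norm_mult)
  have gA: "g (p t) \<in> A" "v (g (p t)) = p t" for t
  proof -
    show vg: "v (g (p t)) = p t" using homeomorphism_apply2[OF g pc(1)] .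
    have "g (p t) \<in> X" using g pc(1) unfolding homeomorphism_def by blast
    hence "g (p t) \<in> cball 0 1" "dist \<zeta> (g (p t)) < e" using Xo by (auto simp: X_def)
    moreover have "g (p t) \<noteq> \<zeta>" using vg pc(2)[of t] \<zeta>'(2) by metis
    ultimately show "g (p t) \<in> A" using e by (simp add: A_def)
  qed
  have "continuous_on {0..1} p" unfolding p_def
    using path_circlepath[of 0 d] by (intro continuous_intros) (auto simp: path_def)
  hence "continuous_on {0..1} (\<lambda>t. g (p t))"
  proof -
    have "continuous_on (cball w0 d) g" using g by (simp add: homeomorphism_def)
    moreover have "p ` {0..1} \<subseteq> cball w0 d" using pc(1) by blast
    ultimately show ?thesis using \<open>continuous_on {0..1} p\<close> continuous_on_compose2 by blast
  qed
  hence path: "path (\<lambda>t. L (g (p t)))"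
    unfolding path_def by (intro continuous_on_compose2[OF L(1)]) (use gA in auto)
  have "exp \<circ> (\<lambda>t. L (g (p t))) = circlepath 0 d"
    using L(2)[OF gA(1)] gA(2) by (auto simp: fun_eq_iff p_def)
  moreover have "p 1 = p 0" by (simp add: p_def circlepath)
  ultimately have "winding_number (circlepath 0 d) 0 = 0"
    using winding_number_compose_exp[OF path] by (simp add: pathfinish_def pathstart_def)
  thus False using winding_number_circlepath_centre[OF d(1), of 0] by simp
qed

end

section \<open>Finite Blaschke products and the topology of the image\<close>

lemma normalized_Riemann_map:
  assumes "open S" "simply_connected S" "S \<noteq> UNIV" "a \<in> S"
  obtains f g where "f holomorphic_on S" "g holomorphic_on ball 0 1"
    "\<And>z. z \<in> S \<Longrightarrow> f z \<in> ball 0 1 \<and> g (f z) = z" "\<And>z. z \<in> ball 0 1 \<Longrightarrow> g z \<in> S \<and> f (g z) = z"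
    "f a = (0::complex)"
proof -
  have "\<exists>f g. f holomorphic_on S \<and> g holomorphic_on ball 0 1 \<and>
      (\<forall>z\<in>S. f z \<in> ball 0 1 \<and> g (f z) = z) \<and> (\<forall>z\<in>ball 0 1. g z \<in> S \<and> f (g z) = z)"
    using assms Riemann_mapping_theorem[of S] by blast
  then obtain f g where fg: "f holomorphic_on S" "g holomorphic_on ball 0 1"
    "\<And>z. z \<in> S \<Longrightarrow> f z \<in> ball 0 1 \<and> g (f z) = z" "\<And>z. z \<in> ball 0 1 \<Longrightarrow> g z \<in> S \<and> f (g z) = z"
    by blast
  obtain h k where hk: "h (f a) = 0" "h holomorphic_on ball 0 1" "h ` ball 0 1 \<subseteq> ball 0 1"
                "k holomorphic_on ball 0 1" "k ` ball 0 1 \<subseteq> ball 0 1"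
                "\<And>z. z \<in> ball 0 1 \<Longrightarrow> h (k z) = z" "\<And>z. z \<in> ball 0 1 \<Longrightarrow> k (h z) = z"
    using ball_biholomorphism_exists[of "f a"] fg(3)[OF assms(4)] by metis
  show ?thesis
  proof (rule that[of "h \<circ> f" "g \<circ> k"])
    show "h \<circ> f holomorphic_on S"
      by (rule holomorphic_on_compose_gen[OF fg(1) hk(2)]) (use fg(3) in blast)
    show "g \<circ> k holomorphic_on ball 0 1"
      by (rule holomorphic_on_compose_gen[OF hk(4) fg(2)]) (use hk(5) in blast)
    show "(h \<circ> f) z \<in> ball 0 1 \<and> (g \<circ> k) ((h \<circ> f) z) = z" if "z \<in> S" for z
      using fg(3)[OF that] hk(3,7) by (auto simp: image_subset_iff)
    show "(g \<circ> k) z \<in> S \<and> (h \<circ> f) ((g \<circ> k) z) = z" if "z \<in> ball 0 1" for z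
    proof -
      have "k z \<in> ball 0 1" using hk(5) that by blast
      thus ?thesis using fg(4)[of "k z"] hk(6)[OF that] by simp
    qed
  qed (use hk(1) in auto)
qed

text \<open>A maximum principle for functions of which only the modulus extends continuously to the closed disc.\<close>

lemma boundary_modulus_le_one:
  assumes J: "J holomorphic_on ball 0 1"
    and m: "continuous_on (cball 0 1) m" "\<And>z. z \<in> ball 0 1 \<Longrightarrow> m z = cmod (J z)" "\<And>z. z \<in> sphere 0 1 \<Longrightarrow> m z = 1"
    and z: "z \<in> ball 0 1"
  shows "cmod (J z) \<le> 1"
proof (rule field_le_epsilon)
  fix e :: real assume "e > 0"
  have "uniformly_continuous_on (cball 0 1) m" by (intro compact_uniformly_continuous m) auto
  then obtain d where d: "d > 0" "\<And>x y. x \<in> cball 0 1 \<Longrightarrow> y \<in> cball 0 1 \<Longrightarrow> dist y x < d \<Longrightarrow> dist (m y) (m x) < e"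
    using \<open>e > 0\<close> unfolding uniformly_continuous_on_def by metis
  define r where "r = max ((1 + cmod z) / 2) (1 - d / 2)"
  have r: "cmod z < r" "r < 1" "1 - r < d" using z d(1) by (auto simp: r_def less_max_iff_disj)
  have "r > 0" using r(1) norm_ge_zero[of z] by linarith
  note r = r this
  have "cmod (J z) \<le> 1 + e"
  proof (rule maximum_modulus_frontier[of J "ball 0 r"])
    show "J holomorphic_on interior (ball 0 r)" using r by (intro holomorphic_on_subset[OF J]) auto
    show "continuous_on (closure (ball 0 r)) J"
      using r by (intro holomorphic_on_imp_continuous_on holomorphic_on_subset[OF J]) auto
    fix u :: complex assume "u \<in> frontier (ball 0 r)"
    hence u: "cmod u = r" using r by simp
    define y where "y = u / of_real r"
    have y: "cmod y = 1" using u r by (simp add: y_def norm_divide)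
    have "u - y = (of_real r - 1) * y" using r by (simp add: y_def field_simps)
    hence "dist u y = 1 - r" using y r by (simp add: dist_norm norm_mult) (metis abs_minus_commute abs_of_pos diff_gt_0_iff_gt norm_of_real of_real_1 of_real_diff)
    hence "dist (m u) (m y) < e" using d(2)[of y u] y u r by auto
    thus "cmod (J u) \<le> 1 + e" using m(2)[of u] m(3)[of y] u y r by (auto simp: dist_real_def)
  qed (use r in auto)
  thus "cmod (J z) \<le> 1 + e" .
qed

lemma boundary_modulus_constant:
  assumes J: "J holomorphic_on ball 0 1" "\<And>z. z \<in> ball 0 1 \<Longrightarrow> J z \<noteq> 0"
    and m: "continuous_on (cball 0 1) m" "\<And>z. z \<in> ball 0 1 \<Longrightarrow> m z = cmod (J z)" "\<And>z. z \<in> sphere 0 1 \<Longrightarrow> m z = 1"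
  obtains c where "cmod c = 1" "\<And>z. z \<in> ball 0 1 \<Longrightarrow> J z = c"
proof -
  have mnz: "m z \<noteq> 0" if "z \<in> cball 0 1" for z
    using m(2,3)[of z] J(2)[of z] that by (cases "z \<in> ball 0 1") auto
  have "cmod (1 / J z) \<le> 1" if "z \<in> ball 0 1" for z
  proof (rule boundary_modulus_le_one[of "\<lambda>z. 1 / J z" "\<lambda>z. 1 / m z"])
    show "continuous_on (cball 0 1) (\<lambda>z. 1 / m z)" using mnz by (intro continuous_intros m) auto
  qed (use J m that in \<open>auto intro!: holomorphic_intros simp: norm_divide\<close>)
  moreover have "cmod (J z) \<le> 1" if "z \<in> ball 0 1" for z
    by (rule boundary_modulus_le_one[OF J(1) m that])
  ultimately have one: "cmod (J z) = 1" if "z \<in> ball 0 1" for z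
    using J(2)[OF that] that by (fastforce simp: norm_divide field_simps)
  have "J constant_on ball 0 1"
    by (rule maximum_modulus_principle[OF J(1), of "ball 0 1" 0]) (use one in auto)
  then obtain c where "\<And>z. z \<in> ball 0 1 \<Longrightarrow> J z = c" by (auto simp: constant_on_def)
  thus ?thesis using one[of 0] by (intro that[of c]) auto
qed

text \<open>The quotient by the polynomial with the same zeros is defined at a zero by the leading factor of the
local expansion there.\<close>

lemma holomorphic_factor_finite_zeros:
  assumes f: "f holomorphic_on S" and S: "open S" "connected S" and nz: "\<exists>z\<in>S. f z \<noteq> 0"
    and fin: "finite {z \<in> S. f z = 0}"
  obtains h where "h holomorphic_on S" "\<And>z. z \<in> S \<Longrightarrow> h z \<noteq> 0"
    "\<And>z. z \<in> S \<Longrightarrow> f z = h z * (\<Prod>a\<in>{z \<in> S. f z = 0}. (z - a) ^ nat (zorder f a))"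
proof -
  define Z where "Z = {z \<in> S. f z = 0}"
  define n where "n = (\<lambda>a. nat (zorder f a))"
  \<comment> \<open>the product without the factor at a zero is needed to define the quotient there\<close>
  define q where "q = (\<lambda>A z. \<Prod>a\<in>A. (z - a) ^ n a)"
  define h where "h = (\<lambda>z. if z \<in> Z then zor_poly f z z / q (Z - {z}) z else f z / q Z z)"
  have finZ: "finite Z" using fin by (simp add: Z_def)
  have q0: "q A z \<noteq> 0" if "z \<notin> A" "finite A" for A z using that by (auto simp: q_def)
  have qs: "q Z z = (z - a) ^ n a * q (Z - {a}) z" if "a \<in> Z" for a z
    using finZ that by (simp add: q_def prod.remove)
  have loc: "\<exists>r>0. cball a r \<subseteq> S \<and> zor_poly f a holomorphic_on cball a r
    \<and> (\<forall>w\<in>cball a r. f w = zor_poly f a w * (w - a) ^ n a \<and> zor_poly f a w \<noteq> 0) \<and> n a > 0" if "a \<in> Z" for a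
    using zorder_exist_zero[OF f S, of a] that nz by (auto simp: Z_def n_def)
  have h0: "h z \<noteq> 0" if "z \<in> S" for z
  proof (cases "z \<in> Z")
    case True
    then obtain r where "r > 0" "\<forall>w\<in>cball z r. zor_poly f z w \<noteq> 0" using loc by blast
    thus ?thesis using q0[of z "Z - {z}"] finZ True by (auto simp: h_def)
  next
    case False
    thus ?thesis using q0[of z Z] finZ that by (auto simp: h_def Z_def)
  qed
  have hq: "f z = h z * q Z z" if "z \<in> S" for z
  proof (cases "z \<in> Z")
    case True
    hence "n z > 0" using loc by blast
    hence "q Z z = 0" using True finZ by (auto simp: q_def)
    thus ?thesis using True by (simp add: Z_def)
  next
    case False
    thus ?thesis using q0[of z Z] finZ by (simp add: h_def)
  qed
  have "h field_differentiable (at z)" if "z \<in> S" for z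
  proof (cases "z \<in> Z")
    case True
    then obtain r where r: "r > 0" "cball z r \<subseteq> S" "zor_poly f z holomorphic_on cball z r"
      "\<And>w. w \<in> cball z r \<Longrightarrow> f w = zor_poly f z w * (w - z) ^ n z" "\<And>w. w \<in> cball z r \<Longrightarrow> zor_poly f z w \<noteq> 0" "n z > 0"
      using loc by blast
    have nZ: "w \<notin> Z" if "w \<in> cball z r" "w \<noteq> z" for w
      using r(4,5)[OF that(1)] that(2) by (auto simp: Z_def)
    have eq: "zor_poly f z w / q (Z - {z}) w = h w" if "w \<in> ball z r" for w
    proof (cases "w = z")
      case False
      have "w \<in> cball z r" using that by auto
      thus ?thesis using nZ[OF _ False] r(4)[of w] False qs[OF True, of w] by (simp add: h_def)
    qed (use True in \<open>simp add: h_def\<close>)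
    have qh: "q (Z - {z}) holomorphic_on ball z r" unfolding q_def by (intro holomorphic_intros)
    have nZ': "w \<notin> Z - {z}" if "w \<in> ball z r" for w using nZ[of w] that by auto
    have "(\<lambda>w. zor_poly f z w / q (Z - {z}) w) holomorphic_on ball z r"
      by (intro holomorphic_on_divide qh holomorphic_on_subset[OF r(3)] q0 nZ') (use finZ in auto)
    hence "h holomorphic_on ball z r" by (rule holomorphic_transform) (use eq in auto)
    thus ?thesis using r(1) by (intro holomorphic_on_imp_differentiable_at[of h "ball z r"]) auto
  next
    case False
    have "open (S - Z)" using S(1) finZ by (intro open_Diff finite_imp_closed)
    have qh: "q Z holomorphic_on S - Z" unfolding q_def by (intro holomorphic_intros)
    have "(\<lambda>w. f w / q Z w) holomorphic_on S - Z"
      by (intro holomorphic_on_divide qh holomorphic_on_subset[OF f] q0) (use finZ in auto)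
    hence "h holomorphic_on S - Z" by (rule holomorphic_transform) (auto simp: h_def)
    thus ?thesis using \<open>open (S - Z)\<close> False that by (intro holomorphic_on_imp_differentiable_at[of h "S - Z"]) auto
  qed
  hence "h holomorphic_on S" by (auto simp: holomorphic_on_def field_differentiable_at_within)
  thus ?thesis using h0 hq by (intro that[of h]) (auto simp: q_def Z_def n_def)
qed

text \<open>Both images are homeomorphic to the graph of one map as a function of the other.\<close>

lemma homeomorphic_images_same_fibres:
  fixes f :: "'a::metric_space \<Rightarrow> complex" and g :: "'a \<Rightarrow> complex"
  assumes X: "compact X" and f: "continuous_on X f" and g: "continuous_on X g"
    and fib: "\<And>x y. x \<in> X \<Longrightarrow> y \<in> X \<Longrightarrow> f x = f y \<longleftrightarrow> g x = g y"
  shows "f ` X homeomorphic g ` X"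
proof -
  define G where "G = (\<lambda>x. (f x, g x)) ` X"
  have G: "compact G" unfolding G_def by (intro compact_continuous_image continuous_intros f g X)
  have "G homeomorphic f ` X"
    by (rule homeomorphic_compact[OF G, of fst]) (use fib in \<open>auto simp: G_def image_image inj_on_def intro!: continuous_intros\<close>)
  moreover have "G homeomorphic g ` X"
    by (rule homeomorphic_compact[OF G, of snd]) (use fib in \<open>auto simp: G_def image_image inj_on_def intro!: continuous_intros\<close>)
  ultimately show ?thesis using homeomorphic_sym homeomorphic_trans by blast
qed

context exact_valence
begin

lemma image_disjoint: "v ` ball 0 1 \<inter> v ` sphere 0 1 = {}"
  using boundary_image_not_interior interior_image by blast

lemma interior_eq: "interior (v ` cball 0 1) = v ` ball 0 1"
proof
  show "interior (v ` cball 0 1) \<subseteq> v ` ball 0 1"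
  proof
    fix w assume w: "w \<in> interior (v ` cball 0 1)"
    then obtain z where z: "z \<in> cball 0 1" "w = v z" using interior_subset by blast
    hence "z \<notin> sphere 0 1" using w boundary_image_not_interior by blast
    thus "w \<in> v ` ball 0 1" using z by auto
  qed
qed (rule interior_image)

text \<open>The image of the open disc is a component of the complement of the boundary curve.\<close>

lemma disc_image_simply_connected:
  "simply_connected (v ` ball 0 1)" "open (v ` ball 0 1)" "bounded (v ` ball 0 1)"
proof -
  show op: "open (v ` ball 0 1)" using interior_eq open_interior by metis
  define C where "C = connected_component_set (- v ` sphere 0 1) (v 0)"
  have "v 0 \<in> v ` ball 0 1" by auto
  hence v0: "v 0 \<in> - v ` sphere 0 1" using image_disjoint by blast
  have C: "C \<in> components (- v ` sphere 0 1)" unfolding C_def by (rule componentsI[OF v0])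
  have "connected (v ` ball 0 1)"
    by (intro connected_continuous_image holomorphic_on_imp_continuous_on hol) auto
  hence sub: "v ` ball 0 1 \<subseteq> C"
    unfolding C_def using image_disjoint by (intro connected_component_maximal) auto
  have "v 0 \<in> v ` cball 0 1" by auto
  hence "C \<inter> v ` cball 0 1 \<noteq> {}" using sub \<open>v 0 \<in> v ` ball 0 1\<close> by blast
  note C' = component_simply_connected[OF C this]
  have "C \<subseteq> v ` ball 0 1"
  proof
    fix w assume w: "w \<in> C"
    then obtain z where z: "z \<in> cball 0 1" "w = v z" using C'(4) by blast
    have "z \<notin> sphere 0 1" using in_components_subset[OF C] w z by blast
    thus "w \<in> v ` ball 0 1" using z by auto
  qed
  with sub have "v ` ball 0 1 = C" by blast
  thus "simply_connected (v ` ball 0 1)" "bounded (v ` ball 0 1)" using C' by auto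
qed

lemma mult_sum_interior:
  assumes "w \<in> v ` ball 0 1"
  shows "finite {z \<in> ball 0 1. v z = w}" "(\<Sum>z\<in>{z \<in> ball 0 1. v z = w}. nat (zorder (\<lambda>u. v u - w) z)) = N"
proof -
  have "w \<in> v ` cball 0 1" using assms by auto
  moreover have "{z \<in> cball 0 1. v z = w} = {z \<in> ball 0 1. v z = w}"
  proof -
    have "cmod z \<noteq> 1" if "v z = w" for z
    proof
      assume "cmod z = 1"
      hence "w \<in> v ` sphere 0 1" using that by (intro image_eqI[of _ _ z]) auto
      thus False using assms image_disjoint by blast
    qed
    thus ?thesis by force
  qed
  ultimately show "finite {z \<in> ball 0 1. v z = w}" "(\<Sum>z\<in>{z \<in> ball 0 1. v z = w}. nat (zorder (\<lambda>u. v u - w) z)) = N"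
    using fibre_finite[of w] fibre_sum[of w] by (auto simp: solution_mult_def)
qed

text \<open>The composition of \<open>v\<close> with a Riemann map of its image has modulus tending to one at the circle, because
values on the circle lie on the boundary of the image, and has \<open>N\<close> zeros. Its quotient by the finite
Blaschke product with the same zeros is zero-free with boundary modulus one, hence a constant, which
is absorbed into the Riemann map. The last two conclusions say that numerator and denominator are
reflections of each other in the circle.\<close>

theorem Blaschke_factorization:
  obtains \<psi> W bp br where "\<psi> holomorphic_on v ` ball 0 1" "W holomorphic_on ball 0 1"
    "\<And>w. w \<in> v ` ball 0 1 \<Longrightarrow> \<psi> w \<in> ball 0 1 \<and> W (\<psi> w) = w"
    "\<And>z. z \<in> ball 0 1 \<Longrightarrow> W z \<in> v ` ball 0 1 \<and> \<psi> (W z) = z"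
    "\<psi> (v 0) = 0"
    "degree bp \<le> N" "degree br \<le> N"
    "\<And>z. cmod z \<le> 1 \<Longrightarrow> poly br z \<noteq> 0"
    "\<And>z. z \<in> ball 0 1 \<Longrightarrow> \<psi> (v z) = poly bp z / poly br z"
    "\<And>z. z \<noteq> 0 \<Longrightarrow> poly bp (1 / cnj z) * cnj z ^ N = cnj (poly br z)"
    "\<And>z. z \<noteq> 0 \<Longrightarrow> poly br (1 / cnj z) * cnj z ^ N = cnj (poly bp z)"
proof -
  define w0 where "w0 = v 0"
  have w0: "w0 \<in> v ` ball 0 1" by (auto simp: w0_def)
  have nU: "v ` ball 0 1 \<noteq> UNIV" using disc_image_simply_connected(3) not_bounded_UNIV by auto
  obtain f g where fg: "f holomorphic_on v ` ball 0 1" "g holomorphic_on ball 0 1"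
    "\<And>w. w \<in> v ` ball 0 1 \<Longrightarrow> f w \<in> ball 0 1 \<and> g (f w) = w"
    "\<And>z. z \<in> ball 0 1 \<Longrightarrow> g z \<in> v ` ball 0 1 \<and> f (g z) = z" "f w0 = 0"
    using normalized_Riemann_map[OF disc_image_simply_connected(2,1) nU w0] by metis
  define Z where "Z = {z \<in> ball 0 1. v z = w0}"
  define n where "n = (\<lambda>a. nat (zorder (\<lambda>u. v u - w0) a))"
  have Z: "finite Z" "(\<Sum>a\<in>Z. n a) = N" using mult_sum_interior[OF w0] by (auto simp: Z_def n_def)
  define bp :: "complex poly" where "bp = (\<Prod>a\<in>Z. [:- a, 1:] ^ n a)"
  define br :: "complex poly" where "br = (\<Prod>a\<in>Z. [:1, - cnj a:] ^ n a)"
  have pbp: "poly bp z = (\<Prod>a\<in>Z. (z - a) ^ n a)" for z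
    by (simp add: bp_def poly_prod poly_power)
  have pbr: "poly br z = (\<Prod>a\<in>Z. (1 - cnj a * z) ^ n a)" for z
    by (simp add: br_def poly_prod poly_power mult.commute)
  have dbp: "degree bp \<le> N"
  proof -
    have "degree bp \<le> (\<Sum>a\<in>Z. degree ([:- a, 1:] ^ n a))" unfolding bp_def using degree_prod_sum_le[OF Z(1)] by (simp add: o_def)
    also have "\<dots> \<le> (\<Sum>a\<in>Z. n a)" by (intro sum_mono order_trans[OF degree_power_le]) simp
    finally show ?thesis by (simp add: Z(2))
  qed
  have dbr: "degree br \<le> N"
  proof -
    have "degree br \<le> (\<Sum>a\<in>Z. degree ([:1, - cnj a:] ^ n a))" unfolding br_def using degree_prod_sum_le[OF Z(1)] by (simp add: o_def)
    also have "\<dots> \<le> (\<Sum>a\<in>Z. n a)" by (intro sum_mono order_trans[OF degree_power_le]) simp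
    finally show ?thesis by (simp add: Z(2))
  qed
  have powN: "x ^ N = (\<Prod>a\<in>Z. x ^ n a)" for x :: complex by (simp add: Z(2)[symmetric] power_sum)
  have refl1: "poly bp (1 / cnj z) * cnj z ^ N = cnj (poly br z)" if "z \<noteq> 0" for z
    unfolding pbp pbr powN prod.distrib[symmetric] cnj_prod power_mult_distrib[symmetric] complex_cnj_power
    using that by (intro prod.cong refl arg_cong2[of _ _ _ _ "(^)"]) (auto simp: field_simps)
  have refl2: "poly br (1 / cnj z) * cnj z ^ N = cnj (poly bp z)" if "z \<noteq> 0" for z
    unfolding pbp pbr powN prod.distrib[symmetric] cnj_prod power_mult_distrib[symmetric] complex_cnj_power
    using that by (intro prod.cong refl arg_cong2[of _ _ _ _ "(^)"]) (auto simp: field_simps)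
  have br0: "poly br z \<noteq> 0" if "cmod z \<le> 1" for z
  proof
    assume "poly br z = 0"
    then obtain a where "a \<in> Z" "cnj a * z = 1" using Z(1) by (auto simp: pbr)
    hence "cmod a < 1" "cmod a * cmod z = 1" by (auto simp: Z_def) (metis complex_mod_cnj norm_mult norm_one)
    thus False using that mult_left_le[of "cmod z" "cmod a"] by auto
  qed
  define B where "B = f \<circ> v"
  have Bh: "B holomorphic_on ball 0 1"
    unfolding B_def by (rule holomorphic_on_compose_gen[OF hol fg(1)]) auto
  have Bb: "B z \<in> ball 0 1" if "z \<in> ball 0 1" for z using fg(3) that by (auto simp: B_def)
  have inj: "inj_on f (v ` ball 0 1)" by (rule inj_on_inverseI[of _ g]) (use fg(3) in auto)
  have B0: "B z = 0 \<longleftrightarrow> v z = w0" if "z \<in> ball 0 1" for z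
    using inj_on_eq_iff[OF inj, of "v z" w0] that w0 fg(5) by (auto simp: B_def)
  have ZB: "{z \<in> ball 0 1. B z = 0} = Z" using B0 by (auto simp: Z_def)
  \<comment> \<open>composition with the injective map f does not change multiplicities\<close>
  have zB: "zorder B a = zorder (\<lambda>u. v u - w0) a" if a: "a \<in> Z" for a
  proof -
    define D where "D = (\<lambda>w. if w = w0 then deriv f w0 else (f w - f w0) / (w - w0))"
    have D: "D holomorphic_on v ` ball 0 1" unfolding D_def
      by (rule pole_lemma_open[OF fg(1) disc_image_simply_connected(2)])
    have D0: "D w0 \<noteq> 0"
      using holomorphic_injective_imp_regular[OF fg(1) disc_image_simply_connected(2) inj w0] by (simp add: D_def)
    have fD: "f w = D w * (w - w0)" if "w \<in> v ` ball 0 1" for w using fg(5) by (auto simp: D_def)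
    have a': "a \<in> ball 0 1" "v a = w0" using a by (auto simp: Z_def)
    have "(\<lambda>u. v u - w0) holomorphic_on ball 0 1" by (intro holomorphic_intros hol)
    from zorder_exist_zero[OF this open_ball connected_ball a'(1) nonconstant[of w0]]
    obtain r where pos: "zorder (\<lambda>u. v u - w0) a > 0" and r: "r > 0" "cball a r \<subseteq> ball 0 1"
       "zor_poly (\<lambda>u. v u - w0) a holomorphic_on cball a r"
       "\<And>w. w \<in> cball a r \<Longrightarrow> v w - w0 = zor_poly (\<lambda>u. v u - w0) a w * (w - a) ^ n a \<and> zor_poly (\<lambda>u. v u - w0) a w \<noteq> 0"
      using a' by (auto simp: n_def)
    have "zorder B a = int (n a)"
    proof (rule zorder_eqI[of "ball a r" a "\<lambda>u. D (v u) * zor_poly (\<lambda>u. v u - w0) a u"])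
      have "(D \<circ> v) holomorphic_on ball a r"
      proof (rule holomorphic_on_compose_gen[OF holomorphic_on_subset[OF hol] D])
        show "ball a r \<subseteq> ball 0 1" using r(2) by force
        thus "v ` ball a r \<subseteq> v ` ball 0 1" by blast
      qed
      thus "(\<lambda>u. D (v u) * zor_poly (\<lambda>u. v u - w0) a u) holomorphic_on ball a r"
        by (intro holomorphic_intros holomorphic_on_subset[OF r(3)]) (auto simp: o_def)
      show "D (v a) * zor_poly (\<lambda>u. v u - w0) a a \<noteq> 0" using a' D0 r(4)[of a] r(1) by auto
      fix w assume w: "w \<in> ball a r" "w \<noteq> a"
      have "w \<in> cball a r" using w by simp
      hence "w \<in> ball 0 1" using r(2) by blast
      hence "B w = D (v w) * (v w - w0)" using fD[of "v w"] by (auto simp: B_def)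
      thus "B w = D (v w) * zor_poly (\<lambda>u. v u - w0) a w * (w - a) powi int (n a)"
        using r(4)[of w] w by (simp add: mult.assoc)
    qed (use r in auto)
    thus ?thesis using pos by (simp add: n_def)
  qed
  have nzB: "\<exists>z\<in>ball 0 1. B z \<noteq> 0" using nonconstant[of w0] B0 by auto
  obtain h where h: "h holomorphic_on ball 0 1" "\<And>z. z \<in> ball 0 1 \<Longrightarrow> h z \<noteq> 0"
    "\<And>z. z \<in> ball 0 1 \<Longrightarrow> B z = h z * (\<Prod>a\<in>Z. (z - a) ^ nat (zorder B a))"
    using holomorphic_factor_finite_zeros[OF Bh open_ball connected_ball nzB, unfolded ZB, OF Z(1)] by blast
  have Bhp: "B z = h z * poly bp z" if "z \<in> ball 0 1" for z
    using h(3)[OF that] zB by (simp add: pbp n_def)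
  have eqmod: "cmod (poly bp z) = cmod (poly br z)" if "cmod z = 1" for z
  proof -
    have "z \<noteq> 0" using that by auto
    moreover have "1 / cnj z = z" using complex_norm_square[of z] that \<open>z \<noteq> 0\<close> by (simp add: field_simps)
    ultimately have "poly bp z * cnj z ^ N = cnj (poly br z)" using refl1[of z] by simp
    hence "cmod (poly bp z * cnj z ^ N) = cmod (poly br z)" by simp
    thus ?thesis using that by (simp add: norm_mult norm_power)
  qed
  define M where "M = (\<lambda>w. if w \<in> v ` ball 0 1 then cmod (f w) else 1)"
  have M: "continuous_on UNIV M" unfolding M_def
    by (rule disc_map_modulus_continuous[OF disc_image_simply_connected(2) fg(1-4)])
  have bp0: "poly bp z = 0 \<longleftrightarrow> z \<in> Z" if "z \<in> cball 0 1" for z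
  proof -
    have "n a > 0" if "a \<in> Z" for a using zorder_pos[of a w0] that by (auto simp: Z_def n_def)
    thus ?thesis using Z(1) by (auto simp: pbp)
  qed
  \<comment> \<open>the quotient of f \<circ> v by the finite Blaschke product with the same zeros\<close>
  define J where "J = (\<lambda>z. h z * poly br z)"
  define m where "m = (\<lambda>z. if z \<in> ball 0 1 then cmod (J z) else 1)"
  have mc: "continuous_on (cball 0 1) m"
  proof -
    have "continuous (at z within cball 0 1) m" if z: "z \<in> cball 0 1" for z
    proof (cases "z \<in> ball 0 1")
      case True
      have "isCont (\<lambda>z. cmod (J z)) z"
        using holomorphic_on_imp_continuous_on[OF h(1)] True unfolding J_def
        by (intro continuous_intros) (auto simp: continuous_on_eq_continuous_at)
      moreover have "\<forall>\<^sub>F x in nhds z. cmod (J x) = m x"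
        using eventually_nhds_in_open[OF open_ball True] by eventually_elim (auto simp: m_def)
      ultimately have "isCont m z" using isCont_cong by fast
      thus ?thesis by (rule continuous_at_imp_continuous_at_within)
    next
      case False
      hence z1: "cmod z = 1" using z by auto
      have zZ: "z \<notin> Z" using False by (auto simp: Z_def)
      define G where "G = (\<lambda>x. M (v x) * cmod (poly br x) / cmod (poly bp x))"
      have "v z \<notin> v ` ball 0 1" using z1 image_disjoint by force
      hence Gz: "G z = 1" using eqmod[OF z1] bp0[OF z] br0[of z] z1 zZ by (simp add: G_def M_def)
      have "continuous (at z within cball 0 1) (\<lambda>x. M (v x))"
      proof -
        have "continuous_on (cball 0 1) (\<lambda>x. M (v x))" by (rule continuous_on_compose2[OF M cont]) auto
        thus ?thesis using z by (simp add: continuous_on_eq_continuous_within)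
      qed
      moreover have "continuous (at z within cball 0 1) (\<lambda>x. poly br x)" "continuous (at z within cball 0 1) (\<lambda>x. poly bp x)"
        by (rule continuous_at_imp_continuous_at_within, rule poly_isCont)+
      ultimately have "continuous (at z within cball 0 1) G"
        unfolding G_def using bp0[OF z] zZ by (intro continuous_intros) auto
      hence "(G \<longlongrightarrow> 1) (at z within cball 0 1)" using Gz by (simp add: continuous_within)
      moreover have "\<forall>\<^sub>F x in at z within cball 0 1. G x = m x"
      proof -
        have "open (- Z)" using finite_imp_closed[OF Z(1)] by auto
        hence "\<forall>\<^sub>F x in at z within cball 0 1. x \<in> - Z"
          using zZ by (metis ComplI at_within_le_nhds eventually_nhds_in_open filter_leD)
        moreover have "\<forall>\<^sub>F x in at z within cball 0 1. x \<in> cball 0 1" by (simp add: eventually_at_filter)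
        ultimately show ?thesis
        proof eventually_elim
          case (elim x)
          hence nz: "poly bp x \<noteq> 0" using bp0 by auto
          show ?case
          proof (cases "x \<in> ball 0 1")
            case True
            hence "M (v x) = cmod (B x)" by (auto simp: M_def B_def)
            thus ?thesis using True Bhp[OF True] nz by (simp add: G_def m_def J_def norm_mult)
          next
            case False
            hence "cmod x = 1" using elim by auto
            moreover from this have "v x \<notin> v ` ball 0 1" using image_disjoint by force
            ultimately show ?thesis using eqmod[of x] nz False br0[of x] by (simp add: G_def m_def M_def)
          qed
        qed
      qed
      ultimately have "(m \<longlongrightarrow> 1) (at z within cball 0 1)" by (rule Lim_transform_eventually)
      thus ?thesis using False by (simp add: continuous_within m_def)
    qed
    thus ?thesis by (simp add: continuous_on_eq_continuous_within)
  qed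
  obtain c where c: "cmod c = 1" "\<And>z. z \<in> ball 0 1 \<Longrightarrow> J z = c"
  proof (rule boundary_modulus_constant[of J m])
    show "J holomorphic_on ball 0 1" unfolding J_def by (intro holomorphic_intros h)
    show "J z \<noteq> 0" if "z \<in> ball 0 1" for z using h(2)[OF that] br0[of z] that by (auto simp: J_def)
  qed (use mc in \<open>auto simp: m_def\<close>)
  have "c \<noteq> 0" using c(1) by auto
  have Bform: "B z = c * (poly bp z / poly br z)" if "z \<in> ball 0 1" for z
  proof -
    have "poly br z \<noteq> 0" using br0[of z] that by auto
    thus ?thesis using c(2)[OF that] Bhp[OF that] by (auto simp: J_def field_simps)
  qed
  show ?thesis
  proof (rule that[of "\<lambda>w. f w / c" "\<lambda>z. g (c * z)" bp br])
    show "(\<lambda>w. f w / c) holomorphic_on v ` ball 0 1" using \<open>c \<noteq> 0\<close> by (intro holomorphic_intros fg(1)) auto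
    have "(g \<circ> (\<lambda>z. c * z)) holomorphic_on ball 0 1"
      by (rule holomorphic_on_compose_gen[OF _ fg(2)]) (use c in \<open>auto intro!: holomorphic_intros simp: norm_mult\<close>)
    thus "(\<lambda>z. g (c * z)) holomorphic_on ball 0 1" by (simp add: o_def)
    show "f w / c \<in> ball 0 1 \<and> g (c * (f w / c)) = w" if "w \<in> v ` ball 0 1" for w
      using fg(3)[OF that] c(1) \<open>c \<noteq> 0\<close> by (auto simp: norm_divide)
    show "g (c * z) \<in> v ` ball 0 1 \<and> f (g (c * z)) / c = z" if "z \<in> ball 0 1" for z
      using fg(4)[of "c * z"] that c(1) \<open>c \<noteq> 0\<close> by (auto simp: norm_mult)
    show "f (v 0) / c = 0" using fg(5) by (simp add: w0_def)
    show "f (v z) / c = poly bp z / poly br z" if "z \<in> ball 0 1" for z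
      using Bform[OF that] \<open>c \<noteq> 0\<close> by (simp add: B_def)
  qed (use dbp dbr br0 refl1 refl2 in auto)
qed

text \<open>The composition \<open>\<psi> \<circ> v\<close> is a finite Blaschke product \<open>B\<close>, so it extends to the closed disc, and the
extension has the same fibres as \<open>v\<close>. This is clear inside the disc. If \<open>B\<close> agrees at two points of the
circle, then \<open>B\<close>, being open, agrees at pairs of points of the disc close to them, and so does
\<open>v = W \<circ> B\<close>; in the limit \<open>v\<close> agrees. For the converse, solutions on the circle continue inwards, which
exchanges the roles of \<open>v\<close> and \<open>B\<close>. Hence the images of the closed disc under
\<open>v\<close> and \<open>B\<close> are homeomorphic, and the latter is the closed disc.\<close>

theorem connected_complement_image: "connected (- v ` cball 0 1)"
proof -
  obtain \<psi> W bp br where \<psi>: "\<psi> holomorphic_on v ` ball 0 1" and W: "W holomorphic_on ball 0 1"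
    and \<psi>W: "\<And>w. w \<in> v ` ball 0 1 \<Longrightarrow> \<psi> w \<in> ball 0 1 \<and> W (\<psi> w) = w"
    and W\<psi>: "\<And>z. z \<in> ball 0 1 \<Longrightarrow> W z \<in> v ` ball 0 1 \<and> \<psi> (W z) = z"
    and br0: "\<And>z. cmod z \<le> 1 \<Longrightarrow> poly br z \<noteq> 0"
    and form: "\<And>z. z \<in> ball 0 1 \<Longrightarrow> \<psi> (v z) = poly bp z / poly br z"
    and refl1: "\<And>z. z \<noteq> 0 \<Longrightarrow> poly bp (1 / cnj z) * cnj z ^ N = cnj (poly br z)"
    and refl2: "\<And>z. z \<noteq> 0 \<Longrightarrow> poly br (1 / cnj z) * cnj z ^ N = cnj (poly bp z)"
  proof (rule Blaschke_factorization, goal_cases)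
    case (1 \<psi> W bp br)
    show ?case by (rule 1(1)[OF 1(2,3,4,5,9,10,11,12)])
  qed
  define B where "B = (\<lambda>z. poly bp z / poly br z)"
  have Bin: "cmod (B z) < 1" if "cmod z < 1" for z
    using form[of z] \<psi>W[of "v z"] that by (auto simp: B_def)
  have Bout: "cmod (B z) \<ge> 1" if z: "cmod z \<ge> 1" "poly br z \<noteq> 0" for z
  proof -
    define w where "w = 1 / cnj z"
    have "z \<noteq> 0" using z by auto
    hence w: "w \<noteq> 0" "1 / cnj w = z" "cmod w = 1 / cmod z" by (auto simp: w_def norm_divide)
    have 1: "cmod (poly bp z) * cmod w ^ N = cmod (poly br w)"
      using arg_cong[OF refl1[OF w(1)], of cmod] by (simp add: w(2) norm_mult norm_power)
    have 2: "cmod (poly br z) * cmod w ^ N = cmod (poly bp w)"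
      using arg_cong[OF refl2[OF w(1)], of cmod] by (simp add: w(2) norm_mult norm_power)
    have bpw: "poly bp w \<noteq> 0" using 2 z(2) w(1) by auto
    have "cmod w \<le> 1" using w(3) z \<open>z \<noteq> 0\<close> by (simp add: divide_le_eq)
    have "cmod (poly bp w) \<le> cmod (poly br w)"
    proof (cases "cmod w < 1")
      case True
      thus ?thesis using Bin[OF True] br0[of w] by (simp add: B_def norm_divide divide_less_eq)
    next
      case False
      hence "cmod w = 1" using \<open>cmod w \<le> 1\<close> by simp
      moreover from this have "1 / cnj w = w"
        using complex_norm_square[of w] w(1) by (simp add: field_simps)
      ultimately have "cmod (poly bp w) = cmod (poly br w)" using 1 w(2) by simp
      thus ?thesis by simp
    qed
    hence "cmod (poly br z) * cmod w ^ N \<le> cmod (poly bp z) * cmod w ^ N" using 1 2 by simp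
    hence "cmod (poly br z) \<le> cmod (poly bp z)" using w(1) by simp
    thus ?thesis using z(2) by (simp add: B_def norm_divide le_divide_eq)
  qed
  have Bcont: "continuous_on (cball 0 1) B" unfolding B_def using br0 by (intro continuous_intros) auto
  have BS: "cmod (B z) = 1" if z: "cmod z = 1" for z
  proof (rule antisym)
    show "1 \<le> cmod (B z)" using z br0[of z] by (intro Bout) auto
    have zc: "z \<in> cball 0 1" using z by simp
    have "continuous_on (closure (ball 0 1)) (\<lambda>z. cmod (B z))" using Bcont by (intro continuous_intros) simp
    moreover have "(\<lambda>z. cmod (B z)) ` ball 0 1 \<subseteq> {..1}" using Bin by (auto intro: less_imp_le)
    ultimately have "(\<lambda>z. cmod (B z)) ` closure (ball 0 1) \<subseteq> {..1}"
      by (intro image_closure_subset) auto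
    thus "cmod (B z) \<le> 1" using zc by (simp add: image_subset_iff)
  qed
  have near: "\<exists>y\<in>ball 0 1. dist y z < d \<and> dist (f y) (f z) < e"
    if z: "cmod z = 1" and f: "continuous_on (cball 0 1) f" and "d > 0" "e > 0" for z d e and f :: "complex \<Rightarrow> complex"
  proof -
    have zc: "z \<in> cball 0 1" using z by simp
    obtain d' where d': "d' > 0" "\<And>y. y \<in> cball 0 1 \<Longrightarrow> dist y z < d' \<Longrightarrow> dist (f y) (f z) < e"
      using f[unfolded continuous_on_iff, rule_format, OF zc \<open>e > 0\<close>] by blast
    have "z \<in> closure (ball 0 1)" using z by simp
    moreover have "min d d' > 0" using d' \<open>d > 0\<close> by simp
    ultimately obtain y where "y \<in> ball 0 1" "dist y z < min d d'" using closure_approachable by metis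
    thus ?thesis using d'(2)[of y] by (intro bexI[of _ y]) auto
  qed
  have same1: "v z = v z'" if z: "cmod z = 1" "cmod z' = 1" "B z = B z'" for z z'
  proof -
    have "dist (v z) (v z') \<le> 0 + e" if "e > 0" for e
    proof -
      have zc: "z \<in> cball 0 1" "z' \<in> cball 0 1" using z by auto
      have e2: "e / 2 > 0" using that by simp
      obtain d where d: "d > 0" "\<And>y. y \<in> cball 0 1 \<Longrightarrow> dist y z' < d \<Longrightarrow> dist (v y) (v z') < e / 2"
        using cont[unfolded continuous_on_iff, rule_format, OF zc(2) e2] by blast
      obtain d0 where d0: "d0 > 0" "\<And>y. y \<in> cball 0 1 \<Longrightarrow> dist y z < d0 \<Longrightarrow> dist (v y) (v z) < e / 2"
        using cont[unfolded continuous_on_iff, rule_format, OF zc(1) e2] by blast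
      have "open {y. poly br y \<noteq> 0}" by (intro open_Collect_neq continuous_intros)
      moreover have "z' \<in> {y. poly br y \<noteq> 0}" using br0[of z'] z by auto
      ultimately obtain d1 where d1: "d1 > 0" "ball z' d1 \<subseteq> {y. poly br y \<noteq> 0}" by (meson openE)
      define G where "G = ball z' (min d d1)"
      have GB: "B holomorphic_on G" unfolding B_def using d1(2) by (intro holomorphic_intros) (auto simp: G_def)
      have z'G: "z' \<in> G" using d d1 by (simp add: G_def)
      have "\<not> B constant_on G"
      proof
        assume "B constant_on G"
        then obtain c where c: "\<And>y. y \<in> G \<Longrightarrow> B y = c" by (auto simp: constant_on_def)
        obtain y where y: "y \<in> ball 0 1" "dist y z' < min d d1"
          using near[OF z(2) Bcont _ zero_less_one, of "min d d1"] d d1 by auto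
        hence "B y = B z'" using c z'G by (auto simp: G_def dist_commute)
        thus False using Bin[of y] BS[of z'] y z by auto
      qed
      hence "open (B ` G)" by (intro open_mapping_thm[OF GB]) (auto simp: G_def)
      moreover have "B z \<in> B ` G" using z'G z by auto
      ultimately obtain \<epsilon> where \<epsilon>: "\<epsilon> > 0" "ball (B z) \<epsilon> \<subseteq> B ` G" by (meson openE)
      obtain y where y: "y \<in> ball 0 1" "dist y z < d0" "dist (B y) (B z) < \<epsilon>"
        using near[OF z(1) Bcont d0(1) \<epsilon>(1)] by blast
      have "B y \<in> B ` G" using y(3) \<epsilon>(2) by (auto simp: dist_commute)
      then obtain y' where y': "y' \<in> G" "B y' = B y" by auto
      have "poly br y' \<noteq> 0" using y'(1) d1(2) by (auto simp: G_def)
      hence "cmod y' < 1" using Bout[of y'] Bin[of y] y y' by force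
      have "v y = W (B y)" using \<psi>W[of "v y"] form[OF y(1)] y(1) by (auto simp: B_def)
      moreover have "v y' = W (B y')" using \<psi>W[of "v y'"] form[of y'] \<open>cmod y' < 1\<close> by (auto simp: B_def)
      ultimately have "v y = v y'" using y'(2) by simp
      moreover have "dist (v y) (v z) < e / 2" using d0(2)[of y] y by auto
      moreover have "dist (v y') (v z') < e / 2" using d(2)[of y'] y'(1) \<open>cmod y' < 1\<close> by (auto simp: G_def dist_commute)
      ultimately show ?thesis using dist_triangle2[of "v z" "v z'" "v y"] by (simp add: dist_commute)
    qed
    hence "dist (v z) (v z') \<le> 0" by (rule field_le_epsilon)
    thus ?thesis by simp
  qed
  have vB: "\<psi> (v y) = B y" if "cmod y < 1" for y using form[of y] that by (simp add: B_def)
  have same2: "B z = B z'" if z: "cmod z = 1" "cmod z' = 1" "v z = v z'" for z z'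
  proof (rule ccontr)
    assume ne: "B z \<noteq> B z'"
    define \<eta> where "\<eta> = dist (B z) (B z') / 2"
    have \<eta>: "\<eta> > 0" using ne by (simp add: \<eta>_def)
    have z'c: "z' \<in> cball 0 1" using z by simp
    obtain e0 where e0: "e0 > 0" "\<And>y. y \<in> cball 0 1 \<Longrightarrow> dist y z' < e0 \<Longrightarrow> dist (B y) (B z') < \<eta>"
      using Bcont[unfolded continuous_on_iff, rule_format, OF z'c \<eta>] by blast
    define w0 where "w0 = v z"
    have w0: "w0 \<in> v ` sphere 0 1" using z by (auto simp: w0_def)
    have F0: "z \<in> sphere_fibre w0" "z' \<in> sphere_fibre w0" using z by (auto simp: sphere_fibre_def w0_def)
    have inner: "z \<notin> ball 0 1" if "v z \<in> v ` sphere 0 1" for z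
    proof
      assume "z \<in> ball 0 1"
      hence "v z \<in> v ` ball 0 1" by blast
      thus False using that image_disjoint by blast
    qed
    obtain e \<delta> where e: "e \<le> e0" and \<delta>: "\<delta> > 0"
      and ex: "\<And>w \<zeta>. w \<in> v ` cball 0 1 \<Longrightarrow> dist w w0 < \<delta> \<Longrightarrow> w \<notin> v ` sphere 0 1 \<Longrightarrow> \<zeta> \<in> sphere_fibre w0 \<Longrightarrow>
         \<exists>z. z \<in> outer_fibre (1 / 2) w \<and> dist \<zeta> z < e"
    proof (rule boundary_solutions_continue[OF w0, of "1 / 2" 1 e0])
      show "cmod u < 1 / 2" if "cmod u < 1" "v u = w0" for u using inner[of u] that w0 by auto
      show "u \<notin> ball 0 1" if "w \<in> v ` sphere 0 1" "u \<in> outer_fibre (1 / 2) w" for u w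
        using inner[of u] that by (auto simp: outer_fibre_def)
    qed (use e0 in auto)
    obtain y where y: "y \<in> ball 0 1" "dist (v y) w0 < \<delta>" "dist (B y) (B z) < \<eta>"
    proof -
      have zc: "z \<in> cball 0 1" using z by simp
      obtain d where d: "d > 0" "\<And>y. y \<in> cball 0 1 \<Longrightarrow> dist y z < d \<Longrightarrow> dist (v y) (v z) < \<delta>"
        using cont[unfolded continuous_on_iff, rule_format, OF zc \<delta>] by blast
      obtain y where "y \<in> ball 0 1" "dist y z < d" "dist (B y) (B z) < \<eta>"
        using near[OF z(1) Bcont d(1) \<eta>] by blast
      thus ?thesis using d(2)[of y] by (intro that[of y]) (auto simp: w0_def)
    qed
    have "v y \<notin> v ` sphere 0 1" using inner[of y] y(1) by blast
    then obtain y1 where y1: "y1 \<in> outer_fibre (1 / 2) (v y)" "dist z' y1 < e"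
      using ex[of "v y" z'] y F0 by auto
    have y1': "v y1 = v y" "cmod y1 \<le> 1" using y1 by (auto simp: outer_fibre_def)
    have "cmod y1 \<noteq> 1"
    proof
      assume "cmod y1 = 1"
      hence "v y \<in> v ` sphere 0 1" using y1' by (intro image_eqI[of _ _ y1]) auto
      thus False using \<open>v y \<notin> v ` sphere 0 1\<close> by simp
    qed
    hence "B y1 = B y" using vB[of y1] vB[of y] y1' y(1) by simp
    moreover have "dist (B y1) (B z') < \<eta>" using e0(2)[of y1] y1' y1(2) e by (auto simp: dist_commute)
    ultimately have "dist (B z) (B z') < 2 * \<eta>" using y(3) dist_triangle2[of "B z" "B z'" "B y"] by (simp add: dist_commute)
    thus False by (simp add: \<eta>_def)
  qed
  have fibres: "v z = v z' \<longleftrightarrow> B z = B z'" if z: "z \<in> cball 0 1" "z' \<in> cball 0 1" for z z'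
  proof -
    consider "cmod z < 1" "cmod z' < 1" | "cmod z < 1" "cmod z' = 1" | "cmod z = 1" "cmod z' < 1" | "cmod z = 1" "cmod z' = 1"
      using z by fastforce
    thus ?thesis
    proof cases
      case 1
      have "v z = W (B z)" "v z' = W (B z')" using \<psi>W[of "v z"] \<psi>W[of "v z'"] vB 1 by force+
      thus ?thesis using vB 1 by metis
    next
      case 2
      have "v z \<in> v ` ball 0 1" "v z' \<in> v ` sphere 0 1" using 2 by auto
      thus ?thesis using image_disjoint Bin[of z] BS[of z'] 2 by force
    next
      case 3
      have "v z' \<in> v ` ball 0 1" "v z \<in> v ` sphere 0 1" using 3 by auto
      thus ?thesis using image_disjoint Bin[of z'] BS[of z] 3 by force
    next
      case 4
      thus ?thesis using same1 same2 by blast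
    qed
  qed
  have "B ` cball 0 1 = cball 0 1"
  proof
    show "B ` cball 0 1 \<subseteq> cball 0 1"
    proof
      fix u assume "u \<in> B ` cball 0 1"
      then obtain z where "u = B z" "cmod z \<le> 1" by auto
      thus "u \<in> cball 0 1" using Bin[of z] BS[of z] by (cases "cmod z = 1") auto
    qed
    have "compact (B ` cball 0 1)" by (intro compact_continuous_image Bcont) auto
    hence "closed (B ` cball 0 1)" by (rule compact_imp_closed)
    moreover have "ball 0 1 \<subseteq> B ` cball 0 1"
    proof
      fix u :: complex assume u: "u \<in> ball 0 1"
      then obtain z where "z \<in> ball 0 1" "W u = v z" using W\<psi>[OF u] by auto
      hence "B z = u" using vB[of z] W\<psi>[OF u] by auto
      thus "u \<in> B ` cball 0 1" using \<open>z \<in> ball 0 1\<close> by (intro image_eqI[of _ _ z]) auto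
    qed
    ultimately have "closure (ball 0 1) \<subseteq> B ` cball 0 1" by (intro closure_minimal)
    thus "cball 0 1 \<subseteq> B ` cball 0 1" by simp
  qed
  moreover have "v ` cball 0 1 homeomorphic B ` cball 0 1"
    by (rule homeomorphic_images_same_fibres[OF _ cont Bcont fibres]) auto
  ultimately have "v ` cball 0 1 homeomorphic cball (0::complex) 1" by simp
  thus ?thesis by (rule connected_complement_homeomorphic_convex_compact) auto
qed

end

section \<open>Uniform approximation by polynomials\<close>

definition poly_approximable :: "complex set \<Rightarrow> (complex \<Rightarrow> complex) \<Rightarrow> bool" where
  "poly_approximable K f \<longleftrightarrow> (\<forall>e>0. \<exists>p :: complex poly. \<forall>z\<in>K. cmod (f z - poly p z) < e)"

lemma poly_approximable_limit:
  assumes "\<And>e. e > 0 \<Longrightarrow> \<exists>g. poly_approximable K g \<and> (\<forall>z\<in>K. cmod (f z - g z) < e)"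
  shows "poly_approximable K f"
  unfolding poly_approximable_def
proof (intro allI impI)
  fix e :: real assume "e > 0"
  then obtain g where g: "poly_approximable K g" "\<And>z. z \<in> K \<Longrightarrow> cmod (f z - g z) < e / 2"
    using assms[of "e / 2"] by auto
  then obtain p where p: "\<And>z. z \<in> K \<Longrightarrow> cmod (g z - poly p z) < e / 2"
    unfolding poly_approximable_def using \<open>e > 0\<close> by (meson half_gt_zero)
  show "\<exists>p. \<forall>z\<in>K. cmod (f z - poly p z) < e"
  proof (intro exI[of _ p] ballI)
    fix z assume "z \<in> K"
    thus "cmod (f z - poly p z) < e"
      using g(2)[of z] p[of z] norm_triangle_ineq[of "f z - g z" "g z - poly p z"] by simp
  qed
qed

lemma poly_approximable_poly: "poly_approximable K (poly p)"
  unfolding poly_approximable_def by (auto intro!: exI[of _ p])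

lemma poly_approximable_const: "poly_approximable K (\<lambda>_. c)"
  unfolding poly_approximable_def by (auto intro!: exI[of _ "[:c:]"])

lemma poly_approximable_id: "poly_approximable K (\<lambda>z. z)"
  unfolding poly_approximable_def by (auto intro!: exI[of _ "[:0, 1:]"])

lemma poly_approximable_add:
  assumes "poly_approximable K f" "poly_approximable K g"
  shows "poly_approximable K (\<lambda>z. f z + g z)"
  unfolding poly_approximable_def
proof (intro allI impI)
  fix e :: real assume "e > 0"
  then obtain p q where pq: "\<And>z. z \<in> K \<Longrightarrow> cmod (f z - poly p z) < e / 2" "\<And>z. z \<in> K \<Longrightarrow> cmod (g z - poly q z) < e / 2"
    using assms unfolding poly_approximable_def by (meson half_gt_zero)
  show "\<exists>p. \<forall>z\<in>K. cmod (f z + g z - poly p z) < e"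
  proof (intro exI[of _ "p + q"] ballI)
    fix z assume "z \<in> K"
    thus "cmod (f z + g z - poly (p + q) z) < e"
      using pq[of z] norm_triangle_ineq[of "f z - poly p z" "g z - poly q z"] by (simp add: algebra_simps)
  qed
qed

lemma poly_approximable_bounded:
  assumes "compact K" "poly_approximable K f"
  obtains B where "B > 0" "\<And>z. z \<in> K \<Longrightarrow> cmod (f z) \<le> B"
proof -
  obtain p where p: "\<And>z. z \<in> K \<Longrightarrow> cmod (f z - poly p z) < 1"
    using assms(2) unfolding poly_approximable_def by (meson zero_less_one)
  have "bounded (poly p ` K)"
    by (intro compact_imp_bounded compact_continuous_image assms continuous_intros)
  then obtain B where B: "\<And>z. z \<in> K \<Longrightarrow> cmod (poly p z) \<le> B" by (auto simp: bounded_iff)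
  show ?thesis
  proof (rule that)
    show "max B 0 + 1 > 0" by simp
    show "cmod (f z) \<le> max B 0 + 1" if "z \<in> K" for z
      using p[OF that] B[OF that] norm_triangle_ineq[of "f z - poly p z" "poly p z"] by simp
  qed
qed

lemma poly_approximable_mult:
  assumes "compact K" "poly_approximable K f" "poly_approximable K g"
  shows "poly_approximable K (\<lambda>z. f z * g z)"
proof -
  have 1: "poly_approximable K (\<lambda>z. h z * poly p z)" if h: "poly_approximable K h" for h p
    unfolding poly_approximable_def
  proof (intro allI impI)
    fix e :: real assume "e > 0"
    obtain B where B: "B > 0" "\<And>z. z \<in> K \<Longrightarrow> cmod (poly p z) \<le> B"
      using poly_approximable_bounded[OF assms(1) poly_approximable_poly[of K p]] by blast
    obtain q where q: "\<And>z. z \<in> K \<Longrightarrow> cmod (h z - poly q z) < e / B"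
      using h \<open>e > 0\<close> B(1) unfolding poly_approximable_def by (meson divide_pos_pos)
    show "\<exists>q. \<forall>z\<in>K. cmod (h z * poly p z - poly q z) < e"
    proof (intro exI[of _ "q * p"] ballI)
      fix z assume z: "z \<in> K"
      have "h z * poly p z - poly (q * p) z = (h z - poly q z) * poly p z" by (simp add: algebra_simps)
      also have "cmod \<dots> \<le> cmod (h z - poly q z) * B" using B(2)[OF z] by (auto simp: norm_mult intro: mult_left_mono)
      also have "\<dots> < e / B * B" using q[OF z] B(1) by (intro mult_strict_right_mono)
      finally show "cmod (h z * poly p z - poly (q * p) z) < e" using B(1) by simp
    qed
  qed
  obtain B where B: "B > 0" "\<And>z. z \<in> K \<Longrightarrow> cmod (f z) \<le> B"
    using poly_approximable_bounded[OF assms(1,2)] by blast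
  show ?thesis
  proof (rule poly_approximable_limit)
    fix e :: real assume "e > 0"
    then obtain p where p: "\<And>z. z \<in> K \<Longrightarrow> cmod (g z - poly p z) < e / B"
      using assms(3) B(1) unfolding poly_approximable_def by (meson divide_pos_pos)
    have "cmod (f z * g z - f z * poly p z) < e" if z: "z \<in> K" for z
    proof -
      have "cmod (f z * g z - f z * poly p z) = cmod (f z) * cmod (g z - poly p z)"
        by (simp add: norm_mult[symmetric] algebra_simps)
      also have "\<dots> \<le> B * cmod (g z - poly p z)" using B(2)[OF z] by (intro mult_right_mono) auto
      also have "\<dots> < B * (e / B)" using p[OF z] B(1) by (intro mult_strict_left_mono)
      finally show ?thesis using B(1) by simp
    qed
    thus "\<exists>h. poly_approximable K h \<and> (\<forall>z\<in>K. cmod (f z * g z - h z) < e)"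
      using 1[OF assms(2), of p] by blast
  qed
qed

lemma poly_approximable_power:
  assumes "compact K" "poly_approximable K f"
  shows "poly_approximable K (\<lambda>z. f z ^ n)"
  by (induction n) (auto intro: poly_approximable_const poly_approximable_mult assms)

lemma poly_approximable_sum:
  assumes "\<And>i. i \<in> I \<Longrightarrow> poly_approximable K (f i)"
  shows "poly_approximable K (\<lambda>z. \<Sum>i\<in>I. f i z)"
  using assms by (induction I rule: infinite_finite_induct) (auto intro: poly_approximable_const poly_approximable_add)

lemma poly_approximable_Neumann:
  assumes "compact K" "poly_approximable K a" "\<And>z. z \<in> K \<Longrightarrow> cmod (a z) \<le> 1 / 2"
  shows "poly_approximable K (\<lambda>z. 1 / (1 - a z))"
proof (rule poly_approximable_limit)
  fix e :: real assume "e > 0"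
  obtain n where n: "(1 / 2 :: real) ^ n < e / 2"
    using real_arch_pow_inv[of "e / 2" "1 / 2"] \<open>e > 0\<close> by auto
  have "cmod (1 / (1 - a z) - (\<Sum>i<n. a z ^ i)) < e" if z: "z \<in> K" for z
  proof -
    have "a z \<noteq> 1" using assms(3)[OF z] by auto
    hence "(\<Sum>i<n. a z ^ i) = (1 - a z ^ n) / (1 - a z)"
      by (simp add: sum_gp_strict)
    hence "1 / (1 - a z) - (\<Sum>i<n. a z ^ i) = a z ^ n / (1 - a z)"
      by (simp add: diff_divide_distrib)
    hence "cmod (1 / (1 - a z) - (\<Sum>i<n. a z ^ i)) = cmod (a z) ^ n / cmod (1 - a z)"
      by (simp add: norm_divide norm_power)
    also have "\<dots> \<le> (1 / 2) ^ n / (1 / 2)"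
      using assms(3)[OF z] norm_triangle_ineq2[of 1 "a z"] by (intro frac_le power_mono) auto
    also have "\<dots> < e" using n by simp
    finally show ?thesis .
  qed
  thus "\<exists>g. poly_approximable K g \<and> (\<forall>z\<in>K. cmod (1 / (1 - a z) - g z) < e)"
    by (intro exI[of _ "\<lambda>z. \<Sum>i<n. a z ^ i"] conjI poly_approximable_sum poly_approximable_power assms) auto
qed

lemma poly_approximable_resolvent_step:
  assumes "compact K" "poly_approximable K (\<lambda>w. 1 / (w - x))" "d > 0"
    "\<And>w. w \<in> K \<Longrightarrow> cmod (w - x) \<ge> d" "cmod (y - x) \<le> d / 2"
  shows "poly_approximable K (\<lambda>w. 1 / (w - y))"
proof -
  have "poly_approximable K (\<lambda>w. 1 / (w - x) * (1 / (1 - (y - x) * (1 / (w - x)))))"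
  proof (intro poly_approximable_mult poly_approximable_Neumann poly_approximable_const assms(1,2))
    fix w assume w: "w \<in> K"
    have "cmod ((y - x) * (1 / (w - x))) = cmod (y - x) / cmod (w - x)" by (simp add: norm_divide)
    also have "\<dots> \<le> (d / 2) / d" using assms(3,4,5) w by (intro frac_le) auto
    finally show "cmod ((y - x) * (1 / (w - x))) \<le> 1 / 2" using assms(3) by simp
  qed
  moreover have "1 / (w - x) * (1 / (1 - (y - x) * (1 / (w - x)))) = 1 / (w - y)" if "w \<in> K" for w
  proof -
    have "w \<noteq> x" using assms(3,4) that by force
    thus ?thesis by (simp add: divide_simps)
  qed
  ultimately show ?thesis unfolding poly_approximable_def by (metis (no_types, lifting))
qed

text \<open>Runge's pole pushing: by the Neumann series the set of admissible poles is open and closed relative to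
the complement of \<open>K\<close>, and it contains all points far away from \<open>K\<close>. As the complement is connected, no
pole is excluded.\<close>

lemma poly_approximable_resolvent:
  assumes K: "compact K" "connected (- K)" and "\<zeta> \<notin> K"
  shows "poly_approximable K (\<lambda>w. 1 / (w - \<zeta>))"
proof -
  obtain R where R: "R > 0" "\<And>w. w \<in> K \<Longrightarrow> cmod w \<le> R"
    using compact_imp_bounded[OF K(1)] by (auto simp: bounded_pos)
  define y :: complex where "y = of_real (2 * R)"
  have "y \<notin> K" using R by (force simp: y_def)
  have "poly_approximable K (\<lambda>w. (- 1 / y) * (1 / (1 - w * (1 / y))))"
  proof (intro poly_approximable_mult poly_approximable_Neumann poly_approximable_const poly_approximable_id K(1))
    fix w assume "w \<in> K"
    hence "cmod w / (2 * R) \<le> R / (2 * R)" using R by (intro divide_right_mono) auto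
    thus "cmod (w * (1 / y)) \<le> 1 / 2" using R(1) by (simp add: y_def norm_divide norm_mult)
  qed
  moreover have "(- 1 / y) * (1 / (1 - w * (1 / y))) = 1 / (w - y)" if "w \<in> K" for w
  proof -
    have "y \<noteq> 0" "w \<noteq> y" using R(1) that \<open>y \<notin> K\<close> by (auto simp: y_def)
    thus ?thesis by (simp add: divide_simps)
  qed
  ultimately have "poly_approximable K (\<lambda>w. 1 / (w - y))"
    unfolding poly_approximable_def by (metis (no_types, lifting))
  moreover have "\<exists>T. openin (top_of_set (- K)) T \<and> a \<in> T \<and>
      (\<forall>x\<in>T. \<forall>y\<in>T. poly_approximable K (\<lambda>w. 1 / (w - x)) \<longrightarrow> poly_approximable K (\<lambda>w. 1 / (w - y)))"
    if a: "a \<in> - K" for a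
  proof -
    obtain d where d: "d > 0" "ball a d \<subseteq> - K"
      using compact_imp_closed[OF K(1)] a open_contains_ball[of "- K"] by auto
    show ?thesis
    proof (intro exI[of _ "ball a (d / 8)"] conjI ballI impI)
      have "ball a (d / 8) \<subseteq> - K" using d subset_ball[of "d / 8" d a] by auto
      thus "openin (top_of_set (- K)) (ball a (d / 8))"
        by (metis openin_open_eq open_ball compact_imp_closed K(1) open_Compl)
      show "a \<in> ball a (d / 8)" using d by simp
      fix x y assume xy: "x \<in> ball a (d / 8)" "y \<in> ball a (d / 8)" and *: "poly_approximable K (\<lambda>w. 1 / (w - x))"
      show "poly_approximable K (\<lambda>w. 1 / (w - y))"
      proof (rule poly_approximable_resolvent_step[OF K(1) *])
        show "d / 2 > 0" using d by simp
        show "cmod (w - x) \<ge> d / 2" if "w \<in> K" for w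
        proof -
          have "dist a w \<ge> d" using d(2) that by (force simp: not_less[symmetric])
          moreover have "dist a w \<le> dist a x + dist x w" by (rule dist_triangle)
          ultimately show ?thesis using xy d(1) by (simp add: dist_norm norm_minus_commute)
        qed
        have "dist y x \<le> dist a y + dist a x" by (metis dist_commute dist_triangle)
        thus "cmod (y - x) \<le> d / 2 / 2" using xy d(1) by (simp add: dist_norm)
      qed
    qed
  qed
  ultimately show ?thesis
    using connected_induction_simple[OF K(2), of y \<zeta> "\<lambda>x. poly_approximable K (\<lambda>w. 1 / (w - x))"]
      \<open>y \<notin> K\<close> \<open>\<zeta> \<notin> K\<close> by auto
qed

text \<open>Riemann sums converge uniformly on \<open>K\<close>.\<close>

lemma poly_approximable_integral:
  fixes G :: "real \<Rightarrow> complex \<Rightarrow> complex"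
  assumes K: "compact K" and cont: "continuous_on ({0..1} \<times> K) (\<lambda>(t, w). G t w)"
    and G: "\<And>t. t \<in> {0..1} \<Longrightarrow> poly_approximable K (G t)"
  shows "poly_approximable K (\<lambda>w. integral {0..1} (\<lambda>t. G t w))"
proof (rule poly_approximable_limit)
  fix e :: real assume e: "e > 0"
  have "uniformly_continuous_on ({0..1} \<times> K) (\<lambda>(t, w). G t w)"
    by (intro compact_uniformly_continuous cont compact_Times K) auto
  then obtain d where d: "d > 0"
    "\<And>x y. x \<in> {0..1} \<times> K \<Longrightarrow> y \<in> {0..1} \<times> K \<Longrightarrow> dist y x < d \<Longrightarrow> dist (case y of (t, w) \<Rightarrow> G t w) (case x of (t, w) \<Rightarrow> G t w) < e / 2"
    using e unfolding uniformly_continuous_on_def by (meson half_gt_zero)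
  obtain n :: nat where n: "n > 0" "1 / real n < d"
    using d(1) by (metis nat_approx_posE of_nat_0_less_iff zero_less_Suc)
  define g where "g = (\<lambda>w. \<Sum>i<n. of_real (1 / n) * G (real i / n) w)"
  have "poly_approximable K g"
    unfolding g_def
    by (intro poly_approximable_sum poly_approximable_mult poly_approximable_const K G) auto
  moreover have "cmod (integral {0..1} (\<lambda>t. G t w) - g w) < e" if w: "w \<in> K" for w
  proof -
    have Gc: "continuous_on {0..1} (\<lambda>t. G t w)"
    proof -
      have "continuous_on {0..1} ((\<lambda>(t, w). G t w) \<circ> (\<lambda>t. (t, w)))"
        by (intro continuous_on_compose continuous_on_subset[OF cont] continuous_intros) (use w in auto)
      thus ?thesis by (simp add: o_def)
    qed
    have int: "(\<lambda>t. G t w) integrable_on {a..b}" if "0 \<le> a" "b \<le> 1" for a b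
      by (intro integrable_continuous_real continuous_on_subset[OF Gc]) (use that in auto)
    have "cmod (integral {0..real k / n} (\<lambda>t. G t w) - (\<Sum>i<k. of_real (1 / n) * G (real i / n) w)) \<le> e / 2 * (k / n)"
      if "k \<le> n" for k
      using that
    proof (induction k)
      case (Suc k)
      have le: "real k / n \<le> real (Suc k) / n" "real (Suc k) / n \<le> 1" "0 \<le> real k / n"
        using Suc.prems n(1) by (auto simp: field_simps)
      have "integral {0..real (Suc k) / n} (\<lambda>t. G t w) =
        integral {0..real k / n} (\<lambda>t. G t w) + integral {real k / n..real (Suc k) / n} (\<lambda>t. G t w)"
        by (rule Henstock_Kurzweil_Integration.integral_combine[symmetric]) (use le int in auto)
      moreover have "cmod (integral {real k / n..real (Suc k) / n} (\<lambda>t. G t w) - of_real (1 / n) * G (real k / n) w) \<le> e / 2 * (1 / n)"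
      proof -
        have len: "real (Suc k) / n - real k / n = 1 / n" by (simp add: add_divide_distrib)
        have "integral {real k / n..real (Suc k) / n} (\<lambda>t. G t w - G (real k / n) w) =
           integral {real k / n..real (Suc k) / n} (\<lambda>t. G t w) - integral {real k / n..real (Suc k) / n} (\<lambda>t. G (real k / n) w)"
          by (rule Henstock_Kurzweil_Integration.integral_diff) (use int le in auto)
        also have "integral {real k / n..real (Suc k) / n} (\<lambda>t. G (real k / n) w) = of_real (1 / n) * G (real k / n) w"
          using le len by (simp add: scaleR_conv_of_real)
        finally have "cmod (integral {real k / n..real (Suc k) / n} (\<lambda>t. G t w) - of_real (1 / n) * G (real k / n) w)
           = cmod (integral {real k / n..real (Suc k) / n} (\<lambda>t. G t w - G (real k / n) w))" by simp
        also have "\<dots> \<le> e / 2 * (real (Suc k) / n - real k / n)"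
        proof (rule integral_bound)
          show "continuous_on {real k / n..real (Suc k) / n} (\<lambda>t. G t w - G (real k / n) w)"
            by (intro continuous_intros continuous_on_subset[OF Gc]) (use le in auto)
          show "cmod (G t w - G (real k / n) w) \<le> e / 2" if t: "t \<in> {real k / n..real (Suc k) / n}" for t
          proof -
            have "dist (t, w) (real k / n, w) \<le> 1 / n" using t len by (auto simp: dist_Pair_Pair dist_real_def)
            moreover have "0 \<le> t" "t \<le> 1" using t le by (meson atLeastAtMost_iff order_trans)+
            ultimately show ?thesis using d(2)[of "(real k / n, w)" "(t, w)"] le w n by (auto simp: dist_norm)
          qed
        qed (use le in auto)
        finally show ?thesis by (simp only: len)
      qed
      moreover have "e / 2 * (Suc k / n) = e / 2 * (k / n) + e / 2 * (1 / n)" by (simp add: add_divide_distrib distrib_left)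
      ultimately show ?case using Suc.IH Suc.prems
        norm_triangle_ineq[of "integral {0..real k / n} (\<lambda>t. G t w) - (\<Sum>i<k. of_real (1 / n) * G (real i / n) w)"
          "integral {real k / n..real (Suc k) / n} (\<lambda>t. G t w) - of_real (1 / n) * G (real k / n) w"]
        by (simp add: algebra_simps)
    qed auto
    from this[of n] show ?thesis using n(1) e by (simp add: g_def)
  qed
  ultimately show "\<exists>g. poly_approximable K g \<and> (\<forall>w\<in>K. cmod (integral {0..1} (\<lambda>t. G t w) - g w) < e)" by blast
qed

text \<open>This is Runge's theorem for a Riemann map, where no contour around \<open>K\<close> has to be constructed: with
\<open>g\<close> the inverse of \<open>f\<close>, the image under \<open>g\<close> of a circle surrounding \<open>f ` K\<close> serves as one. The residue
theorem for \<open>u g'(u) / (g(u) - w)\<close> represents \<open>f w\<close> as an integral over this circle, whose integrand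
depends on \<open>w\<close> through resolvents only.\<close>

lemma Riemann_map_poly_approximable:
  assumes K: "compact K" "connected (- K)" "K \<subseteq> S"
    and f: "f holomorphic_on S" and g: "g holomorphic_on ball 0 1"
    and fg: "\<And>z. z \<in> S \<Longrightarrow> f z \<in> ball 0 1 \<and> g (f z) = z"
    and gf: "\<And>z. z \<in> ball 0 1 \<Longrightarrow> g z \<in> S \<and> f (g z) = z"
  shows "poly_approximable K f"
proof -
  have "compact (f ` K)"
    by (intro compact_continuous_image K holomorphic_on_imp_continuous_on holomorphic_on_subset[OF f])
  moreover have "f ` K \<subseteq> ball 0 1" using fg K(3) by auto
  ultimately obtain r where r: "0 < r" "r < 1" "f ` K \<subseteq> ball 0 r"
  proof -
    assume c: "compact (f ` K)" "f ` K \<subseteq> ball 0 1" and that: "\<And>r. 0 < r \<Longrightarrow> r < 1 \<Longrightarrow> f ` K \<subseteq> ball 0 r \<Longrightarrow> thesis"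
    show thesis
    proof (cases "K = {}")
      case True
      thus ?thesis using that[of "1 / 2"] by auto
    next
      case False
      have "compact ((\<lambda>z. cmod (f z)) ` K)"
        by (intro compact_continuous_image K continuous_on_norm holomorphic_on_imp_continuous_on holomorphic_on_subset[OF f])
      then obtain w where w: "w \<in> K" "\<And>z. z \<in> K \<Longrightarrow> cmod (f z) \<le> cmod (f w)"
        using compact_attains_sup[of "(\<lambda>z. cmod (f z)) ` K"] False by auto
      have "cmod (f w) < 1" using c(2) w(1) by auto
      moreover have "cmod (f z) < (1 + cmod (f w)) / 2" if "z \<in> K" for z
        using w(2)[OF that] \<open>cmod (f w) < 1\<close> by simp
      hence "f ` K \<subseteq> ball 0 ((1 + cmod (f w)) / 2)" by auto
      ultimately show ?thesis using that[of "(1 + cmod (f w)) / 2"] norm_ge_zero[of "f w"] by (auto simp: add_pos_nonneg)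
    qed
  qed
  have inj: "inj_on g (ball 0 1)" by (rule inj_on_inverseI[of _ f]) (use gf in auto)
  define \<gamma> where "\<gamma> = circlepath (0::complex) r"
  have \<gamma>: "cmod (\<gamma> t) = r" for t using r by (simp add: \<gamma>_def circlepath norm_mult)
  have \<gamma>b: "\<gamma> t \<in> ball 0 1" for t using \<gamma>[of t] r by simp
  have ne: "g (\<gamma> t) \<noteq> w" if "w \<in> K" for t w
  proof
    assume "g (\<gamma> t) = w"
    hence "f w = \<gamma> t" using gf[OF \<gamma>b[of t]] by auto
    thus False using r(3) that \<gamma>[of t] by force
  qed
  define G where "G = (\<lambda>t w. \<gamma> t ^ 2 * deriv g (\<gamma> t) / (g (\<gamma> t) - w))"
  have dg: "deriv g holomorphic_on ball 0 1" by (intro holomorphic_deriv g) auto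
  have \<gamma>c: "continuous_on {0..1} \<gamma>"
    unfolding \<gamma>_def using path_circlepath path_def by blast
  have "poly_approximable K (\<lambda>w. integral {0..1} (\<lambda>t. G t w))"
  proof (rule poly_approximable_integral[OF K(1)])
    have c1: "continuous_on {0..1} (\<lambda>t. deriv g (\<gamma> t))"
      by (rule continuous_on_compose2[OF holomorphic_on_imp_continuous_on[OF dg] \<gamma>c]) (use \<gamma>b in auto)
    have c2: "continuous_on {0..1} (\<lambda>t. g (\<gamma> t))"
      by (rule continuous_on_compose2[OF holomorphic_on_imp_continuous_on[OF g] \<gamma>c]) (use \<gamma>b in auto)
    show "continuous_on ({0..1} \<times> K) (\<lambda>(t, w). G t w)"
      unfolding G_def case_prod_unfold
      by (intro continuous_intros continuous_on_compose2[OF c1] continuous_on_compose2[OF c2] continuous_on_compose2[OF \<gamma>c])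
         (use ne in auto)
    fix t :: real assume t: "t \<in> {0..1}"
    have res: "poly_approximable K (\<lambda>w. 1 / (w - g (\<gamma> t)))" using ne by (intro poly_approximable_resolvent K) blast
    have "poly_approximable K (\<lambda>w. (- (\<gamma> t ^ 2 * deriv g (\<gamma> t))) * (1 / (w - g (\<gamma> t))))"
      by (rule poly_approximable_mult[OF K(1) poly_approximable_const res])
    moreover have "(\<lambda>w. (- (\<gamma> t ^ 2 * deriv g (\<gamma> t))) * (1 / (w - g (\<gamma> t)))) = G t"
      by (auto simp: G_def fun_eq_iff divide_simps) (auto simp: algebra_simps)
    ultimately show "poly_approximable K (G t)" by simp
  qed
  moreover have "integral {0..1} (\<lambda>t. G t w) = f w" if w: "w \<in> K" for w
  proof -
    define a where "a = f w"
    have a: "cmod a < r" "g a = w" using r(3) w fg K(3) by (auto simp: a_def)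
    have ab: "a \<in> ball 0 1" using a r by simp
    define D where "D = (\<lambda>u. if u = a then deriv g a else (g u - g a) / (u - a))"
    have D: "D holomorphic_on ball 0 1"
      unfolding D_def by (rule pole_lemma_open[OF g]) auto
    have Dnz: "D u \<noteq> 0" if "u \<in> ball 0 1" for u
      using holomorphic_injective_imp_regular[OF g open_ball inj ab] inj_onD[OF inj _ that ab]
      by (auto simp: D_def)
    define h where "h = (\<lambda>u. u * deriv g u / D u)"
    have h: "h holomorphic_on cball 0 r"
      unfolding h_def using Dnz r
      by (intro holomorphic_intros holomorphic_on_subset[OF dg] holomorphic_on_subset[OF D]) auto
    have "((\<lambda>u. h u / (u - a)) has_contour_integral 2 * of_real pi * \<i> * h a) (circlepath 0 r)"
      by (rule Cauchy_integral_circlepath_simple[OF h]) (use a in auto)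
    hence "((\<lambda>t. h (\<gamma> t) / (\<gamma> t - a) * vector_derivative \<gamma> (at t within {0..1})) has_integral 2 * of_real pi * \<i> * h a) {0..1}"
      by (simp add: has_contour_integral_def \<gamma>_def)
    moreover have "h (\<gamma> t) / (\<gamma> t - a) * vector_derivative \<gamma> (at t within {0..1}) = 2 * of_real pi * \<i> * G t w"
      if t: "t \<in> {0..1}" for t
    proof -
      have "vector_derivative \<gamma> (at t within {0..1}) = 2 * of_real pi * \<i> * \<gamma> t"
        using t unfolding \<gamma>_def by (subst vector_derivative_circlepath01) (auto simp: circlepath)
      moreover have "\<gamma> t \<noteq> a" using \<gamma>[of t] a by auto
      moreover from this have "h (\<gamma> t) / (\<gamma> t - a) = \<gamma> t * deriv g (\<gamma> t) / (g (\<gamma> t) - w)"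
        using a by (simp add: h_def D_def)
      ultimately show ?thesis by (simp add: G_def power2_eq_square)
    qed
    ultimately have "((\<lambda>t. 2 * of_real pi * \<i> * G t w) has_integral 2 * of_real pi * \<i> * h a) {0..1}"
      by (subst (asm) has_integral_cong) auto
    hence "((\<lambda>t. (1 / (2 * of_real pi * \<i>)) * (2 * of_real pi * \<i> * G t w)) has_integral (1 / (2 * of_real pi * \<i>)) * (2 * of_real pi * \<i> * h a)) {0..1}"
      by (rule has_integral_mult_right)
    hence "((\<lambda>t. G t w) has_integral h a) {0..1}" by simp
    moreover have "h a = a"
      using holomorphic_injective_imp_regular[OF g open_ball inj ab] by (simp add: h_def D_def)
    ultimately show ?thesis by (simp add: a_def integral_unique)
  qed
  ultimately show ?thesis unfolding poly_approximable_def by (metis (no_types, lifting))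
qed

section \<open>Bounded approximation of a Riemann map\<close>

text \<open>Fatten \<open>K\<close>, fill the holes by passing to the complement of the unbounded outside, and take the component
around \<open>K\<close>. A point off \<open>K\<close> is joined to infinity by a path avoiding \<open>K\<close>, which is also avoided by all
sufficiently thin fattenings; so the point drops out together with a neighbourhood.\<close>

lemma decreasing_simply_connected_neighbourhoods:
  assumes K: "compact K" "connected K" "connected (- K)" and a: "a \<in> (K :: complex set)"
  obtains D R where "\<And>n. open (D n)" "\<And>n. simply_connected (D n)" "\<And>n. K \<subseteq> D n" "\<And>n. D n \<subseteq> ball 0 R"
    "\<And>p. p \<notin> K \<Longrightarrow> \<exists>r>0. \<exists>m::nat. \<forall>n\<ge>m. D n \<inter> ball p r = {}"
proof -
  define L where "L = (\<lambda>n::nat. {w. infdist w K \<le> 1 / (Suc n)})"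
  define D where "D = (\<lambda>n. connected_component_set (- closure (outside (L n))) a)"
  have Kne: "K \<noteq> {}" using a by auto
  have Lc: "closed (L n)" for n unfolding L_def by (intro closed_Collect_le continuous_intros)
  have L0: "L n \<subseteq> L m" if "m \<le> n" for m n
  proof
    fix w assume "w \<in> L n"
    hence "infdist w K \<le> 1 / (Suc n)" by (simp add: L_def)
    also have "\<dots> \<le> 1 / (Suc m)" using that by (intro divide_left_mono) auto
    finally show "w \<in> L m" by (simp add: L_def)
  qed
  have bL: "bounded (L n)" for n
  proof -
    obtain B where B: "\<And>x. x \<in> K \<Longrightarrow> cmod x \<le> B" using compact_imp_bounded[OF K(1)] by (auto simp: bounded_iff)
    have "cmod w \<le> B + 1" if "w \<in> L n" for w
    proof -
      obtain x where x: "x \<in> K" "infdist w K = dist w x"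
        using infdist_attains_inf[OF compact_imp_closed[OF K(1)] Kne] by blast
      have "dist w x \<le> 1 / (Suc n)" using that x by (simp add: L_def)
      also have "\<dots> \<le> 1" by simp
      finally have "cmod (w - x) \<le> 1" by (simp add: dist_norm)
      thus ?thesis using B[OF x(1)] norm_triangle_ineq[of "w - x" x] by simp
    qed
    thus ?thesis by (auto simp: bounded_iff)
  qed
  have sub: "K \<subseteq> - closure (outside (L n))" for n
  proof -
    define G where "G = {w. infdist w K < 1 / (Suc n)}"
    have "open G" unfolding G_def by (intro open_Collect_less continuous_intros)
    moreover have "G \<inter> outside (L n) = {}" 
    proof -
      have "G \<subseteq> L n" by (auto simp: G_def L_def)
      thus ?thesis using outside_no_overlap[of "L n"] by blast
    qed
    ultimately have "G \<inter> closure (outside (L n)) = {}" by (simp add: open_Int_closure_eq_empty)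
    moreover have "K \<subseteq> G" using Kne by (auto simp: G_def)
    ultimately show ?thesis by blast
  qed
  have comp: "D n \<in> components (- closure (outside (L n)))" for n
    unfolding D_def using sub a by (intro componentsI) auto
  have op: "open (D n)" for n by (rule open_components[OF _ comp]) auto
  have Dout: "D n \<subseteq> - outside (L n)" for n
    using in_components_subset[OF comp[of n]] closure_subset[of "outside (L n)"] by blast
  have bd: "bounded (D n)" for n
    using cobounded_outside[OF bL] Dout by (rule bounded_subset)
  have "bounded (- outside (L 0))" by (rule cobounded_outside[OF bL])
  then obtain R where R: "- outside (L 0) \<subseteq> ball 0 R" using bounded_subset_ballD by blast
  show ?thesis
  proof (rule that[of D R])
    show "open (D n)" for n by (rule op)
    show "simply_connected (D n)" for n
    proof -
      have "connected (closure (outside (L n)))"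
        by (intro connected_imp_connected_closure connected_outside bL) auto
      hence "connected (- D n)" by (rule component_complement_connected[OF _ comp])
      thus ?thesis using simply_connected_iff_simple[OF op bd] in_components_connected[OF comp] by simp
    qed
    show "K \<subseteq> D n" for n unfolding D_def by (rule connected_component_maximal[OF a K(2) sub])
    show "D n \<subseteq> ball 0 R" for n
      using Dout[of n] outside_mono[OF L0[of 0 n]] R by auto
    fix p assume p: "p \<notin> K"
    have "outside (L 0) \<noteq> {}" using cobounded_outside[OF bL, of 0] not_bounded_UNIV by auto
    then obtain q where q: "q \<in> outside (L 0)" by auto
    hence qn: "q \<in> outside (L n)" for n using outside_mono[OF L0[of 0 n]] by auto
    have "q \<notin> L 0" using q outside_no_overlap[of "L 0"] by blast
    hence "q \<notin> K" using Kne by (auto simp: L_def)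
    have "path_connected (- K)"
      using connected_open_path_connected[of "- K"] K compact_imp_closed[OF K(1)] by auto
    then obtain g where g: "path g" "path_image g \<subseteq> - K" "pathstart g = q" "pathfinish g = p"
      using p \<open>q \<notin> K\<close> unfolding path_connected_def by (metis ComplI)
    have "\<exists>d>0. \<forall>x\<in>path_image g. \<forall>y\<in>K. d \<le> dist x y"
      by (rule separate_compact_closed[OF compact_path_image[OF g(1)] compact_imp_closed[OF K(1)]]) (use g(2) in auto)
    then obtain d where d: "d > 0" "\<And>x y. x \<in> path_image g \<Longrightarrow> y \<in> K \<Longrightarrow> d \<le> dist x y" by blast
    obtain m :: nat where m: "1 / real (Suc m) < d / 2"
      using d(1) nat_approx_posE[of "d / 2"] by auto
    have "D n \<inter> ball p (d / 2) = {}" if n: "n \<ge> m" for n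
    proof -
      have mn: "1 / real (Suc n) < d / 2"
      proof -
        have "1 / real (Suc n) \<le> 1 / real (Suc m)" using n by (intro divide_left_mono) auto
        thus ?thesis using m by simp
      qed
      have far: "x \<notin> L n" if x: "x \<in> path_image g \<union> ball p (d / 2)" for x
      proof
        assume "x \<in> L n"
        obtain y where y: "y \<in> K" "infdist x K = dist x y"
          using infdist_attains_inf[OF compact_imp_closed[OF K(1)] Kne] by blast
        have xy: "dist x y < d / 2" using \<open>x \<in> L n\<close> y(2) mn by (simp add: L_def)
        show False
        proof (cases "x \<in> path_image g")
          case True
          thus ?thesis using d(2)[OF True y(1)] xy d(1) by simp
        next
          case False
          hence "dist p x < d / 2" using x by simp
          moreover have "d \<le> dist p y" using g(4) y(1) by (intro d(2)) auto
          ultimately show ?thesis using xy dist_triangle[of p y x] by simp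
        qed
      qed
      have con: "connected (path_image g \<union> ball p (d / 2))"
        using g(1,4) d(1) by (intro connected_Un connected_path_image) (auto simp: pathfinish_in_path_image)
      have "y \<in> outside (L n)" if y: "y \<in> ball p (d / 2)" for y
      proof (rule outside_same_component[OF _ qn])
        show "connected_component (- L n) q y"
          unfolding connected_component_def using con far y g(3)
          by (intro exI[of _ "path_image g \<union> ball p (d / 2)"]) auto
      qed
      thus ?thesis using Dout[of n] by blast
    qed
    thus "\<exists>r>0. \<exists>m::nat. \<forall>n\<ge>m. D n \<inter> ball p r = {}" using d(1) by (intro exI[of _ "d / 2"]) auto
  qed
qed

text \<open>The functions are Riemann maps of simply connected neighbourhoods shrinking to \<open>K\<close>, and the convergence
is that of Caratheodory's kernel theorem. A limit \<open>\<xi>\<close> of their inverses maps the disc into \<open>K\<close>, hence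
into its interior; comparing \<open>\<xi>\<close> with \<open>W\<close> by the Schwarz lemma in both directions shows that the
derivatives at the origin have the same modulus. After a rotation, \<open>\<phi> \<circ> W\<close> has a derivative close to one
at the origin, which by the Schwarz lemma means that \<open>\<phi>\<close> is close to \<open>\<psi>\<close>.\<close>

lemma Riemann_map_bounded_approximation:
  assumes K: "compact K" "connected K" "connected (- K)"
    and \<psi>: "\<psi> holomorphic_on interior K" and W: "W holomorphic_on ball 0 1"
    and \<psi>W: "\<And>w. w \<in> interior K \<Longrightarrow> \<psi> w \<in> ball 0 1 \<and> W (\<psi> w) = w"
    and W\<psi>: "\<And>z. z \<in> ball 0 1 \<Longrightarrow> W z \<in> interior K \<and> \<psi> (W z) = z"
    and \<psi>0: "\<psi> a = 0" and a: "a \<in> interior K" and e: "e > 0"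
  obtains \<phi> where "poly_approximable K \<phi>" "\<phi> holomorphic_on interior K"
    "\<And>w. w \<in> interior K \<Longrightarrow> cmod (\<phi> w) < 1" "\<phi> a = 0" "cmod (deriv (\<phi> \<circ> W) 0 - 1) < e"
proof -
  have aK: "a \<in> K" using a interior_subset by auto
  have W0: "W 0 = a" using \<psi>W[OF a] \<psi>0 by auto
  obtain D R where D: "\<And>n. open (D n)" "\<And>n. simply_connected (D n)" "\<And>n. K \<subseteq> D n" "\<And>n. D n \<subseteq> ball 0 R"
    "\<And>p. p \<notin> K \<Longrightarrow> \<exists>r>0. \<exists>m::nat. \<forall>n\<ge>m. D n \<inter> ball p r = {}"
    using decreasing_simply_connected_neighbourhoods[OF K aK] by blast
  have nU: "D n \<noteq> UNIV" for n
    using D(4)[of n] not_bounded_UNIV bounded_ball bounded_subset by metis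
  have aD: "a \<in> D n" for n using aK D(3) by auto
  have "\<exists>f g. f holomorphic_on D n \<and> g holomorphic_on ball 0 1 \<and>
    (\<forall>z\<in>D n. f z \<in> ball 0 1 \<and> g (f z) = z) \<and> (\<forall>z\<in>ball 0 1. g z \<in> D n \<and> f (g z) = z) \<and> f a = 0" for n
    using normalized_Riemann_map[OF D(1) D(2) nU aD] by metis
  then obtain f g where fg: "\<And>n. f n holomorphic_on D n" "\<And>n. g n holomorphic_on ball 0 1"
    "\<And>n z. z \<in> D n \<Longrightarrow> f n z \<in> ball 0 1 \<and> g n (f n z) = z"
    "\<And>n z. z \<in> ball 0 1 \<Longrightarrow> g n z \<in> D n \<and> f n (g n z) = z" "\<And>n. f n a = 0"
    by metis
  have g0: "g n 0 = a" for n using fg(3)[OF aD, of n] fg(5)[of n] by auto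
  obtain \<xi> r where \<xi>: "\<xi> holomorphic_on ball 0 1" "strict_mono (r :: nat \<Rightarrow> nat)"
    "\<And>x. x \<in> ball 0 1 \<Longrightarrow> (\<lambda>n. g (r n) x) \<longlonglongrightarrow> \<xi> x"
    "\<And>K. compact K \<Longrightarrow> K \<subseteq> ball 0 1 \<Longrightarrow> uniform_limit K (g \<circ> r) \<xi> sequentially"
  proof (rule Montel[of "ball 0 1" "range g" g])
    fix K' :: "complex set" assume "compact K'" "K' \<subseteq> ball 0 1"
    thus "\<exists>B. \<forall>h\<in>range g. \<forall>z\<in>K'. cmod (h z) \<le> B"
      using fg(4) D(4) by (intro exI[of _ R]) (force intro: less_imp_le)
  qed (use fg(2) in auto)
  have \<xi>0: "\<xi> 0 = a"
  proof -
    have "(\<lambda>n. g (r n) 0) \<longlonglongrightarrow> \<xi> 0" by (intro \<xi>(3)) auto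
    thus ?thesis using g0 by (simp add: LIMSEQ_const_iff)
  qed
  have dlim: "(\<lambda>n. deriv (g (r n)) 0) \<longlonglongrightarrow> deriv \<xi> 0"
  proof -
    have "uniform_limit (cball 0 (1 / 2)) (g \<circ> r) \<xi> sequentially" by (intro \<xi>(4)) auto
    hence "uniform_limit (ball 0 (1 / 2)) (g \<circ> r) \<xi> sequentially"
      by (rule uniform_limit_on_subset) auto
    hence "(\<lambda>n. deriv ((g \<circ> r) n) 0) \<longlonglongrightarrow> deriv \<xi> 0"
      by (rule deriv_complex_uniform_limit)
         (auto intro!: always_eventually holomorphic_on_subset[OF fg(2)])
    thus ?thesis by simp
  qed
  \<comment> \<open>the maps t n compare the interior of K with its neighbourhoods\<close>
  define t where "t = (\<lambda>n. f n \<circ> W)"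
  have WD: "W z \<in> D n" if "z \<in> ball 0 1" for z n using W\<psi>[OF that] interior_subset D(3) by blast
  have t: "t n holomorphic_on ball 0 1" for n
    unfolding t_def by (rule holomorphic_on_compose_gen[OF W fg(1)]) (use WD in auto)
  have tb: "cmod (t n z) < 1" if "cmod z < 1" for n z
    using fg(3)[OF WD[of z n]] that by (auto simp: t_def)
  have t0: "t n 0 = 0" for n using fg(5) W0 by (simp add: t_def)
  have dt1: "cmod (deriv (t n) 0) \<le> 1" for n
    using Schwarz_Lemma(2)[of "t n" 0] t t0 tb by auto
  have diffW: "W field_differentiable (at 0)"
    using W by (rule holomorphic_on_imp_differentiable_at) auto
  have chain1: "deriv W 0 = deriv (g n) 0 * deriv (t n) 0" for n
  proof -
    have "deriv (g n \<circ> t n) 0 = deriv (g n) (t n 0) * deriv (t n) 0"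
      using t0 by (intro deriv_chain holomorphic_on_imp_differentiable_at[OF t] holomorphic_on_imp_differentiable_at[OF fg(2)]) auto
    moreover have "deriv (g n \<circ> t n) 0 = deriv W 0"
    proof (rule deriv_cong_ev)
      have "\<forall>\<^sub>F z in nhds (0::complex). z \<in> ball 0 1" by (intro eventually_nhds_in_open) auto
      thus "\<forall>\<^sub>F z in nhds 0. (g n \<circ> t n) z = W z"
        by eventually_elim (use fg(3) WD in \<open>simp add: t_def\<close>)
    qed simp
    ultimately show ?thesis using t0 by simp
  qed
  have dW: "deriv W 0 \<noteq> 0"
  proof (rule holomorphic_injective_imp_regular[OF W])
    show "inj_on W (ball 0 1)" by (rule inj_on_inverseI[of _ \<psi>]) (use W\<psi> in auto)
  qed auto
  have "cmod (deriv W 0) \<le> cmod (deriv (g n) 0)" for n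
    unfolding chain1[of n] norm_mult by (rule mult_left_le[OF dt1]) auto
  hence "cmod (deriv W 0) \<le> cmod (deriv \<xi> 0)"
    using dlim by (intro tendsto_lowerbound[OF tendsto_norm[OF dlim]]) auto
  hence d\<xi>: "deriv \<xi> 0 \<noteq> 0" using dW by auto
  have \<xi>K: "\<xi> z \<in> K" if z: "z \<in> ball 0 1" for z
  proof (rule ccontr)
    assume "\<xi> z \<notin> K"
    then obtain d m where d: "d > 0" "\<And>n. n \<ge> m \<Longrightarrow> D n \<inter> ball (\<xi> z) d = {}" using D(5) by blast
    have "\<forall>\<^sub>F n in sequentially. dist (g (r n) z) (\<xi> z) < d"
      using \<xi>(3)[OF z] d(1) by (rule tendstoD)
    moreover have "\<forall>\<^sub>F n in sequentially. n \<ge> m" by (rule eventually_ge_at_top)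
    ultimately have "\<forall>\<^sub>F n in sequentially. False"
    proof eventually_elim
      case (elim n)
      have "r n \<ge> m" using seq_suble[OF \<xi>(2), of n] elim by simp
      thus False using d(2)[of "r n"] fg(4)[OF z, of "r n"] elim by (auto simp: dist_commute)
    qed
    thus False by simp
  qed
  have "\<xi> ` ball 0 1 \<subseteq> interior K"
  proof (rule interior_maximal)
    have "\<not> \<xi> constant_on ball 0 1"
    proof
      assume "\<xi> constant_on ball 0 1"
      then obtain c where "\<And>z. z \<in> ball 0 1 \<Longrightarrow> \<xi> z = c" by (auto simp: constant_on_def)
      hence "\<forall>\<^sub>F z in nhds (0::complex). \<xi> z = c"
        using eventually_nhds_in_open[of "ball (0::complex) 1" 0] by (auto elim: eventually_mono)
      hence "deriv \<xi> 0 = deriv (\<lambda>_. c) 0" by (intro deriv_cong_ev) auto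
      thus False using d\<xi> by simp
    qed
    thus "open (\<xi> ` ball 0 1)" by (intro open_mapping_thm[OF \<xi>(1)]) auto
  qed (use \<xi>K in auto)
  hence \<xi>I: "\<xi> z \<in> interior K" if "z \<in> ball 0 1" for z using that by auto
  define s where "s = \<psi> \<circ> \<xi>"
  have s: "s holomorphic_on ball 0 1"
    unfolding s_def by (rule holomorphic_on_compose_gen[OF \<xi>(1) \<psi>]) (use \<xi>I in auto)
  have "cmod (deriv s 0) \<le> 1"
  proof (rule Schwarz_Lemma(2)[OF s, of 0])
    show "s 0 = 0" using \<xi>0 \<psi>0 by (simp add: s_def)
    show "cmod (s z) < 1" if "cmod z < 1" for z using \<psi>W[OF \<xi>I[of z]] that by (auto simp: s_def)
  qed auto
  moreover have "deriv \<xi> 0 = deriv W 0 * deriv s 0"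
  proof -
    have "s 0 = 0" using \<xi>0 \<psi>0 by (simp add: s_def)
    hence "deriv (W \<circ> s) 0 = deriv W (s 0) * deriv s 0"
      by (intro deriv_chain holomorphic_on_imp_differentiable_at[OF s] holomorphic_on_imp_differentiable_at[OF W]) auto
    moreover have "deriv (W \<circ> s) 0 = deriv \<xi> 0"
    proof (rule deriv_cong_ev)
      have "\<forall>\<^sub>F z in nhds (0::complex). z \<in> ball 0 1" by (intro eventually_nhds_in_open) auto
      thus "\<forall>\<^sub>F z in nhds 0. (W \<circ> s) z = \<xi> z"
        by eventually_elim (use \<psi>W \<xi>I in \<open>simp add: s_def\<close>)
    qed simp
    ultimately show ?thesis using \<open>s 0 = 0\<close> by simp
  qed
  ultimately have le: "cmod (deriv \<xi> 0) \<le> cmod (deriv W 0)"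
    by (auto simp: norm_mult intro: mult_left_le)
  have dtn: "cmod (deriv (t n) 0) = cmod (deriv W 0) / cmod (deriv (g n) 0)" for n
    using arg_cong[OF chain1[of n], of cmod] dW chain1[of n] by (auto simp: norm_mult)
  have "(\<lambda>n. cmod (deriv (t (r n)) 0)) \<longlonglongrightarrow> cmod (deriv W 0) / cmod (deriv \<xi> 0)"
    unfolding dtn using d\<xi> by (intro tendsto_intros dlim) auto
  moreover have "1 - e < cmod (deriv W 0) / cmod (deriv \<xi> 0)"
  proof -
    have "1 \<le> cmod (deriv W 0) / cmod (deriv \<xi> 0)" using le d\<xi> by (simp add: le_divide_eq)
    thus ?thesis using e by simp
  qed
  ultimately have "\<forall>\<^sub>F n in sequentially. 1 - e < cmod (deriv (t (r n)) 0)" by (rule order_tendstoD(1))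
  then obtain m where m: "1 - e < cmod (deriv (t (r m)) 0)" by (auto simp: eventually_sequentially)
  define n where "n = r m"
  define d where "d = deriv (t n) 0"
  have d0: "d \<noteq> 0" using chain1[of n] dW by (auto simp: d_def)
  define c where "c = cnj d / of_real (cmod d)"
  have c: "cmod c = 1" "c * d = of_real (cmod d)"
  proof -
    show "cmod c = 1" using d0 by (simp add: c_def norm_divide)
    have "cnj d * d = of_real (cmod d) * of_real (cmod d)"
      using complex_norm_square[of d] by (simp add: power2_eq_square mult.commute)
    thus "c * d = of_real (cmod d)" using d0 by (simp add: c_def)
  qed
  show ?thesis
  proof (rule that[of "\<lambda>w. c * f n w"])
    show "poly_approximable K (\<lambda>w. c * f n w)"
      by (intro poly_approximable_mult poly_approximable_const K(1)
          Riemann_map_poly_approximable[OF K(1,3) D(3) fg(1,2), of n n]) (use fg in auto)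
    show "(\<lambda>w. c * f n w) holomorphic_on interior K"
      using D(3) interior_subset by (intro holomorphic_intros holomorphic_on_subset[OF fg(1)]) blast
    show "cmod (c * f n w) < 1" if "w \<in> interior K" for w
      using fg(3)[of w n] D(3) interior_subset that c(1) by (force simp: norm_mult)
    show "c * f n a = 0" using fg(5) by simp
    have "deriv ((\<lambda>w. c * f n w) \<circ> W) 0 = c * d"
    proof -
      have "(\<lambda>w. c * f n w) \<circ> W = (\<lambda>z. c * t n z)" by (auto simp: t_def)
      moreover have "t n field_differentiable (at 0)" using t by (rule holomorphic_on_imp_differentiable_at) auto
      ultimately show ?thesis by (simp add: d_def)
    qed
    hence "deriv ((\<lambda>w. c * f n w) \<circ> W) 0 - 1 = of_real (cmod d - 1)" using c(2) by simp
    hence "cmod (deriv ((\<lambda>w. c * f n w) \<circ> W) 0 - 1) = \<bar>cmod d - 1\<bar>" by (simp only: norm_of_real)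
    also have "\<dots> < e" using m dt1[of n] by (simp add: d_def n_def)
    finally show "cmod (deriv ((\<lambda>w. c * f n w) \<circ> W) 0 - 1) < e" .
  qed
qed

section \<open>Square integrable functions on the circle\<close>

abbreviation circle_mean :: "(complex \<Rightarrow> 'a::{banach, second_countable_topology}) \<Rightarrow> 'a" where
  "circle_mean f \<equiv> integral\<^sup>L circle_measure f"

lemma uniform_measure_alt:
  "uniform_measure lborel {0..2*pi} = density lborel (\<lambda>x. ennreal (indicator {0..2*pi} x / (2 * pi)))"
proof -
  have "indicator {0..2*pi} x / emeasure lborel {0..2*pi} = ennreal (indicator {0..2*pi} x / (2 * pi))" for x :: real
    by (auto simp: indicator_def divide_ennreal[symmetric] ennreal_numeral)
  thus ?thesis by (simp add: uniform_measure_def)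
qed

lemma cis_measurable [measurable]:
  "cis \<in> uniform_measure lborel {0..2*pi} \<rightarrow>\<^sub>M restrict_space borel (sphere 0 1)"
proof (rule measurable_restrict_space2)
  have "continuous_on UNIV cis" by (intro continuous_intros)
  hence "cis \<in> borel_measurable borel" by (rule borel_measurable_continuous_onI)
  thus "cis \<in> borel_measurable (uniform_measure lborel {0..2*pi})" by simp
qed auto

lemma cnj_borel_measurable [measurable (raw)]:
  assumes "f \<in> borel_measurable M"
  shows "(\<lambda>x. cnj (f x)) \<in> borel_measurable M"
  by (rule borel_measurable_continuous_on[OF _ assms]) (intro continuous_intros)

lemma space_circle [simp]: "space circle_measure = sphere 0 1"
  by (simp add: circle_measure_def space_restrict_space)

lemma sets_circle: "sets circle_measure = sets (restrict_space borel (sphere 0 1))"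
  by (simp add: circle_measure_def)

lemma emeasure_circle: "emeasure circle_measure (space circle_measure) = 1"
proof -
  have "emeasure circle_measure (sphere 0 1) = emeasure (uniform_measure lborel {0..2*pi}) (cis -` sphere 0 1 \<inter> space (uniform_measure lborel {0..2*pi}))"
    unfolding circle_measure_def
    by (rule emeasure_distr[OF cis_measurable])
       (use sets.top[of "restrict_space borel (sphere (0::complex) 1)"] in \<open>simp add: space_restrict_space\<close>)
  also have "cis -` sphere 0 1 \<inter> space (uniform_measure lborel {0..2*pi}) = UNIV" by auto
  also have "emeasure (uniform_measure lborel {0..2*pi}) UNIV = 1"
    by (subst emeasure_uniform_measure) (auto simp: divide_ennreal)
  finally show ?thesis by simp
qed

interpretation circle: finite_measure circle_measure
  by standard (use emeasure_circle in simp)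

lemma circle_measure_UNIV: "measure circle_measure (sphere 0 1) = 1"
  using emeasure_circle by (simp add: measure_def)

lemma circle_measurable_continuous:
  "continuous_on (sphere 0 1) f \<Longrightarrow> f \<in> borel_measurable circle_measure"
  using borel_measurable_continuous_on_restrict[of "sphere 0 1" f]
  by (subst measurable_cong_sets[OF sets_circle refl])

lemma circle_integrable_bounded:
  fixes f :: "complex \<Rightarrow> 'a::{banach, second_countable_topology}"
  assumes "f \<in> borel_measurable circle_measure" "\<And>z. cmod z = 1 \<Longrightarrow> norm (f z) \<le> B"
  shows "integrable circle_measure f"
  by (rule circle.integrable_const_bound[of _ B]) (use assms in auto)

lemma circle_integrable_continuous:
  fixes f :: "complex \<Rightarrow> 'a::{banach, second_countable_topology}"
  assumes f: "continuous_on (sphere 0 1) f"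
  shows "integrable circle_measure f"
proof -
  have "bounded (f ` sphere 0 1)" by (intro compact_imp_bounded compact_continuous_image f) auto
  then obtain B where "\<And>z. cmod z = 1 \<Longrightarrow> norm (f z) \<le> B"
    by (metis bounded_iff image_eqI mem_sphere_0)
  thus ?thesis by (intro circle_integrable_bounded circle_measurable_continuous f)
qed

lemma circle_integral:
  fixes f :: "complex \<Rightarrow> complex"
  assumes "f \<in> borel_measurable circle_measure"
  shows "circle_mean f = (\<integral>t. (indicator {0..2*pi} t / (2 * pi)) *\<^sub>R f (cis t) \<partial>lborel)"
proof -
  have f: "f \<in> borel_measurable (restrict_space borel (sphere 0 1))"
    using assms by (subst (asm) measurable_cong_sets[OF sets_circle refl])
  have "circle_mean f = (\<integral>t. f (cis t) \<partial>uniform_measure lborel {0..2*pi})"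
    unfolding circle_measure_def by (rule integral_distr[OF cis_measurable f])
  also have "\<dots> = (\<integral>t. (indicator {0..2*pi} t / (2 * pi)) *\<^sub>R f (cis t) \<partial>lborel)"
    unfolding uniform_measure_alt
  proof (rule integral_density)
    have "(\<lambda>t. f (cis t)) \<in> borel_measurable (uniform_measure lborel {0..2*pi})"
      by (rule measurable_compose[OF cis_measurable f])
    thus "(\<lambda>t. f (cis t)) \<in> borel_measurable lborel" by simp
  qed auto
  finally show ?thesis .
qed

lemma circle_mean_monomial: "circle_mean (\<lambda>\<zeta>. \<zeta> ^ m * cnj \<zeta> ^ n) = (if m = n then 1 else 0)"
proof (cases "m = n")
  case True
  have "circle_mean (\<lambda>\<zeta>. \<zeta> ^ m * cnj \<zeta> ^ n) = circle_mean (\<lambda>_. 1)"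
  proof (rule Bochner_Integration.integral_cong)
    fix z assume "z \<in> space circle_measure"
    hence "z * cnj z = 1" using complex_norm_square[of z] by simp
    thus "z ^ m * cnj z ^ n = 1" using True by (simp add: power_mult_distrib[symmetric])
  qed auto
  thus ?thesis using True by (simp add: circle_measure_UNIV)
next
  case False
  define k where "k = real m - real n"
  have k: "k \<noteq> 0" using False by (simp add: k_def)
  have c: "cis t ^ m * cnj (cis t) ^ n = cis (k * t)" for t
  proof -
    have "cis t ^ m * cnj (cis t) ^ n = cis (real m * t) * cis (real n * (- t))"
      by (simp only: cis_cnj Complex.DeMoivre)
    thus ?thesis by (simp add: cis_mult k_def algebra_simps)
  qed
  have "circle_mean (\<lambda>\<zeta>. \<zeta> ^ m * cnj \<zeta> ^ n) = (\<integral>t. (indicator {0..2*pi} t / (2 * pi)) *\<^sub>R cis (k * t) \<partial>lborel)"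
    by (subst circle_integral) (auto simp: c intro!: circle_measurable_continuous continuous_intros)
  also have "\<dots> = (\<integral>t. indicator {0..2*pi} t *\<^sub>R (cis (k * t) / (2 * pi)) \<partial>lborel)"
    by (intro Bochner_Integration.integral_cong) (auto simp: scaleR_conv_of_real)
  also have "\<dots> = cis (k * (2 * pi)) / (\<i> * k * (2 * pi)) - cis (k * 0) / (\<i> * k * (2 * pi))"
  proof (rule integral_FTC_atLeastAtMost)
    fix t :: real
    have "((\<lambda>z. exp (\<i> * of_real k * z) / (\<i> * k * (2 * pi))) has_field_derivative
       exp (\<i> * of_real k * of_real t) / (2 * pi)) (at (of_real t))"
      by (rule derivative_eq_intros refl | use k in simp)+
    from has_vector_derivative_real_field[OF this]
    show "((\<lambda>t. cis (k * t) / (\<i> * k * (2 * pi))) has_vector_derivative cis (k * t) / (2 * pi)) (at t within {0..2*pi})"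
      by (simp add: cis_conv_exp mult.assoc)
  qed (auto intro!: continuous_intros)
  also have "cis (k * (2 * pi)) = 1"
  proof -
    have "cis (k * (2 * pi)) = cis (2 * pi * real m) * cis (- (2 * pi * real n))" by (simp add: cis_mult k_def algebra_simps)
    moreover have "cis (2 * pi * real j) = 1" for j by (simp add: cis_multiple_2pi)
    ultimately show ?thesis by (simp add: cis_cnj[symmetric])
  qed
  finally show ?thesis using False by simp
qed

definition mean_square :: "(complex \<Rightarrow> complex) \<Rightarrow> real" where
  "mean_square f = circle_mean (\<lambda>\<zeta>. (cmod (f \<zeta>))\<^sup>2)"

lemma mean_square_nonneg: "mean_square f \<ge> 0"
  by (simp add: mean_square_def)

lemma L2_circleI: "continuous_on (sphere 0 1) f \<Longrightarrow> f \<in> L2_circle"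
  unfolding L2_circle_def
  by (auto intro!: circle_measurable_continuous circle_integrable_continuous continuous_intros)

lemma L2_measurable: "f \<in> L2_circle \<Longrightarrow> f \<in> borel_measurable circle_measure"
  and L2_square_integrable: "f \<in> L2_circle \<Longrightarrow> integrable circle_measure (\<lambda>\<zeta>. (cmod (f \<zeta>))\<^sup>2)"
  by (auto simp: L2_circle_def)

lemma L2_circle_bound:
  assumes "f \<in> L2_circle" "g \<in> L2_circle" "h \<in> borel_measurable circle_measure"
    "\<And>z. cmod z = 1 \<Longrightarrow> cmod (h z) \<le> A * cmod (f z) + B * cmod (g z)" "A \<ge> 0" "B \<ge> 0"
  shows "h \<in> L2_circle"
    and "mean_square h \<le> 2 * A\<^sup>2 * mean_square f + 2 * B\<^sup>2 * mean_square g"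
proof -
  have bd: "(cmod (h z))\<^sup>2 \<le> 2 * A\<^sup>2 * (cmod (f z))\<^sup>2 + 2 * B\<^sup>2 * (cmod (g z))\<^sup>2" if "cmod z = 1" for z
  proof -
    have "(cmod (h z))\<^sup>2 \<le> (A * cmod (f z) + B * cmod (g z))\<^sup>2"
      using assms(4)[OF that] by (intro power_mono) auto
    also have "\<dots> \<le> 2 * (A * cmod (f z))\<^sup>2 + 2 * (B * cmod (g z))\<^sup>2"
      using sum_squares_ge_zero[of "A * cmod (f z) - B * cmod (g z)" 0] by (simp add: power2_eq_square algebra_simps)
    finally show ?thesis by (simp add: power_mult_distrib algebra_simps)
  qed
  have i: "integrable circle_measure (\<lambda>z. 2 * A\<^sup>2 * (cmod (f z))\<^sup>2 + 2 * B\<^sup>2 * (cmod (g z))\<^sup>2)"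
    by (intro Bochner_Integration.integrable_add integrable_mult_right L2_square_integrable assms)
  have m: "(\<lambda>z. (cmod (h z))\<^sup>2) \<in> borel_measurable circle_measure" using assms(3) by measurable
  have ih: "integrable circle_measure (\<lambda>z. (cmod (h z))\<^sup>2)"
    by (rule Bochner_Integration.integrable_bound[OF i m]) (use bd in \<open>auto simp: abs_of_nonneg\<close>)
  thus "h \<in> L2_circle" using assms(3) by (simp add: L2_circle_def)
  have "mean_square h \<le> circle_mean (\<lambda>z. 2 * A\<^sup>2 * (cmod (f z))\<^sup>2 + 2 * B\<^sup>2 * (cmod (g z))\<^sup>2)"
    unfolding mean_square_def by (rule integral_mono[OF ih i]) (use bd in auto)
  also have "\<dots> = 2 * A\<^sup>2 * mean_square f + 2 * B\<^sup>2 * mean_square g"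
    using L2_square_integrable[OF assms(1)] L2_square_integrable[OF assms(2)] by (simp add: mean_square_def)
  finally show "mean_square h \<le> 2 * A\<^sup>2 * mean_square f + 2 * B\<^sup>2 * mean_square g" .
qed

lemma L2_diff: "f \<in> L2_circle \<Longrightarrow> g \<in> L2_circle \<Longrightarrow> (\<lambda>z. f z - g z) \<in> L2_circle"
  and mean_square_add: "f \<in> L2_circle \<Longrightarrow> g \<in> L2_circle \<Longrightarrow> mean_square (\<lambda>z. f z + g z) \<le> 2 * mean_square f + 2 * mean_square g"
  and mean_square_diff: "f \<in> L2_circle \<Longrightarrow> g \<in> L2_circle \<Longrightarrow> mean_square (\<lambda>z. f z - g z) \<le> 2 * mean_square f + 2 * mean_square g"
  using L2_circle_bound[of f g "\<lambda>z. f z + g z" 1 1] L2_circle_bound[of f g "\<lambda>z. f z - g z" 1 1]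
  by (auto simp: norm_triangle_ineq norm_triangle_ineq4 dest!: L2_measurable)

lemma L2_mult_bounded:
  assumes "\<psi> \<in> borel_measurable circle_measure" "\<And>z. cmod z = 1 \<Longrightarrow> cmod (\<psi> z) \<le> S" "f \<in> L2_circle"
  shows "(\<lambda>z. \<psi> z * f z) \<in> L2_circle" "mean_square (\<lambda>z. \<psi> z * f z) \<le> S\<^sup>2 * mean_square f"
proof -
  have bd: "(cmod (\<psi> z * f z))\<^sup>2 \<le> S\<^sup>2 * (cmod (f z))\<^sup>2" if "cmod z = 1" for z
    using assms(2)[OF that] by (auto simp: norm_mult power_mult_distrib intro!: mult_right_mono power_mono)
  have i: "integrable circle_measure (\<lambda>z. S\<^sup>2 * (cmod (f z))\<^sup>2)"
    by (intro integrable_mult_right L2_square_integrable assms)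
  have m: "(\<lambda>z. \<psi> z * f z) \<in> borel_measurable circle_measure"
    using assms(1) L2_measurable[OF assms(3)] by measurable
  hence m2: "(\<lambda>z. (cmod (\<psi> z * f z))\<^sup>2) \<in> borel_measurable circle_measure" by measurable
  have ih: "integrable circle_measure (\<lambda>z. (cmod (\<psi> z * f z))\<^sup>2)"
    by (rule Bochner_Integration.integrable_bound[OF i m2]) (use bd in \<open>auto simp: abs_of_nonneg\<close>)
  thus "(\<lambda>z. \<psi> z * f z) \<in> L2_circle" using m by (simp add: L2_circle_def)
  have "mean_square (\<lambda>z. \<psi> z * f z) \<le> circle_mean (\<lambda>z. S\<^sup>2 * (cmod (f z))\<^sup>2)"
    unfolding mean_square_def by (rule integral_mono[OF ih i]) (use bd in auto)
  thus "mean_square (\<lambda>z. \<psi> z * f z) \<le> S\<^sup>2 * mean_square f" by (simp add: mean_square_def)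
qed

lemma young: "a * b \<le> (t * a\<^sup>2 + b\<^sup>2 / t) / 2" if "t > 0" for a b t :: real
proof -
  have "0 \<le> (t * a - b)\<^sup>2 / t" using that by simp
  also have "\<dots> = t * a\<^sup>2 + b\<^sup>2 / t - 2 * (a * b)" using that by (simp add: power2_eq_square field_simps)
  finally show ?thesis by simp
qed

text \<open>The second estimate, with its free parameter \<open>t\<close>, takes the place of the Cauchy-Schwarz inequality.\<close>

lemma L2_pairing:
  assumes "f \<in> L2_circle" "g \<in> L2_circle"
  shows "integrable circle_measure (\<lambda>z. f z * cnj (g z))"
    and "t > 0 \<Longrightarrow> cmod (circle_mean (\<lambda>z. f z * cnj (g z))) \<le> (t * mean_square f + mean_square g / t) / 2"
proof -
  have i: "integrable circle_measure (\<lambda>z. (t * (cmod (f z))\<^sup>2 + (cmod (g z))\<^sup>2 / t) / 2)" for t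
    using L2_square_integrable[OF assms(1)] L2_square_integrable[OF assms(2)] by simp
  have m: "(\<lambda>z. f z * cnj (g z)) \<in> borel_measurable circle_measure"
    using L2_measurable[OF assms(1)] L2_measurable[OF assms(2)] by measurable
  have bd: "cmod (f z * cnj (g z)) \<le> (t * (cmod (f z))\<^sup>2 + (cmod (g z))\<^sup>2 / t) / 2" if "t > 0" for t z
    using young[OF that, of "cmod (f z)" "cmod (g z)"] by (simp add: norm_mult)
  show int: "integrable circle_measure (\<lambda>z. f z * cnj (g z))"
    by (rule Bochner_Integration.integrable_bound[OF i[of 1] m]) (use bd[of 1] in \<open>auto simp: abs_of_nonneg intro: order_trans[OF _ abs_ge_self]\<close>)
  assume t: "t > 0"
  have "cmod (circle_mean (\<lambda>z. f z * cnj (g z))) \<le> circle_mean (\<lambda>z. (t * (cmod (f z))\<^sup>2 + (cmod (g z))\<^sup>2 / t) / 2)"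
    by (rule Bochner_Integration.integral_norm_bound_integral[OF int i]) (use bd[OF t] in auto)
  also have "\<dots> = (t * mean_square f + mean_square g / t) / 2"
    using L2_square_integrable[OF assms(1)] L2_square_integrable[OF assms(2)] by (simp add: mean_square_def)
  finally show "cmod (circle_mean (\<lambda>z. f z * cnj (g z))) \<le> (t * mean_square f + mean_square g / t) / 2" .
qed

lemma L2_pairing_tendsto_0:
  assumes f: "f \<in> L2_circle" and g: "\<forall>\<^sub>F r in F. g r \<in> L2_circle" and lim: "((\<lambda>r. mean_square (g r)) \<longlongrightarrow> 0) F"
  shows "((\<lambda>r. circle_mean (\<lambda>z. f z * cnj (g r z))) \<longlongrightarrow> 0) F"
proof (rule tendstoI)
  fix e :: real assume e: "e > 0"
  define t where "t = e / (mean_square f + 1)"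
  have t: "t > 0" using e mean_square_nonneg[of f] by (simp add: t_def add_nonneg_pos)
  have "t * mean_square f \<le> e"
    using e mean_square_nonneg[of f] by (simp add: t_def divide_le_eq mult_left_mono)
  have "\<forall>\<^sub>F r in F. mean_square (g r) < e * t" using lim e t by (intro order_tendstoD) auto
  with g show "\<forall>\<^sub>F r in F. dist (circle_mean (\<lambda>z. f z * cnj (g r z))) 0 < e"
  proof eventually_elim
    case (elim r)
    have "cmod (circle_mean (\<lambda>z. f z * cnj (g r z))) \<le> (t * mean_square f + mean_square (g r) / t) / 2"
      by (rule L2_pairing(2)[OF f elim(1) t])
    also have "mean_square (g r) / t < e" using elim(2) t by (simp add: divide_less_eq)
    finally show ?case using \<open>t * mean_square f \<le> e\<close> by simp
  qed
qed

lemma trig_mean_square: "mean_square (\<lambda>\<zeta>. \<Sum>n<m. c n * \<zeta> ^ n) = (\<Sum>n<m. (cmod (c n))\<^sup>2)"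
proof -
  have "complex_of_real (mean_square (\<lambda>\<zeta>. \<Sum>n<m. c n * \<zeta> ^ n))
     = circle_mean (\<lambda>\<zeta>. \<Sum>n<m. \<Sum>k<m. c n * cnj (c k) * (\<zeta> ^ n * cnj \<zeta> ^ k))"
    unfolding mean_square_def integral_complex_of_real[symmetric] complex_norm_square
    by (intro Bochner_Integration.integral_cong) (auto simp: sum_product algebra_simps)
  also have "\<dots> = (\<Sum>n<m. \<Sum>k<m. c n * cnj (c k) * (if n = k then 1 else 0))"
    by (subst Bochner_Integration.integral_sum, (intro circle_integrable_continuous continuous_intros)[1])+
       (simp add: circle_mean_monomial)
  also have "\<dots> = of_real (\<Sum>n<m. (cmod (c n))\<^sup>2)"
    by (simp add: complex_norm_square[symmetric] if_distrib cong: if_cong)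
  finally show ?thesis by (simp only: of_real_eq_iff)
qed

text \<open>Dominated convergence of the partial sums, bounded by the sum of the moduli of the coefficients.\<close>

lemma power_series_circle:
  assumes c: "summable (\<lambda>n. cmod (c n))"
  defines "h \<equiv> (\<lambda>\<zeta>. \<Sum>n. c n * \<zeta> ^ n)"
  shows "h \<in> L2_circle" "summable (\<lambda>n. (cmod (c n))\<^sup>2)" "mean_square h = (\<Sum>n. (cmod (c n))\<^sup>2)"
    and "D \<in> L2_circle \<Longrightarrow> (\<And>n. circle_mean (\<lambda>\<zeta>. D \<zeta> * cnj (\<zeta> ^ n)) = 0) \<Longrightarrow> circle_mean (\<lambda>\<zeta>. D \<zeta> * cnj (h \<zeta>)) = 0"
    and "circle_mean (\<lambda>\<zeta>. h \<zeta> * cnj (\<zeta> ^ k)) = c k"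
proof -
  define B where "B = (\<Sum>n. cmod (c n))"
  define p where "p = (\<lambda>m \<zeta>. \<Sum>n<m. c n * \<zeta> ^ n)"
  have sum: "summable (\<lambda>n. cmod (c n * \<zeta> ^ n))" if "cmod \<zeta> = 1" for \<zeta>
    using c that by (simp add: norm_mult norm_power)
  have lim: "(\<lambda>m. p m \<zeta>) \<longlonglongrightarrow> h \<zeta>" if "cmod \<zeta> = 1" for \<zeta>
    unfolding p_def h_def by (rule summable_LIMSEQ[OF summable_norm_cancel[OF sum[OF that]]])
  have bd: "cmod (p m \<zeta>) \<le> B" if "cmod \<zeta> = 1" for m \<zeta>
  proof -
    have "cmod (p m \<zeta>) \<le> (\<Sum>n<m. cmod (c n))"
      unfolding p_def by (rule sum_norm_le) (use that in \<open>auto simp: norm_mult norm_power\<close>)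
    also have "\<dots> \<le> B" unfolding B_def by (rule sum_le_suminf[OF c]) auto
    finally show ?thesis .
  qed
  have hbd: "cmod (h \<zeta>) \<le> B" if "cmod \<zeta> = 1" for \<zeta>
    by (rule Lim_bounded[OF tendsto_norm[OF lim[OF that]]]) (use bd[OF that] in auto)
  have B0: "B \<ge> 0" unfolding B_def by (intro suminf_nonneg c) auto
  have pm: "p m \<in> borel_measurable circle_measure" for m
    unfolding p_def by (intro circle_measurable_continuous continuous_intros)
  have hm: "h \<in> borel_measurable circle_measure"
    by (rule borel_measurable_LIMSEQ_metric[OF pm]) (use lim in auto)
  show hL: "h \<in> L2_circle"
    unfolding L2_circle_def using hm hbd B0
    by (auto intro!: circle_integrable_bounded[where B = "B\<^sup>2"] power_mono)
  have "(\<lambda>m. mean_square (p m)) \<longlonglongrightarrow> mean_square h"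
    unfolding mean_square_def
  proof (rule integral_dominated_convergence[where w = "\<lambda>_. B\<^sup>2"])
    show "AE x in circle_measure. (\<lambda>m. (cmod (p m x))\<^sup>2) \<longlonglongrightarrow> (cmod (h x))\<^sup>2"
      using lim by (auto intro!: AE_I2 tendsto_intros)
    show "AE x in circle_measure. norm ((cmod (p m x))\<^sup>2) \<le> B\<^sup>2" for m
      using bd by (auto intro!: AE_I2 power_mono)
  qed (use hm pm in measurable)
  hence "(\<lambda>n. (cmod (c n))\<^sup>2) sums mean_square h"
    unfolding p_def trig_mean_square sums_def .
  thus "summable (\<lambda>n. (cmod (c n))\<^sup>2)" "mean_square h = (\<Sum>n. (cmod (c n))\<^sup>2)"
    by (auto simp: sums_iff)
  have pair: "(\<lambda>m. circle_mean (\<lambda>\<zeta>. D \<zeta> * cnj (p m \<zeta>))) \<longlonglongrightarrow> circle_mean (\<lambda>\<zeta>. D \<zeta> * cnj (h \<zeta>))" if D: "D \<in> L2_circle" for D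
  proof (rule integral_dominated_convergence[where w = "\<lambda>z. cmod (D z * cnj 1) * B"])
    show "AE x in circle_measure. (\<lambda>m. D x * cnj (p m x)) \<longlonglongrightarrow> D x * cnj (h x)"
      using lim by (auto intro!: AE_I2 tendsto_intros)
    show "AE x in circle_measure. norm (D x * cnj (p m x)) \<le> cmod (D x * cnj 1) * B" for m
      using bd by (auto intro!: AE_I2 mult_left_mono simp: norm_mult)
    have "(\<lambda>_. 1) \<in> L2_circle" by (intro L2_circleI) auto
    from L2_pairing(1)[OF D this] show "integrable circle_measure (\<lambda>z. cmod (D z * cnj 1) * B)" by simp
  qed (use hm pm L2_measurable[OF D] in measurable)
  have mono: "(\<lambda>\<zeta>. \<zeta> ^ n) \<in> L2_circle" for n by (intro L2_circleI continuous_intros)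
  show "circle_mean (\<lambda>\<zeta>. D \<zeta> * cnj (h \<zeta>)) = 0" if D: "D \<in> L2_circle" and 0: "\<And>n. circle_mean (\<lambda>\<zeta>. D \<zeta> * cnj (\<zeta> ^ n)) = 0"
  proof -
    have "circle_mean (\<lambda>\<zeta>. D \<zeta> * cnj (p m \<zeta>)) = (\<Sum>n<m. circle_mean (\<lambda>\<zeta>. cnj (c n) * (D \<zeta> * cnj (\<zeta> ^ n))))" for m
    proof -
      have "circle_mean (\<lambda>\<zeta>. D \<zeta> * cnj (p m \<zeta>)) = circle_mean (\<lambda>\<zeta>. \<Sum>n<m. cnj (c n) * (D \<zeta> * cnj (\<zeta> ^ n)))"
        by (intro Bochner_Integration.integral_cong) (auto simp: p_def sum_distrib_left algebra_simps)
      thus ?thesis using L2_pairing(1)[OF D mono] by (subst (asm) Bochner_Integration.integral_sum) auto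
    qed
    hence "circle_mean (\<lambda>\<zeta>. D \<zeta> * cnj (p m \<zeta>)) = 0" for m using 0 L2_pairing(1)[OF D mono] by simp
    thus ?thesis using pair[OF D] by (simp add: LIMSEQ_const_iff)
  qed
  show "circle_mean (\<lambda>\<zeta>. h \<zeta> * cnj (\<zeta> ^ k)) = c k"
  proof -
    have "(\<lambda>m. circle_mean (\<lambda>\<zeta>. p m \<zeta> * cnj (\<zeta> ^ k))) \<longlonglongrightarrow> circle_mean (\<lambda>\<zeta>. h \<zeta> * cnj (\<zeta> ^ k))"
    proof (rule integral_dominated_convergence[where w = "\<lambda>z. B"])
      show "AE x in circle_measure. (\<lambda>m. p m x * cnj (x ^ k)) \<longlonglongrightarrow> h x * cnj (x ^ k)"
        using lim by (auto intro!: AE_I2 tendsto_intros)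
      show "AE x in circle_measure. norm (p m x * cnj (x ^ k)) \<le> B" for m
        using bd by (auto intro!: AE_I2 simp: norm_mult norm_power)
    qed (use hm pm L2_measurable[OF mono] in measurable)
    moreover have pk: "circle_mean (\<lambda>\<zeta>. p m \<zeta> * cnj (\<zeta> ^ k)) = c k" if "m > k" for m
    proof -
      have "circle_mean (\<lambda>\<zeta>. p m \<zeta> * cnj (\<zeta> ^ k)) = circle_mean (\<lambda>\<zeta>. \<Sum>n<m. c n * (\<zeta> ^ n * cnj \<zeta> ^ k))"
        by (intro Bochner_Integration.integral_cong) (auto simp: p_def sum_distrib_right mult.assoc)
      also have "\<dots> = (\<Sum>n<m. c n * (if n = k then 1 else 0))"
        by (subst Bochner_Integration.integral_sum, (intro circle_integrable_continuous continuous_intros)[1])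
           (simp add: circle_mean_monomial)
      also have "\<dots> = c k" using that by (simp add: if_distrib cong: if_cong)
      finally show ?thesis .
    qed
    have "\<forall>\<^sub>F m in sequentially. circle_mean (\<lambda>\<zeta>. p m \<zeta> * cnj (\<zeta> ^ k)) = c k"
      using eventually_gt_at_top[of k] by eventually_elim (rule pk)
    hence "(\<lambda>m. circle_mean (\<lambda>\<zeta>. p m \<zeta> * cnj (\<zeta> ^ k))) \<longlonglongrightarrow> c k" by (rule tendsto_eventually)
    ultimately show ?thesis by (rule LIMSEQ_unique)
  qed
qed

lemma L2_square_lemma:
  assumes h: "h \<in> borel_measurable circle_measure" and "(\<integral>\<^sup>+z. ennreal ((cmod (h z))\<^sup>2) \<partial>circle_measure) \<le> ennreal B" "B \<ge> 0"
  shows "h \<in> L2_circle" "mean_square h \<le> B"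
proof -
  have m: "(\<lambda>z. (cmod (h z))\<^sup>2) \<in> borel_measurable circle_measure" using h by measurable
  have i: "integrable circle_measure (\<lambda>z. (cmod (h z))\<^sup>2)"
    using assms(2) by (intro integrableI_nonneg m) (auto simp: less_top[symmetric] top_unique)
  thus "h \<in> L2_circle" using h by (simp add: L2_circle_def)
  have "ennreal (mean_square h) \<le> ennreal B"
    using assms(2) by (simp add: mean_square_def nn_integral_eq_integral[OF i])
  thus "mean_square h \<le> B" using assms(3) by simp
qed

text \<open>The Riesz-Fischer theorem: a subsequence of the partial sums, chosen with geometrically decreasing
differences, converges almost everywhere, and Fatou's lemma bounds its distance from the limit.\<close>

lemma Riesz_Fischer_circle:
  fixes a :: "nat \<Rightarrow> complex"
  assumes a: "summable (\<lambda>n. (cmod (a n))\<^sup>2)"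
  obtains g where "g \<in> L2_circle"
    "\<And>e. e > 0 \<Longrightarrow> \<exists>m. (\<Sum>n. (cmod (a (n + m)))\<^sup>2) \<le> e \<and> mean_square (\<lambda>\<zeta>. (\<Sum>n<m. a n * \<zeta> ^ n) - g \<zeta>) \<le> e"
proof -
  define tail where "tail = (\<lambda>m. \<Sum>n. (cmod (a (n + m)))\<^sup>2)"
  have tail0: "tail m \<ge> 0" for m unfolding tail_def by (intro suminf_nonneg summable_ignore_initial_segment[OF a]) auto
  have tail_eq: "tail m = (\<Sum>n. (cmod (a n))\<^sup>2) - (\<Sum>n<m. (cmod (a n))\<^sup>2)" for m
    unfolding tail_def by (rule suminf_minus_initial_segment[OF a])
  have tail_mono: "tail n \<le> tail m" if "m \<le> n" for m n
    unfolding tail_eq using that by (intro diff_left_mono sum_mono2) auto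
  have "tail \<longlonglongrightarrow> (\<Sum>n. (cmod (a n))\<^sup>2) - (\<Sum>n. (cmod (a n))\<^sup>2)"
    unfolding tail_eq by (intro tendsto_intros summable_LIMSEQ a)
  hence "\<exists>m. tail m < (1 / 4) ^ k" for k :: nat
    using order_tendstoD(2)[of tail 0 sequentially "(1/4) ^ k"] by (auto simp: eventually_sequentially)
  then obtain M0 where M0: "\<And>k::nat. tail (M0 k) < (1 / 4) ^ k" by metis
  \<comment> \<open>cumulative sums make the sequence of indices increasing\<close>
  define M where "M = (\<lambda>k. \<Sum>j\<le>k. M0 j)"
  have M_mono: "M k \<le> M l" if "k \<le> l" for k l unfolding M_def using that by (intro sum_mono2) auto
  have tailM: "tail (M k) \<le> (1 / 4) ^ k" for k
  proof -
    have "M0 k \<le> M k" unfolding M_def by (rule member_le_sum) auto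
    thus ?thesis using tail_mono M0[of k] by (meson less_imp_le order_trans)
  qed
  define S where "S = (\<lambda>m \<zeta>. \<Sum>n<m. a n * \<zeta> ^ n)"
  have Sc: "continuous_on A (S m)" for A m unfolding S_def by (intro continuous_intros)
  have Sdiff: "mean_square (\<lambda>\<zeta>. S l \<zeta> - S m \<zeta>) \<le> tail m" if "m \<le> l" for l m
  proof -
    have "S l \<zeta> - S m \<zeta> = (\<Sum>n<l. (if n < m then 0 else a n) * \<zeta> ^ n)" for \<zeta>
    proof -
      have "(\<Sum>n<l. (if n < m then 0 else a n) * \<zeta> ^ n) = (\<Sum>n<l. a n * \<zeta> ^ n) - (\<Sum>n<l. if n < m then a n * \<zeta> ^ n else 0)"
        unfolding sum_subtractf[symmetric] by (intro sum.cong) auto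
      also have "(\<Sum>n<l. if n < m then a n * \<zeta> ^ n else 0) = (\<Sum>n<m. a n * \<zeta> ^ n)"
        using that by (intro sum.mono_neutral_cong_right) auto
      finally show ?thesis by (simp add: S_def)
    qed
    hence "mean_square (\<lambda>\<zeta>. S l \<zeta> - S m \<zeta>) = (\<Sum>n<l. (cmod (if n < m then 0 else a n))\<^sup>2)"
      by (simp only: trig_mean_square)
    also have "\<dots> = (\<Sum>n<l. (cmod (a n))\<^sup>2) - (\<Sum>n<m. (cmod (a n))\<^sup>2)"
    proof -
      have "(\<Sum>n<m. (cmod (a n))\<^sup>2) = (\<Sum>n<l. if n < m then (cmod (a n))\<^sup>2 else 0)"
        using that by (intro sum.mono_neutral_cong_left) auto
      thus ?thesis by (simp add: sum_subtractf[symmetric]) (intro sum.cong, auto)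
    qed
    also have "\<dots> \<le> tail m"
      unfolding tail_eq by (intro diff_right_mono sum_le_suminf a) auto
    finally show ?thesis .
  qed
  define u where "u = (\<lambda>k. S (M k))"
  have uL: "u k \<in> L2_circle" for k unfolding u_def by (intro L2_circleI Sc)
  note um = L2_measurable[OF uL]
  have udiff: "mean_square (\<lambda>\<zeta>. u k \<zeta> - u l \<zeta>) \<le> (1 / 4) ^ k" if "k \<le> l" for k l
  proof -
    have "mean_square (\<lambda>\<zeta>. u k \<zeta> - u l \<zeta>) = mean_square (\<lambda>\<zeta>. u l \<zeta> - u k \<zeta>)"
      by (simp add: mean_square_def norm_minus_commute)
    also have "\<dots> \<le> (1 / 4) ^ k" using Sdiff[OF M_mono[OF that]] tailM[of k] by (simp add: u_def)
    finally show ?thesis .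
  qed
  define d where "d = (\<lambda>k \<zeta>. u (Suc k) \<zeta> - u k \<zeta>)"
  have dint: "integrable circle_measure (\<lambda>\<zeta>. cmod (d k \<zeta>))" for k
    unfolding d_def u_def by (intro circle_integrable_continuous continuous_intros Sc)
  have d1: "circle_mean (\<lambda>\<zeta>. cmod (d k \<zeta>)) \<le> (1 / 2) ^ k" for k
  proof -
    have i: "integrable circle_measure (\<lambda>\<zeta>. (2 ^ k * (cmod (d k \<zeta>))\<^sup>2 + 1\<^sup>2 / 2 ^ k) / 2)"
      unfolding d_def u_def by (intro circle_integrable_continuous continuous_intros Sc) auto
    have i2: "integrable circle_measure (\<lambda>\<zeta>. (cmod (d k \<zeta>))\<^sup>2)"
      unfolding d_def u_def by (intro circle_integrable_continuous continuous_intros Sc)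
    have "circle_mean (\<lambda>\<zeta>. cmod (d k \<zeta>)) \<le> circle_mean (\<lambda>\<zeta>. (2 ^ k * (cmod (d k \<zeta>))\<^sup>2 + 1\<^sup>2 / 2 ^ k) / 2)"
      by (rule integral_mono[OF dint i]) (use young[of "2 ^ k" _ 1] in simp)
    also have "\<dots> = (2 ^ k * mean_square (d k) + 1 / 2 ^ k) / 2"
      using i2 by (simp add: mean_square_def circle_measure_UNIV)
    also have "\<dots> \<le> (2 ^ k * (1 / 4) ^ k + 1 / 2 ^ k) / 2"
      using udiff[of k "Suc k"] by (intro divide_right_mono add_right_mono mult_left_mono)
        (auto simp: d_def mean_square_def norm_minus_commute)
    also have "\<dots> = (1 / 2) ^ k"
    proof -
      have "(1 / 4 :: real) ^ k = (1 / 2) ^ k * (1 / 2) ^ k" by (simp flip: power_mult_distrib)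
      moreover have "(2 :: real) ^ k * (1 / 2) ^ k = 1" by (simp flip: power_mult_distrib)
      ultimately have "(2 :: real) ^ k * (1 / 4) ^ k = (1 / 2) ^ k" by (metis mult.assoc mult_1)
      moreover have "1 / 2 ^ k = (1 / 2 :: real) ^ k" by (simp only: power_divide power_one)
      ultimately have "(2 ^ k * (1 / 4) ^ k + 1 / 2 ^ k) / 2 = ((1 / 2) ^ k + (1 / 2) ^ k) / (2 :: real)"
        by (simp only:)
      also have "\<dots> = (1 / 2) ^ k" by (rule field_sum_of_halves[unfolded add_divide_distrib[symmetric]])
      finally show ?thesis .
    qed
    finally show ?thesis .
  qed
  have "(\<integral>\<^sup>+\<zeta>. (\<Sum>k. ennreal (cmod (d k \<zeta>))) \<partial>circle_measure) \<noteq> \<infinity>"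
  proof -
    have dm: "(\<lambda>\<zeta>. ennreal (cmod (d k \<zeta>))) \<in> borel_measurable circle_measure" for k
      using um unfolding d_def by measurable
    have "(\<integral>\<^sup>+\<zeta>. (\<Sum>k. ennreal (cmod (d k \<zeta>))) \<partial>circle_measure) = (\<Sum>k. \<integral>\<^sup>+\<zeta>. ennreal (cmod (d k \<zeta>)) \<partial>circle_measure)"
      by (rule nn_integral_suminf[OF dm])
    also have "\<dots> = (\<Sum>k. ennreal (circle_mean (\<lambda>\<zeta>. cmod (d k \<zeta>))))"
      by (simp add: nn_integral_eq_integral[OF dint])
    also have "\<dots> \<le> (\<Sum>k. ennreal ((1 / 2) ^ k))" using d1 by (intro suminf_le) (auto intro: ennreal_leI)
    also have "\<dots> < \<infinity>"
    proof -
      have "summable (\<lambda>k. (1 / 2 :: real) ^ k)" by (rule summable_geometric) simp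
      hence "(\<Sum>k. ennreal ((1 / 2) ^ k)) \<noteq> top" by (rule ennreal_suminf_neq_top) simp
      thus ?thesis by (simp only: infinity_ennreal_def top.not_eq_extremum)
    qed
    finally show ?thesis by simp
  qed
  moreover have "(\<lambda>\<zeta>. \<Sum>k. ennreal (cmod (d k \<zeta>))) \<in> borel_measurable circle_measure"
    using um unfolding d_def by measurable
  ultimately have ae: "AE \<zeta> in circle_measure. (\<Sum>k. ennreal (cmod (d k \<zeta>))) \<noteq> \<infinity>"
    by (intro nn_integral_PInf_AE)
  define g where "g = (\<lambda>\<zeta>. lim (\<lambda>k. u k \<zeta>))"
  have gm: "g \<in> borel_measurable circle_measure" unfolding g_def by (rule borel_measurable_lim_metric[OF um])
  have conv: "AE \<zeta> in circle_measure. (\<lambda>k. u k \<zeta>) \<longlonglongrightarrow> g \<zeta>"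
    using ae
  proof eventually_elim
    case (elim \<zeta>)
    have "summable (\<lambda>k. cmod (d k \<zeta>))" using elim by (intro summable_suminf_not_top) auto
    hence "summable (\<lambda>k. d k \<zeta>)" by (rule summable_norm_cancel)
    hence "(\<lambda>k. u 0 \<zeta> + (\<Sum>j<k. d j \<zeta>)) \<longlonglongrightarrow> u 0 \<zeta> + (\<Sum>j. d j \<zeta>)"
      by (intro tendsto_intros summable_LIMSEQ)
    moreover have "u 0 \<zeta> + (\<Sum>j<k. d j \<zeta>) = u k \<zeta>" for k
      unfolding d_def using sum_lessThan_telescope[of "\<lambda>k. u k \<zeta>" k] by simp
    ultimately show ?case unfolding g_def by (simp add: limI)
  qed
  have ug: "(\<lambda>\<zeta>. u k \<zeta> - g \<zeta>) \<in> L2_circle \<and> mean_square (\<lambda>\<zeta>. u k \<zeta> - g \<zeta>) \<le> (1 / 4) ^ k" for k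
  proof -
    have "(\<integral>\<^sup>+\<zeta>. ennreal ((cmod (u k \<zeta> - g \<zeta>))\<^sup>2) \<partial>circle_measure)
        = (\<integral>\<^sup>+\<zeta>. liminf (\<lambda>l. ennreal ((cmod (u k \<zeta> - u l \<zeta>))\<^sup>2)) \<partial>circle_measure)"
    proof (rule nn_integral_cong_AE)
      show "AE \<zeta> in circle_measure. ennreal ((cmod (u k \<zeta> - g \<zeta>))\<^sup>2) = liminf (\<lambda>l. ennreal ((cmod (u k \<zeta> - u l \<zeta>))\<^sup>2))"
        using conv
      proof eventually_elim
        case (elim \<zeta>)
        have "(\<lambda>l. ennreal ((cmod (u k \<zeta> - u l \<zeta>))\<^sup>2)) \<longlonglongrightarrow> ennreal ((cmod (u k \<zeta> - g \<zeta>))\<^sup>2)"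
          by (intro tendsto_ennrealI tendsto_intros elim)
        from lim_imp_Liminf[OF sequentially_bot this] show ?case by (rule sym)
      qed
    qed
    also have "\<dots> \<le> liminf (\<lambda>l. \<integral>\<^sup>+\<zeta>. ennreal ((cmod (u k \<zeta> - u l \<zeta>))\<^sup>2) \<partial>circle_measure)"
      by (rule nn_integral_liminf) (use um in measurable)
    also have "\<dots> \<le> liminf (\<lambda>l::nat. ennreal ((1 / 4) ^ k))"
    proof (rule Liminf_mono)
      show "\<forall>\<^sub>F l in sequentially. (\<integral>\<^sup>+\<zeta>. ennreal ((cmod (u k \<zeta> - u l \<zeta>))\<^sup>2) \<partial>circle_measure) \<le> ennreal ((1 / 4) ^ k)"
        using eventually_ge_at_top[of k]
      proof eventually_elim
        case (elim l)
        have "integrable circle_measure (\<lambda>\<zeta>. (cmod (u k \<zeta> - u l \<zeta>))\<^sup>2)"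
          by (intro L2_square_integrable L2_diff uL)
        hence "(\<integral>\<^sup>+\<zeta>. ennreal ((cmod (u k \<zeta> - u l \<zeta>))\<^sup>2) \<partial>circle_measure) = ennreal (mean_square (\<lambda>\<zeta>. u k \<zeta> - u l \<zeta>))"
          unfolding mean_square_def by (intro nn_integral_eq_integral) auto
        thus ?case using udiff[OF elim] by (simp add: ennreal_leI)
      qed
    qed
    also have "\<dots> = ennreal ((1 / 4) ^ k)" by (simp add: Liminf_const)
    finally have le: "(\<integral>\<^sup>+\<zeta>. ennreal ((cmod (u k \<zeta> - g \<zeta>))\<^sup>2) \<partial>circle_measure) \<le> ennreal ((1 / 4) ^ k)" .
    have "(\<lambda>\<zeta>. u k \<zeta> - g \<zeta>) \<in> borel_measurable circle_measure" using um gm by measurable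
    from L2_square_lemma[OF this le] show ?thesis by simp
  qed
  show ?thesis
  proof (rule that)
    have "(\<lambda>\<zeta>. u 0 \<zeta> - (u 0 \<zeta> - g \<zeta>)) \<in> L2_circle" using L2_diff[OF uL[of 0], of "\<lambda>\<zeta>. u 0 \<zeta> - g \<zeta>"] ug[of 0] by blast
    thus "g \<in> L2_circle" by simp
    fix e :: real assume "e > 0"
    then obtain k where "(1 / 4 :: real) ^ k < e" using real_arch_pow_inv[of e "1 / 4"] by auto
    thus "\<exists>m. (\<Sum>n. (cmod (a (n + m)))\<^sup>2) \<le> e \<and> mean_square (\<lambda>\<zeta>. (\<Sum>n<m. a n * \<zeta> ^ n) - g \<zeta>) \<le> e"
      using tailM[of k] ug[of k] by (intro exI[of _ "M k"]) (auto simp: tail_def u_def S_def)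
  qed
qed

section \<open>Boundary functions of elements of the Hardy space\<close>

lemma holomorphic_taylor_sums:
  assumes "F holomorphic_on ball 0 1" "cmod z < 1"
  shows "(\<lambda>n. fps_nth (fps_expansion F 0) n * z ^ n) sums F z"
  by (rule has_fps_expansion_imp_sums_complex[where r = 1])
     (use assms in \<open>auto intro: has_fps_expansion_ball simp: one_ereal_def\<close>)

lemma holomorphic_taylor_abs_summable:
  assumes "F holomorphic_on ball 0 1" "0 \<le> r" "r < 1"
  shows "summable (\<lambda>n. cmod (fps_nth (fps_expansion F 0) n * of_real r ^ n))"
proof -
  have "summable (\<lambda>n. fps_nth (fps_expansion F 0) n * of_real ((1 + r) / 2) ^ n)"
    using holomorphic_taylor_sums[OF assms(1), of "of_real ((1 + r) / 2)"] assms
    by (intro sums_summable) (auto simp del: of_real_add of_real_divide)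
  thus ?thesis by (rule powser_insidea) (use assms in \<open>auto simp del: of_real_add of_real_divide\<close>)
qed

text \<open>The dilations of a holomorphic function have absolutely convergent Fourier series.\<close>

lemma dilation_properties:
  assumes F: "F holomorphic_on ball 0 1" and r: "0 \<le> r" "r < 1"
  defines "c \<equiv> \<lambda>n. fps_nth (fps_expansion F 0) n * of_real r ^ n"
  shows "(\<lambda>\<zeta>. F (of_real r * \<zeta>)) \<in> L2_circle"
    and "summable (\<lambda>n. (cmod (c n))\<^sup>2)" "mean_square (\<lambda>\<zeta>. F (of_real r * \<zeta>)) = (\<Sum>n. (cmod (c n))\<^sup>2)"
    and "D \<in> L2_circle \<Longrightarrow> (\<And>n. circle_mean (\<lambda>\<zeta>. D \<zeta> * cnj (\<zeta> ^ n)) = 0) \<Longrightarrow> circle_mean (\<lambda>\<zeta>. D \<zeta> * cnj (F (of_real r * \<zeta>))) = 0"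
    and "circle_mean (\<lambda>\<zeta>. F (of_real r * \<zeta>) * cnj (\<zeta> ^ k)) = c k"
    and "cmod \<zeta> = 1 \<Longrightarrow> F (of_real r * \<zeta>) = (\<Sum>n. c n * \<zeta> ^ n)"
proof -
  have s: "summable (\<lambda>n. cmod (c n))" unfolding c_def by (rule holomorphic_taylor_abs_summable[OF F r])
  have eq: "F (of_real r * \<zeta>) = (\<Sum>n. c n * \<zeta> ^ n)" if "cmod \<zeta> = 1" for \<zeta>
    using holomorphic_taylor_sums[OF F, of "of_real r * \<zeta>"] that r
    by (simp add: norm_mult c_def power_mult_distrib mult.assoc sums_iff)
  thus "cmod \<zeta> = 1 \<Longrightarrow> F (of_real r * \<zeta>) = (\<Sum>n. c n * \<zeta> ^ n)" by blast
  have ms: "mean_square (\<lambda>\<zeta>. F (of_real r * \<zeta>)) = mean_square (\<lambda>\<zeta>. \<Sum>n. c n * \<zeta> ^ n)"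
    unfolding mean_square_def by (intro Bochner_Integration.integral_cong) (auto simp: eq)
  show "(\<lambda>\<zeta>. F (of_real r * \<zeta>)) \<in> L2_circle"
    by (intro L2_circleI continuous_on_compose2[OF holomorphic_on_imp_continuous_on[OF F]] continuous_intros)
       (use r in \<open>auto simp: norm_mult\<close>)
  note P = power_series_circle[OF s]
  show "summable (\<lambda>n. (cmod (c n))\<^sup>2)" by (rule P(2))
  show "mean_square (\<lambda>\<zeta>. F (of_real r * \<zeta>)) = (\<Sum>n. (cmod (c n))\<^sup>2)" using ms P(3) by simp
  have "circle_mean (\<lambda>\<zeta>. F (of_real r * \<zeta>) * cnj (\<zeta> ^ k)) = circle_mean (\<lambda>\<zeta>. (\<Sum>n. c n * \<zeta> ^ n) * cnj (\<zeta> ^ k))"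
    by (intro Bochner_Integration.integral_cong) (auto simp: eq)
  thus "circle_mean (\<lambda>\<zeta>. F (of_real r * \<zeta>) * cnj (\<zeta> ^ k)) = c k" using P(5) by simp
  have "circle_mean (\<lambda>\<zeta>. D \<zeta> * cnj (F (of_real r * \<zeta>))) = circle_mean (\<lambda>\<zeta>. D \<zeta> * cnj (\<Sum>n. c n * \<zeta> ^ n))"
    by (intro Bochner_Integration.integral_cong) (auto simp: eq)
  thus "D \<in> L2_circle \<Longrightarrow> (\<And>n. circle_mean (\<lambda>\<zeta>. D \<zeta> * cnj (\<zeta> ^ n)) = 0) \<Longrightarrow> circle_mean (\<lambda>\<zeta>. D \<zeta> * cnj (F (of_real r * \<zeta>))) = 0"
    using P(4)[of D] by simp
qed

lemma eventually_at_left_1: "\<forall>\<^sub>F r in at_left (1::real). 0 \<le> r \<and> r < 1"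
  using eventually_at_left_real[of 0 "1::real"] by (auto elim: eventually_mono)

text \<open>The dilations converge in mean square to the sum of the Fourier series with the Taylor coefficients:
this is uniform in the tail of the series and elementary for a polynomial.\<close>

lemma boundary_fun_properties:
  "boundary_fun f \<in> L2_circle"
  "((\<lambda>r. mean_square (\<lambda>\<zeta>. hardy_fun f (of_real r * \<zeta>) - boundary_fun f \<zeta>)) \<longlongrightarrow> 0) (at_left 1)"
proof -
  define a where "a = taylor_coeff f"
  have a: "summable (\<lambda>n. (cmod (a n))\<^sup>2)" unfolding a_def by (rule hardy_summable)
  obtain g where g: "g \<in> L2_circle"
    "\<And>e. e > 0 \<Longrightarrow> \<exists>m. (\<Sum>n. (cmod (a (n + m)))\<^sup>2) \<le> e \<and> mean_square (\<lambda>\<zeta>. (\<Sum>n<m. a n * \<zeta> ^ n) - g \<zeta>) \<le> e"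
    using Riesz_Fischer_circle[OF a] by blast
  have "((\<lambda>r. mean_square (\<lambda>\<zeta>. hardy_fun f (of_real r * \<zeta>) - g \<zeta>)) \<longlongrightarrow> 0) (at_left 1)"
  proof (rule tendstoI)
    fix e :: real assume e: "e > 0"
    obtain m where m: "(\<Sum>n. (cmod (a (n + m)))\<^sup>2) \<le> e / 8" "mean_square (\<lambda>\<zeta>. (\<Sum>n<m. a n * \<zeta> ^ n) - g \<zeta>) \<le> e / 8"
      using g(2)[of "e / 8"] e by auto
    have "((\<lambda>r. \<Sum>n<m. (cmod (a n))\<^sup>2 * (1 - r ^ n)\<^sup>2) \<longlongrightarrow> (\<Sum>n<m. (cmod (a n))\<^sup>2 * (1 - 1 ^ n)\<^sup>2)) (at_left (1::real))"
      by (intro tendsto_intros)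
    hence "\<forall>\<^sub>F r in at_left (1::real). (\<Sum>n<m. (cmod (a n))\<^sup>2 * (1 - r ^ n)\<^sup>2) < e / 8"
      using e by (intro order_tendstoD) auto
    thus "\<forall>\<^sub>F r in at_left 1. dist (mean_square (\<lambda>\<zeta>. hardy_fun f (of_real r * \<zeta>) - g \<zeta>)) 0 < e"
      using eventually_at_left_1
    proof eventually_elim
      case (elim r)
      define p where "p = (\<lambda>\<zeta>. \<Sum>n<m. a n * \<zeta> ^ n)"
      have pL: "p \<in> L2_circle" unfolding p_def by (intro L2_circleI continuous_intros)
      have fL: "(\<lambda>\<zeta>. hardy_fun f (of_real r * \<zeta>)) \<in> L2_circle"
        using elim by (intro dilation_properties hardy_holomorphic) auto
      define c where "c = (\<lambda>n. a n * of_real r ^ n - (if n < m then a n else 0))"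
      have sa: "summable (\<lambda>n. cmod (a n * of_real r ^ n))"
        unfolding a_def taylor_coeff_def using elim by (intro holomorphic_taylor_abs_summable hardy_holomorphic) auto
      have sf: "summable (\<lambda>n. cmod (if n < m then a n else 0))"
        by (rule summable_finite[of "{..<m}"]) auto
      have sc: "summable (\<lambda>n. cmod (c n))"
        unfolding c_def by (rule summable_comparison_test'[OF summable_add[OF sa sf], of 0]) (simp add: norm_triangle_ineq4)
      have eq: "hardy_fun f (of_real r * \<zeta>) - p \<zeta> = (\<Sum>n. c n * \<zeta> ^ n)" if "cmod \<zeta> = 1" for \<zeta>
      proof -
        have "hardy_fun f (of_real r * \<zeta>) = (\<Sum>n. (a n * of_real r ^ n) * \<zeta> ^ n)"
          using dilation_properties(6)[OF hardy_holomorphic, of r \<zeta> f] that elim by (simp add: a_def taylor_coeff_def)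
        moreover have "p \<zeta> = (\<Sum>n. (if n < m then a n else 0) * \<zeta> ^ n)"
          unfolding p_def by (subst suminf_finite[of "{..<m}"]) auto
        moreover have "summable (\<lambda>n. (a n * of_real r ^ n) * \<zeta> ^ n)"
          by (rule summable_norm_cancel) (use sa that in \<open>simp add: norm_mult norm_power\<close>)
        moreover have "summable (\<lambda>n. (if n < m then a n else 0) * \<zeta> ^ n)"
          by (rule summable_finite[of "{..<m}"]) auto
        ultimately show ?thesis by (simp add: suminf_diff c_def left_diff_distrib)
      qed
      have "mean_square (\<lambda>\<zeta>. hardy_fun f (of_real r * \<zeta>) - p \<zeta>) = mean_square (\<lambda>\<zeta>. \<Sum>n. c n * \<zeta> ^ n)"
        unfolding mean_square_def by (intro Bochner_Integration.integral_cong) (auto simp: eq)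
      also have "\<dots> = (\<Sum>n. (cmod (c n))\<^sup>2)" by (rule power_series_circle(3)[OF sc])
      also have "\<dots> = (\<Sum>n. (cmod (c (n + m)))\<^sup>2) + (\<Sum>n<m. (cmod (c n))\<^sup>2)"
        by (rule suminf_split_initial_segment[OF power_series_circle(2)[OF sc]])
      also have "\<dots> \<le> e / 8 + e / 8"
      proof (rule add_mono)
        have sc2: "summable (\<lambda>n. (cmod (c (n + m)))\<^sup>2)"
          by (rule summable_ignore_initial_segment[OF power_series_circle(2)[OF sc]])
        have sa2: "summable (\<lambda>n. (cmod (a (n + m)))\<^sup>2)" by (rule summable_ignore_initial_segment[OF a])
        have "(\<Sum>n. (cmod (c (n + m)))\<^sup>2) \<le> (\<Sum>n. (cmod (a (n + m)))\<^sup>2)"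
        proof (rule suminf_le[OF _ sc2 sa2])
          fix n
          have "cmod (c (n + m)) = cmod (a (n + m)) * r ^ (n + m)" using elim by (simp add: c_def norm_mult norm_power)
          also have "\<dots> \<le> cmod (a (n + m)) * 1" using elim by (intro mult_left_mono power_le_one) auto
          finally show "(cmod (c (n + m)))\<^sup>2 \<le> (cmod (a (n + m)))\<^sup>2" by (intro power_mono) auto
        qed
        thus "(\<Sum>n. (cmod (c (n + m)))\<^sup>2) \<le> e / 8" using m(1) by simp
        have "(\<Sum>n<m. (cmod (c n))\<^sup>2) = (\<Sum>n<m. (cmod (a n))\<^sup>2 * (1 - r ^ n)\<^sup>2)"
        proof (rule sum.cong)
          fix n assume "n \<in> {..<m}"
          hence "c n = a n * of_real (r ^ n - 1)" by (simp add: c_def algebra_simps)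
          hence "(cmod (c n))\<^sup>2 = (cmod (a n))\<^sup>2 * (r ^ n - 1)\<^sup>2"
            by (simp only: norm_mult norm_of_real power_mult_distrib power2_abs)
          thus "(cmod (c n))\<^sup>2 = (cmod (a n))\<^sup>2 * (1 - r ^ n)\<^sup>2" by (simp add: power2_commute)
        qed simp
        thus "(\<Sum>n<m. (cmod (c n))\<^sup>2) \<le> e / 8" using elim by simp
      qed
      finally have 1: "mean_square (\<lambda>\<zeta>. hardy_fun f (of_real r * \<zeta>) - p \<zeta>) \<le> e / 4" by simp
      have "mean_square (\<lambda>\<zeta>. (hardy_fun f (of_real r * \<zeta>) - p \<zeta>) + (p \<zeta> - g \<zeta>)) \<le>
         2 * mean_square (\<lambda>\<zeta>. hardy_fun f (of_real r * \<zeta>) - p \<zeta>) + 2 * mean_square (\<lambda>\<zeta>. p \<zeta> - g \<zeta>)"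
        by (intro mean_square_add L2_diff fL pL g)
      also have "\<dots> \<le> 2 * (e / 4) + 2 * (e / 8)" using 1 m(2) by (simp add: p_def)
      finally have "mean_square (\<lambda>\<zeta>. hardy_fun f (of_real r * \<zeta>) - g \<zeta>) < e" using e by simp
      thus ?case using mean_square_nonneg by (simp add: dist_real_def abs_of_nonneg)
    qed
  qed
  with g(1) have "g \<in> L2_circle \<and> ((\<lambda>r. \<integral>\<zeta>. (cmod (hardy_fun f (of_real r * \<zeta>) - g \<zeta>))\<^sup>2 \<partial>circle_measure) \<longlongrightarrow> 0) (at_left 1)"
    by (simp add: mean_square_def)
  hence "boundary_fun f \<in> L2_circle \<and> ((\<lambda>r. \<integral>\<zeta>. (cmod (hardy_fun f (of_real r * \<zeta>) - boundary_fun f \<zeta>))\<^sup>2 \<partial>circle_measure) \<longlongrightarrow> 0) (at_left 1)"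
    unfolding boundary_fun_def by (rule someI[where P = "\<lambda>g. g \<in> L2_circle \<and> ((\<lambda>r. \<integral>\<zeta>. (cmod (hardy_fun f (of_real r * \<zeta>) - g \<zeta>))\<^sup>2 \<partial>circle_measure) \<longlongrightarrow> 0) (at_left 1)"])
  thus "boundary_fun f \<in> L2_circle"
    "((\<lambda>r. mean_square (\<lambda>\<zeta>. hardy_fun f (of_real r * \<zeta>) - boundary_fun f \<zeta>)) \<longlongrightarrow> 0) (at_left 1)"
    by (auto simp: mean_square_def)
qed

lemma norm_hardy_square: "(norm f)\<^sup>2 = (\<Sum>n. (cmod (taylor_coeff f n))\<^sup>2)"
  unfolding norm_hardy2_def by (simp add: suminf_nonneg hardy_summable)

lemma dilation_mean_square_le:
  assumes "0 \<le> r" "r < 1"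
  shows "mean_square (\<lambda>\<zeta>. hardy_fun f (of_real r * \<zeta>)) \<le> (norm f)\<^sup>2"
proof -
  have le: "(cmod (taylor_coeff f n * of_real r ^ n))\<^sup>2 \<le> (cmod (taylor_coeff f n))\<^sup>2" for n
  proof -
    have "cmod (taylor_coeff f n * of_real r ^ n) = cmod (taylor_coeff f n) * r ^ n" using assms by (simp add: norm_mult norm_power)
    also have "\<dots> \<le> cmod (taylor_coeff f n) * 1" using assms by (intro mult_left_mono power_le_one) auto
    finally show ?thesis by (intro power_mono) auto
  qed
  have "mean_square (\<lambda>\<zeta>. hardy_fun f (of_real r * \<zeta>)) = (\<Sum>n. (cmod (taylor_coeff f n * of_real r ^ n))\<^sup>2)"
    unfolding taylor_coeff_def by (rule dilation_properties(3)[OF hardy_holomorphic assms])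
  also have "\<dots> \<le> (\<Sum>n. (cmod (taylor_coeff f n))\<^sup>2)"
    using dilation_properties(2)[OF hardy_holomorphic assms, of f] le
    by (intro suminf_le hardy_summable) (auto simp: taylor_coeff_def)
  finally show ?thesis by (simp add: norm_hardy_square)
qed

text \<open>The constant two comes from the elementary estimate for the square of a sum. Any constant suffices for
the continuity of Toeplitz operators.\<close>

lemma boundary_fun_mean_square_le: "mean_square (boundary_fun f) \<le> 2 * (norm f)\<^sup>2"
proof (rule tendsto_lowerbound)
  show "((\<lambda>r. 2 * (norm f)\<^sup>2 + 2 * mean_square (\<lambda>\<zeta>. hardy_fun f (of_real r * \<zeta>) - boundary_fun f \<zeta>)) \<longlongrightarrow> 2 * (norm f)\<^sup>2) (at_left 1)"
    by (rule tendsto_eq_intros boundary_fun_properties(2) refl | simp)+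
  show "\<forall>\<^sub>F r in at_left 1. mean_square (boundary_fun f) \<le> 2 * (norm f)\<^sup>2 + 2 * mean_square (\<lambda>\<zeta>. hardy_fun f (of_real r * \<zeta>) - boundary_fun f \<zeta>)"
    using eventually_at_left_1
  proof eventually_elim
    case (elim r)
    have fL: "(\<lambda>\<zeta>. hardy_fun f (of_real r * \<zeta>)) \<in> L2_circle"
      using elim by (intro dilation_properties hardy_holomorphic) auto
    have "mean_square (\<lambda>\<zeta>. hardy_fun f (of_real r * \<zeta>) - (hardy_fun f (of_real r * \<zeta>) - boundary_fun f \<zeta>))
      \<le> 2 * mean_square (\<lambda>\<zeta>. hardy_fun f (of_real r * \<zeta>)) + 2 * mean_square (\<lambda>\<zeta>. hardy_fun f (of_real r * \<zeta>) - boundary_fun f \<zeta>)"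
      by (intro mean_square_diff L2_diff fL boundary_fun_properties)
    thus ?case using dilation_mean_square_le[of r f] elim by simp
  qed
qed auto

lemma boundary_pairing_tendsto:
  assumes "D \<in> L2_circle"
  shows "((\<lambda>r. circle_mean (\<lambda>\<zeta>. D \<zeta> * cnj (hardy_fun f (of_real r * \<zeta>)))) \<longlongrightarrow> circle_mean (\<lambda>\<zeta>. D \<zeta> * cnj (boundary_fun f \<zeta>))) (at_left 1)"
proof -
  have ev: "\<forall>\<^sub>F r in at_left 1. (\<lambda>\<zeta>. hardy_fun f (of_real r * \<zeta>)) \<in> L2_circle"
    using eventually_at_left_1 by eventually_elim (intro dilation_properties hardy_holomorphic, auto)
  hence "\<forall>\<^sub>F r in at_left 1. (\<lambda>\<zeta>. hardy_fun f (of_real r * \<zeta>) - boundary_fun f \<zeta>) \<in> L2_circle"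
    by eventually_elim (intro L2_diff boundary_fun_properties)
  from L2_pairing_tendsto_0[OF assms this boundary_fun_properties(2)]
  have "((\<lambda>r. circle_mean (\<lambda>\<zeta>. D \<zeta> * cnj (hardy_fun f (of_real r * \<zeta>) - boundary_fun f \<zeta>)) + circle_mean (\<lambda>\<zeta>. D \<zeta> * cnj (boundary_fun f \<zeta>)))
    \<longlongrightarrow> 0 + circle_mean (\<lambda>\<zeta>. D \<zeta> * cnj (boundary_fun f \<zeta>))) (at_left 1)"
    by (intro tendsto_intros)
  hence "((\<lambda>r. circle_mean (\<lambda>\<zeta>. D \<zeta> * cnj (hardy_fun f (of_real r * \<zeta>) - boundary_fun f \<zeta>)) + circle_mean (\<lambda>\<zeta>. D \<zeta> * cnj (boundary_fun f \<zeta>)))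
    \<longlongrightarrow> circle_mean (\<lambda>\<zeta>. D \<zeta> * cnj (boundary_fun f \<zeta>))) (at_left 1)" by simp
  thus ?thesis
  proof (rule Lim_transform_eventually)
    show "\<forall>\<^sub>F r in at_left 1. circle_mean (\<lambda>\<zeta>. D \<zeta> * cnj (hardy_fun f (of_real r * \<zeta>) - boundary_fun f \<zeta>)) + circle_mean (\<lambda>\<zeta>. D \<zeta> * cnj (boundary_fun f \<zeta>))
      = circle_mean (\<lambda>\<zeta>. D \<zeta> * cnj (hardy_fun f (of_real r * \<zeta>)))"
      using ev
    proof eventually_elim
      case (elim r)
      show ?case
        using L2_pairing(1)[OF assms elim] L2_pairing(1)[OF assms boundary_fun_properties(1)[of f]]
        by (simp add: right_diff_distrib)
    qed
  qed
qed

lemma boundary_fun_orthogonal: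
  assumes "D \<in> L2_circle" "\<And>n. circle_mean (\<lambda>\<zeta>. D \<zeta> * cnj (\<zeta> ^ n)) = 0"
  shows "circle_mean (\<lambda>\<zeta>. D \<zeta> * cnj (boundary_fun f \<zeta>)) = 0"
proof -
  have "\<forall>\<^sub>F r in at_left 1. circle_mean (\<lambda>\<zeta>. D \<zeta> * cnj (hardy_fun f (of_real r * \<zeta>))) = 0"
    using eventually_at_left_1 by eventually_elim (intro dilation_properties(4) hardy_holomorphic assms, auto)
  hence "((\<lambda>r. circle_mean (\<lambda>\<zeta>. D \<zeta> * cnj (hardy_fun f (of_real r * \<zeta>)))) \<longlongrightarrow> 0) (at_left 1)"
    by (rule tendsto_eventually)
  thus ?thesis using boundary_pairing_tendsto[OF assms(1), of f] tendsto_unique[OF trivial_limit_at_left_real] by blast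
qed

lemma circle_mean_cnj: "circle_mean (\<lambda>\<zeta>. cnj (h \<zeta>)) = cnj (circle_mean h)"
  using Bochner_Integration.integral_cnj[of circle_measure h] by simp

lemma boundary_fun_coeff: "circle_mean (\<lambda>\<zeta>. boundary_fun f \<zeta> * cnj (\<zeta> ^ n)) = taylor_coeff f n"
proof -
  have mono: "(\<lambda>\<zeta>. \<zeta> ^ n) \<in> L2_circle" by (intro L2_circleI continuous_intros)
  have flip: "circle_mean (\<lambda>\<zeta>. \<zeta> ^ n * cnj (g \<zeta>)) = cnj (circle_mean (\<lambda>\<zeta>. g \<zeta> * cnj (\<zeta> ^ n)))" for g
    by (subst circle_mean_cnj[symmetric]) (simp add: mult.commute)
  have "\<forall>\<^sub>F r in at_left 1. cnj (taylor_coeff f n * of_real r ^ n) = circle_mean (\<lambda>\<zeta>. \<zeta> ^ n * cnj (hardy_fun f (of_real r * \<zeta>)))"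
    using eventually_at_left_1
    by eventually_elim (simp only: flip taylor_coeff_def dilation_properties(5)[OF hardy_holomorphic])
  moreover have "((\<lambda>r. cnj (taylor_coeff f n * of_real r ^ n)) \<longlongrightarrow> cnj (taylor_coeff f n * of_real 1 ^ n)) (at_left (1::real))"
    by (intro tendsto_intros)
  ultimately have "((\<lambda>r. circle_mean (\<lambda>\<zeta>. \<zeta> ^ n * cnj (hardy_fun f (of_real r * \<zeta>)))) \<longlongrightarrow> cnj (taylor_coeff f n * of_real 1 ^ n)) (at_left (1::real))"
    by (rule Lim_transform_eventually[rotated])
  hence "cnj (taylor_coeff f n * of_real 1 ^ n) = circle_mean (\<lambda>\<zeta>. \<zeta> ^ n * cnj (boundary_fun f \<zeta>))"
    using boundary_pairing_tendsto[OF mono, of f] tendsto_unique[OF trivial_limit_at_left_real] by blast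
  thus ?thesis unfolding flip by simp
qed

lemma Bessel_circle:
  assumes g: "g \<in> L2_circle"
  defines "c \<equiv> \<lambda>n. circle_mean (\<lambda>\<zeta>. g \<zeta> * cnj (\<zeta> ^ n))"
  shows "(\<Sum>n<m. (cmod (c n))\<^sup>2) \<le> mean_square g"
proof -
  define p where "p = (\<lambda>\<zeta>. \<Sum>n<m. c n * \<zeta> ^ n)"
  have pL: "p \<in> L2_circle" unfolding p_def by (intro L2_circleI continuous_intros)
  have mono: "(\<lambda>\<zeta>. \<zeta> ^ n) \<in> L2_circle" for n by (intro L2_circleI continuous_intros)
  note igp = L2_pairing(1)[OF g pL]
  have ms: "complex_of_real (mean_square h) = circle_mean (\<lambda>\<zeta>. h \<zeta> * cnj (h \<zeta>))" for h
    unfolding mean_square_def integral_complex_of_real[symmetric] complex_norm_square ..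
  have gp: "circle_mean (\<lambda>\<zeta>. g \<zeta> * cnj (p \<zeta>)) = of_real (\<Sum>n<m. (cmod (c n))\<^sup>2)"
  proof -
    have "circle_mean (\<lambda>\<zeta>. g \<zeta> * cnj (p \<zeta>)) = circle_mean (\<lambda>\<zeta>. \<Sum>n<m. cnj (c n) * (g \<zeta> * cnj (\<zeta> ^ n)))"
      by (intro Bochner_Integration.integral_cong) (auto simp: p_def sum_distrib_left algebra_simps)
    also have "\<dots> = (\<Sum>n<m. circle_mean (\<lambda>\<zeta>. cnj (c n) * (g \<zeta> * cnj (\<zeta> ^ n))))"
      using L2_pairing(1)[OF g mono] by (intro Bochner_Integration.integral_sum) auto
    also have "\<dots> = (\<Sum>n<m. cnj (c n) * c n)" using L2_pairing(1)[OF g mono] by (simp add: c_def)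
    also have "\<dots> = of_real (\<Sum>n<m. (cmod (c n))\<^sup>2)" by (simp add: complex_norm_square mult.commute del: of_real_power)
    finally show ?thesis .
  qed
  have pg: "circle_mean (\<lambda>\<zeta>. p \<zeta> * cnj (g \<zeta>)) = of_real (\<Sum>n<m. (cmod (c n))\<^sup>2)"
  proof -
    have "circle_mean (\<lambda>\<zeta>. p \<zeta> * cnj (g \<zeta>)) = circle_mean (\<lambda>\<zeta>. cnj (g \<zeta> * cnj (p \<zeta>)))" by (simp add: mult.commute)
    also have "\<dots> = cnj (of_real (\<Sum>n<m. (cmod (c n))\<^sup>2))" unfolding circle_mean_cnj gp ..
    finally show ?thesis by simp
  qed
  have "complex_of_real (mean_square (\<lambda>\<zeta>. g \<zeta> - p \<zeta>)) =
     circle_mean (\<lambda>\<zeta>. g \<zeta> * cnj (g \<zeta>) - g \<zeta> * cnj (p \<zeta>) - (p \<zeta> * cnj (g \<zeta>) - p \<zeta> * cnj (p \<zeta>)))"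
    unfolding ms by (intro Bochner_Integration.integral_cong) (auto simp: algebra_simps)
  also have "\<dots> = circle_mean (\<lambda>\<zeta>. g \<zeta> * cnj (g \<zeta>)) - circle_mean (\<lambda>\<zeta>. g \<zeta> * cnj (p \<zeta>)) - (circle_mean (\<lambda>\<zeta>. p \<zeta> * cnj (g \<zeta>)) - circle_mean (\<lambda>\<zeta>. p \<zeta> * cnj (p \<zeta>)))"
    using igp L2_pairing(1)[OF g g] L2_pairing(1)[OF pL pL] L2_pairing(1)[OF pL g] by simp
  also have "\<dots> = of_real (mean_square g - (\<Sum>n<m. (cmod (c n))\<^sup>2) - ((\<Sum>n<m. (cmod (c n))\<^sup>2) - mean_square p))"
    unfolding gp pg ms[symmetric] by simp
  finally have msq: "mean_square (\<lambda>\<zeta>. g \<zeta> - p \<zeta>) = mean_square g - (\<Sum>n<m. (cmod (c n))\<^sup>2) - ((\<Sum>n<m. (cmod (c n))\<^sup>2) - mean_square p)"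
    by (simp only: of_real_eq_iff)
  have "mean_square p = (\<Sum>n<m. (cmod (c n))\<^sup>2)" unfolding p_def by (rule trig_mean_square)
  thus ?thesis using msq mean_square_nonneg[of "\<lambda>\<zeta>. g \<zeta> - p \<zeta>"] by simp
qed

section \<open>Toeplitz operators with continuous symbols\<close>

lemma hardy_eq_funI:
  assumes "\<And>z. z \<in> ball 0 1 \<Longrightarrow> hardy_fun f z = hardy_fun g z"
  shows "f = g"
proof -
  have "hardy_fun f z = hardy_fun g z" for z
    using assms[of z] hardy_outside[of z f] hardy_outside[of z g] by (cases "z \<in> ball 0 1") simp_all
  thus ?thesis by (simp add: hardy_fun_inject[symmetric] fun_eq_iff)
qed

lemma hardy_fun_add: "hardy_fun (f + g) z = hardy_fun f z + hardy_fun g z"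
  and hardy_fun_scaleC: "hardy_fun (c *\<^sub>C f) z = c * hardy_fun f z"
  and hardy_fun_zero: "hardy_fun 0 z = 0"
  by (simp_all add: plus_hardy2.rep_eq scaleC_hardy2.rep_eq zero_hardy2.rep_eq)

lemma hardy_fun_diff: "hardy_fun (f - g) z = hardy_fun f z - hardy_fun g z"
  unfolding minus_hardy2_def plus_hardy2.rep_eq uminus_hardy2.rep_eq by simp

text \<open>The projection retains the Fourier coefficients of nonnegative index. Bessel's inequality provides an
element of \<open>H\<^sup>2\<close> with these coefficients, and orthogonality to the monomials passes to
orthogonality to all boundary functions.\<close>

lemma riesz_projection_coeff:
  assumes g: "g \<in> L2_circle"
  shows "taylor_coeff (riesz_projection g) n = circle_mean (\<lambda>\<zeta>. g \<zeta> * cnj (\<zeta> ^ n))"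
proof -
  define c where "c = (\<lambda>n. circle_mean (\<lambda>\<zeta>. g \<zeta> * cnj (\<zeta> ^ n)))"
  have mono: "(\<lambda>\<zeta>. \<zeta> ^ n) \<in> L2_circle" for n by (intro L2_circleI continuous_intros)
  have "summable (\<lambda>n. (cmod (c n))\<^sup>2)"
    by (rule summableI_nonneg_bounded[where x = "mean_square g"]) (use Bessel_circle[OF g] in \<open>auto simp: c_def\<close>)
  then obtain h where h: "\<And>n. taylor_coeff h n = c n" using hardy_from_coeffs by blast
  have D: "(\<lambda>\<zeta>. g \<zeta> - boundary_fun k \<zeta>) \<in> L2_circle" for k by (intro L2_diff g boundary_fun_properties)
  have coeff: "circle_mean (\<lambda>\<zeta>. (g \<zeta> - boundary_fun k \<zeta>) * cnj (\<zeta> ^ n)) = c n - taylor_coeff k n" for k n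
    using L2_pairing(1)[OF g mono[of n]] L2_pairing(1)[OF boundary_fun_properties(1)[of k] mono[of n]]
    by (simp add: left_diff_distrib c_def boundary_fun_coeff[simplified])
  have "riesz_projection g = h"
    unfolding riesz_projection_def
  proof (rule the_equality)
    show "\<forall>f. circle_mean (\<lambda>\<zeta>. (g \<zeta> - boundary_fun h \<zeta>) * cnj (boundary_fun f \<zeta>)) = 0"
      by (intro allI boundary_fun_orthogonal D) (simp add: coeff[simplified] h)
    fix k assume k: "\<forall>f. circle_mean (\<lambda>\<zeta>. (g \<zeta> - boundary_fun k \<zeta>) * cnj (boundary_fun f \<zeta>)) = 0"
    show "k = h"
    proof (rule hardy_eqI)
      fix n
      have "summable (\<lambda>j. (cmod (if j = n then 1 else 0 :: complex))\<^sup>2)"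
        by (rule summable_finite[of "{n}"]) auto
      then obtain e where e: "\<And>j. taylor_coeff e j = (if j = n then 1 else 0)"
        using hardy_from_coeffs[of "\<lambda>j. if j = n then 1 else 0"] by auto
      have en: "hardy_fun e z = z ^ n" if "z \<in> ball 0 1" for z
      proof -
        have "(\<lambda>j. taylor_coeff e j * z ^ j) sums (\<Sum>j\<in>{n}. taylor_coeff e j * z ^ j)"
          by (rule sums_finite) (auto simp: e)
        thus ?thesis using sums_unique2[OF hardy_sums[OF that, of e]] by (simp add: e)
      qed
      have ev: "\<forall>\<^sub>F r in at_left 1. of_real r ^ n * circle_mean (\<lambda>\<zeta>. (g \<zeta> - boundary_fun k \<zeta>) * cnj (\<zeta> ^ n)) =
         circle_mean (\<lambda>\<zeta>. (g \<zeta> - boundary_fun k \<zeta>) * cnj (hardy_fun e (of_real r * \<zeta>)))"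
        using eventually_at_left_1
      proof eventually_elim
        case (elim r)
        have "circle_mean (\<lambda>\<zeta>. (g \<zeta> - boundary_fun k \<zeta>) * cnj (hardy_fun e (of_real r * \<zeta>)))
          = circle_mean (\<lambda>\<zeta>. of_real r ^ n * ((g \<zeta> - boundary_fun k \<zeta>) * cnj (\<zeta> ^ n)))"
          by (intro Bochner_Integration.integral_cong refl, subst en)
             (use elim in \<open>auto simp: norm_mult power_mult_distrib\<close>)
        thus ?case by simp
      qed
      have "((\<lambda>r. of_real r ^ n * circle_mean (\<lambda>\<zeta>. (g \<zeta> - boundary_fun k \<zeta>) * cnj (\<zeta> ^ n)))
          \<longlongrightarrow> of_real 1 ^ n * circle_mean (\<lambda>\<zeta>. (g \<zeta> - boundary_fun k \<zeta>) * cnj (\<zeta> ^ n))) (at_left (1::real))"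
        by (intro tendsto_intros)
      from Lim_transform_eventually[OF this ev] boundary_pairing_tendsto[OF D, of k e]
      have "of_real 1 ^ n * circle_mean (\<lambda>\<zeta>. (g \<zeta> - boundary_fun k \<zeta>) * cnj (\<zeta> ^ n)) = circle_mean (\<lambda>\<zeta>. (g \<zeta> - boundary_fun k \<zeta>) * cnj (boundary_fun e \<zeta>))"
        using tendsto_unique[OF trivial_limit_at_left_real] by blast
      hence "c n - taylor_coeff k n = 0" unfolding coeff using k by simp
      thus "taylor_coeff k n = taylor_coeff h n" by (simp add: h)
    qed
  qed
  thus ?thesis using h by (simp add: c_def)
qed

lemma continuous_sphere_bounded:
  assumes "continuous_on (sphere 0 1) (\<psi> :: complex \<Rightarrow> complex)"
  obtains S where "S \<ge> 0" "\<And>z. cmod z = 1 \<Longrightarrow> cmod (\<psi> z) \<le> S"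
proof -
  have "bounded (\<psi> ` sphere 0 1)" by (intro compact_imp_bounded compact_continuous_image assms) auto
  then obtain B where B: "\<And>z. cmod z = 1 \<Longrightarrow> cmod (\<psi> z) \<le> B"
    by (metis bounded_iff image_eqI mem_sphere_0)
  thus ?thesis using that[of "max B 0"] by force
qed

context
  fixes \<psi> :: "complex \<Rightarrow> complex"
  assumes \<psi>: "continuous_on (sphere 0 1) \<psi>"
begin

lemma symbol_L2: "(\<lambda>\<zeta>. \<psi> \<zeta> * boundary_fun f \<zeta>) \<in> L2_circle"
proof -
  obtain S where "\<And>z. cmod z = 1 \<Longrightarrow> cmod (\<psi> z) \<le> S" using continuous_sphere_bounded[OF \<psi>] by blast
  thus ?thesis by (intro L2_mult_bounded(1)[of \<psi> S] circle_measurable_continuous \<psi> boundary_fun_properties)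
qed

lemma toeplitz_coeff:
  "taylor_coeff (toeplitz \<psi> f) n = circle_mean (\<lambda>\<zeta>. \<psi> \<zeta> * boundary_fun f \<zeta> * cnj (\<zeta> ^ n))"
  unfolding toeplitz_def by (rule riesz_projection_coeff[OF symbol_L2])

text \<open>Replacing the boundary function by dilations turns identities between elements of \<open>H\<^sup>2\<close> into
identities between continuous functions. This is how the linearity of the Toeplitz operator is
obtained, boundary functions being determined only almost everywhere.\<close>

lemma toeplitz_coeff_tendsto:
  "((\<lambda>r. circle_mean (\<lambda>\<zeta>. hardy_fun f (of_real r * \<zeta>) * (\<psi> \<zeta> * cnj (\<zeta> ^ n)))) \<longlongrightarrow> taylor_coeff (toeplitz \<psi> f) n) (at_left 1)"
proof -
  define q where "q = (\<lambda>\<zeta>. cnj (\<psi> \<zeta>) * \<zeta> ^ n)"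
  have qL: "q \<in> L2_circle" unfolding q_def by (intro L2_circleI continuous_intros \<psi>)
  have flip: "cnj (circle_mean (\<lambda>\<zeta>. q \<zeta> * cnj (g \<zeta>))) = circle_mean (\<lambda>\<zeta>. g \<zeta> * (\<psi> \<zeta> * cnj (\<zeta> ^ n)))" for g
    by (subst circle_mean_cnj[symmetric]) (simp add: q_def mult_ac)
  have "((\<lambda>r. cnj (circle_mean (\<lambda>\<zeta>. q \<zeta> * cnj (hardy_fun f (of_real r * \<zeta>))))) \<longlongrightarrow> cnj (circle_mean (\<lambda>\<zeta>. q \<zeta> * cnj (boundary_fun f \<zeta>)))) (at_left 1)"
    by (intro tendsto_intros boundary_pairing_tendsto qL)
  thus ?thesis unfolding flip toeplitz_coeff by (simp add: mult_ac)
qed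

lemma dilation_symbol_integrable:
  assumes "0 \<le> r" "r < 1"
  shows "integrable circle_measure (\<lambda>\<zeta>. hardy_fun f (of_real r * \<zeta>) * (\<psi> \<zeta> * cnj (\<zeta> ^ n)))"
  by (intro circle_integrable_continuous continuous_intros \<psi>
      continuous_on_compose2[OF holomorphic_on_imp_continuous_on[OF hardy_holomorphic[of f]]])
     (use assms in \<open>auto simp: norm_mult\<close>)

lemma toeplitz_add: "toeplitz \<psi> (f + g) = toeplitz \<psi> f + toeplitz \<psi> g"
proof (rule hardy_eqI)
  fix n
  have "((\<lambda>r. circle_mean (\<lambda>\<zeta>. hardy_fun (f + g) (of_real r * \<zeta>) * (\<psi> \<zeta> * cnj (\<zeta> ^ n)))) \<longlongrightarrow> taylor_coeff (toeplitz \<psi> f) n + taylor_coeff (toeplitz \<psi> g) n) (at_left 1)"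
  proof (rule Lim_transform_eventually[OF tendsto_add[OF toeplitz_coeff_tendsto[of f n] toeplitz_coeff_tendsto[of g n]]])
    show "\<forall>\<^sub>F r in at_left 1. circle_mean (\<lambda>\<zeta>. hardy_fun f (of_real r * \<zeta>) * (\<psi> \<zeta> * cnj (\<zeta> ^ n))) + circle_mean (\<lambda>\<zeta>. hardy_fun g (of_real r * \<zeta>) * (\<psi> \<zeta> * cnj (\<zeta> ^ n)))
      = circle_mean (\<lambda>\<zeta>. hardy_fun (f + g) (of_real r * \<zeta>) * (\<psi> \<zeta> * cnj (\<zeta> ^ n)))"
      using eventually_at_left_1
    proof eventually_elim
      case (elim r)
      show ?case
        using dilation_symbol_integrable[of r f n] dilation_symbol_integrable[of r g n] elim
        by (simp add: hardy_fun_add distrib_right)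
    qed
  qed
  thus "taylor_coeff (toeplitz \<psi> (f + g)) n = taylor_coeff (toeplitz \<psi> f + toeplitz \<psi> g) n"
    using toeplitz_coeff_tendsto[of "f + g" n] tendsto_unique[OF trivial_limit_at_left_real]
    by (simp add: taylor_coeff_add) blast
qed

lemma toeplitz_scaleC: "toeplitz \<psi> (c *\<^sub>C f) = c *\<^sub>C toeplitz \<psi> f"
proof (rule hardy_eqI)
  fix n
  have "((\<lambda>r. c * circle_mean (\<lambda>\<zeta>. hardy_fun f (of_real r * \<zeta>) * (\<psi> \<zeta> * cnj (\<zeta> ^ n)))) \<longlongrightarrow> c * taylor_coeff (toeplitz \<psi> f) n) (at_left 1)"
    by (intro tendsto_intros toeplitz_coeff_tendsto)
  moreover have "c * circle_mean (\<lambda>\<zeta>. hardy_fun f (of_real r * \<zeta>) * (\<psi> \<zeta> * cnj (\<zeta> ^ n))) = circle_mean (\<lambda>\<zeta>. hardy_fun (c *\<^sub>C f) (of_real r * \<zeta>) * (\<psi> \<zeta> * cnj (\<zeta> ^ n)))" for r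
    by (simp add: hardy_fun_scaleC mult.assoc)
  ultimately show "taylor_coeff (toeplitz \<psi> (c *\<^sub>C f)) n = taylor_coeff (c *\<^sub>C toeplitz \<psi> f) n"
    using toeplitz_coeff_tendsto[of "c *\<^sub>C f" n] tendsto_unique[OF trivial_limit_at_left_real]
    by (simp add: taylor_coeff_scaleC) blast
qed

lemma bounded_linear_toeplitz: "bounded_linear (toeplitz \<psi>)"
proof -
  obtain S where S: "S \<ge> 0" "\<And>z. cmod z = 1 \<Longrightarrow> cmod (\<psi> z) \<le> S" using continuous_sphere_bounded[OF \<psi>] by blast
  have "norm (toeplitz \<psi> f) \<le> norm f * (2 * S)" for f
  proof (rule power2_le_imp_le)
    have "(\<Sum>n<m. (cmod (taylor_coeff (toeplitz \<psi> f) n))\<^sup>2) \<le> (norm f * (2 * S))\<^sup>2" for m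
    proof -
      have "(\<Sum>n<m. (cmod (taylor_coeff (toeplitz \<psi> f) n))\<^sup>2) \<le> mean_square (\<lambda>\<zeta>. \<psi> \<zeta> * boundary_fun f \<zeta>)"
        unfolding toeplitz_coeff by (rule Bessel_circle[OF symbol_L2])
      also have "\<dots> \<le> S\<^sup>2 * mean_square (boundary_fun f)"
        by (intro L2_mult_bounded(2) circle_measurable_continuous \<psi> S boundary_fun_properties)
      also have "\<dots> \<le> S\<^sup>2 * (2 * (norm f)\<^sup>2)" by (intro mult_left_mono boundary_fun_mean_square_le) auto
      also have "\<dots> \<le> (norm f * (2 * S))\<^sup>2" by (simp add: power_mult_distrib)
      finally show ?thesis .
    qed
    thus "(norm (toeplitz \<psi> f))\<^sup>2 \<le> (norm f * (2 * S))\<^sup>2"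
      unfolding norm_hardy_square by (intro suminf_le_const hardy_summable)
  qed (use S in auto)
  moreover have "toeplitz \<psi> (t *\<^sub>R f) = t *\<^sub>R toeplitz \<psi> f" for t f
    using toeplitz_scaleC[of "of_real t" f] by (simp add: scaleC_of_real)
  ultimately show ?thesis
    by (intro bounded_linear_intro[where K = "2 * S"] toeplitz_add)
qed

text \<open>If \<open>f\<close> extends continuously to the closed disc, its boundary function agrees with the
extension almost everywhere on the circle. The part \<open>G\<close> is orthogonal to \<open>H\<^sup>2\<close> and is annihilated by the projection.\<close>

lemma toeplitz_eigenvector:
  assumes F: "continuous_on (cball 0 1) F" "\<And>z. z \<in> ball 0 1 \<Longrightarrow> hardy_fun f z = F z"
    and G: "continuous_on (sphere 0 1) G" "\<And>\<zeta>. cmod \<zeta> = 1 \<Longrightarrow> \<psi> \<zeta> * F \<zeta> = \<mu> * F \<zeta> + G \<zeta>"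
    and G0: "\<And>n. circle_mean (\<lambda>\<zeta>. G \<zeta> * cnj (\<zeta> ^ n)) = 0"
  shows "toeplitz \<psi> f = \<mu> *\<^sub>C f"
proof -
  have FL: "F \<in> L2_circle" by (intro L2_circleI continuous_on_subset[OF F(1)]) auto
  have bL: "boundary_fun f \<in> L2_circle" by (rule boundary_fun_properties)
  have unif: "uniformly_continuous_on (cball 0 1) F" by (intro compact_uniformly_continuous F) auto
  have lim: "((\<lambda>r. mean_square (\<lambda>\<zeta>. hardy_fun f (of_real r * \<zeta>) - F \<zeta>)) \<longlongrightarrow> 0) (at_left 1)"
  proof (rule tendstoI)
    fix e :: real assume e: "e > 0"
    have e2: "sqrt (e / 2) > 0" using e by simp
    then obtain d where d: "d > 0" "\<And>x y. x \<in> cball 0 1 \<Longrightarrow> y \<in> cball 0 1 \<Longrightarrow> dist y x < d \<Longrightarrow> dist (F y) (F x) < sqrt (e / 2)"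
      using unif unfolding uniformly_continuous_on_def by metis
    have "\<forall>\<^sub>F r in at_left (1::real). 1 - d < r" using d(1) by (intro order_tendstoD(1)[OF tendsto_ident_at]) auto
    with eventually_at_left_1
    show "\<forall>\<^sub>F r in at_left 1. dist (mean_square (\<lambda>\<zeta>. hardy_fun f (of_real r * \<zeta>) - F \<zeta>)) 0 < e"
    proof eventually_elim
      case (elim r)
      have bd: "(cmod (hardy_fun f (of_real r * \<zeta>) - F \<zeta>))\<^sup>2 \<le> e / 2" if \<zeta>: "cmod \<zeta> = 1" for \<zeta>
      proof -
        have rz: "of_real r * \<zeta> \<in> ball 0 1" using \<zeta> elim by (simp add: norm_mult)
        have "of_real r * \<zeta> - \<zeta> = of_real (r - 1) * \<zeta>" by (simp add: algebra_simps)
        hence "dist (of_real r * \<zeta>) \<zeta> = \<bar>r - 1\<bar>" using \<zeta> by (simp only: dist_norm norm_mult norm_of_real) simp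
        hence "dist (F (of_real r * \<zeta>)) (F \<zeta>) < sqrt (e / 2)" using \<zeta> elim rz by (intro d(2)) auto
        hence "cmod (hardy_fun f (of_real r * \<zeta>) - F \<zeta>) \<le> sqrt (e / 2)" using F(2)[OF rz] by (simp add: dist_norm)
        hence "(cmod (hardy_fun f (of_real r * \<zeta>) - F \<zeta>))\<^sup>2 \<le> (sqrt (e / 2))\<^sup>2" by (intro power_mono) auto
        thus ?thesis using e by simp
      qed
      have L: "(\<lambda>\<zeta>. hardy_fun f (of_real r * \<zeta>) - F \<zeta>) \<in> L2_circle"
        using elim by (intro L2_diff FL dilation_properties hardy_holomorphic) auto
      have "mean_square (\<lambda>\<zeta>. hardy_fun f (of_real r * \<zeta>) - F \<zeta>) \<le> circle_mean (\<lambda>_. e / 2)"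
        unfolding mean_square_def by (rule integral_mono[OF L2_square_integrable[OF L]]) (use bd in auto)
      also have "\<dots> = e / 2" by (simp add: circle_measure_UNIV)
      finally show ?case using e mean_square_nonneg by (simp add: dist_real_def abs_of_nonneg)
    qed
  qed
  have "mean_square (\<lambda>\<zeta>. boundary_fun f \<zeta> - F \<zeta>) \<le> 0"
  proof (rule tendsto_lowerbound)
    show "((\<lambda>r. 2 * mean_square (\<lambda>\<zeta>. hardy_fun f (of_real r * \<zeta>) - F \<zeta>) + 2 * mean_square (\<lambda>\<zeta>. hardy_fun f (of_real r * \<zeta>) - boundary_fun f \<zeta>)) \<longlongrightarrow> 0) (at_left 1)"
      by (rule tendsto_eq_intros lim boundary_fun_properties(2) refl | simp)+
    show "\<forall>\<^sub>F r in at_left 1. mean_square (\<lambda>\<zeta>. boundary_fun f \<zeta> - F \<zeta>) \<le> 2 * mean_square (\<lambda>\<zeta>. hardy_fun f (of_real r * \<zeta>) - F \<zeta>) + 2 * mean_square (\<lambda>\<zeta>. hardy_fun f (of_real r * \<zeta>) - boundary_fun f \<zeta>)"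
      using eventually_at_left_1
    proof eventually_elim
      case (elim r)
      have rL: "(\<lambda>\<zeta>. hardy_fun f (of_real r * \<zeta>)) \<in> L2_circle"
        using elim by (intro dilation_properties hardy_holomorphic) auto
      have "mean_square (\<lambda>\<zeta>. (hardy_fun f (of_real r * \<zeta>) - F \<zeta>) - (hardy_fun f (of_real r * \<zeta>) - boundary_fun f \<zeta>))
        \<le> 2 * mean_square (\<lambda>\<zeta>. hardy_fun f (of_real r * \<zeta>) - F \<zeta>) + 2 * mean_square (\<lambda>\<zeta>. hardy_fun f (of_real r * \<zeta>) - boundary_fun f \<zeta>)"
        by (intro mean_square_diff L2_diff rL FL bL)
      thus ?case by simp
    qed
  qed auto
  hence "mean_square (\<lambda>\<zeta>. boundary_fun f \<zeta> - F \<zeta>) = 0" using mean_square_nonneg by (intro antisym)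
  hence "AE \<zeta> in circle_measure. (cmod (boundary_fun f \<zeta> - F \<zeta>))\<^sup>2 = 0"
    unfolding mean_square_def by (subst (asm) integral_nonneg_eq_0_iff_AE) (auto intro!: L2_square_integrable L2_diff bL FL)
  hence ae: "AE \<zeta> in circle_measure. boundary_fun f \<zeta> = F \<zeta>" by eventually_elim simp
  have mono: "(\<lambda>\<zeta>. \<zeta> ^ n) \<in> L2_circle" for n by (intro L2_circleI continuous_intros)
  have GL: "G \<in> L2_circle" by (intro L2_circleI G)
  show ?thesis
  proof (rule hardy_eqI)
    fix n
    have "taylor_coeff (toeplitz \<psi> f) n = circle_mean (\<lambda>\<zeta>. \<mu> * (boundary_fun f \<zeta> * cnj (\<zeta> ^ n)) + G \<zeta> * cnj (\<zeta> ^ n))"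
      unfolding toeplitz_coeff
    proof (rule integral_cong_AE)
      show "AE \<zeta> in circle_measure. \<psi> \<zeta> * boundary_fun f \<zeta> * cnj (\<zeta> ^ n) = \<mu> * (boundary_fun f \<zeta> * cnj (\<zeta> ^ n)) + G \<zeta> * cnj (\<zeta> ^ n)"
        using ae AE_space by eventually_elim (use G(2) in \<open>auto simp: algebra_simps\<close>)
      show "(\<lambda>\<zeta>. \<psi> \<zeta> * boundary_fun f \<zeta> * cnj (\<zeta> ^ n)) \<in> borel_measurable circle_measure"
        using L2_pairing(1)[OF symbol_L2 mono[of n]] by (rule borel_measurable_integrable)
      show "(\<lambda>\<zeta>. \<mu> * (boundary_fun f \<zeta> * cnj (\<zeta> ^ n)) + G \<zeta> * cnj (\<zeta> ^ n)) \<in> borel_measurable circle_measure"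
        using L2_pairing(1)[OF bL mono[of n]] L2_pairing(1)[OF GL mono[of n]] by (intro borel_measurable_integrable) auto
    qed
    also have "\<dots> = \<mu> * circle_mean (\<lambda>\<zeta>. boundary_fun f \<zeta> * cnj (\<zeta> ^ n)) + circle_mean (\<lambda>\<zeta>. G \<zeta> * cnj (\<zeta> ^ n))"
      using L2_pairing(1)[OF bL mono[of n]] L2_pairing(1)[OF GL mono[of n]] by simp
    also have "\<dots> = \<mu> * taylor_coeff f n" unfolding boundary_fun_coeff G0 by simp
    finally show "taylor_coeff (toeplitz \<psi> f) n = taylor_coeff (\<mu> *\<^sub>C f) n" by (simp add: taylor_coeff_scaleC)
  qed
qed

end

section \<open>Multiplication by bounded holomorphic functions\<close>

definition hardy_mult :: "(complex \<Rightarrow> complex) \<Rightarrow> hardy2 \<Rightarrow> hardy2" where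
  "hardy_mult a f = Abs_hardy2 (\<lambda>z. if z \<in> ball 0 1 then a z * hardy_fun f z else 0)"

text \<open>The mean square of the product on a smaller circle is at most \<open>C\<^sup>2\<close> times that of \<open>f\<close>, and the radius
tends to one.\<close>

lemma
  assumes a: "a holomorphic_on ball 0 1" "\<And>z. z \<in> ball 0 1 \<Longrightarrow> cmod (a z) \<le> C"
  shows hardy_mult_fun: "z \<in> ball 0 1 \<Longrightarrow> hardy_fun (hardy_mult a f) z = a z * hardy_fun f z"
    and hardy_mult_norm: "norm (hardy_mult a f) \<le> C * norm f"
proof -
  define F where "F = (\<lambda>z. if z \<in> ball 0 1 then a z * hardy_fun f z else 0)"
  have "(\<lambda>z. a z * hardy_fun f z) holomorphic_on ball 0 1" by (intro holomorphic_intros a hardy_holomorphic)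
  hence F: "F holomorphic_on ball 0 1" by (rule holomorphic_transform) (simp add: F_def)
  define b where "b = (\<lambda>n. fps_nth (fps_expansion F 0) n)"
  have C: "C \<ge> 0" using order_trans[OF norm_ge_zero a(2)[of 0]] by simp
  have fin: "(\<Sum>n<m. (cmod (b n))\<^sup>2) \<le> (C * norm f)\<^sup>2" for m
  proof (rule tendsto_upperbound)
    show "((\<lambda>r. \<Sum>n<m. (cmod (b n * of_real r ^ n))\<^sup>2) \<longlongrightarrow> (\<Sum>n<m. (cmod (b n))\<^sup>2)) (at_left (1::real))"
      by (rule tendsto_eq_intros refl | simp)+
    show "\<forall>\<^sub>F r in at_left (1::real). (\<Sum>n<m. (cmod (b n * of_real r ^ n))\<^sup>2) \<le> (C * norm f)\<^sup>2"
      using eventually_at_left_1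
    proof eventually_elim
      case (elim r)
      hence r: "0 \<le> r" "r < 1" by auto
      have "(\<Sum>n<m. (cmod (b n * of_real r ^ n))\<^sup>2) \<le> (\<Sum>n. (cmod (b n * of_real r ^ n))\<^sup>2)"
        unfolding b_def by (rule sum_le_suminf[OF dilation_properties(2)[OF F r]]) auto
      also have "\<dots> = mean_square (\<lambda>\<zeta>. F (of_real r * \<zeta>))"
        unfolding b_def by (rule dilation_properties(3)[OF F r, symmetric])
      also have "\<dots> = mean_square (\<lambda>\<zeta>. a (of_real r * \<zeta>) * hardy_fun f (of_real r * \<zeta>))"
        unfolding mean_square_def using r by (intro Bochner_Integration.integral_cong) (auto simp: F_def norm_mult)
      also have "\<dots> \<le> C\<^sup>2 * mean_square (\<lambda>\<zeta>. hardy_fun f (of_real r * \<zeta>))"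
      proof (rule L2_mult_bounded(2))
        show "(\<lambda>\<zeta>. a (of_real r * \<zeta>)) \<in> borel_measurable circle_measure"
          by (rule L2_measurable[OF dilation_properties(1)[OF a(1) r]])
        show "(\<lambda>\<zeta>. hardy_fun f (of_real r * \<zeta>)) \<in> L2_circle" by (rule dilation_properties(1)[OF hardy_holomorphic r])
        show "cmod (a (of_real r * z)) \<le> C" if "cmod z = 1" for z using that r by (intro a(2)) (auto simp: norm_mult)
      qed
      also have "\<dots> \<le> C\<^sup>2 * (norm f)\<^sup>2" by (intro mult_left_mono dilation_mean_square_le r) auto
      finally show ?case by (simp add: power_mult_distrib)
    qed
  qed auto
  have sb: "summable (\<lambda>n. (cmod (b n))\<^sup>2)" by (rule summableI_nonneg_bounded[OF _ fin]) auto
  have eq: "hardy_fun (hardy_mult a f) = F"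
    unfolding hardy_mult_def F_def[symmetric]
    by (rule Abs_hardy2_inverse) (use F sb in \<open>auto simp: b_def F_def\<close>)
  thus "z \<in> ball 0 1 \<Longrightarrow> hardy_fun (hardy_mult a f) z = a z * hardy_fun f z" by (simp add: F_def)
  have tb: "taylor_coeff (hardy_mult a f) = b" by (rule ext) (simp only: taylor_coeff_def eq b_def)
  have "(norm (hardy_mult a f))\<^sup>2 \<le> (C * norm f)\<^sup>2"
    unfolding norm_hardy_square tb by (rule suminf_le_const[OF sb fin])
  thus "norm (hardy_mult a f) \<le> C * norm f" by (rule power2_le_imp_le) (simp add: C)
qed

definition hardy_one :: hardy2 where
  "hardy_one = (SOME f. \<forall>n. taylor_coeff f n = (if n = 0 then 1 else 0))"

lemma hardy_one_coeff: "taylor_coeff hardy_one n = (if n = 0 then 1 else 0)"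
proof -
  have "summable (\<lambda>j. (cmod (if j = 0 then 1 else 0 :: complex))\<^sup>2)"
    by (rule summable_finite[of "{0}"]) auto
  hence "\<exists>f. \<forall>n. taylor_coeff f n = (if n = 0 then 1 else 0)"
    using hardy_from_coeffs[of "\<lambda>j. if j = 0 then 1 else 0"] by metis
  hence "\<forall>n. taylor_coeff hardy_one n = (if n = 0 then 1 else 0)"
    unfolding hardy_one_def by (rule someI_ex)
  thus ?thesis by blast
qed

lemma hardy_one_fun: "z \<in> ball 0 1 \<Longrightarrow> hardy_fun hardy_one z = 1"
proof -
  assume z: "z \<in> ball 0 1"
  have "(\<lambda>j. taylor_coeff hardy_one j * z ^ j) sums (\<Sum>j\<in>{0}. taylor_coeff hardy_one j * z ^ j)"
    by (rule sums_finite) (auto simp: hardy_one_coeff)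
  thus ?thesis using sums_unique2[OF hardy_sums[OF z, of hardy_one]] by (simp add: hardy_one_coeff)
qed

lemma norm_hardy_one: "norm hardy_one = 1"
proof -
  have "(\<Sum>n. (cmod (taylor_coeff hardy_one n))\<^sup>2) = (\<Sum>n\<in>{0}. (cmod (taylor_coeff hardy_one n))\<^sup>2)"
    by (rule suminf_finite) (auto simp: hardy_one_coeff)
  also have "\<dots> = 1" by (simp add: hardy_one_coeff)
  finally show ?thesis by (simp only: norm_hardy2_def real_sqrt_one)
qed

text \<open>A function in the unit ball of \<open>H\<^sup>2\<close> whose value at the origin is close to one is close to the constant
function one in norm. This is how pointwise information at one point gives convergence in \<open>H\<^sup>2\<close>.\<close>

lemma norm_diff_hardy_one:
  assumes "norm f \<le> 1"
  shows "(norm (f - hardy_one))\<^sup>2 \<le> 2 - 2 * Re (hardy_fun f 0)"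
proof -
  have f0: "hardy_fun f 0 = taylor_coeff f 0"
  proof -
    have "(\<lambda>n. taylor_coeff f n * 0 ^ n) sums hardy_fun f 0" by (rule hardy_sums) simp
    thus ?thesis by (rule sums_unique2[OF _ powser_sums_zero])
  qed
  have "(\<lambda>n. (cmod (taylor_coeff f n))\<^sup>2 + (if n = 0 then 1 - 2 * Re (taylor_coeff f 0) else 0)) sums ((norm f)\<^sup>2 + (1 - 2 * Re (taylor_coeff f 0)))"
    unfolding norm_hardy_square
    by (rule sums_add[OF summable_sums[OF hardy_summable] sums_single[of 0 "\<lambda>_. 1 - 2 * Re (taylor_coeff f 0)"]])
  moreover have "(cmod (taylor_coeff (f - hardy_one) n))\<^sup>2 = (cmod (taylor_coeff f n))\<^sup>2 + (if n = 0 then 1 - 2 * Re (taylor_coeff f 0) else 0)" for n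
    unfolding cmod_power2 by (cases "n = 0") (simp_all add: taylor_coeff_diff hardy_one_coeff power2_eq_square algebra_simps)
  ultimately have "(norm (f - hardy_one))\<^sup>2 = (norm f)\<^sup>2 + (1 - 2 * Re (taylor_coeff f 0))"
    unfolding norm_hardy_square by (simp add: sums_iff)
  also have "(norm f)\<^sup>2 \<le> 1" using assms by (simp add: power_le_one)
  finally show ?thesis by (simp add: f0)
qed

section \<open>Closed subspaces of the Hardy space\<close>

definition complex_subspace :: "'a::complex_banach set \<Rightarrow> bool" where
  "complex_subspace M \<longleftrightarrow> 0 \<in> M \<and> (\<forall>x\<in>M. \<forall>y\<in>M. x + y \<in> M) \<and> (\<forall>c. \<forall>x\<in>M. c *\<^sub>C x \<in> M)"

lemma scaleC_minus_one: "(- 1) *\<^sub>C x = - (x :: 'a :: complex_banach)"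
  using scaleC_of_real[of "- 1" x] by simp

lemma scaleC_one: "1 *\<^sub>C x = (x :: 'a :: complex_banach)"
  using scaleC_of_real[of 1 x] by simp

lemma scaleC_diff_right: "c *\<^sub>C (x - y) = c *\<^sub>C x - c *\<^sub>C (y :: 'a :: complex_banach)"
proof -
  have "c *\<^sub>C (- y) = - (c *\<^sub>C y)"
    by (metis scaleC_minus_one scaleC_scaleC mult.commute)
  thus ?thesis using scaleC_add_right[of c x "- y"] by simp
qed

lemma complex_subspace_diff: "complex_subspace M \<Longrightarrow> x \<in> M \<Longrightarrow> y \<in> M \<Longrightarrow> x - y \<in> M"
  unfolding complex_subspace_def by (metis scaleC_minus_one add_uminus_conv_diff)

lemma complex_subspace_sum: "complex_subspace M \<Longrightarrow> (\<And>i. i \<in> I \<Longrightarrow> f i \<in> M) \<Longrightarrow> sum f I \<in> M"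
  by (induction I rule: infinite_finite_induct) (auto simp: complex_subspace_def)

lemma closed_approx:
  assumes "closed M" "\<And>e. e > 0 \<Longrightarrow> \<exists>y\<in>M. norm (y - x) < (e :: real)"
  shows "x \<in> (M :: 'a :: real_normed_vector set)"
proof -
  have "x \<in> closure M" unfolding closure_approachable using assms(2) by (auto simp: dist_norm)
  thus ?thesis using assms(1) by simp
qed

text \<open>The subspace contains the partial sums up to the power \<open>n - 1\<close>, by induction, hence the difference of
\<open>S \<mu>\<close> and these. Divided by \<open>\<mu>\<^sup>n\<close> it tends to the coefficient \<open>x n\<close>.\<close>

lemma power_series_coefficients_in_subspace:
  fixes x :: "nat \<Rightarrow> 'a :: complex_banach"
  assumes M: "closed M" "complex_subspace M" and r: "r > 0" and "K \<ge> 0" "B \<ge> 0"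
    and S: "\<And>\<mu>. \<mu> \<noteq> 0 \<Longrightarrow> cmod \<mu> < r \<Longrightarrow> S \<mu> \<in> M"
    and rem: "\<And>\<mu> n. \<mu> \<noteq> 0 \<Longrightarrow> cmod \<mu> < r \<Longrightarrow> norm (S \<mu> - (\<Sum>i<n. \<mu> ^ i *\<^sub>C x i)) \<le> K * (B * cmod \<mu>) ^ n"
  shows "x n \<in> M"
proof (induction n rule: less_induct)
  case (less n)
  show ?case
  proof (rule closed_approx[OF M(1)])
    fix e :: real assume e: "e > 0"
    define t where "t = min (r / 2) (e / (2 * (K * B ^ Suc n + 1)))"
    have KB: "K * B ^ Suc n \<ge> 0" using assms(4,5) by simp
    have "e / (2 * (K * B ^ Suc n + 1)) > 0" using e KB by (intro divide_pos_pos) auto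
    hence t: "t > 0" "t < r" unfolding t_def using r by linarith+
    define \<mu> :: complex where "\<mu> = of_real t"
    have \<mu>: "\<mu> \<noteq> 0" "cmod \<mu> < r" "cmod \<mu> = t" using t by (auto simp: \<mu>_def)
    define y where "y = (1 / \<mu> ^ n) *\<^sub>C (S \<mu> - (\<Sum>i<n. \<mu> ^ i *\<^sub>C x i))"
    have "S \<mu> - (\<Sum>i<n. \<mu> ^ i *\<^sub>C x i) \<in> M"
      using M(2) less by (intro complex_subspace_diff complex_subspace_sum S \<mu>) (auto simp: complex_subspace_def)
    hence "y \<in> M" using M(2) by (simp add: y_def complex_subspace_def)
    have "y - x n = (1 / \<mu> ^ n) *\<^sub>C (S \<mu> - (\<Sum>i<Suc n. \<mu> ^ i *\<^sub>C x i))"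
    proof -
      have "(1 / \<mu> ^ n) *\<^sub>C (\<mu> ^ n *\<^sub>C x n) = x n" using \<mu>(1) by (simp add: scaleC_scaleC scaleC_one)
      thus ?thesis by (simp add: y_def scaleC_diff_right scaleC_add_right)
    qed
    hence "norm (y - x n) = norm (S \<mu> - (\<Sum>i<Suc n. \<mu> ^ i *\<^sub>C x i)) / t ^ n"
      using \<mu>(3) by (simp add: norm_scaleC norm_divide norm_power)
    also have "\<dots> \<le> K * (B * t) ^ Suc n / t ^ n"
      using rem[OF \<mu>(1,2), of "Suc n"] \<mu>(3) t by (intro divide_right_mono) auto
    also have "\<dots> = K * B ^ Suc n * t" using t(1) by (simp add: power_mult_distrib)
    also have "\<dots> \<le> K * B ^ Suc n * (e / (2 * (K * B ^ Suc n + 1)))"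
      using KB by (intro mult_left_mono) (auto simp: t_def)
    also have "\<dots> < e"
    proof -
      have "x / (2 * (x + 1)) < 1" if "x \<ge> 0" for x :: real
        using that by (simp add: divide_less_eq)
      hence "K * B ^ Suc n / (2 * (K * B ^ Suc n + 1)) < 1"  using KB by blast
      hence "e * (K * B ^ Suc n / (2 * (K * B ^ Suc n + 1))) < e * 1" using e by (intro mult_strict_left_mono)
      thus ?thesis by (simp add: mult.commute)
    qed
    finally show "\<exists>y\<in>M. norm (y - x n) < e" using \<open>y \<in> M\<close> by blast
  qed
qed

definition bounded_holo :: "(complex \<Rightarrow> complex) \<Rightarrow> bool" where
  "bounded_holo a \<longleftrightarrow> a holomorphic_on ball 0 1 \<and> (\<exists>C. \<forall>z\<in>ball 0 1. cmod (a z) \<le> C)"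

definition hardy_of :: "(complex \<Rightarrow> complex) \<Rightarrow> hardy2" where
  "hardy_of a = hardy_mult a hardy_one"

lemma bounded_holoI: "a holomorphic_on ball 0 1 \<Longrightarrow> (\<And>z. z \<in> ball 0 1 \<Longrightarrow> cmod (a z) \<le> C) \<Longrightarrow> bounded_holo a"
  unfolding bounded_holo_def by blast

lemma bounded_holo_bound:
  assumes "bounded_holo a"
  obtains C where "C > 0" "\<And>z. z \<in> ball 0 1 \<Longrightarrow> cmod (a z) \<le> C"
proof -
  obtain C where C: "\<And>z. z \<in> ball 0 1 \<Longrightarrow> cmod (a z) \<le> C" using assms unfolding bounded_holo_def by blast
  show ?thesis
  proof (rule that[of "max C 1"])
    show "cmod (a z) \<le> max C 1" if "z \<in> ball 0 1" for z using C[OF that] by simp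
  qed simp
qed

lemma bounded_holo_const: "bounded_holo (\<lambda>_. c)"
  by (rule bounded_holoI[where C = "cmod c"]) auto

lemma bounded_holo_mult: "bounded_holo a \<Longrightarrow> bounded_holo b \<Longrightarrow> bounded_holo (\<lambda>z. a z * b z)"
proof -
  assume a: "bounded_holo a" and b: "bounded_holo b"
  obtain C where C: "C > 0" "\<And>z. z \<in> ball 0 1 \<Longrightarrow> cmod (a z) \<le> C" using bounded_holo_bound[OF a] by blast
  obtain D where D: "D > 0" "\<And>z. z \<in> ball 0 1 \<Longrightarrow> cmod (b z) \<le> D" using bounded_holo_bound[OF b] by blast
  show ?thesis
  proof (rule bounded_holoI[where C = "C * D"])
    show "(\<lambda>z. a z * b z) holomorphic_on ball 0 1" using a b by (auto simp: bounded_holo_def intro!: holomorphic_intros)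
    show "cmod (a z * b z) \<le> C * D" if "z \<in> ball 0 1" for z
      using C(1) C(2)[OF that] D(2)[OF that] by (auto simp: norm_mult intro!: mult_mono)
  qed
qed

lemma bounded_holo_add: "bounded_holo a \<Longrightarrow> bounded_holo b \<Longrightarrow> bounded_holo (\<lambda>z. a z + b z)"
proof -
  assume a: "bounded_holo a" and b: "bounded_holo b"
  obtain C where C: "C > 0" "\<And>z. z \<in> ball 0 1 \<Longrightarrow> cmod (a z) \<le> C" using bounded_holo_bound[OF a] by blast
  obtain D where D: "D > 0" "\<And>z. z \<in> ball 0 1 \<Longrightarrow> cmod (b z) \<le> D" using bounded_holo_bound[OF b] by blast
  show ?thesis
  proof (rule bounded_holoI[where C = "C + D"])
    show "(\<lambda>z. a z + b z) holomorphic_on ball 0 1" using a b by (auto simp: bounded_holo_def intro!: holomorphic_intros)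
    show "cmod (a z + b z) \<le> C + D" if "z \<in> ball 0 1" for z
      using C(2)[OF that] D(2)[OF that] by (rule norm_triangle_mono)
  qed
qed

lemma bounded_holo_diff: "bounded_holo a \<Longrightarrow> bounded_holo b \<Longrightarrow> bounded_holo (\<lambda>z. a z - b z)"
  using bounded_holo_add[of a "\<lambda>z. (- 1) * b z"] bounded_holo_mult[OF bounded_holo_const, of b "- 1"] by simp

lemma bounded_holo_power: "bounded_holo a \<Longrightarrow> bounded_holo (\<lambda>z. a z ^ n)"
  by (induction n) (auto intro: bounded_holo_const bounded_holo_mult)

lemma bounded_holo_sum: "(\<And>i. i \<in> I \<Longrightarrow> bounded_holo (f i)) \<Longrightarrow> bounded_holo (\<lambda>z. \<Sum>i\<in>I. f i z)"
  by (induction I rule: infinite_finite_induct) (auto intro: bounded_holo_const bounded_holo_add)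

lemma bounded_holo_disc_algebra:
  assumes "continuous_on (cball 0 1) a" "a holomorphic_on ball 0 1"
  shows "bounded_holo a"
proof -
  have "bounded (a ` cball 0 1)" by (intro compact_imp_bounded compact_continuous_image assms) auto
  then obtain B where "\<forall>x\<in>a ` cball 0 1. cmod x \<le> B" by (auto simp: bounded_iff)
  thus ?thesis using assms(2) by (intro bounded_holoI[where C = B]) auto
qed

lemma bounded_holo_cong: "bounded_holo a \<Longrightarrow> (\<And>z. z \<in> ball 0 1 \<Longrightarrow> a z = b z) \<Longrightarrow> bounded_holo b"
  unfolding bounded_holo_def by (auto intro: holomorphic_transform)

lemma hardy_of_fun: "bounded_holo a \<Longrightarrow> z \<in> ball 0 1 \<Longrightarrow> hardy_fun (hardy_of a) z = a z"
  unfolding hardy_of_def bounded_holo_def using hardy_mult_fun[of a _ z hardy_one] by (metis hardy_one_fun mult.right_neutral)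

lemma hardy_of_eqI:
  assumes "bounded_holo a" "\<And>z. z \<in> ball 0 1 \<Longrightarrow> hardy_fun f z = a z"
  shows "f = hardy_of a"
  by (rule hardy_eq_funI) (simp add: assms hardy_of_fun)

lemma hardy_of_cong: "(\<And>z. z \<in> ball 0 1 \<Longrightarrow> a z = b z) \<Longrightarrow> hardy_of a = hardy_of b"
  unfolding hardy_of_def hardy_mult_def by (rule arg_cong[of _ _ Abs_hardy2]) auto

lemma hardy_of_add: "bounded_holo a \<Longrightarrow> bounded_holo b \<Longrightarrow> hardy_of (\<lambda>z. a z + b z) = hardy_of a + hardy_of b"
  by (rule hardy_of_eqI[symmetric]) (auto simp: bounded_holo_add hardy_fun_add hardy_of_fun)

lemma hardy_of_diff: "bounded_holo a \<Longrightarrow> bounded_holo b \<Longrightarrow> hardy_of (\<lambda>z. a z - b z) = hardy_of a - hardy_of b"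
  by (rule hardy_of_eqI[symmetric]) (auto simp: bounded_holo_diff hardy_fun_diff hardy_of_fun)

lemma hardy_of_scaleC: "bounded_holo a \<Longrightarrow> hardy_of (\<lambda>z. c * a z) = c *\<^sub>C hardy_of a"
  by (rule hardy_of_eqI[symmetric]) (auto simp: bounded_holo_mult bounded_holo_const hardy_fun_scaleC hardy_of_fun)

lemma hardy_of_sum:
  "(\<And>i. i \<in> I \<Longrightarrow> bounded_holo (f i)) \<Longrightarrow> hardy_of (\<lambda>z. \<Sum>i\<in>I. f i z) = (\<Sum>i\<in>I. hardy_of (f i))"
proof (induction I rule: infinite_finite_induct)
  case (insert i I)
  thus ?case by (simp add: hardy_of_add bounded_holo_sum)
qed (rule hardy_of_eqI[symmetric], simp_all add: bounded_holo_const hardy_fun_zero)+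

lemma norm_hardy_of_mult_le:
  assumes "bounded_holo a" "bounded_holo b" "\<And>z. z \<in> ball 0 1 \<Longrightarrow> cmod (a z) \<le> C"
  shows "norm (hardy_of (\<lambda>z. a z * b z)) \<le> C * norm (hardy_of b)"
proof -
  have a: "a holomorphic_on ball 0 1" using assms by (simp add: bounded_holo_def)
  have "hardy_mult a (hardy_of b) = hardy_of (\<lambda>z. a z * b z)"
    by (rule hardy_of_eqI[OF bounded_holo_mult[OF assms(1,2)]], subst hardy_mult_fun[OF a assms(3)])
       (simp_all only: hardy_of_fun[OF assms(2)])
  thus ?thesis using hardy_mult_norm[OF a assms(3), of "hardy_of b"] by simp
qed

lemma norm_hardy_of_le:
  assumes "bounded_holo a" "\<And>z. z \<in> ball 0 1 \<Longrightarrow> cmod (a z) \<le> C"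
  shows "norm (hardy_of a) \<le> C"
  using hardy_mult_norm[of a C hardy_one] assms by (simp add: hardy_of_def bounded_holo_def norm_hardy_one)

lemma hardy_one_eq: "hardy_one = hardy_of (\<lambda>_. 1)"
  by (rule hardy_of_eqI) (auto simp: bounded_holo_const hardy_one_fun)

lemma taylor_coeff_monomial: "taylor_coeff (hardy_of (\<lambda>z. z ^ n)) j = (if j = n then 1 else 0)"
proof -
  have "summable (\<lambda>j. (cmod (if j = n then 1 else 0 :: complex))\<^sup>2)"
    by (rule summable_finite[of "{n}"]) auto
  then obtain e where e: "\<And>j. taylor_coeff e j = (if j = n then 1 else 0)"
    using hardy_from_coeffs[of "\<lambda>j. if j = n then 1 else 0"] by auto
  have "hardy_fun e z = z ^ n" if "z \<in> ball 0 1" for z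
  proof -
    have "(\<lambda>j. taylor_coeff e j * z ^ j) sums (\<Sum>j\<in>{n}. taylor_coeff e j * z ^ j)"
      by (rule sums_finite) (auto simp: e)
    thus ?thesis using sums_unique2[OF hardy_sums[OF that, of e]] by (simp add: e)
  qed
  hence "e = hardy_of (\<lambda>z. z ^ n)"
    by (intro hardy_of_eqI bounded_holoI[where C = 1]) (auto simp: norm_power power_le_one intro!: holomorphic_intros)
  thus ?thesis using e by simp
qed

lemma taylor_coeff_sum: "taylor_coeff (\<Sum>i\<in>I. f i) j = (\<Sum>i\<in>I. taylor_coeff (f i) j)"
  by (induction I rule: infinite_finite_induct) (auto simp: taylor_coeff_0 taylor_coeff_add)

lemma taylor_polynomials_tendsto:
  assumes "e > 0"
  shows "\<exists>m. norm (f - (\<Sum>n<m. taylor_coeff f n *\<^sub>C hardy_of (\<lambda>z. z ^ n))) < e"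
proof -
  define a where "a = taylor_coeff f"
  have s: "summable (\<lambda>n. (cmod (a n))\<^sup>2)" unfolding a_def by (rule hardy_summable)
  have "(\<lambda>m. (\<Sum>n. (cmod (a n))\<^sup>2) - (\<Sum>n<m. (cmod (a n))\<^sup>2)) \<longlonglongrightarrow> (\<Sum>n. (cmod (a n))\<^sup>2) - (\<Sum>n. (cmod (a n))\<^sup>2)"
    by (intro tendsto_intros summable_LIMSEQ s)
  hence "\<forall>\<^sub>F m in sequentially. (\<Sum>n. (cmod (a n))\<^sup>2) - (\<Sum>n<m. (cmod (a n))\<^sup>2) < e\<^sup>2"
    using assms by (intro order_tendstoD) auto
  then obtain m where m: "(\<Sum>n. (cmod (a n))\<^sup>2) - (\<Sum>n<m. (cmod (a n))\<^sup>2) < e\<^sup>2"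
    by (auto simp: eventually_sequentially)
  define g where "g = f - (\<Sum>n<m. taylor_coeff f n *\<^sub>C hardy_of (\<lambda>z. z ^ n))"
  have g: "taylor_coeff g j = (if j < m then 0 else a j)" for j
  proof -
    have "(\<Sum>n<m. a n * (if j = n then 1 else 0)) = (if j < m then a j else 0)"
      by (simp add: if_distrib cong: if_cong)
    thus ?thesis
      by (simp add: g_def taylor_coeff_diff taylor_coeff_sum taylor_coeff_scaleC taylor_coeff_monomial a_def)
  qed
  have "(norm g)\<^sup>2 = (\<Sum>j. (cmod (taylor_coeff g (j + m)))\<^sup>2) + (\<Sum>j<m. (cmod (taylor_coeff g j))\<^sup>2)"
    unfolding norm_hardy_square by (rule suminf_split_initial_segment[OF hardy_summable])
  also have "\<dots> = (\<Sum>j. (cmod (a (j + m)))\<^sup>2)" by (simp add: g)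
  also have "\<dots> = (\<Sum>n. (cmod (a n))\<^sup>2) - (\<Sum>n<m. (cmod (a n))\<^sup>2)" by (rule suminf_minus_initial_segment[OF s])
  also have "\<dots> < e\<^sup>2" by (rule m)
  finally have "norm g < e" using assms power_less_imp_less_base by fastforce
  thus ?thesis unfolding g_def by blast
qed

section \<open>Completeness of the resolvent family\<close>

text \<open>The right-hand side vanishes at \<open>1 / cnj \<zeta>\<close> because numerator and denominator of the Blaschke product
are reflections of each other. Divided by \<open>poly br z * cnj (poly br \<zeta>)\<close>, the identity expresses
the reproducing kernel of the model space of the Blaschke product as a polynomial over \<open>poly br\<close>.\<close>

lemma Blaschke_kernel_polynomial:
  fixes bp br :: "complex poly"
  assumes deg: "degree bp \<le> N" "degree br \<le> N" and \<zeta>: "\<zeta> \<noteq> 0"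
    and refl1: "poly bp (1 / cnj \<zeta>) * cnj \<zeta> ^ N = cnj (poly br \<zeta>)"
    and refl2: "poly br (1 / cnj \<zeta>) * cnj \<zeta> ^ N = cnj (poly bp \<zeta>)"
    and N: "N > 0"
  obtains p where "degree p < N"
    "\<And>z. poly p z * (1 - cnj \<zeta> * z) = cnj (poly br \<zeta>) * poly br z - cnj (poly bp \<zeta>) * poly bp z"
proof -
  define X where "X = smult (cnj (poly br \<zeta>)) br - smult (cnj (poly bp \<zeta>)) bp"
  have "poly X (1 / cnj \<zeta>) * cnj \<zeta> ^ N = 0"
    unfolding X_def using refl1 refl2 by (simp add: algebra_simps)
  hence "poly X (1 / cnj \<zeta>) = 0" using \<zeta> by simp
  then obtain p where p: "X = [:- (1 / cnj \<zeta>), 1:] * p" by (auto simp: poly_eq_0_iff_dvd elim: dvdE)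
  have X: "degree X \<le> N" unfolding X_def
    by (intro degree_diff_le order_trans[OF degree_smult_le] deg)
  have dp: "degree p < N"
  proof (cases "p = 0")
    case False
    hence "degree X = 1 + degree p" unfolding p by (subst degree_mult_eq) auto
    thus ?thesis using X by simp
  qed (use N in simp)
  show ?thesis
  proof (rule that[of "smult (- (1 / cnj \<zeta>)) p"])
    show "degree (smult (- (1 / cnj \<zeta>)) p) < N" using dp degree_smult_le le_less_trans by blast
    fix z
    have "poly X z = (z - 1 / cnj \<zeta>) * poly p z" by (simp add: p algebra_simps)
    hence "cnj (poly br \<zeta>) * poly br z - cnj (poly bp \<zeta>) * poly bp z = (z - 1 / cnj \<zeta>) * poly p z"
      by (simp add: X_def)
    thus "poly (smult (- (1 / cnj \<zeta>)) p) z * (1 - cnj \<zeta> * z) = cnj (poly br \<zeta>) * poly br z - cnj (poly bp \<zeta>) * poly bp z"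
      using \<zeta> by (simp add: field_simps)
  qed
qed

lemma geometric_remainder: "1 / (1 - x) - (\<Sum>i<n. x ^ i) = x ^ n / (1 - x)" if "x \<noteq> 1" for x :: complex
proof -
  have "(\<Sum>i<n. x ^ i) = (1 - x ^ n) / (1 - x)" using that by (simp add: sum_gp_strict)
  thus ?thesis by (simp add: diff_divide_distrib)
qed

context exact_valence
begin

lemma bounded_holo_v: "bounded_holo v"
  by (rule bounded_holo_disc_algebra[OF cont hol])

lemma bounded_holo_poly: "bounded_holo (poly p)"
  by (rule bounded_holo_disc_algebra) (auto intro!: continuous_intros holomorphic_intros)

text \<open>The subspace is enlarged step by step. It contains the products of \<open>p / D0\<close> with the powers of \<open>v\<close>, with
uniform limits of polynomials in \<open>v\<close>, and with the powers of the Blaschke product \<open>B\<close>. The kernel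
identity then yields the products of the denominator \<open>br\<close> of \<open>B\<close>, divided by \<open>D0\<close>, with all Cauchy kernels
and with all powers of \<open>z\<close>.\<close>

theorem resolvent_family_complete:
  assumes N: "N > 0"
    and D0: "continuous_on (cball 0 1) D0" "D0 holomorphic_on ball 0 1" "\<And>z. z \<in> cball 0 1 \<Longrightarrow> D0 z \<noteq> 0"
    and M: "closed M" "complex_subspace M" and r: "r > 0"
    and eig: "\<And>\<mu> p. cmod \<mu> < r \<Longrightarrow> degree p < N \<Longrightarrow> hardy_of (\<lambda>z. poly p z / (D0 z * (1 - \<mu> * v z))) \<in> M"
  shows "M = UNIV"
proof -
  define h where "h = (\<lambda>z. 1 / D0 z)"
  have hb: "bounded_holo h" unfolding h_def
    by (rule bounded_holo_disc_algebra) (use D0 in \<open>auto intro!: continuous_intros holomorphic_intros\<close>)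
  obtain R where R: "R > 0" "\<And>z. z \<in> ball 0 1 \<Longrightarrow> cmod (v z) \<le> R" using bounded_holo_bound[OF bounded_holo_v] by blast
  \<comment> \<open>differentiation with respect to the eigenvalue yields the powers of v\<close>
  have step1: "hardy_of (\<lambda>z. poly p z * h z * v z ^ n) \<in> M" if p: "degree p < N" for p n
  proof -
    obtain C where C: "C > 0" "\<And>z. z \<in> ball 0 1 \<Longrightarrow> cmod (poly p z * h z) \<le> C"
      using bounded_holo_bound[OF bounded_holo_mult[OF bounded_holo_poly hb]] by blast
    define S where "S = (\<lambda>\<mu>. hardy_of (\<lambda>z. poly p z / (D0 z * (1 - \<mu> * v z))))"
    show ?thesis
    proof (rule power_series_coefficients_in_subspace[OF M, of "min r (1 / (2 * R))" "2 * C" R S "\<lambda>n. hardy_of (\<lambda>z. poly p z * h z * v z ^ n)"])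
      show "min r (1 / (2 * R)) > 0" using r R by simp
      show "S \<mu> \<in> M" if "cmod \<mu> < min r (1 / (2 * R))" for \<mu> unfolding S_def using that p by (intro eig) auto
      fix \<mu> :: complex and n assume \<mu>: "\<mu> \<noteq> 0" "cmod \<mu> < min r (1 / (2 * R))"
      have small: "cmod (\<mu> * v z) \<le> 1 / 2" if "z \<in> ball 0 1" for z
      proof -
        have "cmod (\<mu> * v z) \<le> 1 / (2 * R) * R" unfolding norm_mult
          using \<mu>(2) R(2)[OF that] R(1) by (intro mult_mono) auto
        thus ?thesis using R(1) by simp
      qed
      hence ne: "\<mu> * v z \<noteq> 1" if "z \<in> ball 0 1" for z using that by fastforce
      have half: "1 / 2 \<le> cmod (1 - \<mu> * v z)" if "z \<in> ball 0 1" for z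
        using small[OF that] norm_triangle_ineq2[of 1 "\<mu> * v z"] by simp
      have inv: "bounded_holo (\<lambda>z. 1 / (1 - \<mu> * v z))"
      proof (rule bounded_holoI[where C = 2])
        show "(\<lambda>z. 1 / (1 - \<mu> * v z)) holomorphic_on ball 0 1" using ne by (intro holomorphic_intros hol) auto
        show "cmod (1 / (1 - \<mu> * v z)) \<le> 2" if "z \<in> ball 0 1" for z
        proof -
          have "1 / cmod (1 - \<mu> * v z) \<le> 1 / (1 / 2)" using half[OF that] by (intro divide_left_mono) auto
          thus ?thesis by (simp add: norm_divide)
        qed
      qed
      have ph: "bounded_holo (\<lambda>z. poly p z * h z)" by (rule bounded_holo_mult[OF bounded_holo_poly hb])
      have t: "bounded_holo (\<lambda>z. \<mu> ^ i * (poly p z * h z * v z ^ i))" for i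
        by (intro bounded_holo_mult bounded_holo_const bounded_holo_poly hb bounded_holo_power bounded_holo_v)
      have S: "S \<mu> = hardy_of (\<lambda>z. poly p z * h z * (1 / (1 - \<mu> * v z)))"
        unfolding S_def by (rule hardy_of_cong) (simp add: h_def)
      have "S \<mu> - (\<Sum>i<n. \<mu> ^ i *\<^sub>C hardy_of (\<lambda>z. poly p z * h z * v z ^ i))
         = hardy_of (\<lambda>z. poly p z * h z * (1 / (1 - \<mu> * v z)) - (\<Sum>i<n. \<mu> ^ i * (poly p z * h z * v z ^ i)))"
        unfolding S
        by (subst hardy_of_diff, (intro bounded_holo_mult ph inv bounded_holo_sum t)+, subst hardy_of_sum[OF t],
            subst hardy_of_scaleC) (auto intro!: bounded_holo_mult bounded_holo_poly hb bounded_holo_power bounded_holo_v)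
      also have "\<dots> = hardy_of (\<lambda>z. (poly p z * h z) * ((1 / (1 - \<mu> * v z)) * (\<mu> * v z) ^ n))"
      proof (rule hardy_of_cong)
        fix z :: complex assume z: "z \<in> ball 0 1"
        have "(\<Sum>i<n. \<mu> ^ i * (poly p z * h z * v z ^ i)) = poly p z * h z * (\<Sum>i<n. (\<mu> * v z) ^ i)"
          by (simp add: sum_distrib_left power_mult_distrib mult_ac)
        hence "poly p z * h z * (1 / (1 - \<mu> * v z)) - (\<Sum>i<n. \<mu> ^ i * (poly p z * h z * v z ^ i))
           = poly p z * h z * (1 / (1 - \<mu> * v z) - (\<Sum>i<n. (\<mu> * v z) ^ i))" by (simp only: right_diff_distrib)
        thus "poly p z * h z * (1 / (1 - \<mu> * v z)) - (\<Sum>i<n. \<mu> ^ i * (poly p z * h z * v z ^ i))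
           = (poly p z * h z) * ((1 / (1 - \<mu> * v z)) * (\<mu> * v z) ^ n)"
          by (simp only: geometric_remainder[OF ne[OF z]]) simp
      qed
      also have "norm \<dots> \<le> 2 * C * (R * cmod \<mu>) ^ n"
      proof (rule norm_hardy_of_le)
        show "bounded_holo (\<lambda>z. (poly p z * h z) * ((1 / (1 - \<mu> * v z)) * (\<mu> * v z) ^ n))"
          by (intro bounded_holo_mult ph inv bounded_holo_power bounded_holo_const bounded_holo_v)
        fix z :: complex assume z: "z \<in> ball 0 1"
        have "cmod ((poly p z * h z) * ((1 / (1 - \<mu> * v z)) * (\<mu> * v z) ^ n))
          = cmod (poly p z * h z) * (1 / cmod (1 - \<mu> * v z)) * (cmod (v z) * cmod \<mu>) ^ n"
          by (simp add: norm_mult norm_divide norm_power mult_ac)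
        also have "\<dots> \<le> C * (1 / (1 / 2)) * (R * cmod \<mu>) ^ n"
          using C R half[OF z] z by (intro mult_mono power_mono divide_left_mono) auto
        finally show "cmod ((poly p z * h z) * ((1 / (1 - \<mu> * v z)) * (\<mu> * v z) ^ n)) \<le> 2 * C * (R * cmod \<mu>) ^ n" by (simp add: mult_ac)
      qed
      finally show "norm (S \<mu> - (\<Sum>i<n. \<mu> ^ i *\<^sub>C hardy_of (\<lambda>z. poly p z * h z * v z ^ i))) \<le> 2 * C * (R * cmod \<mu>) ^ n" .
    qed (use C R in auto)
  qed
  \<comment> \<open>uniform limits of polynomials in v\<close>
  have step2: "hardy_of (\<lambda>z. poly p z * h z * F (v z)) \<in> M"
    if p: "degree p < N" and F: "poly_approximable (v ` cball 0 1) F" and Fh: "bounded_holo (\<lambda>z. F (v z))" for p F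
  proof (rule closed_approx[OF M(1)])
    fix e :: real assume e: "e > 0"
    have ph: "bounded_holo (\<lambda>z. poly p z * h z)" by (rule bounded_holo_mult[OF bounded_holo_poly hb])
    obtain C where C: "C > 0" "\<And>z. z \<in> ball 0 1 \<Longrightarrow> cmod (poly p z * h z) \<le> C" using bounded_holo_bound[OF ph] by blast
    have "e / (2 * C) > 0" using e C by simp
    then obtain q where q: "\<And>w. w \<in> v ` cball 0 1 \<Longrightarrow> cmod (F w - poly q w) < e / (2 * C)"
      using F unfolding poly_approximable_def by blast
    have qv: "bounded_holo (\<lambda>z. poly q (v z))"
      by (rule bounded_holo_disc_algebra)
         (auto intro!: continuous_intros cont holomorphic_intros hol)
    have eq: "hardy_of (\<lambda>z. poly p z * h z * poly q (v z)) = (\<Sum>i\<le>degree q. coeff q i *\<^sub>C hardy_of (\<lambda>z. poly p z * h z * v z ^ i))"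
    proof -
      have t: "bounded_holo (\<lambda>z. poly p z * h z * v z ^ i)" for i
        by (intro bounded_holo_mult bounded_holo_poly hb bounded_holo_power bounded_holo_v)
      have "hardy_of (\<lambda>z. poly p z * h z * poly q (v z)) = hardy_of (\<lambda>z. \<Sum>i\<le>degree q. coeff q i * (poly p z * h z * v z ^ i))"
        by (rule hardy_of_cong) (simp add: poly_altdef[of q] sum_distrib_left mult_ac)
      thus ?thesis using t by (simp add: hardy_of_sum hardy_of_scaleC bounded_holo_mult bounded_holo_const)
    qed
    have inM: "hardy_of (\<lambda>z. poly p z * h z * poly q (v z)) \<in> M"
      unfolding eq using M(2) step1[OF p] by (intro complex_subspace_sum) (auto simp: complex_subspace_def)
    have "hardy_of (\<lambda>z. poly p z * h z * poly q (v z)) - hardy_of (\<lambda>z. poly p z * h z * F (v z))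
      = hardy_of (\<lambda>z. poly p z * h z * poly q (v z) - poly p z * h z * F (v z))"
      by (rule hardy_of_diff[symmetric]) (intro bounded_holo_mult ph qv Fh)+
    also have "norm \<dots> \<le> e / 2"
    proof (rule norm_hardy_of_le)
      show "bounded_holo (\<lambda>z. poly p z * h z * poly q (v z) - poly p z * h z * F (v z))"
        by (intro bounded_holo_diff bounded_holo_mult bounded_holo_poly hb qv Fh)
      fix z :: complex assume z: "z \<in> ball 0 1"
      have "poly p z * h z * poly q (v z) - poly p z * h z * F (v z) = (poly p z * h z) * (poly q (v z) - F (v z))"
        by (simp add: algebra_simps)
      hence "cmod (poly p z * h z * poly q (v z) - poly p z * h z * F (v z)) = cmod (poly p z * h z) * cmod (F (v z) - poly q (v z))"
        by (simp add: norm_mult norm_minus_commute)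
      also have "\<dots> \<le> C * (e / (2 * C))"
        using C z q[of "v z"] by (intro mult_mono) (auto intro: less_imp_le)
      finally show "cmod (poly p z * h z * poly q (v z) - poly p z * h z * F (v z)) \<le> e / 2" using C(1) by simp
    qed
    finally show "\<exists>y\<in>M. norm (y - hardy_of (\<lambda>z. poly p z * h z * F (v z))) < e"
      using inM e by (intro bexI[of _ "hardy_of (\<lambda>z. poly p z * h z * poly q (v z))"]) auto
  qed
  obtain \<psi> W bp br where \<psi>: "\<psi> holomorphic_on v ` ball 0 1" and W: "W holomorphic_on ball 0 1"
    and \<psi>W: "\<And>w. w \<in> v ` ball 0 1 \<Longrightarrow> \<psi> w \<in> ball 0 1 \<and> W (\<psi> w) = w"
    and W\<psi>: "\<And>z. z \<in> ball 0 1 \<Longrightarrow> W z \<in> v ` ball 0 1 \<and> \<psi> (W z) = z"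
    and \<psi>0: "\<psi> (v 0) = 0"
    and deg: "degree bp \<le> N" "degree br \<le> N"
    and br0: "\<And>z. cmod z \<le> 1 \<Longrightarrow> poly br z \<noteq> 0"
    and form: "\<And>z. z \<in> ball 0 1 \<Longrightarrow> \<psi> (v z) = poly bp z / poly br z"
    and refl1: "\<And>z. z \<noteq> 0 \<Longrightarrow> poly bp (1 / cnj z) * cnj z ^ N = cnj (poly br z)"
    and refl2: "\<And>z. z \<noteq> 0 \<Longrightarrow> poly br (1 / cnj z) * cnj z ^ N = cnj (poly bp z)"
  proof (rule Blaschke_factorization, goal_cases)
    case 1
    show ?case by (rule 1(1)) (fact 1)+
  qed
  define B where "B = (\<lambda>z. \<psi> (v z))"
  have B1: "cmod (B z) < 1" if "z \<in> ball 0 1" for z using \<psi>W[of "v z"] that by (auto simp: B_def)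
  have Bhol: "B holomorphic_on ball 0 1"
    using holomorphic_on_compose_gen[OF hol \<psi>] by (auto simp: B_def o_def)
  have Bb: "bounded_holo B" by (rule bounded_holoI[where C = 1]) (use Bhol B1 in \<open>auto intro: less_imp_le\<close>)
  have B0: "B 0 = 0" using \<psi>0 by (simp add: B_def)
  \<comment> \<open>passage from polynomials in v to powers of the Blaschke product\<close>
  have step3: "hardy_of (\<lambda>z. poly p z * h z * B z ^ m) \<in> M" if p: "degree p < N" for p m
  proof (rule closed_approx[OF M(1)])
    fix e :: real assume e: "e > 0"
    have ph: "bounded_holo (\<lambda>z. poly p z * h z)" by (rule bounded_holo_mult[OF bounded_holo_poly hb])
    obtain C where C: "C > 0" "\<And>z. z \<in> ball 0 1 \<Longrightarrow> cmod (poly p z * h z) \<le> C" using bounded_holo_bound[OF ph] by blast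
    define d where "d = e / (C * (real m + 1))"
    have d: "d > 0" using e C by (simp add: d_def)
    define K where "K = v ` cball 0 1"
    have conK: "connected K" unfolding K_def by (intro connected_continuous_image cont) auto
    have intK: "interior K = v ` ball 0 1" unfolding K_def by (rule interior_eq)
    obtain \<phi> where \<phi>: "poly_approximable K \<phi>" "\<phi> holomorphic_on interior K"
       "\<And>w. w \<in> interior K \<Longrightarrow> cmod (\<phi> w) < 1" "\<phi> (v 0) = 0" "cmod (deriv (\<phi> \<circ> W) 0 - 1) < d\<^sup>2 / 4"
    proof (rule Riemann_map_bounded_approximation[of K \<psi> W "v 0" "d\<^sup>2 / 4"])
      show "compact K" unfolding K_def by (rule compact_image)
      show "connected (- K)" unfolding K_def by (rule connected_complement_image)
    qed (use conK intK \<psi> W \<psi>W W\<psi> \<psi>0 d in auto)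
    define t where "t = \<phi> \<circ> W"
    have W0: "W 0 = v 0" using \<psi>W[of "v 0"] \<psi>0 by auto
    have th: "t holomorphic_on ball 0 1" unfolding t_def
      by (rule holomorphic_on_compose_gen[OF W \<phi>(2)]) (use W\<psi> intK in auto)
    have t0: "t 0 = 0" using W0 \<phi>(4) by (simp add: t_def)
    have t1: "cmod (t z) < 1" if "cmod z < 1" for z using \<phi>(3)[of "W z"] W\<psi>[of z] that intK by (auto simp: t_def)
    \<comment> \<open>the Schwarz lemma bounds the quotient of t by the identity, so that J is bounded by one\<close>
    obtain j where j: "j holomorphic_on ball 0 1" "\<And>z. cmod z < 1 \<Longrightarrow> t z = z * j z" "deriv t 0 = j 0"
      using Schwarz3[OF th t0] by blast
    have j1: "cmod (j z) \<le> 1" if z: "cmod z < 1" for z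
    proof (cases "z = 0")
      case True
      have "cmod (deriv t 0) \<le> 1" using Schwarz_Lemma(2)[of t 0] th t0 t1 by auto
      thus ?thesis using j(3) True by simp
    next
      case False
      have "cmod (t z) \<le> cmod z" using Schwarz_Lemma(1)[of t z] th t0 t1 z by auto
      thus ?thesis using j(2)[OF z] False by (simp add: norm_mult)
    qed
    define J where "J = (\<lambda>z. j (B z))"
    have Jh: "J holomorphic_on ball 0 1"
      using holomorphic_on_compose_gen[OF Bhol j(1)] B1 by (auto simp: J_def o_def image_subset_iff)
    have J1: "cmod (J z) \<le> 1" if "z \<in> ball 0 1" for z using j1[OF B1[OF that]] by (simp add: J_def)
    have Jb: "bounded_holo J" by (rule bounded_holoI[OF Jh J1])
    have sJ: "\<phi> (v z) = B z * J z" if "z \<in> ball 0 1" for z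
      using j(2)[OF B1[OF that]] \<psi>W[of "v z"] that by (auto simp: t_def B_def J_def)
    have sb: "bounded_holo (\<lambda>z. \<phi> (v z))"
      by (rule bounded_holo_cong[OF bounded_holo_mult[OF Bb Jb]]) (simp add: sJ)
    have inM: "hardy_of (\<lambda>z. poly p z * h z * \<phi> (v z) ^ m) \<in> M"
    proof (rule step2[OF p, of "\<lambda>w. \<phi> w ^ m"])
      show "poly_approximable (v ` cball 0 1) (\<lambda>w. \<phi> w ^ m)"
        using \<phi>(1) compact_image by (intro poly_approximable_power) (auto simp: K_def)
      show "bounded_holo (\<lambda>z. \<phi> (v z) ^ m)" by (rule bounded_holo_power[OF sb])
    qed
    have "norm (hardy_of J - hardy_one) \<le> d"
    proof (rule power2_le_imp_le)
      have "norm (hardy_of J) \<le> 1" by (rule norm_hardy_of_le[OF Jb J1])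
      hence "(norm (hardy_of J - hardy_one))\<^sup>2 \<le> 2 - 2 * Re (hardy_fun (hardy_of J) 0)"
        by (rule norm_diff_hardy_one)
      also have "hardy_fun (hardy_of J) 0 = deriv t 0" using Jb j(3) B0 by (simp add: hardy_of_fun J_def)
      also have "2 - 2 * Re (deriv t 0) \<le> 2 * cmod (deriv t 0 - 1)"
        using abs_Re_le_cmod[of "deriv t 0 - 1"] by simp
      also have "\<dots> \<le> d\<^sup>2" using \<phi>(5) norm_ge_zero[of "deriv t 0 - 1"] unfolding t_def by linarith
      finally show "(norm (hardy_of J - hardy_one))\<^sup>2 \<le> d\<^sup>2" .
    qed (use d in auto)
    hence Jd: "norm (hardy_of (\<lambda>z. J z - 1)) \<le> d"
      by (simp add: hardy_of_diff Jb bounded_holo_const hardy_one_eq)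
    have J1b: "bounded_holo (\<lambda>z. J z - 1)" by (rule bounded_holo_diff[OF Jb bounded_holo_const])
    have Bm: "bounded_holo (\<lambda>z. poly p z * h z * B z ^ m)" by (rule bounded_holo_mult[OF ph bounded_holo_power[OF Bb]])
    have sm: "bounded_holo (\<lambda>z. poly p z * h z * \<phi> (v z) ^ m)" by (rule bounded_holo_mult[OF ph bounded_holo_power[OF sb]])
    have "hardy_of (\<lambda>z. poly p z * h z * \<phi> (v z) ^ m) - hardy_of (\<lambda>z. poly p z * h z * B z ^ m)
       = hardy_of (\<lambda>z. poly p z * h z * \<phi> (v z) ^ m - poly p z * h z * B z ^ m)"
      by (rule hardy_of_diff[OF sm Bm, symmetric])
    also have "\<dots> = hardy_of (\<lambda>z. (poly p z * h z * B z ^ m * (\<Sum>i<m. J z ^ i)) * (J z - 1))"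
    proof (rule hardy_of_cong)
      fix z :: complex assume z: "z \<in> ball 0 1"
      have "(\<Sum>i<m. J z ^ i) * (J z - 1) = J z ^ m - 1" by (metis power_diff_1_eq mult.commute)
      thus "poly p z * h z * \<phi> (v z) ^ m - poly p z * h z * B z ^ m = (poly p z * h z * B z ^ m * (\<Sum>i<m. J z ^ i)) * (J z - 1)"
        unfolding sJ[OF z] power_mult_distrib by (simp only: mult.assoc) (simp only: right_diff_distrib mult.right_neutral mult_1_right)
    qed
    also have "norm \<dots> \<le> (C * real m) * norm (hardy_of (\<lambda>z. J z - 1))"
    proof (rule norm_hardy_of_mult_le)
      show "bounded_holo (\<lambda>z. poly p z * h z * B z ^ m * (\<Sum>i<m. J z ^ i))"
        by (intro bounded_holo_mult[OF Bm] bounded_holo_sum bounded_holo_power Jb)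
      fix z :: complex assume z: "z \<in> ball 0 1"
      have "cmod (\<Sum>i<m. J z ^ i) \<le> (\<Sum>i<m. 1)"
        by (rule sum_norm_le) (use J1[OF z] in \<open>auto simp: norm_power power_le_one\<close>)
      moreover have "cmod (B z ^ m) \<le> 1" using B1[OF z] by (simp add: norm_power power_le_one)
      ultimately have "cmod (poly p z * h z) * cmod (B z ^ m) * cmod (\<Sum>i<m. J z ^ i) \<le> C * 1 * real m"
        using C(1) C(2)[OF z] by (intro mult_mono) auto
      thus "cmod (poly p z * h z * B z ^ m * (\<Sum>i<m. J z ^ i)) \<le> C * real m" by (simp add: norm_mult)
    qed (rule J1b)
    also have "\<dots> \<le> (C * real m) * d" using C(1) Jd by (intro mult_left_mono) auto
    also have "\<dots> < C * (real m + 1) * d" using C(1) d by simp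
    also have "\<dots> = e" using C(1) by (simp add: d_def add_nonneg_eq_0_iff)
    finally show "\<exists>y\<in>M. norm (y - hardy_of (\<lambda>z. poly p z * h z * B z ^ m)) < e" using inM by blast
  qed
  have brb: "bounded_holo (poly br)" by (rule bounded_holo_poly)
  have hbr: "bounded_holo (\<lambda>z. h z * poly br z)" by (rule bounded_holo_mult[OF hb brb])
  \<comment> \<open>the kernel identity expands Cauchy kernels in powers of the Blaschke product\<close>
  have step4: "hardy_of (\<lambda>z. h z * poly br z * (1 / (1 - \<mu> * z))) \<in> M" if \<mu>: "\<mu> \<noteq> 0" "cmod \<mu> < 1" for \<mu>
  proof (rule closed_approx[OF M(1)])
    fix e :: real assume e: "e > 0"
    define \<zeta> where "\<zeta> = cnj \<mu>"
    have \<zeta>: "\<zeta> \<noteq> 0" "cmod \<zeta> < 1" "cnj \<zeta> = \<mu>" using \<mu> by (auto simp: \<zeta>_def)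
    obtain p where p: "degree p < N"
      "\<And>z. poly p z * (1 - \<mu> * z) = cnj (poly br \<zeta>) * poly br z - cnj (poly bp \<zeta>) * poly bp z"
      using Blaschke_kernel_polynomial[OF deg \<zeta>(1) refl1[OF \<zeta>(1)] refl2[OF \<zeta>(1)] N] \<zeta>(3) by metis
    define b where "b = cnj (B \<zeta>)"
    define c where "c = cnj (poly br \<zeta>)"
    have c: "c \<noteq> 0" using br0[of \<zeta>] \<zeta>(2) by (simp add: c_def)
    have b1: "cmod b < 1" using B1[of \<zeta>] \<zeta>(2) by (simp add: b_def)
    have bB: "cmod (b * B z) < 1" if "z \<in> ball 0 1" for z
    proof -
      have "cmod (b * B z) \<le> cmod b * 1" unfolding norm_mult using B1[OF that] by (intro mult_left_mono) auto
      thus ?thesis using b1 by simp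
    qed
    have \<mu>z: "cmod (\<mu> * z) < 1" if "z \<in> ball 0 1" for z
    proof -
      have "cmod (\<mu> * z) \<le> cmod \<mu> * 1" unfolding norm_mult using that by (intro mult_left_mono) auto
      thus ?thesis using \<mu> by simp
    qed
    have ident: "h z * poly br z * (1 / (1 - \<mu> * z)) = (1 / c) * (poly p z * h z * (1 / (1 - b * B z)))" if z: "z \<in> ball 0 1" for z
    proof -
      have nz: "poly br z \<noteq> 0" using br0[of z] z by auto
      have "poly bp z = B z * poly br z" using form[OF z] nz by (simp add: B_def)
      moreover have "poly bp \<zeta> = B \<zeta> * poly br \<zeta>"
        using form[of \<zeta>] br0[of \<zeta>] \<zeta>(2) by (simp add: B_def)
      ultimately have "poly p z * (1 - \<mu> * z) = c * poly br z * (1 - b * B z)"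
        using p(2)[of z] by (simp add: b_def c_def algebra_simps)
      moreover have "1 - b * B z \<noteq> 0" "1 - \<mu> * z \<noteq> 0" using bB[OF z] \<mu>z[OF z] by auto
      moreover have "x * y * (1 / u) = (1 / c) * (q * x * (1 / w))"
        if "q * u = c * y * w" "w \<noteq> 0" "u \<noteq> 0" for x y q u w
      proof -
        have "q = c * y * w / u" using that by (simp add: eq_divide_eq)
        thus ?thesis using that(2) c by simp
      qed
      ultimately show ?thesis by blast
    qed
    obtain C where C: "C > 0" "\<And>z. z \<in> ball 0 1 \<Longrightarrow> cmod (h z * poly br z) \<le> C" using bounded_holo_bound[OF hbr] by blast
    define E where "E = C / (1 - cmod \<mu>)"
    have E: "E > 0" using C \<mu> by (simp add: E_def)
    obtain n where n: "cmod b ^ n < e / E" using real_arch_pow_inv[of "e / E" "cmod b"] b1 e E by auto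
    have kb: "bounded_holo (\<lambda>z. 1 / (1 - \<mu> * z))"
    proof (rule bounded_holoI[where C = "1 / (1 - cmod \<mu>)"])
      show "(\<lambda>z. 1 / (1 - \<mu> * z)) holomorphic_on ball 0 1" using \<mu>z by (intro holomorphic_intros) force
      fix z :: complex assume z: "z \<in> ball 0 1"
      have "1 - cmod \<mu> \<le> 1 - cmod (\<mu> * z)" using z by (simp add: norm_mult mult_left_le)
      also have "\<dots> \<le> cmod (1 - \<mu> * z)" using norm_triangle_ineq2[of 1 "\<mu> * z"] by simp
      finally show "cmod (1 / (1 - \<mu> * z)) \<le> 1 / (1 - cmod \<mu>)" using \<mu> by (simp add: norm_divide frac_le)
    qed
    have t: "bounded_holo (\<lambda>z. poly p z * h z * B z ^ i)" for i
      by (intro bounded_holo_mult bounded_holo_poly hb bounded_holo_power Bb)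
    define y where "y = (\<Sum>i<n. (b ^ i / c) *\<^sub>C hardy_of (\<lambda>z. poly p z * h z * B z ^ i))"
    have yM: "y \<in> M" unfolding y_def using M(2) step3[OF p(1)]
      by (intro complex_subspace_sum) (auto simp: complex_subspace_def)
    have yfun: "y = hardy_of (\<lambda>z. \<Sum>i<n. (b ^ i / c) * (poly p z * h z * B z ^ i))"
      unfolding y_def using t
      by (simp add: hardy_of_sum hardy_of_scaleC bounded_holo_mult bounded_holo_const
            del: times_divide_eq_left times_divide_eq_right)
    have yb: "bounded_holo (\<lambda>z. \<Sum>i<n. (b ^ i / c) * (poly p z * h z * B z ^ i))"
      by (intro bounded_holo_sum bounded_holo_mult[OF bounded_holo_const] t)
    have fb: "bounded_holo (\<lambda>z. h z * poly br z * (1 / (1 - \<mu> * z)))" by (rule bounded_holo_mult[OF hbr kb])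
    have "hardy_of (\<lambda>z. h z * poly br z * (1 / (1 - \<mu> * z))) - y =
       hardy_of (\<lambda>z. h z * poly br z * (1 / (1 - \<mu> * z)) - (\<Sum>i<n. (b ^ i / c) * (poly p z * h z * B z ^ i)))"
      unfolding yfun by (rule hardy_of_diff[OF fb yb, symmetric])
    also have "\<dots> = hardy_of (\<lambda>z. h z * poly br z * (1 / (1 - \<mu> * z)) * (b * B z) ^ n)"
    proof (rule hardy_of_cong)
      fix z :: complex assume z: "z \<in> ball 0 1"
      have ne: "b * B z \<noteq> 1" using bB[OF z] by auto
      have "(\<Sum>i<n. (b ^ i / c) * (poly p z * h z * B z ^ i)) = (1 / c) * (poly p z * h z * (\<Sum>i<n. (b * B z) ^ i))"
        by (simp add: sum_distrib_left power_mult_distrib mult_ac)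
      hence "h z * poly br z * (1 / (1 - \<mu> * z)) - (\<Sum>i<n. (b ^ i / c) * (poly p z * h z * B z ^ i))
        = (1 / c) * (poly p z * h z * (1 / (1 - b * B z) - (\<Sum>i<n. (b * B z) ^ i)))"
        unfolding ident[OF z] by (simp only: right_diff_distrib)
      also have "\<dots> = (1 / c) * (poly p z * h z * (1 / (1 - b * B z))) * (b * B z) ^ n"
        unfolding geometric_remainder[OF ne] by simp
      finally show "h z * poly br z * (1 / (1 - \<mu> * z)) - (\<Sum>i<n. (b ^ i / c) * (poly p z * h z * B z ^ i))
        = h z * poly br z * (1 / (1 - \<mu> * z)) * (b * B z) ^ n" unfolding ident[OF z] .
    qed
    also have "norm \<dots> \<le> E * cmod b ^ n"
    proof (rule norm_hardy_of_le)
      show "bounded_holo (\<lambda>z. h z * poly br z * (1 / (1 - \<mu> * z)) * (b * B z) ^ n)"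
        by (intro bounded_holo_mult[OF fb] bounded_holo_power bounded_holo_mult bounded_holo_const Bb)
      fix z :: complex assume z: "z \<in> ball 0 1"
      have "1 - cmod \<mu> \<le> 1 - cmod (\<mu> * z)" using z by (simp add: norm_mult mult_left_le)
      also have "\<dots> \<le> cmod (1 - \<mu> * z)" using norm_triangle_ineq2[of 1 "\<mu> * z"] by simp
      finally have "1 / cmod (1 - \<mu> * z) \<le> 1 / (1 - cmod \<mu>)" using \<mu> by (simp add: frac_le)
      moreover have "(cmod b * cmod (B z)) ^ n \<le> (cmod b * 1) ^ n"
        using B1[OF z] by (intro power_mono mult_left_mono) auto
      ultimately have "cmod (h z * poly br z) * (1 / cmod (1 - \<mu> * z)) * (cmod b * cmod (B z)) ^ n \<le> C * (1 / (1 - cmod \<mu>)) * (cmod b * 1) ^ n"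
        using C(1) C(2)[OF z] \<mu> by (intro mult_mono) auto
      thus "cmod (h z * poly br z * (1 / (1 - \<mu> * z)) * (b * B z) ^ n) \<le> E * cmod b ^ n"
        by (simp add: norm_mult norm_divide norm_power E_def)
    qed
    also have "\<dots> < e" using n E by (simp add: less_divide_eq mult.commute)
    finally show "\<exists>y\<in>M. norm (y - hardy_of (\<lambda>z. h z * poly br z * (1 / (1 - \<mu> * z)))) < e"
      using yM by (auto simp: norm_minus_commute)
  qed
  have step5: "hardy_of (\<lambda>z. h z * poly br z * z ^ n) \<in> M" for n
  proof -
    obtain C where C: "C > 0" "\<And>z. z \<in> ball 0 1 \<Longrightarrow> cmod (h z * poly br z) \<le> C" using bounded_holo_bound[OF hbr] by blast
    have zb: "bounded_holo (\<lambda>z. z ^ i)" for i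
      by (rule bounded_holoI[where C = 1]) (auto simp: norm_power power_le_one intro!: holomorphic_intros)
    define S where "S = (\<lambda>\<mu>. hardy_of (\<lambda>z. h z * poly br z * (1 / (1 - \<mu> * z))))"
    show ?thesis
    proof (rule power_series_coefficients_in_subspace[OF M, of "1 / 2" "2 * C" 1 S "\<lambda>n. hardy_of (\<lambda>z. h z * poly br z * z ^ n)"])
      show "S \<mu> \<in> M" if "\<mu> \<noteq> 0" "cmod \<mu> < 1 / 2" for \<mu> unfolding S_def using that by (intro step4) auto
      fix \<mu> :: complex and n assume \<mu>: "\<mu> \<noteq> 0" "cmod \<mu> < 1 / 2"
      have small: "cmod (\<mu> * z) \<le> 1 / 2" if "z \<in> ball 0 1" for z
      proof -
        have "cmod (\<mu> * z) \<le> 1 / 2 * 1" unfolding norm_mult using \<mu>(2) that by (intro mult_mono) auto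
        thus ?thesis by simp
      qed
      hence ne: "\<mu> * z \<noteq> 1" if "z \<in> ball 0 1" for z using that by fastforce
      have half: "1 / 2 \<le> cmod (1 - \<mu> * z)" if "z \<in> ball 0 1" for z
        using small[OF that] norm_triangle_ineq2[of 1 "\<mu> * z"] by simp
      have inv: "bounded_holo (\<lambda>z. 1 / (1 - \<mu> * z))"
      proof (rule bounded_holoI[where C = 2])
        show "(\<lambda>z. 1 / (1 - \<mu> * z)) holomorphic_on ball 0 1" using ne by (intro holomorphic_intros) auto
        show "cmod (1 / (1 - \<mu> * z)) \<le> 2" if "z \<in> ball 0 1" for z
        proof -
          have "1 / cmod (1 - \<mu> * z) \<le> 1 / (1 / 2)" using half[OF that] by (intro divide_left_mono) auto
          thus ?thesis by (simp add: norm_divide)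
        qed
      qed
      have t0: "bounded_holo (\<lambda>z. h z * poly br z * z ^ i)" for i by (rule bounded_holo_mult[OF hbr zb])
      have t: "bounded_holo (\<lambda>z. \<mu> ^ i * (h z * poly br z * z ^ i))" for i
        by (rule bounded_holo_mult[OF bounded_holo_const t0])
      have sumeq: "(\<Sum>i<n. \<mu> ^ i *\<^sub>C hardy_of (\<lambda>z. h z * poly br z * z ^ i)) = hardy_of (\<lambda>z. \<Sum>i<n. \<mu> ^ i * (h z * poly br z * z ^ i))"
        using t t0 by (simp add: hardy_of_sum hardy_of_scaleC)
      have "S \<mu> - (\<Sum>i<n. \<mu> ^ i *\<^sub>C hardy_of (\<lambda>z. h z * poly br z * z ^ i))
         = hardy_of (\<lambda>z. h z * poly br z * (1 / (1 - \<mu> * z)) - (\<Sum>i<n. \<mu> ^ i * (h z * poly br z * z ^ i)))"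
        unfolding S_def sumeq
        by (rule hardy_of_diff[symmetric]) (intro bounded_holo_mult hbr inv bounded_holo_sum t)+
      also have "\<dots> = hardy_of (\<lambda>z. (h z * poly br z) * ((1 / (1 - \<mu> * z)) * (\<mu> * z) ^ n))"
      proof (rule hardy_of_cong)
        fix z :: complex assume z: "z \<in> ball 0 1"
        have "(\<Sum>i<n. \<mu> ^ i * (h z * poly br z * z ^ i)) = h z * poly br z * (\<Sum>i<n. (\<mu> * z) ^ i)"
          by (simp add: sum_distrib_left power_mult_distrib mult_ac)
        hence "h z * poly br z * (1 / (1 - \<mu> * z)) - (\<Sum>i<n. \<mu> ^ i * (h z * poly br z * z ^ i))
           = h z * poly br z * (1 / (1 - \<mu> * z) - (\<Sum>i<n. (\<mu> * z) ^ i))" by (simp only: right_diff_distrib)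
        thus "h z * poly br z * (1 / (1 - \<mu> * z)) - (\<Sum>i<n. \<mu> ^ i * (h z * poly br z * z ^ i))
           = (h z * poly br z) * ((1 / (1 - \<mu> * z)) * (\<mu> * z) ^ n)"
          by (simp only: geometric_remainder[OF ne[OF z]]) simp
      qed
      also have "norm \<dots> \<le> 2 * C * (1 * cmod \<mu>) ^ n"
      proof (rule norm_hardy_of_le)
        show "bounded_holo (\<lambda>z. (h z * poly br z) * ((1 / (1 - \<mu> * z)) * (\<mu> * z) ^ n))"
          using zb[of 1] by (intro bounded_holo_mult hbr inv bounded_holo_power bounded_holo_const) simp
        fix z :: complex assume z: "z \<in> ball 0 1"
        have "cmod ((h z * poly br z) * ((1 / (1 - \<mu> * z)) * (\<mu> * z) ^ n))
          = cmod (h z * poly br z) * (1 / cmod (1 - \<mu> * z)) * (cmod z * cmod \<mu>) ^ n"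
          by (simp add: norm_mult norm_divide norm_power mult_ac)
        also have "\<dots> \<le> C * (1 / (1 / 2)) * (1 * cmod \<mu>) ^ n"
          using C half[OF z] z by (intro mult_mono power_mono divide_left_mono) auto
        finally show "cmod ((h z * poly br z) * ((1 / (1 - \<mu> * z)) * (\<mu> * z) ^ n)) \<le> 2 * C * (1 * cmod \<mu>) ^ n" by (simp add: mult_ac)
      qed
      finally show "norm (S \<mu> - (\<Sum>i<n. \<mu> ^ i *\<^sub>C hardy_of (\<lambda>z. h z * poly br z * z ^ i))) \<le> 2 * C * (1 * cmod \<mu>) ^ n" .
    qed (use C in auto)
  qed
  have "f \<in> M" for f
  proof (rule closed_approx[OF M(1)])
    fix e :: real assume e: "e > 0"
    obtain C where C: "C > 0" "\<And>z. z \<in> ball 0 1 \<Longrightarrow> cmod (h z * poly br z) \<le> C" using bounded_holo_bound[OF hbr] by blast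
    have hbrh: "(\<lambda>z. h z * poly br z) holomorphic_on ball 0 1" using hbr by (simp add: bounded_holo_def)
    have qb: "bounded_holo (\<lambda>z. D0 z / poly br z)"
      by (rule bounded_holo_disc_algebra) (use D0 br0 in \<open>auto intro!: continuous_intros holomorphic_intros\<close>)
    obtain C' where C': "C' > 0" "\<And>z. z \<in> ball 0 1 \<Longrightarrow> cmod (D0 z / poly br z) \<le> C'" using bounded_holo_bound[OF qb] by blast
    have qh: "(\<lambda>z. D0 z / poly br z) holomorphic_on ball 0 1" using qb by (simp add: bounded_holo_def)
    define g where "g = hardy_mult (\<lambda>z. D0 z / poly br z) f"
    have "e / C > 0" using e C by simp
    then obtain m where m: "norm (g - (\<Sum>n<m. taylor_coeff g n *\<^sub>C hardy_of (\<lambda>z. z ^ n))) < e / C"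
      using taylor_polynomials_tendsto by blast
    define y where "y = (\<Sum>n<m. taylor_coeff g n *\<^sub>C hardy_of (\<lambda>z. h z * poly br z * z ^ n))"
    have yM: "y \<in> M" unfolding y_def using M(2) step5 by (intro complex_subspace_sum) (auto simp: complex_subspace_def)
    have zb: "bounded_holo (\<lambda>z. z ^ i)" for i
      by (rule bounded_holoI[where C = 1]) (auto simp: norm_power power_le_one intro!: holomorphic_intros)
    define P where "P = (\<Sum>n<m. taylor_coeff g n *\<^sub>C hardy_of (\<lambda>z. z ^ n))"
    have Pfun: "P = hardy_of (\<lambda>z. \<Sum>n<m. taylor_coeff g n * z ^ n)"
      unfolding P_def using zb by (simp add: hardy_of_sum hardy_of_scaleC bounded_holo_mult bounded_holo_const)
    have Pb: "bounded_holo (\<lambda>z. \<Sum>n<m. taylor_coeff g n * z ^ n)"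
      by (intro bounded_holo_sum bounded_holo_mult[OF bounded_holo_const] zb)
    have tb: "bounded_holo (\<lambda>z. h z * poly br z * z ^ i)" for i by (rule bounded_holo_mult[OF hbr zb])
    have yfun: "y = hardy_of (\<lambda>z. \<Sum>n<m. taylor_coeff g n * (h z * poly br z * z ^ n))"
      unfolding y_def using tb by (simp add: hardy_of_sum hardy_of_scaleC bounded_holo_mult bounded_holo_const)
    have yb: "bounded_holo (\<lambda>z. \<Sum>n<m. taylor_coeff g n * (h z * poly br z * z ^ n))"
      by (intro bounded_holo_sum bounded_holo_mult[OF bounded_holo_const] tb)
    have "f - y = hardy_mult (\<lambda>z. h z * poly br z) (g - P)"
    proof (rule hardy_eq_funI)
      fix z :: complex assume z: "z \<in> ball 0 1"
      have "poly br z \<noteq> 0" "D0 z \<noteq> 0" using br0[of z] D0(3)[of z] z by auto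
      hence gz: "h z * poly br z * hardy_fun g z = hardy_fun f z"
        unfolding g_def using hardy_mult_fun[OF qh C'(2) z, of f] by (simp add: h_def)
      have "hardy_fun (hardy_mult (\<lambda>z. h z * poly br z) (g - P)) z = h z * poly br z * (hardy_fun g z - (\<Sum>n<m. taylor_coeff g n * z ^ n))"
        using hardy_mult_fun[OF hbrh C(2) z, of "g - P"] by (simp add: hardy_fun_diff Pfun hardy_of_fun[OF Pb z])
      also have "\<dots> = hardy_fun f z - (\<Sum>n<m. taylor_coeff g n * (h z * poly br z * z ^ n))"
        unfolding right_diff_distrib gz by (simp add: sum_distrib_left mult_ac)
      also have "\<dots> = hardy_fun (f - y) z" by (simp add: hardy_fun_diff yfun hardy_of_fun[OF yb z])
      finally show "hardy_fun (f - y) z = hardy_fun (hardy_mult (\<lambda>z. h z * poly br z) (g - P)) z" ..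
    qed
    hence "norm (f - y) \<le> C * norm (g - P)" using hardy_mult_norm[OF hbrh C(2), of "g - P"] by simp
    also have "\<dots> < C * (e / C)" using m C(1) unfolding P_def by (intro mult_strict_left_mono)
    finally have "norm (y - f) < e" using C(1) by (simp add: norm_minus_commute)
    thus "\<exists>y\<in>M. norm (y - f) < e" using yM by blast
  qed
  thus ?thesis by blast
qed

end

section \<open>The Godefroy-Shapiro criterion\<close>

text \<open>Birkhoff's transitivity theorem. For each ball of a countable family the set of points whose orbit
visits the ball is open and, by transitivity, dense; by Baire's theorem some orbit visits all the
balls.\<close>

lemma dense_orbit_if_transitive:
  fixes T :: "'a::banach \<Rightarrow> 'a"
  assumes T: "bounded_linear T" and D: "countable (D :: 'a set)" "closure D = UNIV"
    and trans: "\<And>U V. open U \<Longrightarrow> U \<noteq> {} \<Longrightarrow> open V \<Longrightarrow> V \<noteq> {} \<Longrightarrow> \<exists>n. \<exists>x\<in>U. (T ^^ n) x \<in> V"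
  shows "\<exists>x. closure (range (\<lambda>n. (T ^^ n) x)) = UNIV"
proof -
  have cont: "continuous_on UNIV (T ^^ n)" for n
  proof (induction n)
    case (Suc n)
    have "continuous_on UNIV (\<lambda>x. T ((T ^^ n) x))"
      by (rule bounded_linear.continuous_on[OF T Suc])
    thus ?case by (simp add: o_def)
  qed (simp add: id_def)
  define G where "G = (\<lambda>(d, m). \<Union>n. (T ^^ n) -` ball d (1 / real (Suc m)))"
  have G: "open (G dm)" "closure (G dm) = UNIV" for dm
  proof -
    obtain d m where dm: "dm = (d, m)" by (cases dm)
    show "open (G dm)"
      unfolding G_def dm using cont by (auto intro!: open_UN open_vimage simp del: of_nat_Suc)
    have "\<exists>y\<in>G dm. dist y x < e" if e: "e > 0" for x e
    proof -
      have "ball d (1 / real (Suc m)) \<noteq> {}" "ball x e \<noteq> {}" using e by auto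
      then obtain n y where "y \<in> ball x e" "(T ^^ n) y \<in> ball d (1 / real (Suc m))"
        using trans[of "ball x e" "ball d (1 / real (Suc m))"] by blast
      moreover from this have "y \<in> G dm" unfolding G_def dm by blast
      ultimately show ?thesis by (auto simp: dist_commute)
    qed
    thus "closure (G dm) = UNIV" by (auto simp: closure_approachable)
  qed
  have "Met_TC.mtopology closure_of \<Inter>(G ` (D \<times> UNIV)) = (UNIV :: 'a set)"
  proof (rule Met_TC.metric_Baire_category)
    show "Met_TC.mcomplete TYPE('a)"
      by (simp add: complete_UNIV)
    show "countable (G ` (D \<times> UNIV))" using D by auto
    fix S assume "S \<in> G ` (D \<times> UNIV)"
    thus "openin Met_TC.mtopology S \<and> Met_TC.mtopology closure_of S = UNIV"
      using G by auto
  qed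
  hence "\<Inter>(G ` (D \<times> UNIV)) \<noteq> {}" by (metis closure_of_empty UNIV_not_empty)
  then obtain x where x: "x \<in> \<Inter>(G ` (D \<times> UNIV))" unfolding ex_in_conv[symmetric] by (rule exE)
  have "y \<in> closure (range (\<lambda>n. (T ^^ n) x))" for y
    unfolding closure_approachable
  proof (intro allI impI)
    fix e :: real assume e: "e > 0"
    obtain m where m: "1 / real (Suc m) < e / 2" using e nat_approx_posE[of "e / 2"] by auto
    obtain d where d: "d \<in> D" "dist d y < e / 2"
      using D(2) e by (metis UNIV_I closure_approachable half_gt_zero)
    have "x \<in> G (d, m)" using x d by blast
    then obtain n where n: "dist d ((T ^^ n) x) < 1 / real (Suc m)" by (auto simp: G_def simp del: of_nat_Suc)
    have "dist ((T ^^ n) x) y < e"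
      using n m d(2) dist_triangle[of "(T ^^ n) x" y d] by (simp add: dist_commute)
    thus "\<exists>z\<in>range (\<lambda>n. (T ^^ n) x). dist z y < e" by blast
  qed
  thus ?thesis by blast
qed

lemma closure_complex_subspace:
  assumes "complex_subspace M"
  shows "complex_subspace (closure M)"
  unfolding complex_subspace_def
proof (intro conjI ballI allI)
  show "0 \<in> closure M" using assms closure_subset by (auto simp: complex_subspace_def)
  fix x assume "x \<in> closure M"
  then obtain a where a: "\<And>n. a n \<in> M" "a \<longlonglongrightarrow> x" by (auto simp: closure_sequential)
  {
    fix y assume "y \<in> closure M"
    then obtain b where b: "\<And>n. b n \<in> M" "b \<longlonglongrightarrow> y" by (auto simp: closure_sequential)
    have "(\<lambda>n. a n + b n) \<longlonglongrightarrow> x + y" by (intro tendsto_intros a b)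
    moreover have "a n + b n \<in> M" for n using a b assms by (auto simp: complex_subspace_def)
    ultimately show "x + y \<in> closure M" unfolding closure_sequential by (intro exI[of _ "\<lambda>n. a n + b n"]) auto
  next
    fix c
    have "(\<lambda>n. c *\<^sub>C a n - c *\<^sub>C x) \<longlonglongrightarrow> 0"
    proof (rule tendsto_norm_zero_cancel)
      have "(\<lambda>n. cmod c * norm (a n - x)) \<longlonglongrightarrow> cmod c * norm (x - x)" by (intro tendsto_intros a)
      thus "(\<lambda>n. norm (c *\<^sub>C a n - c *\<^sub>C x)) \<longlonglongrightarrow> 0"
        by (simp add: scaleC_diff_right[symmetric] norm_scaleC)
    qed
    hence "(\<lambda>n. c *\<^sub>C a n) \<longlonglongrightarrow> c *\<^sub>C x" by (rule Lim_null[THEN iffD2])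
    moreover have "c *\<^sub>C a n \<in> M" for n using a assms by (auto simp: complex_subspace_def)
    ultimately show "c *\<^sub>C x \<in> closure M" unfolding closure_sequential by (intro exI[of _ "\<lambda>n. c *\<^sub>C a n"]) auto
  }
qed

lemma tendsto_zero_scaleC:
  fixes u :: "nat \<Rightarrow> 'a::complex_banach"
  assumes "u \<longlonglongrightarrow> 0" shows "(\<lambda>n. c *\<^sub>C u n) \<longlonglongrightarrow> 0"
proof (rule tendsto_norm_zero_cancel)
  have "(\<lambda>n. cmod c * norm (u n)) \<longlonglongrightarrow> cmod c * norm (0 :: 'a)" by (intro tendsto_intros assms)
  thus "(\<lambda>n. norm (c *\<^sub>C u n)) \<longlonglongrightarrow> 0" by (simp add: norm_scaleC)
qed

text \<open>Orbits of combinations of eigenvectors with small eigenvalues tend to zero, and combinations of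
eigenvectors with large eigenvalues have backward orbits tending to zero. A vector close to a given
\<open>x\<close> whose iterate is close to a given \<open>y\<close> is then obtained by adding to \<open>x\<close> a term of the backward orbit
of \<open>y\<close>. Completeness of the eigenvectors is expressed by closed subspaces, which avoids explicit linear
combinations.\<close>

theorem Godefroy_Shapiro:
  fixes T :: "'a::complex_banach \<Rightarrow> 'a"
  assumes T: "bounded_linear T" and TC: "\<And>c x. T (c *\<^sub>C x) = c *\<^sub>C T x"
    and D: "countable (D :: 'a set)" "closure D = UNIV"
    and small: "\<And>M. closed M \<Longrightarrow> complex_subspace M \<Longrightarrow>
      (\<And>c x. cmod c < 1 \<Longrightarrow> T x = c *\<^sub>C x \<Longrightarrow> x \<in> M) \<Longrightarrow> M = UNIV"
    and large: "\<And>M. closed M \<Longrightarrow> complex_subspace M \<Longrightarrow>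
      (\<And>c x. cmod c > 1 \<Longrightarrow> T x = c *\<^sub>C x \<Longrightarrow> x \<in> M) \<Longrightarrow> M = UNIV"
  shows "hypercyclic T"
proof -
  have Tn_add: "(T ^^ n) (x + y) = (T ^^ n) x + (T ^^ n) y" for n x y
    by (induction n) (auto simp: linear_add[OF bounded_linear.linear[OF T]])
  have Tn_scale: "(T ^^ n) (c *\<^sub>C x) = c *\<^sub>C (T ^^ n) x" for n c x
    by (induction n) (auto simp: TC)
  have zero_left: "0 *\<^sub>C x = 0" for x :: 'a using scaleC_of_real[of 0 x] by simp
  have Tn_zero: "(T ^^ n) 0 = 0" for n using Tn_scale[of n 0 0] by (simp add: zero_left)
  have scale_zero: "c *\<^sub>C 0 = (0 :: 'a)" for c
    using scaleC_add_right[of c 0 "0 :: 'a"] by simp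
  have eig: "(T ^^ n) x = c ^ n *\<^sub>C x" if "T x = c *\<^sub>C x" for n c x
    by (induction n) (auto simp: scaleC_one TC that scaleC_scaleC mult.commute)
  have geometric: "(\<lambda>n. c ^ n *\<^sub>C x) \<longlonglongrightarrow> 0" if "cmod c < 1" for c x
  proof (rule tendsto_norm_zero_cancel)
    have "(\<lambda>n. cmod c ^ n * norm x) \<longlonglongrightarrow> 0 * norm x"
      using that by (intro tendsto_intros LIMSEQ_realpow_zero) auto
    thus "(\<lambda>n. norm (c ^ n *\<^sub>C x)) \<longlonglongrightarrow> 0" by (simp add: norm_scaleC norm_power)
  qed
  \<comment> \<open>the vectors with orbits, respectively backward orbits, tending to zero\<close>
  define X where "X = {x. (\<lambda>n. (T ^^ n) x) \<longlonglongrightarrow> 0}"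
  define Y where "Y = {y. \<exists>u. u \<longlonglongrightarrow> 0 \<and> (\<forall>n. (T ^^ n) (u n) = y)}"
  have "complex_subspace X"
    unfolding complex_subspace_def X_def using tendsto_add_zero tendsto_zero_scaleC
    by (auto simp: Tn_zero Tn_add Tn_scale)
  hence X: "closure X = UNIV"
  proof (intro small closure_complex_subspace)
    fix c x assume "cmod c < 1" "T x = c *\<^sub>C x"
    hence "x \<in> X" by (simp add: X_def eig geometric)
    thus "x \<in> closure X" using closure_subset by blast
  qed auto
  have "complex_subspace Y"
    unfolding complex_subspace_def
  proof (intro conjI ballI allI)
    show "0 \<in> Y" unfolding Y_def using Tn_zero by (auto intro!: exI[of _ "\<lambda>_. 0"])
    fix x assume "x \<in> Y"
    then obtain u where u: "u \<longlonglongrightarrow> 0" "\<And>n. (T ^^ n) (u n) = x" by (auto simp: Y_def)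
    show "c *\<^sub>C x \<in> Y" for c
      unfolding Y_def using tendsto_zero_scaleC[OF u(1)]
      by (auto simp: Tn_scale u(2) intro!: exI[of _ "\<lambda>n. c *\<^sub>C u n"])
    fix y assume "y \<in> Y"
    then obtain w where w: "w \<longlonglongrightarrow> 0" "\<And>n. (T ^^ n) (w n) = y" by (auto simp: Y_def)
    show "x + y \<in> Y"
      unfolding Y_def using tendsto_add_zero[OF u(1) w(1)]
      by (auto simp: Tn_add u(2) w(2) intro!: exI[of _ "\<lambda>n. u n + w n"])
  qed
  hence Y: "closure Y = UNIV"
  proof (intro large closure_complex_subspace)
    fix c x assume c: "cmod c > 1" "T x = c *\<^sub>C x"
    have "(\<lambda>n. (1 / c) ^ n *\<^sub>C x) \<longlonglongrightarrow> 0" using c by (intro geometric) (simp add: norm_divide divide_less_eq_1)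
    moreover have "(T ^^ n) ((1 / c) ^ n *\<^sub>C x) = x" for n
    proof -
      have "(1 / c) ^ n * c ^ n = 1" using c(1) by (auto simp: power_mult_distrib[symmetric])
      thus ?thesis by (simp add: Tn_scale eig[OF c(2)] scaleC_scaleC scaleC_one)
    qed
    ultimately have "x \<in> Y" unfolding Y_def by blast
    thus "x \<in> closure Y" using closure_subset by blast
  qed auto
  have "\<exists>x. closure (range (\<lambda>n. (T ^^ n) x)) = UNIV"
  proof (rule dense_orbit_if_transitive[OF T D])
    fix U V :: "'a set" assume U: "open U" "U \<noteq> {}" and V: "open V" "V \<noteq> {}"
    obtain x where x: "x \<in> U" "x \<in> X"
      using open_Int_closure_eq_empty[OF U(1), of X] X U(2) by auto
    obtain y where y: "y \<in> V" "y \<in> Y"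
      using open_Int_closure_eq_empty[OF V(1), of Y] Y V(2) by auto
    obtain u where u: "u \<longlonglongrightarrow> 0" "\<And>n. (T ^^ n) (u n) = y" using y(2) by (auto simp: Y_def)
    have "(\<lambda>n. x + u n) \<longlonglongrightarrow> x + 0" by (intro tendsto_intros u)
    hence "\<forall>\<^sub>F n in sequentially. x + u n \<in> U" using x(1) U(1) by (auto intro: topological_tendstoD)
    moreover have "(\<lambda>n. (T ^^ n) (x + u n)) \<longlonglongrightarrow> 0 + y"
      unfolding Tn_add u(2) using x(2) by (intro tendsto_add tendsto_const) (simp add: X_def)
    hence "\<forall>\<^sub>F n in sequentially. (T ^^ n) (x + u n) \<in> V" using y(1) V(1) by (auto intro: topological_tendstoD)
    ultimately have "\<forall>\<^sub>F n in sequentially. x + u n \<in> U \<and> (T ^^ n) (x + u n) \<in> V" by (rule eventually_conj)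
    thus "\<exists>n. \<exists>x\<in>U. (T ^^ n) x \<in> V" by (auto simp: eventually_sequentially)
  qed
  thus ?thesis unfolding hypercyclic_def using T TC by blast
qed

text \<open>The polynomials with coefficients in a countable dense set are dense.\<close>

lemma hardy2_separable:
  obtains D :: "hardy2 set" where "countable D" "closure D = UNIV"
proof -
  obtain Q :: "complex set" where Q: "countable Q" "\<And>X. open X \<Longrightarrow> X \<noteq> {} \<Longrightarrow> \<exists>q\<in>Q. q \<in> X"
    using countable_dense_exists by blast
  define D where "D = (\<lambda>xs. \<Sum>n<length xs. (xs ! n) *\<^sub>C hardy_of (\<lambda>z. z ^ n)) ` lists Q"
  have "f \<in> closure D" for f
    unfolding closure_approachable
  proof (intro allI impI)
    fix e :: real assume e: "e > 0"
    obtain m where m: "norm (f - (\<Sum>n<m. taylor_coeff f n *\<^sub>C hardy_of (\<lambda>z. z ^ n))) < e / 2"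
      using taylor_polynomials_tendsto[of "e / 2" f] e by auto
    define d where "d = e / (2 * real (Suc m))"
    have d: "d > 0" using e by (simp add: d_def)
    have "\<exists>q\<in>Q. dist (taylor_coeff f n) q < d" for n
      using Q(2)[of "ball (taylor_coeff f n) d"] d by auto
    then obtain q where q: "\<And>n. q n \<in> Q" "\<And>n. dist (taylor_coeff f n) (q n) < d" by metis
    define g where "g = (\<Sum>n<m. q n *\<^sub>C hardy_of (\<lambda>z. z ^ n))"
    have "g = (\<Sum>n<length (map q [0..<m]). (map q [0..<m] ! n) *\<^sub>C hardy_of (\<lambda>z. z ^ n))"
      by (simp add: g_def)
    moreover have "map q [0..<m] \<in> lists Q" using q(1) by auto
    ultimately have gD: "g \<in> D" unfolding D_def by blast
    have "norm (hardy_of (\<lambda>z. z ^ n)) \<le> 1" for n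
      by (rule norm_hardy_of_le)
         (auto intro!: bounded_holoI[where C = 1] holomorphic_intros simp: norm_power power_le_one)
    hence "norm (taylor_coeff f n *\<^sub>C hardy_of (\<lambda>z. z ^ n) - q n *\<^sub>C hardy_of (\<lambda>z. z ^ n)) \<le> d * 1" for n
    proof -
      have "taylor_coeff f n *\<^sub>C hardy_of (\<lambda>z. z ^ n) - q n *\<^sub>C hardy_of (\<lambda>z. z ^ n)
         = (taylor_coeff f n - q n) *\<^sub>C hardy_of (\<lambda>z. z ^ n)"
        by (rule hardy_eqI) (simp add: taylor_coeff_diff taylor_coeff_scaleC algebra_simps)
      thus ?thesis using q(2)[of n] d \<open>\<And>n. norm (hardy_of (\<lambda>z. z ^ n)) \<le> 1\<close>
        mult_mono[of "cmod (taylor_coeff f n - q n)" d "norm (hardy_of (\<lambda>z. z ^ n))" 1]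
        by (simp add: norm_scaleC dist_norm)
    qed
    hence "norm (\<Sum>n<m. taylor_coeff f n *\<^sub>C hardy_of (\<lambda>z. z ^ n) - q n *\<^sub>C hardy_of (\<lambda>z. z ^ n)) \<le> (\<Sum>n<m. d)"
      by (intro sum_norm_le) simp
    also have "\<dots> \<le> e / 2" using e by (simp add: d_def field_simps)
    finally have "norm ((\<Sum>n<m. taylor_coeff f n *\<^sub>C hardy_of (\<lambda>z. z ^ n)) - g) \<le> e / 2"
      by (simp add: g_def sum_subtractf)
    hence "dist g f < e"
      using m norm_triangle_ineq[of "f - (\<Sum>n<m. taylor_coeff f n *\<^sub>C hardy_of (\<lambda>z. z ^ n))"
          "(\<Sum>n<m. taylor_coeff f n *\<^sub>C hardy_of (\<lambda>z. z ^ n)) - g"]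
      by (simp add: dist_norm norm_minus_commute)
    thus "\<exists>y\<in>D. dist y f < e" using gD by blast
  qed
  moreover have "countable D" unfolding D_def using Q(1) by simp
  ultimately show ?thesis using that by blast
qed

section \<open>Rational functions of negative powers perturbed by the disc algebra\<close>

lemma zorder_mult_nonvanishing:
  assumes "f analytic_on {z}" "g analytic_on {z}" "g z \<noteq> 0" "\<forall>\<^sub>F u in at z. f u \<noteq> 0"
  shows "zorder (\<lambda>u. f u * g u) z = zorder f z"
proof -
  have "isCont g z" using assms(2) analytic_at_imp_isCont by blast
  hence "\<forall>\<^sub>F u in at z. g u \<noteq> 0" using assms(3) by (metis isCont_def tendsto_imp_eventually_ne)
  hence "\<forall>\<^sub>F u in at z. f u * g u \<noteq> 0" using assms(4) by eventually_elim simp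
  from zorder_times_analytic[OF assms(1,2) this]
  show ?thesis using zorder_eq_0I[OF assms(2,3)] by simp
qed

lemma sum_order_eq_degree:
  fixes p :: "complex poly"
  assumes "p \<noteq> 0"
  shows "(\<Sum>z | poly p z = 0. order z p) = degree p"
  using assms size_proots_complex[of p] by (simp add: size_multiset_overloaded_eq)

text \<open>For \<open>m\<close> at least the degree, the reflection \<open>z\<^sup>m * cnj (p (1 / cnj z))\<close> of \<open>p\<close> in the unit circle.\<close>

definition reciprocal_poly :: "nat \<Rightarrow> complex poly \<Rightarrow> complex poly" where
  "reciprocal_poly m p = (\<Sum>i\<le>m. monom (cnj (coeff p i)) (m - i))"

lemma poly_reciprocal_poly:
  assumes "degree p \<le> m" "z \<noteq> 0"
  shows "poly (reciprocal_poly m p) z = z ^ m * cnj (poly p (1 / cnj z))"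
proof -
  have "poly p (1 / cnj z) = (\<Sum>i\<le>m. coeff p i * (1 / cnj z) ^ i)"
    unfolding poly_altdef
    by (rule sum.mono_neutral_left) (use assms in \<open>auto simp: coeff_eq_0\<close>)
  hence "z ^ m * cnj (poly p (1 / cnj z)) = (\<Sum>i\<le>m. cnj (coeff p i) * (z ^ m * (1 / z) ^ i))"
    by (simp add: sum_distrib_left mult_ac)
  also have "\<dots> = (\<Sum>i\<le>m. cnj (coeff p i) * z ^ (m - i))"
    using assms(2) by (intro sum.cong) (auto simp: power_diff power_one_over divide_simps)
  finally show ?thesis by (simp add: reciprocal_poly_def poly_sum poly_monom)
qed

lemma poly_reciprocal_poly_0: "poly (reciprocal_poly m p) 0 = cnj (coeff p m)"
proof -
  have "poly (reciprocal_poly m p) 0 = (\<Sum>i\<le>m. if i = m then cnj (coeff p m) else 0)"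
    unfolding reciprocal_poly_def poly_sum poly_monom by (intro sum.cong) auto
  thus ?thesis by simp
qed

text \<open>The mean value property: the Taylor series converges absolutely on the circle, and all its terms but the
first have mean zero.\<close>

lemma circle_mean_holomorphic:
  assumes H: "H holomorphic_on ball 0 \<rho>" and \<rho>: "\<rho> > 1"
  shows "circle_mean H = H 0"
proof -
  define c where "c = (\<lambda>n. (deriv ^^ n) H 0 / fact n)"
  have s: "(\<lambda>n. c n * z ^ n) sums H z" if "z \<in> ball 0 \<rho>" for z
    using holomorphic_power_series[OF H that] by (simp add: c_def)
  define t where "t = (1 + \<rho>) / 2"
  have t: "1 < t" "t < \<rho>" using \<rho> by (auto simp: t_def)
  have "summable (\<lambda>n. c n * of_real t ^ n)" using s[of "of_real t"] t by (auto simp: sums_iff)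
  from powser_insidea[OF this, of 1] have "summable (\<lambda>n. cmod (c n))" using t by simp
  from power_series_circle(5)[OF this, of 0]
  have "circle_mean (\<lambda>\<zeta>. \<Sum>n. c n * \<zeta> ^ n) = c 0" by simp
  moreover have "circle_mean (\<lambda>\<zeta>. \<Sum>n. c n * \<zeta> ^ n) = circle_mean H"
    by (rule Bochner_Integration.integral_cong) (use s \<rho> in \<open>auto simp: sums_iff\<close>)
  ultimately show ?thesis by (simp add: c_def)
qed

text \<open>On the circle the conjugate of the integrand is \<open>\<zeta>\<^bsup>n+1\<^esup>\<close> times the quotient of the reflections of \<open>p\<close> and
\<open>Q\<close>, which is holomorphic across the closed disc and vanishes at the origin. The surplus factor \<open>\<zeta>\<close>
comes from the degree of \<open>p\<close> being smaller than that of \<open>Q\<close>.\<close>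

lemma proper_fraction_antianalytic:
  fixes p Q :: "complex poly"
  assumes Q: "\<And>z. poly Q z = 0 \<Longrightarrow> cmod z < 1" and p: "degree p < degree Q"
  shows "circle_mean (\<lambda>\<zeta>. poly p \<zeta> / poly Q \<zeta> * cnj (\<zeta> ^ n)) = 0"
proof -
  define N where "N = degree Q"
  define a b where "a = reciprocal_poly (N - 1) p" and "b = reciprocal_poly N Q"
  have N: "N > 0" using p by (simp add: N_def)
  have b0: "poly b z \<noteq> 0" if "cmod z \<le> 1" for z
  proof (cases "z = 0")
    case True
    thus ?thesis using p by (auto simp: b_def poly_reciprocal_poly_0 N_def)
  next
    case False
    have "1 \<le> cmod (1 / cnj z)" using that False by (simp add: norm_divide)
    hence "poly Q (1 / cnj z) \<noteq> 0" using Q[of "1 / cnj z"] by linarith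
    thus ?thesis using False by (simp add: b_def poly_reciprocal_poly N_def)
  qed
  have "b \<noteq> 0" using b0[of 0] by auto
  hence fin: "finite {z. poly b z = 0}" by (rule poly_roots_finite)
  \<comment> \<open>the number 2 is a default in case that b has no zeros\<close>
  define \<rho> where "\<rho> = Min (insert 2 (cmod ` {z. poly b z = 0}))"
  have \<rho>1: "\<rho> > 1" 
    unfolding \<rho>_def using fin b0 by (subst Min_gr_iff) (auto simp: not_le[symmetric])
  have \<rho>b: "poly b z \<noteq> 0" if "z \<in> ball 0 \<rho>" for z
  proof
    assume "poly b z = 0"
    hence "\<rho> \<le> cmod z" unfolding \<rho>_def using fin by (intro Min_le) auto
    thus False using that by simp
  qed
  define H where "H = (\<lambda>z. z ^ Suc n * poly a z / poly b z)"
  have "circle_mean H = H 0"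
    by (rule circle_mean_holomorphic[OF _ \<rho>1]) (use \<rho>b in \<open>auto simp: H_def intro!: holomorphic_intros\<close>)
  moreover have "circle_mean (\<lambda>\<zeta>. poly p \<zeta> / poly Q \<zeta> * cnj (\<zeta> ^ n)) = circle_mean (\<lambda>\<zeta>. cnj (H \<zeta>))"
  proof (rule Bochner_Integration.integral_cong)
    fix \<zeta> assume "\<zeta> \<in> space circle_measure"
    hence z: "\<zeta> \<noteq> 0" and "\<zeta> * cnj \<zeta> = 1" using complex_norm_square[of \<zeta>] by auto
    hence z: "\<zeta> \<noteq> 0" "1 / cnj \<zeta> = \<zeta>" by (auto simp: divide_eq_eq)
    have A: "poly a \<zeta> = \<zeta> ^ (N - 1) * cnj (poly p \<zeta>)"
      unfolding a_def using poly_reciprocal_poly[of p "N - 1" \<zeta>] z p by (simp add: N_def)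
    have B: "poly b \<zeta> = \<zeta> ^ N * cnj (poly Q \<zeta>)"
      unfolding b_def using poly_reciprocal_poly[of Q N \<zeta>] z by (simp add: N_def)
    have "\<zeta> ^ N = \<zeta> ^ (N - 1) * \<zeta>" using N by (metis Suc_diff_1 power_Suc2)
    hence "H \<zeta> = \<zeta> ^ n * cnj (poly p \<zeta>) / cnj (poly Q \<zeta>)"
      unfolding H_def A B using z(1) by simp
    thus "poly p \<zeta> / poly Q \<zeta> * cnj (\<zeta> ^ n) = cnj (H \<zeta>)" by simp
  qed simp
  moreover have "circle_mean (\<lambda>\<zeta>. cnj (H \<zeta>)) = cnj (circle_mean H)"
    by (rule Bochner_Integration.integral_cnj)
  ultimately show ?thesis by (simp add: H_def)
qed

text \<open>The symbol \<open>R (1 / z) + \<phi> z\<close> after reduction of \<open>R (1 / z)\<close> to a quotient of coprime polynomials. The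
number of solutions is the degree of the denominator.\<close>

locale rational_perturbation =
  fixes A Q :: "complex poly" and \<phi> \<Phi> :: "complex \<Rightarrow> complex"
  assumes Q: "poly Q z = 0 \<Longrightarrow> cmod z < 1"
    and AQ: "poly Q z = 0 \<Longrightarrow> poly A z \<noteq> 0"
    and \<phi>: "\<phi> \<in> disc_algebra"
    and \<Phi>: "cmod z \<le> 1 \<Longrightarrow> poly Q z \<noteq> 0 \<Longrightarrow> \<Phi> z = poly A z / poly Q z + \<phi> z"
    and valence: "w \<in> \<Phi> ` (cball 0 1 - poles \<Phi>) \<Longrightarrow> exactly_n_solutions \<Phi> w (degree Q)"
begin

lemma Q_nonzero: "Q \<noteq> 0" using Q[of 1] by auto

lemma \<phi>_cont: "continuous_on (cball 0 1) \<phi>" and \<phi>_hol: "\<phi> holomorphic_on ball 0 1"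
  using \<phi> by (auto simp: disc_algebra_def)

lemma \<Phi>_continuous: "continuous_on (cball 0 1 - {z. poly Q z = 0}) \<Phi>"
proof -
  have "continuous_on (cball 0 1 - {z. poly Q z = 0}) (\<lambda>z. poly A z / poly Q z + \<phi> z)"
    by (intro continuous_intros continuous_on_subset[OF \<phi>_cont]) auto
  thus ?thesis by (rule continuous_on_eq) (auto simp: \<Phi>)
qed

lemma \<Phi>_holomorphic: "\<Phi> holomorphic_on ball 0 1 - {z. poly Q z = 0}"
proof -
  have "(\<lambda>z. poly A z / poly Q z + \<phi> z) holomorphic_on ball 0 1 - {z. poly Q z = 0}"
    by (intro holomorphic_intros holomorphic_on_subset[OF \<phi>_hol]) auto
  thus ?thesis by (rule holomorphic_transform) (auto simp: \<Phi>)
qed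

lemma open_regular: "open (ball 0 1 - {z. poly Q z = 0})"
  using poly_roots_finite[OF Q_nonzero] by (intro open_Diff finite_imp_closed) auto

lemma poles_eq: "poles \<Phi> = {z. poly Q z = 0}"
proof (intro set_eqI iffI)
  fix z assume z: "z \<in> poles \<Phi>"
  show "z \<in> {z. poly Q z = 0}"
  proof (rule ccontr)
    assume "z \<notin> {z. poly Q z = 0}"
    hence "z \<in> ball 0 1 - {z. poly Q z = 0}" using z by (auto simp: poles_def)
    hence "\<not> is_pole \<Phi> z" by (rule not_is_pole_holomorphic[OF open_regular _ \<Phi>_holomorphic])
    thus False using z by (simp add: poles_def)
  qed
next
  fix z assume "z \<in> {z. poly Q z = 0}"
  hence z: "poly Q z = 0" "z \<in> ball 0 1" using Q by auto
  have \<phi>z: "isCont \<phi> z"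
    using \<phi>_hol z(2) by (meson continuous_on_eq_continuous_at holomorphic_on_imp_continuous_on open_ball)
  have nz: "\<forall>\<^sub>F u in at z. poly Q u \<noteq> 0"
    using poly_roots_finite[OF Q_nonzero] islimpt_finite[of "{u. poly Q u = 0}" z]
    by (auto simp: islimpt_conv_frequently_at frequently_def)
  have "is_pole (\<lambda>u. (poly A u + \<phi> u * poly Q u) / poly Q u) z"
  proof (rule is_pole_divide)
    show "isCont (\<lambda>u. poly A u + \<phi> u * poly Q u) z" using \<phi>z by (intro continuous_intros) auto
    have "poly Q \<midarrow>z\<rightarrow> 0" using poly_isCont[where p = Q and x = z] z(1) by (simp add: isCont_def)
    thus "filterlim (poly Q) (at 0) (at z)" using nz by (simp add: filterlim_at)
    show "poly A z + \<phi> z * poly Q z \<noteq> 0" using AQ z(1) by simp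
  qed
  moreover have "\<forall>\<^sub>F u in at z. u \<in> ball 0 1" using z(2) by (intro eventually_at_in_open') auto
  hence "\<forall>\<^sub>F u in at z. (poly A u + \<phi> u * poly Q u) / poly Q u = \<Phi> u"
    using nz by eventually_elim (simp add: \<Phi> add_divide_distrib)
  hence "is_pole (\<lambda>u. (poly A u + \<phi> u * poly Q u) / poly Q u) z \<longleftrightarrow> is_pole \<Phi> z" by (rule is_pole_cong[OF _ refl])
  ultimately have "is_pole \<Phi> z" by blast
  thus "z \<in> poles \<Phi>" using z(2) by (simp add: poles_def)
qed

text \<open>The value at the point \<open>1\<close> of the circle has at least the solution \<open>1\<close>, which counts once.\<close>

lemma degree_pos: "degree Q > 0"
proof -
  have 1: "poly Q 1 \<noteq> 0" using Q[of 1] by auto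
  hence "\<Phi> 1 \<in> \<Phi> ` (cball 0 1 - poles \<Phi>)" by (auto simp: poles_eq)
  hence "exactly_n_solutions \<Phi> (\<Phi> 1) (degree Q)" by (rule valence)
  hence *: "finite {z \<in> cball 0 1 - poles \<Phi>. \<Phi> z = \<Phi> 1}"
      "(\<Sum>z\<in>{z \<in> cball 0 1 - poles \<Phi>. \<Phi> z = \<Phi> 1}. solution_mult \<Phi> (\<Phi> 1) z) = degree Q"
    by (auto simp: exactly_n_solutions_def)
  have "solution_mult \<Phi> (\<Phi> 1) 1 \<le> degree Q"
    unfolding *(2)[symmetric] by (rule member_le_sum) (use 1 *(1) in \<open>auto simp: poles_eq\<close>)
  thus ?thesis by (simp add: solution_mult_def)
qed

lemma image_in_closure:
  assumes "cmod z \<le> 1" "poly Q z \<noteq> 0"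
  shows "\<Phi> z \<in> closure (\<Phi> ` (ball 0 1 - poles \<Phi>))"
proof -
  have "z islimpt ball 0 1" using assms(1) by (simp add: islimpt_ball)
  moreover have "ball 0 1 = {u. poly Q u = 0} \<union> (ball 0 1 - poles \<Phi>)" unfolding poles_eq using Q by auto
  ultimately have "z islimpt ball 0 1 - poles \<Phi>"
    using islimpt_Un_finite[OF poly_roots_finite[OF Q_nonzero]] by metis
  then obtain x where x: "\<And>n. x n \<in> ball 0 1 - poles \<Phi>" "x \<longlonglongrightarrow> z"
    by (auto simp: islimpt_sequential)
  have "(\<lambda>n. \<Phi> (x n)) \<longlonglongrightarrow> \<Phi> z"
    by (rule continuous_on_tendsto_compose[OF \<Phi>_continuous x(2)])
       (use assms x(1) in \<open>auto simp: poles_eq less_imp_le\<close>)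
  thus ?thesis unfolding closure_sequential using x(1) by (intro exI[of _ "\<lambda>n. \<Phi> (x n)"]) auto
qed

text \<open>The function \<open>Q (\<Phi> - c)\<close>, with its singularities at the zeros of \<open>Q\<close> removed.\<close>

definition cleared :: "complex \<Rightarrow> complex \<Rightarrow> complex" where
  "cleared c z = poly A z + (\<phi> z - c) * poly Q z"

lemma cleared_cont: "continuous_on (cball 0 1) (cleared c)" and cleared_hol: "cleared c holomorphic_on ball 0 1"
  unfolding cleared_def by (intro continuous_intros holomorphic_intros \<phi>_cont \<phi>_hol)+

lemma cleared_eq: "cmod z \<le> 1 \<Longrightarrow> poly Q z \<noteq> 0 \<Longrightarrow> cleared c z = poly Q z * (\<Phi> z - c)"
  by (simp add: \<Phi> cleared_def algebra_simps)

lemma cleared_nonzero: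
  assumes "c \<notin> closure (\<Phi> ` (ball 0 1 - poles \<Phi>))" "cmod z \<le> 1"
  shows "cleared c z \<noteq> 0"
proof (cases "poly Q z = 0")
  case True thus ?thesis using AQ by (simp add: cleared_def)
next
  case False
  thus ?thesis using assms image_in_closure[of z] by (auto simp: cleared_eq)
qed

text \<open>The function is \<open>1 / (\<Phi> - c)\<close>. Its zeros are the poles of \<open>\<Phi>\<close>, whose multiplicities add up to the degree
of \<open>Q\<close>. A value \<open>w \<noteq> 0\<close> is taken where \<open>\<Phi>\<close> takes the value \<open>c + 1 / w\<close>, with the same multiplicity.\<close>

lemma resolvent_exact_valence:
  assumes c: "c \<notin> closure (\<Phi> ` (ball 0 1 - poles \<Phi>))"
  shows "exact_valence (\<lambda>z. poly Q z / cleared c z) (degree Q)"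
proof -
  define v where "v = (\<lambda>z. poly Q z / cleared c z)"
  have nz: "cleared c z \<noteq> 0" if "cmod z \<le> 1" for z by (rule cleared_nonzero[OF c that])
  have vcont: "continuous_on (cball 0 1) v" unfolding v_def using nz by (intro continuous_intros cleared_cont) auto
  have vhol: "v holomorphic_on ball 0 1" unfolding v_def using nz by (intro holomorphic_intros cleared_hol) auto
  have "finite {z \<in> cball 0 1. v z = w} \<and> (\<Sum>z\<in>{z \<in> cball 0 1. v z = w}. solution_mult v w z) = degree Q"
    if w: "w \<in> v ` cball 0 1" for w
  proof (cases "w = 0")
    case True
    have fib: "{z \<in> cball 0 1. v z = w} = {z. poly Q z = 0}"
      using nz Q True by (force simp: v_def less_imp_le)
    have "solution_mult v w z = order z Q" if z: "poly Q z = 0" for z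
    proof -
      obtain q where q: "Q = [:-z, 1:] ^ order z Q * q" "\<not> [:-z, 1:] dvd q"
        using order_decomp[OF Q_nonzero] by blast
      have "zorder (\<lambda>u. v u - w) z = int (order z Q)"
      proof (rule zorder_eqI[of "ball 0 1" z "\<lambda>u. poly q u / cleared c u"])
        show "z \<in> ball 0 1" using Q[OF z] by simp
        show "(\<lambda>u. poly q u / cleared c u) holomorphic_on ball 0 1" using nz by (intro holomorphic_intros cleared_hol) auto
        show "poly q z / cleared c z \<noteq> 0" using q(2) nz[of z] Q[OF z] by (auto simp: poly_eq_0_iff_dvd)
        fix u assume "u \<in> ball 0 1" "u \<noteq> z"
        show "v u - w = poly q u / cleared c u * (u - z) powi int (order z Q)"
          using arg_cong[OF q(1), of "\<lambda>p. poly p u"] True by (simp add: v_def)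
      qed auto
      thus ?thesis using Q[OF z] by (simp add: solution_mult_def)
    qed
    thus ?thesis unfolding fib using poly_roots_finite[OF Q_nonzero] sum_order_eq_degree[OF Q_nonzero] by simp
  next
    case False
    define b where "b = c + 1 / w"
    have iff: "v z = w \<longleftrightarrow> poly Q z \<noteq> 0 \<and> \<Phi> z = b" if z: "cmod z \<le> 1" for z
    proof (cases "poly Q z = 0")
      case True thus ?thesis using False by (simp add: v_def)
    next
      case Q0: False
      have "\<Phi> z - c \<noteq> 0" using nz[OF z] by (auto simp: cleared_eq[OF z Q0])
      moreover have "v z = 1 / (\<Phi> z - c)" using Q0 unfolding v_def cleared_eq[OF z Q0] by simp
      moreover have "1 / (\<Phi> z - c) = w \<longleftrightarrow> \<Phi> z = b" if "\<Phi> z - c \<noteq> 0"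
        using that False unfolding b_def by (auto simp: field_simps)
      ultimately show ?thesis using Q0 by simp
    qed
    have fib: "{z \<in> cball 0 1. v z = w} = {z \<in> cball 0 1 - poles \<Phi>. \<Phi> z = b}"
      using iff by (auto simp: poles_eq)
    have "b \<in> \<Phi> ` (cball 0 1 - poles \<Phi>)"
    proof -
      obtain z where "z \<in> cball 0 1" "v z = w" using w by auto
      hence "z \<in> cball 0 1 - poles \<Phi>" "\<Phi> z = b" using fib by auto
      thus ?thesis by blast
    qed
    hence ex: "finite {z \<in> cball 0 1 - poles \<Phi>. \<Phi> z = b}"
      "(\<Sum>z\<in>{z \<in> cball 0 1 - poles \<Phi>. \<Phi> z = b}. solution_mult \<Phi> b z) = degree Q"
      using valence[of b] by (auto simp: exactly_n_solutions_def)
    have "solution_mult v w z = solution_mult \<Phi> b z" if z: "z \<in> cball 0 1 - poles \<Phi>" "\<Phi> z = b" for z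
    proof (cases "z \<in> ball 0 1")
      case True
      have zr: "z \<in> ball 0 1 - {z. poly Q z = 0}" using True z(1) by (simp add: poles_eq)
      have ev: "\<forall>\<^sub>F u in at z. u \<in> ball 0 1 - {z. poly Q z = 0}"
        by (rule eventually_at_in_open'[OF open_regular zr])
      have "\<forall>\<^sub>F u in at z. u \<notin> {z \<in> cball 0 1 - poles \<Phi>. \<Phi> z = b}"
        using islimpt_finite[OF ex(1), of z] by (simp add: islimpt_conv_frequently_at frequently_def)
      hence ne: "\<forall>\<^sub>F u in at z. \<Phi> u - b \<noteq> 0" using ev by eventually_elim (auto simp: poles_eq)
      have "zorder (\<lambda>u. v u - w) z = zorder (\<lambda>u. (\<Phi> u - b) * (- w * v u)) z"
      proof (rule zorder_cong[OF _ refl])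
        show "\<forall>\<^sub>F u in at z. v u - w = (\<Phi> u - b) * (- w * v u)"
          using ev
        proof eventually_elim
          case (elim u)
          hence u: "cmod u \<le> 1" "poly Q u \<noteq> 0" by auto
          have "\<Phi> u - c \<noteq> 0" using nz[OF u(1)] by (auto simp: cleared_eq[OF u])
          thus ?case using u False unfolding v_def b_def cleared_eq[OF u] by (simp add: field_simps)
        qed
      qed
      also have "\<dots> = zorder (\<lambda>u. \<Phi> u - b) z"
      proof (rule zorder_mult_nonvanishing[OF _ _ _ ne])
        show "(\<lambda>u. \<Phi> u - b) analytic_on {z}"
          using \<Phi>_holomorphic open_regular zr by (intro analytic_intros) (auto simp: analytic_at)
        have "v analytic_on {z}" using vhol True by (metis analytic_at open_ball)
        thus "(\<lambda>u. - w * v u) analytic_on {z}" by (intro analytic_intros)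
        have "v z = w" using iff[of z] z by (auto simp: poles_eq)
        thus "- w * v z \<noteq> 0" using False by simp
      qed
      finally show ?thesis by (simp add: solution_mult_def)
    qed (simp add: solution_mult_def)
    thus ?thesis unfolding fib using ex by simp
  qed
  thus ?thesis using vcont vhol unfolding exact_valence_def v_def by blast
qed

lemma \<Phi>_continuous_sphere: "continuous_on (sphere 0 1) \<Phi>"
  by (rule continuous_on_subset[OF \<Phi>_continuous]) (use Q in force)

lemma eigenvector:
  assumes c: "c \<notin> closure (\<Phi> ` (ball 0 1 - poles \<Phi>))" and p: "degree p < degree Q"
  shows "toeplitz \<Phi> (hardy_of (\<lambda>z. poly p z / cleared c z)) = c *\<^sub>C hardy_of (\<lambda>z. poly p z / cleared c z)"
proof (rule toeplitz_eigenvector[OF \<Phi>_continuous_sphere, of "\<lambda>z. poly p z / cleared c z" _ "\<lambda>z. poly p z / poly Q z"])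
  have nz: "cleared c z \<noteq> 0" if "cmod z \<le> 1" for z by (rule cleared_nonzero[OF c that])
  show F: "continuous_on (cball 0 1) (\<lambda>z. poly p z / cleared c z)" using nz by (intro continuous_intros cleared_cont) auto
  have "(\<lambda>z. poly p z / cleared c z) holomorphic_on ball 0 1" using nz by (intro holomorphic_intros cleared_hol) auto
  hence "bounded_holo (\<lambda>z. poly p z / cleared c z)" using F by (intro bounded_holo_disc_algebra)
  thus "hardy_fun (hardy_of (\<lambda>z. poly p z / cleared c z)) z = poly p z / cleared c z" if "z \<in> ball 0 1" for z
    using that by (rule hardy_of_fun)
  have Q1: "poly Q z \<noteq> 0" if "cmod z = 1" for z using Q[of z] that by auto
  thus "continuous_on (sphere 0 1) (\<lambda>z. poly p z / poly Q z)" by (intro continuous_intros) auto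
  show "\<Phi> z * (poly p z / cleared c z) = c * (poly p z / cleared c z) + poly p z / poly Q z" if z: "cmod z = 1" for z
  proof -
    have zz: "cmod z \<le> 1" using z by simp
    have "\<Phi> z - c \<noteq> 0" using nz[OF zz] by (auto simp: cleared_eq[OF zz Q1[OF z]])
    thus ?thesis unfolding cleared_eq[OF zz Q1[OF z]] using Q1[OF z] by (simp add: field_simps)
  qed
  show "circle_mean (\<lambda>z. poly p z / poly Q z * cnj (z ^ n)) = 0" for n
    by (rule proper_fraction_antianalytic[OF Q p])
qed

text \<open>For eigenvalues \<open>c + \<mu>\<close> near a point \<open>c\<close> the eigenvectors form a resolvent family of the function
\<open>1 / (\<Phi> - c)\<close>.\<close>

theorem eigenvectors_complete:
  assumes W: "open W" "W \<inter> - closure (\<Phi> ` (ball 0 1 - poles \<Phi>)) \<noteq> {}"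
    and M: "closed M" "complex_subspace M"
    and eig: "\<And>c x. c \<in> W \<Longrightarrow> toeplitz \<Phi> x = c *\<^sub>C x \<Longrightarrow> x \<in> M"
  shows "M = UNIV"
proof -
  obtain c where c: "c \<in> W" "c \<notin> closure (\<Phi> ` (ball 0 1 - poles \<Phi>))" using W(2) by blast
  have "open (W - closure (\<Phi> ` (ball 0 1 - poles \<Phi>)))" using W(1) by (intro open_Diff) auto
  then obtain e where e: "e > 0" "ball c e \<subseteq> W - closure (\<Phi> ` (ball 0 1 - poles \<Phi>))"
    using c openE by (metis DiffI)
  show ?thesis
  proof (rule exact_valence.resolvent_family_complete[OF resolvent_exact_valence[OF c(2)] degree_pos cleared_cont cleared_hol _ M e(1)])
    show "cleared c z \<noteq> 0" if "z \<in> cball 0 1" for z using cleared_nonzero[OF c(2)] that by simp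
    fix \<mu> and p :: "complex poly" assume \<mu>: "cmod \<mu> < e" and p: "degree p < degree Q"
    have "c + \<mu> \<in> ball c e" using \<mu> by (simp add: dist_norm)
    hence c\<mu>: "c + \<mu> \<in> W" "c + \<mu> \<notin> closure (\<Phi> ` (ball 0 1 - poles \<Phi>))" using e(2) by auto
    have "hardy_of (\<lambda>z. poly p z / (cleared c z * (1 - \<mu> * (poly Q z / cleared c z)))) = hardy_of (\<lambda>z. poly p z / cleared (c + \<mu>) z)"
    proof (rule hardy_of_cong)
      fix z :: complex assume "z \<in> ball 0 1"
      hence "cleared c z \<noteq> 0" using cleared_nonzero[OF c(2)] by simp
      hence "cleared c z * (1 - \<mu> * (poly Q z / cleared c z)) = cleared (c + \<mu>) z"
        by (simp add: field_simps) (simp add: cleared_def algebra_simps)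
      thus "poly p z / (cleared c z * (1 - \<mu> * (poly Q z / cleared c z))) = poly p z / cleared (c + \<mu>) z" by simp
    qed
    thus "hardy_of (\<lambda>z. poly p z / (cleared c z * (1 - \<mu> * (poly Q z / cleared c z)))) \<in> M"
      using eig[OF c\<mu>(1) eigenvector[OF c\<mu>(2) p]] by simp
  qed
qed

theorem toeplitz_hypercyclic:
  assumes "ball 0 1 \<inter> - closure (\<Phi> ` (ball 0 1 - poles \<Phi>)) \<noteq> {}"
    and "- cball 0 1 \<inter> - closure (\<Phi> ` (ball 0 1 - poles \<Phi>)) \<noteq> {}"
  shows "hypercyclic (toeplitz \<Phi>)"
proof -
  obtain S :: "hardy2 set" where S: "countable S" "closure S = UNIV" by (rule hardy2_separable)
  show ?thesis
  proof (rule Godefroy_Shapiro[OF _ _ S])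
    show "bounded_linear (toeplitz \<Phi>)" by (rule bounded_linear_toeplitz[OF \<Phi>_continuous_sphere])
    show "toeplitz \<Phi> (c *\<^sub>C x) = c *\<^sub>C toeplitz \<Phi> x" for c x by (rule toeplitz_scaleC[OF \<Phi>_continuous_sphere])
    fix M :: "hardy2 set" assume M: "closed M" "complex_subspace M"
    show "M = UNIV" if "\<And>c x. cmod c < 1 \<Longrightarrow> toeplitz \<Phi> x = c *\<^sub>C x \<Longrightarrow> x \<in> M"
      by (rule eigenvectors_complete[OF open_ball assms(1) M]) (use that in auto)
    show "M = UNIV" if "\<And>c x. cmod c > 1 \<Longrightarrow> toeplitz \<Phi> x = c *\<^sub>C x \<Longrightarrow> x \<in> M"
    proof (rule eigenvectors_complete[OF _ assms(2) M])
      fix c x assume "c \<in> - cball 0 1" "toeplitz \<Phi> x = c *\<^sub>C x"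
      thus "x \<in> M" using that[of c x] by simp
    qed auto
  qed
qed

end

section \<open>Partial fractions at the reciprocal point\<close>

definition pole_poly :: "(nat \<Rightarrow> complex) \<Rightarrow> (nat \<Rightarrow> nat) \<Rightarrow> nat set \<Rightarrow> complex poly" where
  "pole_poly \<eta> k I = (\<Prod>l\<in>I. [:- (1 / \<eta> l), 1:] ^ k l)"

lemma poly_pole_poly: "poly (pole_poly \<eta> k I) z = (\<Prod>l\<in>I. (z - 1 / \<eta> l) ^ k l)"
  by (simp add: pole_poly_def poly_prod)

text \<open>The numerator of the partial fraction decomposition evaluated at \<open>1 / z\<close>, over the denominator
\<open>z\<^bsup>degree P\<^esup>\<close> times the polynomial with zeros at the points \<open>1 / \<eta> l\<close>.\<close>

definition reciprocal_numerator ::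
    "complex poly \<Rightarrow> (nat \<Rightarrow> complex) \<Rightarrow> (nat \<Rightarrow> nat) \<Rightarrow> (nat \<Rightarrow> nat \<Rightarrow> complex) \<Rightarrow> nat set \<Rightarrow> complex poly" where
  "reciprocal_numerator P \<eta> k \<alpha> I = reflect_poly P * pole_poly \<eta> k I +
     (\<Sum>l\<in>I. \<Sum>j=1..k l. monom (\<alpha> l j * (- 1 / \<eta> l) ^ j) (j + degree P) *
        ([:- (1 / \<eta> l), 1:] ^ (k l - j) * pole_poly \<eta> k (I - {l})))"

lemma reciprocal_partial_fractions:
  assumes I: "finite I" and \<eta>: "\<And>l. l \<in> I \<Longrightarrow> \<eta> l \<noteq> 0" and z: "z \<noteq> 0" "\<And>l. l \<in> I \<Longrightarrow> k l \<ge> 1 \<Longrightarrow> z \<noteq> 1 / \<eta> l"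
  shows "poly (reciprocal_numerator P \<eta> k \<alpha> I) z / poly (monom 1 (degree P) * pole_poly \<eta> k I) z
     = poly P (1 / z) + (\<Sum>l\<in>I. \<Sum>j=1..k l. \<alpha> l j / (1 / z - \<eta> l) ^ j)"
proof -
  define B where "B = poly (pole_poly \<eta> k I) z"
  define m where "m = degree P"
  have B0: "B \<noteq> 0"
  proof -
    have "(z - 1 / \<eta> l) ^ k l \<noteq> 0" if "l \<in> I" for l using z(2)[OF that] by (cases "k l") auto
    thus ?thesis unfolding B_def poly_pole_poly using I by (simp add: prod_zero_iff)
  qed
  have split: "B = (z - 1 / \<eta> l) ^ k l * poly (pole_poly \<eta> k (I - {l})) z" if "l \<in> I" for l
    unfolding B_def poly_pole_poly by (rule prod.remove[OF I that])
  have P: "poly (reflect_poly P) z = z ^ m * poly P (1 / z)"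
    using poly_reflect_poly_nz[OF z(1), of P] by (simp add: m_def inverse_eq_divide)
  have summand: "\<alpha> l j * (- 1 / \<eta> l) ^ j * z ^ (j + m) * ((z - 1 / \<eta> l) ^ (k l - j) * poly (pole_poly \<eta> k (I - {l})) z)
     = z ^ m * B * (\<alpha> l j / (1 / z - \<eta> l) ^ j)" if l: "l \<in> I" and j: "j \<in> {1..k l}" for l j
  proof -
    define u where "u = z - 1 / \<eta> l"
    have u0: "u \<noteq> 0" using z(2)[OF l] j by (auto simp: u_def)
    have "1 / z - \<eta> l = - \<eta> l * u / z" using z(1) \<eta>[OF l] by (simp add: u_def field_simps)
    hence "1 / (1 / z - \<eta> l) = (- 1 / \<eta> l) * z / u" using z(1) \<eta>[OF l] u0 by simp
    moreover have "\<alpha> l j / (1 / z - \<eta> l) ^ j = \<alpha> l j * (1 / (1 / z - \<eta> l)) ^ j" by (simp add: power_one_over)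
    ultimately have "\<alpha> l j / (1 / z - \<eta> l) ^ j = \<alpha> l j * ((- 1 / \<eta> l) * z / u) ^ j" by simp
    also have "\<dots> = \<alpha> l j * (- 1 / \<eta> l) ^ j * z ^ j / u ^ j"
      by (simp only: power_divide power_mult_distrib times_divide_eq_right times_divide_eq_left mult.assoc)
    finally have E: "\<alpha> l j / (1 / z - \<eta> l) ^ j = \<alpha> l j * (- 1 / \<eta> l) ^ j * z ^ j / u ^ j" .
    have "u ^ k l = u ^ (k l - j) * u ^ j" using j by (simp add: power_add[symmetric])
    thus ?thesis unfolding E split[OF l] u_def[symmetric] using u0 by (simp add: power_add mult_ac)
  qed
  have "poly (reciprocal_numerator P \<eta> k \<alpha> I) z
     = z ^ m * poly P (1 / z) * B + (\<Sum>l\<in>I. \<Sum>j=1..k l. z ^ m * B * (\<alpha> l j / (1 / z - \<eta> l) ^ j))"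
  proof -
    have "(\<Sum>l\<in>I. \<Sum>j=1..k l. poly (monom (\<alpha> l j * (- 1 / \<eta> l) ^ j) (j + degree P) *
        ([:- (1 / \<eta> l), 1:] ^ (k l - j) * pole_poly \<eta> k (I - {l}))) z)
      = (\<Sum>l\<in>I. \<Sum>j=1..k l. z ^ m * B * (\<alpha> l j / (1 / z - \<eta> l) ^ j))"
    proof (intro sum.cong refl)
      fix l j assume "l \<in> I" "j \<in> {1..k l}"
      from summand[OF this] show "poly (monom (\<alpha> l j * (- 1 / \<eta> l) ^ j) (j + degree P) *
        ([:- (1 / \<eta> l), 1:] ^ (k l - j) * pole_poly \<eta> k (I - {l}))) z
        = z ^ m * B * (\<alpha> l j / (1 / z - \<eta> l) ^ j)"
        by (simp add: poly_monom m_def)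
    qed
    thus ?thesis unfolding reciprocal_numerator_def poly_add poly_mult poly_sum P B_def by simp
  qed
  also have "\<dots> = z ^ m * B * (poly P (1 / z) + (\<Sum>l\<in>I. \<Sum>j=1..k l. \<alpha> l j / (1 / z - \<eta> l) ^ j))"
    by (simp add: sum_distrib_left distrib_left mult_ac)
  finally show ?thesis using z(1) B0 by (simp add: poly_monom m_def B_def)
qed

text \<open>At a zero of the denominator all summands but one vanish: at \<open>0\<close> the summand of the polynomial part
remains, and at \<open>1 / \<eta> l\<close> the summand with the highest power of the pole \<open>\<eta> l\<close>.\<close>

lemma reciprocal_numerator_nonzero:
  assumes I: "finite I" and \<eta>: "\<And>l. l \<in> I \<Longrightarrow> \<eta> l \<noteq> 0" "inj_on \<eta> I"
    and k: "\<And>l. l \<in> I \<Longrightarrow> k l \<ge> 1 \<and> \<alpha> l (k l) \<noteq> 0"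
    and z: "poly (monom 1 (degree P) * pole_poly \<eta> k I) z = 0"
  shows "poly (reciprocal_numerator P \<eta> k \<alpha> I) z \<noteq> 0"
proof (cases "z = 0")
  case True
  have B0: "poly (pole_poly \<eta> k I) 0 \<noteq> 0" unfolding poly_pole_poly using I \<eta> by (auto simp: prod_zero_iff)
  hence "degree P > 0" using z True by (cases "degree P") (auto simp: poly_monom)
  hence "P \<noteq> 0" by auto
  moreover have "(\<Sum>l\<in>I. \<Sum>j=1..k l. poly (monom (\<alpha> l j * (- 1 / \<eta> l) ^ j) (j + degree P) *
        ([:- (1 / \<eta> l), 1:] ^ (k l - j) * pole_poly \<eta> k (I - {l}))) 0) = 0"
    by (intro sum.neutral ballI) (simp add: poly_monom)
  ultimately show ?thesis using B0 True by (simp add: reciprocal_numerator_def poly_sum)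
next
  case False
  hence "poly (pole_poly \<eta> k I) z = 0" using z by (simp add: poly_monom)
  then obtain l where l: "l \<in> I" "z = 1 / \<eta> l" unfolding poly_pole_poly using I by (auto simp: prod_zero_iff)
  define t where "t = (\<lambda>l j. poly (monom (\<alpha> l j * (- 1 / \<eta> l) ^ j) (j + degree P) *
        ([:- (1 / \<eta> l), 1:] ^ (k l - j) * pole_poly \<eta> k (I - {l}))) z)"
  have "(\<Sum>j=1..k i. t i j) = 0" if i: "i \<in> I - {l}" for i
  proof (intro sum.neutral ballI)
    fix j
    have "poly (pole_poly \<eta> k (I - {i})) z = 0"
      unfolding poly_pole_poly using I l k[OF l(1)] i by (auto simp: prod_zero_iff)
    thus "t i j = 0" by (simp add: t_def)
  qed
  hence "(\<Sum>i\<in>I. \<Sum>j=1..k i. t i j) = (\<Sum>j=1..k l. t l j)"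
    using sum.remove[OF I l(1), of "\<lambda>i. \<Sum>j=1..k i. t i j"] by (simp add: sum.neutral)
  also have "\<dots> = t l (k l)"
  proof -
    have "(\<Sum>j\<in>{1..k l} - {k l}. t l j) = 0"
      by (intro sum.neutral ballI) (use l(2) in \<open>auto simp: t_def\<close>)
    thus ?thesis using sum.remove[of "{1..k l}" "k l" "t l"] k[OF l(1)] by simp
  qed
  finally have "poly (reciprocal_numerator P \<eta> k \<alpha> I) z = t l (k l)"
    using \<open>poly (pole_poly \<eta> k I) z = 0\<close> by (simp add: reciprocal_numerator_def poly_sum t_def)
  moreover have "poly (pole_poly \<eta> k (I - {l})) z \<noteq> 0"
    unfolding poly_pole_poly using I l(1) \<eta> by (auto simp: prod_zero_iff l(2) dest: inj_onD)
  hence "t l (k l) \<noteq> 0" using False k[OF l(1)] \<eta>(1)[OF l(1)] by (simp add: t_def poly_monom)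
  ultimately show ?thesis by simp
qed

lemma degree_denominator: "degree (monom 1 n * pole_poly \<eta> k I) = n + (\<Sum>l\<in>I. k l)"
proof -
  have 0: "pole_poly \<eta> k I \<noteq> 0" for I
    by (cases "finite I") (auto simp: pole_poly_def prod_zero_iff)
  have "degree (pole_poly \<eta> k I) = (\<Sum>l\<in>I. degree ([:- (1 / \<eta> l), 1:] ^ k l))"
    unfolding pole_poly_def by (rule degree_prod_eq_sum_degree) auto
  also have "\<dots> = (\<Sum>l\<in>I. k l)" by (simp add: degree_linear_power)
  finally show ?thesis using 0[of I] by (simp add: degree_mult_eq degree_monom_eq monom_eq_0_iff)
qed

text \<open>The symbol is brought to the form treated above. When \<open>P\<close> is constant and \<open>0\<close> is not a pole, the value
of the symbol at \<open>0\<close> involves the limit of \<open>R\<close> at infinity.\<close>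

theorem theorem1p3:
  fixes P :: "complex poly" and r :: nat and \<eta> :: "nat \<Rightarrow> complex" and k :: "nat \<Rightarrow> nat"
    and \<alpha> :: "nat \<Rightarrow> nat \<Rightarrow> complex" and N N\<^sub>1 N\<^sub>2 :: nat
    and R \<phi> \<Phi> :: "complex \<Rightarrow> complex"
  assumes "N\<^sub>1 = degree P" and "N\<^sub>2 = (\<Sum>l=1..r. k l)" and "N = N\<^sub>1 + N\<^sub>2"
    and "\<forall>l\<in>{1..r}. \<eta> l \<notin> cball 0 1" and "inj_on \<eta> {1..r}"
    and "\<forall>l\<in>{1..r}. k l \<ge> 1 \<and> \<alpha> l (k l) \<noteq> 0"
    and "R = (\<lambda>z. poly P z + (\<Sum>l=1..r. \<Sum>j=1..k l. \<alpha> l j / (z - \<eta> l) ^ j))"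
    and "\<phi> \<in> disc_algebra"
    and "\<Phi> = (\<lambda>z. at_reciprocal R z + \<phi> z)"
    and "ball 0 1 \<inter> (- closure (\<Phi> ` (ball 0 1 - poles \<Phi>))) \<noteq> {}"
    and "(- cball 0 1) \<inter> (- closure (\<Phi> ` (ball 0 1 - poles \<Phi>))) \<noteq> {}"
    and "\<forall>w \<in> \<Phi> ` (cball 0 1 - poles \<Phi>). exactly_n_solutions \<Phi> w N"
  shows "hypercyclic (toeplitz \<Phi>)"
proof -
  define Q where "Q = monom 1 (degree P) * pole_poly \<eta> k {1..r}"
  define A where "A = reciprocal_numerator P \<eta> k \<alpha> {1..r}"
  have \<eta>1: "cmod (\<eta> l) > 1" if "l \<in> {1..r}" for l using assms(4) that by force
  have \<eta>0: "\<eta> l \<noteq> 0" if "l \<in> {1..r}" for l using \<eta>1[OF that] by auto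
  have Qz: "z = 0 \<or> (\<exists>l\<in>{1..r}. z = 1 / \<eta> l)" if "poly Q z = 0" for z
    using that by (auto simp: Q_def poly_monom poly_pole_poly prod_zero_iff)
  have Q1: "cmod z < 1" if "poly Q z = 0" for z
  proof -
    have "cmod (1 / \<eta> l) < 1" if "l \<in> {1..r}" for l using \<eta>1[OF that] by (simp add: norm_divide divide_less_eq)
    thus ?thesis using Qz[OF that] by auto
  qed
  have AQ: "poly A z \<noteq> 0" if "poly Q z = 0" for z
    unfolding A_def by (rule reciprocal_numerator_nonzero) (use that assms(5,6) \<eta>0 in \<open>auto simp: Q_def\<close>)
  have R: "poly A z / poly Q z = R (1 / z)" if "z \<noteq> 0" "poly Q z \<noteq> 0" for z
    unfolding A_def Q_def assms(7)
  proof (rule reciprocal_partial_fractions)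
    show "z \<noteq> 1 / \<eta> l" if "l \<in> {1..r}" "k l \<ge> 1" for l
    proof
      assume "z = 1 / \<eta> l"
      hence "poly (pole_poly \<eta> k {1..r}) z = 0" using that by (auto simp: poly_pole_poly prod_zero_iff)
      thus False using \<open>poly Q z \<noteq> 0\<close> by (simp add: Q_def)
    qed
  qed (use \<eta>0 that in auto)
  have R0: "at_reciprocal R z = poly A z / poly Q z" if z: "poly Q z \<noteq> 0" for z
  proof (cases "z = 0")
    case True
    have Q: "poly Q \<midarrow>0\<rightarrow> poly Q 0" and A: "poly A \<midarrow>0\<rightarrow> poly A 0"
      using poly_isCont[where p = Q and x = 0] poly_isCont[where p = A and x = 0] by (simp_all add: isCont_def)
    have nz: "\<forall>\<^sub>F u in at 0. poly Q u \<noteq> 0"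
      using tendsto_imp_eventually_ne[OF Q] z True by blast
    have "\<forall>\<^sub>F u::complex in at 0. u \<noteq> 0" by (simp add: eventually_at_filter)
    hence "\<forall>\<^sub>F u in at 0. poly A u / poly Q u = (R \<circ> inverse) u"
      using nz by eventually_elim (simp add: R inverse_eq_divide)
    moreover have "((\<lambda>u. poly A u / poly Q u) \<longlongrightarrow> poly A 0 / poly Q 0) (at 0)"
      using z True by (intro tendsto_divide A Q) simp
    ultimately have "((R \<circ> inverse) \<longlongrightarrow> poly A 0 / poly Q 0) (at 0)"
      by (rule Lim_transform_eventually[rotated])
    hence "(R \<longlongrightarrow> poly A 0 / poly Q 0) at_infinity" by (simp only: lim_at_infinity_0)
    hence "Lim at_infinity R = poly A 0 / poly Q 0" 
      by (intro tendsto_Lim trivial_limit_at_infinity)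
    thus ?thesis using True by (simp add: at_reciprocal_def)
  qed (use z R in \<open>simp add: at_reciprocal_def\<close>)
  interpret rational_perturbation A Q \<phi> \<Phi>
  proof
    fix z w
    show "cmod z < 1" if "poly Q z = 0" using Q1 that .
    show "poly A z \<noteq> 0" if "poly Q z = 0" using AQ that .
    show "\<phi> \<in> disc_algebra" by fact
    show "\<Phi> z = poly A z / poly Q z + \<phi> z" if "cmod z \<le> 1" "poly Q z \<noteq> 0"
      using R0[OF that(2)] by (simp add: assms(9))
    have "degree Q = N" by (simp add: Q_def degree_denominator assms(1-3))
    thus "exactly_n_solutions \<Phi> w (degree Q)" if "w \<in> \<Phi> ` (cball 0 1 - poles \<Phi>)" using assms(12) that by metis
  qed
  show ?thesis by (rule toeplitz_hypercyclic) (use assms(10,11) in auto)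
qed

end
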